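(* Let $\mu>0$, $\nu>0$, $\alpha>1/2$, $f\in V^{\alpha-1}$, and let $\mathcal{Y}^\mu_\alpha=L_2(-\mu,0,V^{1+\alpha})\times V^\alpha$. For $(\phi,u_0)\in\mathcal{Y}^\mu_\alpha$ let $u^\mu$ be the corresponding weak solution of the 3D Navier-Stokes equations with constant delay $\mu$ (as defined in the context). Then $$S(t)(\phi,u_0)=(u^\mu_t,u^\mu(t)),\qquad t\ge0,$$ where $u^\mu_t$ is the segment function $u^\mu_t(s)=u^\mu(t+s)$, $s\in(-\mu,0)$, defines a semigroup $S(t):\mathcal{Y}^\mu_\alpha\to\mathcal{Y}^\mu_\alpha$, $t\ge0$; that is, $S(0)=\mathrm{Id}_{\mathcal{Y}^\mu_\alpha}$ and $S(t+\tau)=S(t)\circ S(\tau)$ for all $t,\tau\ge0$.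
   Context: Function spaces. Fix $L>0$ and let $\mathbb{T}^3_L$ be the three-dimensional torus of side length $L$. For $s\in\mathbb{R}$, $V^s$ is the space of real $L$-periodic divergence-free vector fields (distributions) $u=\sum_{\zeta}e^{i(x,\zeta)}\hat u(\zeta)$, $\zeta\in\frac{2\pi}{L}\mathbb{Z}^3$, with $\hat u(0)=0$, $\hat u(-\zeta)=\overline{\hat u(\zeta)}$, and finite norm $\|u\|_s=\big(L^3\sum_{\zeta\neq0}|\zeta|^{2s}|\hat u(\zeta)|^2\big)^{1/2}$. $(\cdot,\cdot)$ is the scalar product of $V^0$ (the $L_2$ scalar product). The Stokes operator is $A=-\Delta$, so $\|u\|_s=\|A^{s/2}u\|_0$. $V^{-s}$ is the dual of $V^s$, and $\langle\cdot,\cdot\rangle$ denotes the duality pairing between $V^s$ and $V^{-s}$ (extending $(\cdot,\cdot)$) for any $s$. Nonlinearity. $b(u,v,w)=\sum_{i,j=1}^3\int_{\mathbb{T}^3_L}u_j\frac{\partial v_i}{\partial x_j}w_i\,dx$, extended by continuity from trigonometric polynomials to $V^{s_1}\times V^{s_2+1}\times V^{s_3}$ whenever either $s_i+s_j\ge0$ for $i\ne j$ and $s_1+s_2+s_3>3/2$, or $s_i+s_j>0$ for $i\neq j$ and $s_1+s_2+s_3\ge3/2$. $B:V^{s_1}\times V^{s_2+1}\to V^{-s_3}$ is defined by $\langle B(u,v),w\rangle=b(u,v,w)$. Weak solution of the delay equation. The equation is $u'(t)+\nu Au(t)+B(u(t-\mu),u(t))=f$ for $t\ge0$, with $u(t)=\phi(t)$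 for $t\in[-\mu,0)$ and $u(0)=u_0$. For $T>0$, a weak solution on $[-\mu,T]$ is a function $u^\mu\in L_2(-\mu,T,V^{1+\alpha})$ with $u^\mu(0)=u_0$, $u^\mu(t)=\phi(t)$ for (almost all) $t\in[-\mu,0)$, such that for every $v\in V^{\alpha+1}$ and every test function $\varphi\in C_0^\infty([0,T])$ (smooth, compactly supported in $(0,T)$), $$-\int_0^T\langle u^\mu(r),v\rangle\varphi'(r)\,dr+\nu\int_0^T\langle A^{1/2}u^\mu(r),A^{1/2}v\rangle\varphi(r)\,dr+\int_0^T\langle B(u^\mu(r-\mu),u^\mu(r)),v\rangle\varphi(r)\,dr=\int_0^T\langle f,v\rangle\varphi(r)\,dr.$$ For every $T>0$ such a weak solution exists and is unique, and its restriction to $[0,T]$ has a representative in $C([0,T],V^\alpha)$, which is the one used to define $u^\mu(t)$ pointwise; thus $u^\mu$ is defined on $[-\mu,\infty)$. *)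

theory Defs
  imports "HOL-Analysis.Analysis"
begin

text \<open>A periodic distribution on the torus of side \<open>L\<close> is represented by its family of Fourier
  coefficients: \<open>u k\<close> is the coefficient at the wave vector \<open>\<zeta> = (2\<pi>/L) k\<close>, for \<open>k\<close> in the integer
  lattice.\<close>

type_synonym coeffs = "int ^ 3 \<Rightarrow> complex ^ 3"

definition wave :: "real \<Rightarrow> int ^ 3 \<Rightarrow> real ^ 3" where
  "wave L k = (\<chi> i. 2 * pi / L * real_of_int (k $ i))"

definition V :: "real \<Rightarrow> real \<Rightarrow> coeffs set" where
  "V L s = {u. u 0 = 0
     \<and> (\<forall>k. u (- k) = (\<chi> i. cnj (u k $ i)))
     \<and> (\<forall>k. (\<Sum>i\<in>UNIV. complex_of_real (wave L k $ i) * u k $ i) = 0)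
     \<and> (\<lambda>k. norm (wave L k) powr (2 * s) * (norm (u k))\<^sup>2) summable_on - {0}}"

definition snorm :: "real \<Rightarrow> real \<Rightarrow> coeffs \<Rightarrow> real" where
  "snorm L s u = sqrt (L ^ 3 * (\<Sum>\<^sub>\<infinity>k\<in>- {0}. norm (wave L k) powr (2 * s) * (norm (u k))\<^sup>2))"

definition sdist :: "real \<Rightarrow> real \<Rightarrow> coeffs \<Rightarrow> coeffs \<Rightarrow> real" where
  "sdist L s u v = snorm L s (\<lambda>k. u k - v k)"

text \<open>The duality pairing of \<open>V\<^sup>s\<close> and \<open>V\<^sup>-\<^sup>s\<close>.  The inner product of \<open>complex ^ 3\<close> is the real one,
  i.e. the real part of the sum of \<open>u\<^sub>i\<close> times the conjugate of \<open>v\<^sub>i\<close>; for coefficient families of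
  real fields the imaginary parts cancel in the sum over \<open>k\<close>.\<close>

definition pairing :: "real \<Rightarrow> coeffs \<Rightarrow> coeffs \<Rightarrow> real" where
  "pairing L u v = L ^ 3 * (\<Sum>\<^sub>\<infinity>k. u k \<bullet> v k)"

text \<open>Powers \<open>A\<^sup>r\<close> of the Stokes operator \<open>A = -\<Delta>\<close>, whose Fourier multiplier is \<open>|\<zeta>|\<^sup>2\<close>.\<close>

definition stokes_pow :: "real \<Rightarrow> real \<Rightarrow> coeffs \<Rightarrow> coeffs" where
  "stokes_pow L r u = (\<lambda>k. norm (wave L k) powr (2 * r) *\<^sub>R u k)"

definition trig_polys :: "real \<Rightarrow> coeffs set" where
  "trig_polys L = {u \<in> V L 0. finite {k. u k \<noteq> 0}}"

text \<open>The vector field with the given finitely many Fourier coefficients. On \<open>trig_polys\<close> the sum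
  is already real, so taking the real part only changes the type.\<close>

definition field_of :: "real \<Rightarrow> coeffs \<Rightarrow> real ^ 3 \<Rightarrow> real ^ 3" where
  "field_of L u x = (\<chi> i. Re (\<Sum>k | u k \<noteq> 0. exp (\<i> * complex_of_real (x \<bullet> wave L k)) * u k $ i))"

definition partial_deriv :: "3 \<Rightarrow> (real ^ 3 \<Rightarrow> real) \<Rightarrow> real ^ 3 \<Rightarrow> real" where
  "partial_deriv j g x = deriv (\<lambda>h. g (x + h *\<^sub>R axis j 1)) 0"

definition b_trig :: "real \<Rightarrow> coeffs \<Rightarrow> coeffs \<Rightarrow> coeffs \<Rightarrow> real" where
  "b_trig L u v w = (\<Sum>i\<in>UNIV. \<Sum>j\<in>UNIV. LINT x|lebesgue_on (cbox 0 (\<chi> i. L)).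
     field_of L u x $ j * partial_deriv j (\<lambda>y. field_of L v y $ i) x * field_of L w x $ i)"

text \<open>Extension of \<open>b_trig\<close> by continuity to \<open>V\<^sup>s\<^sup>1 \<times> V\<^sup>s\<^sup>2\<^sup>+\<^sup>1 \<times> V\<^sup>s\<^sup>3\<close>: the common limit along all
  approximating sequences of trigonometric polynomials.  It is meaningful for the admissible
  exponents (pairwise sums nonnegative and total sum greater than 3/2, or pairwise sums positive and
  total sum at least 3/2).\<close>

definition b_form :: "real \<Rightarrow> real \<Rightarrow> real \<Rightarrow> real \<Rightarrow> coeffs \<Rightarrow> coeffs \<Rightarrow> coeffs \<Rightarrow> real" where
  "b_form L s1 s2 s3 u v w = (THE l. \<forall>un vn wn.
     (\<forall>n::nat. un n \<in> trig_polys L \<and> vn n \<in> trig_polys L \<and> wn n \<in> trig_polys L)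
     \<and> (\<lambda>n. sdist L s1 (un n) u) \<longlonglongrightarrow> 0
     \<and> (\<lambda>n. sdist L (s2 + 1) (vn n) v) \<longlonglongrightarrow> 0
     \<and> (\<lambda>n. sdist L s3 (wn n) w) \<longlonglongrightarrow> 0
     \<longrightarrow> (\<lambda>n. b_trig L (un n) (vn n) (wn n)) \<longlonglongrightarrow> l)"

definition B_op :: "real \<Rightarrow> real \<Rightarrow> real \<Rightarrow> real \<Rightarrow> coeffs \<Rightarrow> coeffs \<Rightarrow> coeffs" where
  "B_op L s1 s2 s3 u v =
     (THE g. g \<in> V L (- s3) \<and> (\<forall>w\<in>V L s3. pairing L g w = b_form L s1 s2 s3 u v w))"

text \<open>Functions representing elements of \<open>L\<^sub>2(a, b; V\<^sup>s)\<close>: strongly (Bochner) measurable, i.e. almost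
  everywhere limits of simple functions with values in \<open>V\<^sup>s\<close>, with square integrable norm.
  Values are required to lie in \<open>V\<^sup>s\<close> only almost everywhere, so that a representative may be
  continuous into a larger space.\<close>

definition bochner_measurable :: "real \<Rightarrow> real \<Rightarrow> real \<Rightarrow> real \<Rightarrow> (real \<Rightarrow> coeffs) \<Rightarrow> bool" where
  "bochner_measurable L s a b u \<longleftrightarrow>
     (AE t in lebesgue_on {a<..<b}. u t \<in> V L s)
     \<and> (\<exists>g. (\<forall>n::nat. simple_function (lebesgue_on {a<..<b}) (g n) \<and> (\<forall>t. g n t \<in> V L s))
          \<and> (AE t in lebesgue_on {a<..<b}. (\<lambda>n. sdist L s (g n t) (u t)) \<longlonglongrightarrow> 0))"

definition L2_funs :: "real \<Rightarrow> real \<Rightarrow> real \<Rightarrow> real \<Rightarrow> (real \<Rightarrow> coeffs) set" where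
  "L2_funs L s a b = {u. bochner_measurable L s a b u
     \<and> integrable (lebesgue_on {a<..<b}) (\<lambda>t. (snorm L s (u t))\<^sup>2)}"

definition ae_rel :: "real \<Rightarrow> real \<Rightarrow> real \<Rightarrow> real \<Rightarrow> ((real \<Rightarrow> coeffs) \<times> (real \<Rightarrow> coeffs)) set" where
  "ae_rel L s a b = {(u, w). u \<in> L2_funs L s a b \<and> w \<in> L2_funs L s a b
     \<and> (AE t in lebesgue_on {a<..<b}. u t = w t)}"

definition L2_space :: "real \<Rightarrow> real \<Rightarrow> real \<Rightarrow> real \<Rightarrow> (real \<Rightarrow> coeffs) set set" where
  "L2_space L s a b = L2_funs L s a b // ae_rel L s a b"

definition L2_class :: "real \<Rightarrow> real \<Rightarrow> real \<Rightarrow> real \<Rightarrow> (real \<Rightarrow> coeffs) \<Rightarrow> (real \<Rightarrow> coeffs) set" where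
  "L2_class L s a b u = ae_rel L s a b `` {u}"

definition V_continuous_on :: "real \<Rightarrow> real \<Rightarrow> real set \<Rightarrow> (real \<Rightarrow> coeffs) \<Rightarrow> bool" where
  "V_continuous_on L s I u \<longleftrightarrow>
     (\<forall>t\<in>I. u t \<in> V L s \<and> ((\<lambda>r. sdist L s (u r) (u t)) \<longlongrightarrow> 0) (at t within I))"

definition test_functions :: "real \<Rightarrow> (real \<Rightarrow> real) set" where
  "test_functions T = {\<psi>. (\<forall>n x. (deriv ^^ n) \<psi> field_differentiable at x)
     \<and> closure {r. \<psi> r \<noteq> 0} \<subseteq> {0<..<T}}"

text \<open>Test functions vanish near 0, so the initial condition is meaningful only for the
  representative that is continuous on \<open>[0, T]\<close> with values in \<open>V\<^sup>\<alpha>\<close>; this representative is part of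
  the definition.  The nonlinear term uses \<open>B\<close> from \<open>V\<^sup>1\<^sup>+\<^sup>\<alpha> \<times> V\<^sup>1\<^sup>+\<^sup>\<alpha>\<close> to the dual of \<open>V\<^sup>1\<^sup>+\<^sup>\<alpha>\<close>.\<close>

definition weak_solution ::
  "real \<Rightarrow> real \<Rightarrow> real \<Rightarrow> real \<Rightarrow> coeffs \<Rightarrow> (real \<Rightarrow> coeffs) \<Rightarrow> coeffs \<Rightarrow> real \<Rightarrow> (real \<Rightarrow> coeffs) \<Rightarrow> bool" where
  "weak_solution L \<mu> \<nu> \<alpha> f \<phi> u0 T u \<longleftrightarrow>
     u \<in> L2_funs L (1 + \<alpha>) (- \<mu>) T
     \<and> V_continuous_on L \<alpha> {0..T} u
     \<and> u 0 = u0
     \<and> (AE t in lebesgue_on {- \<mu><..<0}. u t = \<phi> t)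
     \<and> (\<forall>v\<in>V L (\<alpha> + 1). \<forall>\<psi>\<in>test_functions T.
          - (LINT r|lebesgue_on {0..T}. pairing L (u r) v * deriv \<psi> r)
          + \<nu> * (LINT r|lebesgue_on {0..T}.
                 pairing L (stokes_pow L (1/2) (u r)) (stokes_pow L (1/2) v) * \<psi> r)
          + (LINT r|lebesgue_on {0..T}.
                 pairing L (B_op L (1 + \<alpha>) \<alpha> (1 + \<alpha>) (u (r - \<mu>)) (u r)) v * \<psi> r)
          = (LINT r|lebesgue_on {0..T}. pairing L f v * \<psi> r))"

definition global_weak_solution ::
  "real \<Rightarrow> real \<Rightarrow> real \<Rightarrow> real \<Rightarrow> coeffs \<Rightarrow> (real \<Rightarrow> coeffs) \<Rightarrow> coeffs \<Rightarrow> (real \<Rightarrow> coeffs) \<Rightarrow> bool" where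
  "global_weak_solution L \<mu> \<nu> \<alpha> f \<phi> u0 u \<longleftrightarrow> (\<forall>T>0. weak_solution L \<mu> \<nu> \<alpha> f \<phi> u0 T u)"

definition Y_space :: "real \<Rightarrow> real \<Rightarrow> real \<Rightarrow> ((real \<Rightarrow> coeffs) set \<times> coeffs) set" where
  "Y_space L \<mu> \<alpha> = L2_space L (1 + \<alpha>) (- \<mu>) 0 \<times> V L \<alpha>"

text \<open>The solution is unique up to a null set of \<open>(-\<mu>, 0)\<close>, so the pair below does not depend on the
  representatives \<open>\<phi>\<close> and \<open>u\<close>.\<close>

definition S_op :: "real \<Rightarrow> real \<Rightarrow> real \<Rightarrow> real \<Rightarrow> coeffs \<Rightarrow> real
    \<Rightarrow> (real \<Rightarrow> coeffs) set \<times> coeffs \<Rightarrow> (real \<Rightarrow> coeffs) set \<times> coeffs" where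
  "S_op L \<mu> \<nu> \<alpha> f t y = (THE z. \<exists>\<phi>\<in>fst y. \<exists>u. global_weak_solution L \<mu> \<nu> \<alpha> f \<phi> (snd y) u
      \<and> z = (L2_class L (1 + \<alpha>) (- \<mu>) 0 (\<lambda>s. u (t + s)), u t))"

end

theory Submission
  imports Defs
begin

text \<open>On each time interval of length at most \<open>\<mu>\<close> the delayed velocity is already known, so the equation
  is linear in \<open>u\<close>. In Fourier variables \<open>B\<close> is a projected convolution, and the Cauchy-Schwarz
  inequality with the convergent lattice sum \<open>\<Sum>|\<zeta>|^(-2(1+\<alpha>))\<close> gives the bound
  \<open>\<parallel>B(w,u)\<parallel>\<^sub>\<alpha>\<^sub>-\<^sub>1 \<le> C \<parallel>w\<parallel>\<^sub>1\<^sub>+\<^sub>\<alpha> \<parallel>u\<parallel>\<^sub>\<alpha>\<close>. Testing the weak formulation with single Fourier modes shows that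
  weak solutions are exactly the solutions of the Duhamel formula. For the latter, the smoothing of the
  Stokes semigroup turns the bound on \<open>B\<close> into a Volterra inequality with the integrable kernel
  \<open>\<parallel>w(s)\<parallel>\<^sub>1\<^sub>+\<^sub>\<alpha>\<^sup>2\<close>, so the Picard series converges and solutions are unique. Marching in steps of length \<open>\<mu>\<close>
  gives a unique global solution. A translate of a weak solution is again a weak solution, with the
  segment at the new initial time as history, and uniqueness turns this into the semigroup law.\<close>

section \<open>Lattice sums\<close>

text \<open>The hypothesis \<alpha> > 1/2 enters through 1 + \<alpha> > 3/2, the threshold for
  convergence of the lattice sum in dimension three. Sizes are measured by \<open>energy\<close>,
  the squared norm without the factor \<open>L ^ 3\<close>, with values in \<open>ennreal\<close>:
  solutions lie in V^(1+\<alpha>) only for almost every time, and an infinite energy keeps every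
  estimate meaningful there, whereas the default values of \<open>infsum\<close> and of the Bochner
  integral would not. The drift contributes a kernel that is merely integrable in time, so the
  Volterra inequality is iterated until a factorial appears, instead of seeking a contraction on
  short intervals. \<open>B_op\<close> is a doubly nested definite description (a limit along
  trigonometric polynomials, then a representing functional), so it must be identified with the
  explicit convolution \<open>Bhat\<close> before anything can be computed. \<open>S_op\<close> is a
  definite description as well; it is well defined because changing the history on a null set
  changes the delayed drift only on a null set, which the Duhamel integral does not see.\<close>

lemma nn_integral_int_powr_finite:
  fixes q :: real
  assumes "q > 1"
  shows "(\<integral>\<^sup>+n. ennreal (max 1 \<bar>real_of_int n\<bar> powr (- q)) \<partial>count_space UNIV) < \<infinity>"
proof -
  define g where "g = (\<lambda>n::int. ennreal (max 1 \<bar>real_of_int n\<bar> powr (- q)))"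
  define G where "G = (\<integral>\<^sup>+n. g (int n) \<partial>count_space UNIV)"
  have gm: "g (- n) = g n" for n by (simp add: g_def)
  have r1: "(\<integral>\<^sup>+n. g n \<partial>count_space (range int)) = G"
    unfolding G_def by (rule nn_integral_bij_count_space[symmetric]) (simp add: bij_betw_def)
  have "bij_betw (\<lambda>n. - int n) UNIV (range (\<lambda>n. - int n))"
    by (auto simp: bij_betw_def inj_on_def)
  from nn_integral_bij_count_space[OF this, of g]
  have r2: "(\<integral>\<^sup>+n. g n \<partial>count_space (range (\<lambda>n. - int n))) = G"
    by (simp add: G_def gm)
  \<comment> \<open>The two half-lines overlap at 0, so the next bound is an inequality only;
    finiteness asks for no more.\<close>
  have cover: "n \<in> range int \<or> n \<in> range (\<lambda>n. - int n)" for n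
    by (metis int_cases2 rangeI)
  have "(\<integral>\<^sup>+n. g n \<partial>count_space UNIV)
      \<le> (\<integral>\<^sup>+n. g n * indicator (range int) n + g n * indicator (range (\<lambda>n. - int n)) n \<partial>count_space UNIV)"
    using cover by (intro nn_integral_mono) (auto simp: indicator_def)
  also have "\<dots> = G + G"
    using r1 r2 by (subst nn_integral_add) (auto simp: nn_integral_count_space_indicator)
  finally have "(\<integral>\<^sup>+n. g n \<partial>count_space UNIV) \<le> G + G" .
  moreover have "G < \<infinity>"
  proof -
    have "summable (\<lambda>n. real n powr (- q))" using assms by (subst summable_real_powr_iff) simp
    then have "summable (\<lambda>n. max 1 (real n) powr (- q))"
      by (rule summable_cong[THEN iffD1, rotated])
         (auto intro!: eventually_sequentiallyI[of 1] simp: max_def)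
    then have "(\<Sum>n. ennreal (max 1 (real n) powr (- q))) \<noteq> top"
      by (intro ennreal_suminf_neq_top) auto
    then show ?thesis
      by (simp add: G_def g_def nn_integral_count_space_nat top.not_eq_extremum)
  qed
  ultimately show ?thesis unfolding g_def by (simp add: order_le_less_trans)
qed

lemma prod_UNIV_3:
  fixes f :: "3 \<Rightarrow> 'a :: comm_monoid_mult"
  shows "(\<Prod>i\<in>UNIV. f i) = f 1 * (f 2 * f 3)"
  unfolding UNIV_3 by simp

lemma nn_integral_count_space_int3_prod:
  fixes g :: "int \<Rightarrow> ennreal"
  shows "(\<integral>\<^sup>+k. (\<Prod>i\<in>UNIV. g (k $ i)) \<partial>count_space (UNIV :: (int ^ 3) set))
    = (\<integral>\<^sup>+n. g n \<partial>count_space UNIV) ^ 3"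
proof -
  define h :: "int \<times> int \<times> int \<Rightarrow> int ^ 3" where "h = (\<lambda>(a, b, c). vector [a, b, c])"
  have "bij h"
    by (rule bij_betw_byWitness[where f' = "\<lambda>k. (k $ 1, k $ 2, k $ 3)"])
       (auto simp: h_def vec_eq_iff forall_3)
  have "(\<integral>\<^sup>+k. (\<Prod>i\<in>UNIV. g (k $ i)) \<partial>count_space (UNIV :: (int ^ 3) set))
      = (\<integral>\<^sup>+z. (\<Prod>i\<in>UNIV. g (h z $ i)) \<partial>count_space UNIV)"
    by (rule nn_integral_bij_count_space[OF \<open>bij h\<close>, symmetric])
  also have "\<dots> = (\<integral>\<^sup>+z. g (fst z) * (g (fst (snd z)) * g (snd (snd z))) \<partial>count_space UNIV)"
    by (intro nn_integral_cong) (simp add: prod_UNIV_3 h_def split: prod.split)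
  also have "\<dots> = (\<integral>\<^sup>+a. \<integral>\<^sup>+z. g a * (g (fst z) * g (snd z)) \<partial>count_space UNIV \<partial>count_space UNIV)"
    by (rule nn_integral_fst_count_space[symmetric, THEN trans]) simp
  also have "\<dots> = (\<integral>\<^sup>+a. \<integral>\<^sup>+b. \<integral>\<^sup>+c. g a * (g b * g c) \<partial>count_space UNIV \<partial>count_space UNIV \<partial>count_space UNIV)"
    by (rule nn_integral_cong, rule nn_integral_fst_count_space[symmetric, THEN trans]) simp
  also have "\<dots> = (\<integral>\<^sup>+n. g n \<partial>count_space UNIV) ^ 3"
    by (simp add: nn_integral_cmult nn_integral_multc power3_eq_cube mult.assoc)
  finally show ?thesis .
qed

lemma wave_add: "wave L (k + l) = wave L k + wave L l"
  by (simp add: wave_def vec_eq_iff algebra_simps)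

lemma wave_minus: "wave L (- k) = - wave L k"
  by (simp add: wave_def vec_eq_iff)

lemma wave_diff: "wave L (k - l) = wave L k - wave L l"
  by (simp add: wave_def vec_eq_iff algebra_simps)

lemma wave_0 [simp]: "wave L 0 = 0"
  by (simp add: wave_def vec_eq_iff)

lemma norm_wave_ge_component:
  assumes "L > 0"
  shows "norm (wave L k) \<ge> 2 * pi / L * \<bar>real_of_int (k $ i)\<bar>"
  using component_le_norm_cart[of "wave L k" i] assms by (simp add: wave_def abs_mult)

lemma norm_wave_ge:
  assumes "L > 0" "k \<noteq> 0"
  shows "norm (wave L k) \<ge> 2 * pi / L"
proof -
  obtain i where "k $ i \<noteq> 0" using assms(2) by (auto simp: vec_eq_iff)
  then have "1 \<le> \<bar>real_of_int (k $ i)\<bar>" by linarith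
  then have "2 * pi / L * 1 \<le> 2 * pi / L * \<bar>real_of_int (k $ i)\<bar>"
    using assms by (intro mult_left_mono) auto
  then show ?thesis using norm_wave_ge_component[OF assms(1), of k i] by linarith
qed

lemma norm_wave_pos:
  assumes "L > 0" "k \<noteq> 0"
  shows "norm (wave L k) > 0"
  using norm_wave_ge[OF assms] assms(1) by (smt (verit) divide_pos_pos pi_gt_zero)

lemma wave_eq_0_iff:
  assumes "L > 0"
  shows "wave L k = 0 \<longleftrightarrow> k = 0"
  using norm_wave_pos[OF assms] by auto

text \<open>The lattice sum is compared with a product of three one-dimensional sums. The norm
  dominates each component, so the exponent 2p is shared equally between the three coordinates, and
  p > 3/2 turns into q = 2p/3 > 1.\<close>

lemma wave_powr_summable:
  assumes "L > 0" "p > 3 / 2"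
  shows "(\<integral>\<^sup>+k. ennreal (norm (wave L k) powr (- 2 * p)) \<partial>count_space UNIV) < \<infinity>"
proof -
  define c where "c = 2 * pi / L"
  have c: "c > 0" using assms by (simp add: c_def)
  define q where "q = 2 * p / 3"
  have q: "q > 1" using assms by (simp add: q_def)
  \<comment> \<open>Components of a nonzero \<open>k\<close> may vanish, and
    \<open>0 powr (- q)\<close> is 0, which bounds nothing; the maximum with 1 replaces it by
    1.\<close>
  define g where "g = (\<lambda>n::int. ennreal (max 1 \<bar>real_of_int n\<bar> powr (- q)))"
  have "ennreal (norm (wave L k) powr (- 2 * p)) \<le> ennreal (c powr (- 2 * p)) * (\<Prod>i\<in>UNIV. g (k $ i))" for k
  proof (cases "k = 0")
    case False
    define r where "r = norm (wave L k) / c"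
    have r: "norm (wave L k) = c * r" "r > 0"
      using c norm_wave_pos[OF assms(1) False] by (auto simp: r_def)
    have "r powr (- q) \<le> max 1 \<bar>real_of_int (k $ i)\<bar> powr (- q)" for i
    proof (rule powr_mono2')
      have "r \<ge> 1" using norm_wave_ge[OF assms(1) False] c unfolding r_def c_def[symmetric] by (simp add: field_simps)
      moreover have "r \<ge> \<bar>real_of_int (k $ i)\<bar>"
        using norm_wave_ge_component[OF assms(1), of k i] c unfolding r_def c_def[symmetric] by (simp add: field_simps)
      ultimately show "max 1 \<bar>real_of_int (k $ i)\<bar> \<le> r" by simp
    qed (use q in auto)
    then have "(\<Prod>i\<in>(UNIV::3 set). r powr (- q)) \<le> (\<Prod>i\<in>UNIV. max 1 \<bar>real_of_int (k $ i)\<bar> powr (- q))"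
      by (intro prod_mono) auto
    moreover have "(\<Prod>i\<in>(UNIV::3 set). r powr (- q)) = r powr (- 2 * p)"
      using r(2) by (simp add: power3_eq_cube powr_add[symmetric] q_def)
    ultimately have "norm (wave L k) powr (- 2 * p)
        \<le> c powr (- 2 * p) * (\<Prod>i\<in>UNIV. max 1 \<bar>real_of_int (k $ i)\<bar> powr (- q))"
      using c r by (simp add: powr_mult mult_left_mono)
    moreover have "(\<Prod>i\<in>UNIV. g (k $ i)) = ennreal (\<Prod>i\<in>UNIV. max 1 \<bar>real_of_int (k $ i)\<bar> powr (- q))"
      unfolding g_def by (rule prod_ennreal) auto
    ultimately show ?thesis
      by (simp add: prod_nonneg ennreal_leI flip: ennreal_mult)
  qed simp
  note le = this
  have "(\<integral>\<^sup>+k. ennreal (norm (wave L k) powr (- 2 * p)) \<partial>count_space UNIV)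
      \<le> (\<integral>\<^sup>+k. ennreal (c powr (- 2 * p)) * (\<Prod>i\<in>(UNIV::3 set). g (k $ i)) \<partial>count_space UNIV)"
    by (rule nn_integral_mono) (rule le)
  also have "\<dots> = ennreal (c powr (- 2 * p)) * (\<integral>\<^sup>+n. g n \<partial>count_space UNIV) ^ 3"
    by (simp add: nn_integral_cmult nn_integral_count_space_int3_prod)
  also have "\<dots> < \<infinity>"
    using nn_integral_int_powr_finite[OF q]
    by (auto simp: g_def ennreal_mult_less_top power_less_top_ennreal)
  finally show ?thesis .
qed

lemma one_add_powr_le:
  fixes r p :: real
  assumes "r \<ge> 0" "p \<ge> 0"
  shows "(1 + r) powr p \<le> 2 powr p * (1 + r powr p)"
proof (cases "r \<le> 1")
  case True
  then have "(1 + r) powr p \<le> 2 powr p" using assms by (intro powr_mono2) auto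
  also have "\<dots> \<le> 2 powr p * (1 + r powr p)" by simp
  finally show ?thesis .
next
  case False
  then have "(1 + r) powr p \<le> (2 * r) powr p" using assms by (intro powr_mono2) auto
  also have "\<dots> = 2 powr p * r powr p" using assms by (simp add: powr_mult)
  also have "\<dots> \<le> 2 powr p * (1 + r powr p)" by (simp add: mult_left_mono)
  finally show ?thesis .
qed

text \<open>Here \<open>x\<close>, \<open>y\<close>, \<open>z\<close> stand for the frequencies of
  the transporting field, of the transported field and of their product. The exponent 1 - a may have
  either sign. Depending on it, y/z or z/y occurs with a nonnegative power, and the triangle
  inequality bounds that ratio by 1 + x/z or 1 + x/y. As this base is at least 1, its exponent can
  be raised to 1 + a.\<close>

lemma bilinear_kernel_bound:
  fixes x y z a :: real
  assumes "x > 0" "y > 0" "z > 0" "y \<le> x + z" "z \<le> x + y" "a \<ge> 0"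
  shows "y powr (1 - a) * z powr (a - 1) \<le> 2 powr (1 + a) * (1 + (x / y) powr (1 + a) + (x / z) powr (1 + a))"
proof -
  have *: "(y' / z') powr b \<le> 2 powr (1 + a) * (1 + (x / z') powr (1 + a))"
    if "y' > 0" "z' > 0" "y' \<le> x + z'" "0 \<le> b" "b \<le> 1 + a" for y' z' b :: real
  proof -
    have "(y' / z') powr b \<le> (1 + x / z') powr b"
      using that assms(1) by (intro powr_mono2) (auto simp: field_simps)
    also have "\<dots> \<le> (1 + x / z') powr (1 + a)"
      using that assms(1) by (intro powr_mono) auto
    also have "\<dots> \<le> 2 powr (1 + a) * (1 + (x / z') powr (1 + a))"
      using that assms by (intro one_add_powr_le) auto
    finally show ?thesis .
  qed
  have pos: "2 powr (1 + a) * r powr (1 + a) \<ge> 0" for r by simp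
  show ?thesis
  proof (cases "a \<le> 1")
    case True
    have "y powr (1 - a) * z powr (a - 1) = (y / z) powr (1 - a)"
      using assms by (simp add: powr_divide powr_minus_divide powr_diff)
    also have "\<dots> \<le> 2 powr (1 + a) * (1 + (x / z) powr (1 + a))"
      using assms True by (intro *) auto
    finally show ?thesis using pos[of "x / y"] unfolding distrib_left by linarith
  next
    case False
    have "y powr (1 - a) * z powr (a - 1) = (z / y) powr (a - 1)"
      using assms by (simp add: powr_divide powr_minus_divide powr_diff)
    also have "\<dots> \<le> 2 powr (1 + a) * (1 + (x / y) powr (1 + a))"
      using assms False by (intro *) auto
    finally show ?thesis using pos[of "x / z"] unfolding distrib_left by linarith
  qed
qed

text \<open>Bridge from the unordered sums of the definitions to nonnegative integrals over the
  counting measure, for which Tonelli, Cauchy-Schwarz and dominated convergence are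
  available.\<close>

lemma
  fixes g :: "'a \<Rightarrow> real"
  assumes "\<And>x. g x \<ge> 0"
  shows summable_on_iff_nn_integral: "g summable_on A \<longleftrightarrow> (\<integral>\<^sup>+x. ennreal (g x) \<partial>count_space A) < \<infinity>"
    and infsum_eq_nn_integral: "infsum g A = enn2real (\<integral>\<^sup>+x. ennreal (g x) \<partial>count_space A)"
proof -
  have abs: "g summable_on A \<longleftrightarrow> Infinite_Set_Sum.abs_summable_on g A"
    unfolding summable_on_iff_abs_summable_on_real[of g] by (rule abs_summable_equivalent)
  also have "\<dots> \<longleftrightarrow> (\<integral>\<^sup>+x. ennreal (g x) \<partial>count_space A) < \<infinity>"
    using assms by (simp add: Infinite_Set_Sum.abs_summable_on_def integrable_iff_bounded)
  finally show iff: "g summable_on A \<longleftrightarrow> (\<integral>\<^sup>+x. ennreal (g x) \<partial>count_space A) < \<infinity>" .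
  show "infsum g A = enn2real (\<integral>\<^sup>+x. ennreal (g x) \<partial>count_space A)"
  proof (cases "g summable_on A")
    case True
    then have "infsum g A = infsetsum g A"
      using abs infsetsum_infsum by fastforce
    then show ?thesis
      using assms by (simp add: infsetsum_def integral_eq_nn_integral)
  next
    \<comment> \<open>Both sides are 0 by convention: \<open>infsum\<close> of a family that is not
      summable and \<open>enn2real\<close> of infinity.\<close>
    case False
    then have "(\<integral>\<^sup>+x. ennreal (g x) \<partial>count_space A) = \<infinity>"
      using iff by (metis infinity_ennreal_def top.not_eq_extremum)
    then show ?thesis using False by (simp add: infsum_not_exists)
  qed
qed

section \<open>Weighted energies of Fourier coefficients\<close>

lemma infsum_eq_integral_count_space:
  fixes f :: "'a \<Rightarrow> real"
  assumes "integrable (count_space A) f"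
  shows "infsum f A = (LINT x|count_space A. f x)"
  using infsetsum_infsum[of f A] assms
  by (simp add: Infinite_Set_Sum.abs_summable_on_def infsetsum_def)

text \<open>Countability of the index set makes joint measurability automatic, so sums over Fourier
  modes stay measurable in time.\<close>

lemma borel_measurable_nn_integral_count_space:
  fixes f :: "'a \<Rightarrow> 'i :: countable \<Rightarrow> ennreal"
  assumes "\<And>i. (\<lambda>x. f x i) \<in> borel_measurable M"
  shows "(\<lambda>x. \<integral>\<^sup>+i. f x i \<partial>count_space UNIV) \<in> borel_measurable M"
proof -
  interpret sigma_finite_measure "count_space (UNIV :: 'i set)"
    by (rule sigma_finite_measure_count_space)
  have "(\<lambda>(i, x). f x i) \<in> borel_measurable (count_space UNIV \<Otimes>\<^sub>M M)"
    using assms by (intro measurable_pair_measure_countable1) auto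
  then have "(\<lambda>(x, i). f x i) \<in> borel_measurable (M \<Otimes>\<^sub>M count_space UNIV)"
    by (subst (asm) measurable_pair_swap_iff) (simp add: case_prod_unfold)
  then show ?thesis by (rule borel_measurable_nn_integral)
qed

lemma borel_measurable_integral_count_space:
  fixes f :: "'a \<Rightarrow> 'i :: countable \<Rightarrow> 'b :: {banach, second_countable_topology}"
  assumes "\<And>i. (\<lambda>x. f x i) \<in> borel_measurable M"
  shows "(\<lambda>x. LINT i|count_space UNIV. f x i) \<in> borel_measurable M"
proof -
  interpret sigma_finite_measure "count_space (UNIV :: 'i set)"
    by (rule sigma_finite_measure_count_space)
  have "(\<lambda>(i, x). f x i) \<in> borel_measurable (count_space UNIV \<Otimes>\<^sub>M M)"
    using assms by (intro measurable_pair_measure_countable1) auto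
  then have "(\<lambda>(x, i). f x i) \<in> borel_measurable (M \<Otimes>\<^sub>M count_space UNIV)"
    by (subst (asm) measurable_pair_swap_iff) (simp add: case_prod_unfold)
  then show ?thesis by (rule borel_measurable_lebesgue_integral)
qed

text \<open>The part of membership in \<open>V L s\<close> that does not depend on \<open>s\<close>.
  It can be tracked at times where the energy is infinite.\<close>

definition solenoidal :: "real \<Rightarrow> coeffs \<Rightarrow> bool" where
  "solenoidal L u \<longleftrightarrow> u 0 = 0 \<and> (\<forall>k. u (- k) = (\<chi> i. cnj (u k $ i)))
     \<and> (\<forall>k. (\<Sum>i\<in>UNIV. complex_of_real (wave L k $ i) * u k $ i) = 0)"

text \<open>The squared norm of V^s divided by \<open>L ^ 3\<close>. The mode 0 contributes nothing,
  since \<open>0 powr s\<close> is 0 for every \<open>s\<close>.\<close>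

definition energy :: "real \<Rightarrow> real \<Rightarrow> coeffs \<Rightarrow> ennreal" where
  "energy L s u = (\<integral>\<^sup>+k. ennreal ((norm (wave L k) powr s * norm (u k))\<^sup>2) \<partial>count_space UNIV)"

lemma sq_powr_mult: "(x powr s * y)\<^sup>2 = x powr (2 * s) * y\<^sup>2" for x s y :: real
  by (simp add: power_mult_distrib power2_eq_square flip: powr_add)

lemma
  shows summable_on_energy_iff:
      "(\<lambda>k. norm (wave L k) powr (2 * s) * (norm (u k))\<^sup>2) summable_on - {0} \<longleftrightarrow> energy L s u < \<infinity>"
    and infsum_energy:
      "(\<Sum>\<^sub>\<infinity>k\<in>- {0}. norm (wave L k) powr (2 * s) * (norm (u k))\<^sup>2) = enn2real (energy L s u)"
proof -
  have *: "energy L s u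
      = (\<integral>\<^sup>+k. ennreal (norm (wave L k) powr (2 * s) * (norm (u k))\<^sup>2) \<partial>count_space (- {0}))"
    unfolding energy_def sq_powr_mult
    by (rule nn_integral_count_space_eq) auto
  show "(\<lambda>k. norm (wave L k) powr (2 * s) * (norm (u k))\<^sup>2) summable_on - {0} \<longleftrightarrow> energy L s u < \<infinity>"
    unfolding * by (rule summable_on_iff_nn_integral) simp
  show "(\<Sum>\<^sub>\<infinity>k\<in>- {0}. norm (wave L k) powr (2 * s) * (norm (u k))\<^sup>2) = enn2real (energy L s u)"
    unfolding * by (rule infsum_eq_nn_integral) simp
qed

lemma V_iff: "u \<in> V L s \<longleftrightarrow> solenoidal L u \<and> energy L s u < \<infinity>"
  by (auto simp: V_def solenoidal_def summable_on_energy_iff)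

lemma snorm_eq: "snorm L s u = sqrt (L ^ 3 * enn2real (energy L s u))"
  by (simp add: snorm_def infsum_energy)

lemma sdist_eq: "sdist L s u v = sqrt (L ^ 3 * enn2real (energy L s (\<lambda>k. u k - v k)))"
  by (simp add: sdist_def snorm_eq)

lemma energy_mono:
  assumes "\<And>k. k \<noteq> 0 \<Longrightarrow> norm (u k) \<le> norm (v k)"
  shows "energy L s u \<le> energy L s v"
  unfolding energy_def
proof (rule nn_integral_mono)
  fix k :: "int ^ 3"
  show "ennreal ((norm (wave L k) powr s * norm (u k))\<^sup>2) \<le> ennreal ((norm (wave L k) powr s * norm (v k))\<^sup>2)"
    using assms[of k] by (cases "k = 0") (auto intro!: ennreal_leI power_mono mult_left_mono)
qed

lemma energy_cong:
  assumes "\<And>k. k \<noteq> 0 \<Longrightarrow> norm (u k) = norm (v k)"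
  shows "energy L s u = energy L s v"
  using assms by (intro antisym energy_mono) auto

lemma energy_0 [simp]: "energy L s (\<lambda>k. 0) = 0"
  by (simp add: energy_def)

lemma energy_scaleR: "energy L s (\<lambda>k. c *\<^sub>R u k) = ennreal (c\<^sup>2) * energy L s u"
  unfolding energy_def
  by (subst nn_integral_cmult[symmetric])
     (auto simp: power_mult_distrib mult_ac ennreal_mult[symmetric] intro!: nn_integral_cong)

lemma sum_sq_le_2: "(norm (a + b))\<^sup>2 \<le> 2 * (norm a)\<^sup>2 + 2 * (norm b)\<^sup>2" for a b :: "'a :: real_normed_vector"
proof -
  have "(norm (a + b))\<^sup>2 \<le> (norm a + norm b)\<^sup>2" by (intro power_mono norm_triangle_ineq) auto
  also have "\<dots> \<le> 2 * (norm a)\<^sup>2 + 2 * (norm b)\<^sup>2"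
    using sum_squares_ge_zero[of "norm a - norm b" 0] by (simp add: power2_eq_square algebra_simps)
  finally show ?thesis .
qed

text \<open>The energy is a squared norm, so this parallelogram-type bound takes the place of the
  triangle inequality.\<close>

lemma energy_add_le: "energy L s (\<lambda>k. u k + v k) \<le> 2 * energy L s u + 2 * energy L s v"
proof -
  have "energy L s (\<lambda>k. u k + v k) \<le> (\<integral>\<^sup>+k. 2 * ennreal ((norm (wave L k) powr s * norm (u k))\<^sup>2)
      + 2 * ennreal ((norm (wave L k) powr s * norm (v k))\<^sup>2) \<partial>count_space UNIV)"
    unfolding energy_def
  proof (rule nn_integral_mono)
    fix k :: "int ^ 3"
    let ?r = "norm (wave L k) powr s"
    have "(?r * norm (u k + v k))\<^sup>2 \<le> 2 * (?r * norm (u k))\<^sup>2 + 2 * (?r * norm (v k))\<^sup>2"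
      using mult_left_mono[OF sum_sq_le_2[of "u k" "v k"], of "?r\<^sup>2"]
      by (simp add: power_mult_distrib algebra_simps)
    then have "ennreal ((?r * norm (u k + v k))\<^sup>2) \<le> ennreal (2 * (?r * norm (u k))\<^sup>2 + 2 * (?r * norm (v k))\<^sup>2)"
      by (rule ennreal_leI)
    then show "ennreal ((?r * norm (u k + v k))\<^sup>2) \<le> 2 * ennreal ((?r * norm (u k))\<^sup>2) + 2 * ennreal ((?r * norm (v k))\<^sup>2)"
      by (simp add: ennreal_mult)
  qed
  also have "\<dots> = 2 * energy L s u + 2 * energy L s v"
    unfolding energy_def by (subst nn_integral_add) (auto simp: nn_integral_cmult)
  finally show ?thesis .
qed

lemma energy_diff_le: "energy L s (\<lambda>k. u k - v k) \<le> 2 * energy L s u + 2 * energy L s v"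
  using energy_add_le[of L s u "\<lambda>k. - v k"] energy_cong[of "\<lambda>k. - v k" v L s] by simp

lemma energy_diff_finite:
  "energy L s u < \<infinity> \<Longrightarrow> energy L s v < \<infinity> \<Longrightarrow> energy L s (\<lambda>k. u k - v k) < \<infinity>"
  using energy_diff_le[of L s u v] by (auto simp: ennreal_mult_less_top intro: order_le_less_trans)

text \<open>Poincare inequality: the least nonzero wave number is \<open>2 * pi / L\<close>, whose
  power is the embedding constant.\<close>

lemma energy_exponent_le:
  assumes "L > 0" "s \<le> s'"
  shows "energy L s u \<le> ennreal ((2 * pi / L) powr (2 * (s - s'))) * energy L s' u"
proof -
  define c where "c = 2 * pi / L"
  have c: "c > 0" using assms by (simp add: c_def)
  have "energy L s u \<le> (\<integral>\<^sup>+k. ennreal (c powr (2 * (s - s'))) * ennreal ((norm (wave L k) powr s' * norm (u k))\<^sup>2) \<partial>count_space UNIV)"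
    unfolding energy_def
  proof (rule nn_integral_mono)
    fix k :: "int ^ 3"
    let ?r = "norm (wave L k)"
    show "ennreal ((?r powr s * norm (u k))\<^sup>2) \<le> ennreal (c powr (2 * (s - s'))) * ennreal ((?r powr s' * norm (u k))\<^sup>2)"
    proof (cases "k = 0")
      case False
      have "c \<le> ?r" using norm_wave_ge[OF assms(1) False] by (simp add: c_def)
      then have "?r powr (2 * (s - s')) \<le> c powr (2 * (s - s'))"
        using c assms by (intro powr_mono2') auto
      then have "?r powr (2 * (s - s')) * (?r powr (2 * s') * (norm (u k))\<^sup>2)
          \<le> c powr (2 * (s - s')) * (?r powr (2 * s') * (norm (u k))\<^sup>2)"
        by (intro mult_right_mono) auto
      moreover have "?r powr (2 * (s - s')) * ?r powr (2 * s') = ?r powr (2 * s)"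
        by (simp add: algebra_simps flip: powr_add)
      ultimately show ?thesis
        by (simp add: sq_powr_mult ennreal_leI flip: ennreal_mult mult.assoc)
    qed simp
  qed
  also have "\<dots> = ennreal (c powr (2 * (s - s'))) * energy L s' u"
    unfolding energy_def by (simp add: nn_integral_cmult)
  finally show ?thesis by (simp add: c_def)
qed

lemma energy_exponent_finite:
  assumes "L > 0" "s \<le> s'" "energy L s' u < \<infinity>"
  shows "energy L s u < \<infinity>"
  using energy_exponent_le[OF assms(1,2), of u] assms(3)
  by (auto simp: ennreal_mult_less_top intro: order_le_less_trans)

lemma V_antimono:
  assumes "L > 0" "s \<le> s'" "u \<in> V L s'"
  shows "u \<in> V L s"
  using assms energy_exponent_finite[OF assms(1,2), of u] by (simp add: V_iff)

lemma norm_coeff_le_energy: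
  "ennreal ((norm (wave L k) powr s * norm (u k))\<^sup>2) \<le> energy L s u"
  unfolding energy_def by (rule nn_integral_ge_point) simp

lemma borel_measurable_energy:
  assumes "\<And>k. (\<lambda>t. u t k) \<in> borel_measurable M"
  shows "(\<lambda>t. energy L s (u t)) \<in> borel_measurable M"
  unfolding energy_def
proof (rule borel_measurable_nn_integral_count_space)
  fix k
  note [measurable] = assms[of k]
  show "(\<lambda>t. ennreal ((norm (wave L k) powr s * norm (u t k))\<^sup>2)) \<in> borel_measurable M"
    by measurable
qed

text \<open>Dominated convergence over the lattice: mode-wise convergence becomes convergence in V^s
  once a single square summable majorant serves all \<open>n\<close>. Truncation, approximation by
  simple functions and continuity in time all rest on it.\<close>

lemma energy_dominated_convergence:
  assumes D: "(\<integral>\<^sup>+k. ennreal ((norm (wave L k) powr s * D k)\<^sup>2) \<partial>count_space UNIV) < \<infinity>"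
    and le: "\<And>n k. k \<noteq> 0 \<Longrightarrow> norm (u n k) \<le> D k"
    and lim: "\<And>k. k \<noteq> 0 \<Longrightarrow> (\<lambda>n. u n k) \<longlonglongrightarrow> v k"
  shows "(\<lambda>n. energy L s (\<lambda>k. u n k - v k)) \<longlonglongrightarrow> 0"
proof -
  have le': "norm (v k) \<le> D k" if "k \<noteq> 0" for k
    using lim[OF that] le[OF that] by (intro Lim_bounded[of "\<lambda>n. norm (u n k)"] tendsto_norm) auto
  let ?w = "\<lambda>k. 4 * ennreal ((norm (wave L k) powr s * D k)\<^sup>2)"
  have "(\<lambda>n. energy L s (\<lambda>k. u n k - v k)) \<longlonglongrightarrow> (\<integral>\<^sup>+k. 0 \<partial>count_space (UNIV :: (int ^ 3) set))"
    unfolding energy_def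
  proof (rule nn_integral_dominated_convergence[where w = ?w])
    show "(\<integral>\<^sup>+k. ?w k \<partial>count_space UNIV) < \<infinity>"
      using D by (simp add: nn_integral_cmult ennreal_mult_less_top)
    show "AE k in count_space UNIV. ennreal ((norm (wave L k) powr s * norm (u n k - v k))\<^sup>2) \<le> ?w k" for n
    proof (rule AE_I2)
      fix k :: "int ^ 3"
      show "ennreal ((norm (wave L k) powr s * norm (u n k - v k))\<^sup>2) \<le> ?w k"
      proof (cases "k = 0")
        case False
        have "norm (u n k - v k) \<le> 2 * D k"
          using norm_triangle_ineq4[of "u n k" "v k"] le[OF False, of n] le'[OF False] by linarith
        then have "(norm (wave L k) powr s * norm (u n k - v k))\<^sup>2 \<le> (norm (wave L k) powr s * (2 * D k))\<^sup>2"
          by (intro power_mono mult_left_mono) auto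
        also have "\<dots> = 4 * (norm (wave L k) powr s * D k)\<^sup>2" by (simp add: power_mult_distrib)
        finally have "ennreal ((norm (wave L k) powr s * norm (u n k - v k))\<^sup>2)
            \<le> ennreal (4 * (norm (wave L k) powr s * D k)\<^sup>2)" by (rule ennreal_leI)
        then show ?thesis by (simp add: ennreal_mult)
      qed simp
    qed
    show "AE k in count_space UNIV. (\<lambda>n. ennreal ((norm (wave L k) powr s * norm (u n k - v k))\<^sup>2)) \<longlonglongrightarrow> 0"
    proof (rule AE_I2)
      fix k :: "int ^ 3"
      show "(\<lambda>n. ennreal ((norm (wave L k) powr s * norm (u n k - v k))\<^sup>2)) \<longlonglongrightarrow> 0"
      proof (cases "k = 0")
        case False
        have "(\<lambda>n. (norm (wave L k) powr s * norm (u n k - v k))\<^sup>2) \<longlonglongrightarrow> (norm (wave L k) powr s * norm (v k - v k))\<^sup>2"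
          by (intro tendsto_intros lim False)
        then have "(\<lambda>n. ennreal ((norm (wave L k) powr s * norm (u n k - v k))\<^sup>2)) \<longlonglongrightarrow> ennreal ((norm (wave L k) powr s * norm (v k - v k))\<^sup>2)"
          by (rule tendsto_ennrealI)
        then show ?thesis by simp
      qed simp
    qed
  qed auto
  then show ?thesis by simp
qed

text \<open>The finiteness hypothesis matters because \<open>sdist\<close> reads an infinite energy
  as distance 0 through \<open>enn2real\<close>.\<close>

lemma sdist_tendsto_0_iff:
  assumes "L > 0" "eventually (\<lambda>n. energy L s (\<lambda>k. u n k - v k) < \<infinity>) F"
  shows "((\<lambda>n. sdist L s (u n) v) \<longlongrightarrow> 0) F \<longleftrightarrow> ((\<lambda>n. energy L s (\<lambda>k. u n k - v k)) \<longlongrightarrow> 0) F"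
proof -
  let ?e = "\<lambda>n. energy L s (\<lambda>k. u n k - v k)"
  have "((\<lambda>n. sdist L s (u n) v) \<longlongrightarrow> 0) F \<longleftrightarrow> ((\<lambda>n. enn2real (?e n)) \<longlongrightarrow> 0) F"
  proof
    assume "((\<lambda>n. sdist L s (u n) v) \<longlongrightarrow> 0) F"
    then have "((\<lambda>n. (sdist L s (u n) v)\<^sup>2 / L ^ 3) \<longlongrightarrow> 0\<^sup>2 / L ^ 3) F"
      using assms(1) by (intro tendsto_intros) auto
    then show "((\<lambda>n. enn2real (?e n)) \<longlongrightarrow> 0) F"
      using assms(1) by (simp add: sdist_eq)
  next
    assume "((\<lambda>n. enn2real (?e n)) \<longlongrightarrow> 0) F"
    then have "((\<lambda>n. sqrt (L ^ 3 * enn2real (?e n))) \<longlongrightarrow> sqrt (L ^ 3 * 0)) F"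
      by (intro tendsto_real_sqrt tendsto_mult_left)
    then show "((\<lambda>n. sdist L s (u n) v) \<longlongrightarrow> 0) F"
      by (simp add: sdist_eq)
  qed
  also have "\<dots> \<longleftrightarrow> ((\<lambda>n. ennreal (enn2real (?e n))) \<longlongrightarrow> ennreal 0) F"
    using tendsto_ennreal_iff[of "\<lambda>n. enn2real (?e n)" F 0] by (simp del: tendsto_ennreal_iff ennreal_enn2real_if)
  also have "\<dots> \<longleftrightarrow> (?e \<longlongrightarrow> ennreal 0) F"
    using assms(2) by (intro tendsto_cong) (auto elim!: eventually_mono)
  finally show ?thesis by simp
qed

lemma solenoidal_0 [simp]: "solenoidal L (\<lambda>k. 0)"
  by (simp add: solenoidal_def vec_eq_iff)

lemma solenoidal_add: "solenoidal L u \<Longrightarrow> solenoidal L v \<Longrightarrow> solenoidal L (\<lambda>k. u k + v k)"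
  by (auto simp: solenoidal_def vec_eq_iff algebra_simps sum.distrib)

lemma solenoidal_diff: "solenoidal L u \<Longrightarrow> solenoidal L v \<Longrightarrow> solenoidal L (\<lambda>k. u k - v k)"
  by (auto simp: solenoidal_def vec_eq_iff algebra_simps sum_subtractf)

lemma norm_cnj_vec: "norm (\<chi> i. cnj (z $ i)) = norm (z :: complex ^ 'n)"
  by (simp add: norm_vec_def)

lemma solenoidal_norm_minus: "solenoidal L u \<Longrightarrow> norm (u (- k)) = norm (u k)"
  by (simp add: solenoidal_def norm_cnj_vec)

section \<open>The advection term in Fourier variables\<close>

definition cwave :: "real \<Rightarrow> int ^ 3 \<Rightarrow> complex ^ 3" where
  "cwave L k = (\<chi> j. complex_of_real (wave L k $ j))"

text \<open>Orthogonal projection of the coefficient onto the complement of its wave vector, which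
  removes the pressure gradient; at \<open>k = 0\<close> it is set to 0 to enforce zero
  mean.\<close>

definition leray :: "real \<Rightarrow> int ^ 3 \<Rightarrow> complex ^ 3 \<Rightarrow> complex ^ 3" where
  "leray L k z = (if k = 0 then 0
     else z - ((\<Sum>j\<in>UNIV. cwave L k $ j * z $ j) / complex_of_real ((norm (wave L k))\<^sup>2)) *s cwave L k)"

text \<open>The summand with index \<open>l\<close> in the convolution that gives coefficient
  \<open>k\<close> of the transport of \<open>u\<close> by \<open>w\<close>; the derivative falls on
  \<open>u\<close> and yields the factor \<open>\<i>\<close> times the wave vector of
  \<open>l\<close>.\<close>

definition advection :: "real \<Rightarrow> coeffs \<Rightarrow> coeffs \<Rightarrow> int ^ 3 \<Rightarrow> int ^ 3 \<Rightarrow> complex ^ 3" where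
  "advection L w u k l = (\<i> * (\<Sum>j\<in>UNIV. w (k - l) $ j * cwave L l $ j)) *s u l"

text \<open>As a Bochner integral the convolution has value 0 when it does not converge absolutely,
  so \<open>Bhat\<close> is total but linear only under energy bounds.\<close>

definition Bhat :: "real \<Rightarrow> coeffs \<Rightarrow> coeffs \<Rightarrow> coeffs" where
  "Bhat L w u k = leray L k (LINT l|count_space UNIV. advection L w u k l)"

lemma norm_cwave [simp]: "norm (cwave L k) = norm (wave L k)"
  by (simp add: norm_vec_def cwave_def)

lemma norm_smult_vec: "norm (c *s z) = norm c * norm z" for z :: "complex ^ 'n"
  by (simp add: norm_vec_def norm_mult L2_set_right_distrib)

lemma norm_sum_mult_le: "norm (\<Sum>j\<in>UNIV. x $ j * y $ j) \<le> norm x * norm y" for x y :: "complex ^ 'n"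
proof -
  have "norm (\<Sum>j\<in>UNIV. x $ j * y $ j) \<le> (\<Sum>j\<in>UNIV. \<bar>norm (x $ j)\<bar> * \<bar>norm (y $ j)\<bar>)"
    by (rule order_trans[OF norm_sum]) (simp add: norm_mult)
  also have "\<dots> \<le> norm x * norm y"
    unfolding norm_vec_def by (rule L2_set_mult_ineq)
  finally show ?thesis .
qed

text \<open>Both terms of the projection have norm at most \<open>norm z\<close>. The triangle
  inequality then gives 2 in place of the sharp constant 1, without any appeal to
  orthogonality.\<close>

lemma norm_leray_le: "norm (leray L k z) \<le> 2 * norm z"
proof (cases "k = 0 \<or> wave L k = 0")
  case False
  then have r: "norm (wave L k) > 0" by simp
  have "norm (((\<Sum>j\<in>UNIV. cwave L k $ j * z $ j) / complex_of_real ((norm (wave L k))\<^sup>2)) *s cwave L k)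
      = norm (\<Sum>j\<in>UNIV. cwave L k $ j * z $ j) / norm (wave L k)"
    using r by (simp add: norm_smult_vec norm_divide norm_mult power2_eq_square)
  also have "\<dots> \<le> norm z"
    using norm_sum_mult_le[of "cwave L k" z] r by (simp add: divide_le_eq mult.commute)
  finally show ?thesis
    using False norm_triangle_ineq4[of z "((\<Sum>j\<in>UNIV. cwave L k $ j * z $ j) / complex_of_real ((norm (wave L k))\<^sup>2)) *s cwave L k"]
    by (simp add: leray_def)
qed (auto simp: leray_def norm_smult_vec)

lemma leray_add: "leray L k (x + y) = leray L k x + leray L k y"
  by (simp add: leray_def vec_eq_iff algebra_simps sum.distrib add_divide_distrib)

lemma leray_scaleR: "leray L k (c *\<^sub>R x) = c *\<^sub>R leray L k x"
proof -
  have "(\<Sum>j\<in>UNIV. cwave L k $ j * (c *\<^sub>R x) $ j) = c *\<^sub>R (\<Sum>j\<in>UNIV. cwave L k $ j * x $ j)"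
    by (simp add: scaleR_sum_right mult_scaleR_right)
  then show ?thesis unfolding leray_def by (simp add: vec_eq_iff scaleR_diff_right) (simp add: scaleR_conv_of_real)
qed

lemma bounded_linear_leray: "bounded_linear (leray L k)"
  by (rule bounded_linear_intro[where K = 2])
     (simp_all add: leray_add leray_scaleR norm_leray_le mult.commute[of _ 2])

lemma sum_cwave_sq: "(\<Sum>j\<in>UNIV. cwave L k $ j * cwave L k $ j) = complex_of_real ((norm (wave L k))\<^sup>2)"
proof -
  have "(norm (wave L k))\<^sup>2 = (\<Sum>j\<in>UNIV. wave L k $ j * wave L k $ j)"
    by (simp add: power2_norm_eq_inner inner_vec_def)
  then show ?thesis by (simp add: cwave_def)
qed

lemma leray_divergence_free:
  assumes "L > 0"
  shows "(\<Sum>j\<in>UNIV. cwave L k $ j * leray L k z $ j) = 0"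
proof (cases "k = 0")
  case False
  let ?s = "\<Sum>j\<in>UNIV. cwave L k $ j * z $ j" and ?n = "complex_of_real ((norm (wave L k))\<^sup>2)"
  have n: "?n \<noteq> 0" using norm_wave_pos[OF assms False] by simp
  have "(\<Sum>j\<in>UNIV. cwave L k $ j * leray L k z $ j)
      = ?s - (\<Sum>j\<in>UNIV. ?s / ?n * (cwave L k $ j * cwave L k $ j))"
    using False by (simp add: leray_def sum_subtractf algebra_simps)
  also have "\<dots> = ?s - ?s / ?n * ?n"
    unfolding sum_distrib_left[symmetric] sum_cwave_sq by simp
  finally show ?thesis using n by simp
qed (simp add: leray_def)

lemma inner_cnj: "(\<chi> i. cnj (x $ i)) \<bullet> (\<chi> i. cnj (y $ i)) = x \<bullet> (y :: complex ^ 'n)"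
  by (simp add: inner_vec_def inner_complex_def)

lemma inner_smult_cwave:
  assumes "(\<Sum>j\<in>UNIV. cwave L k $ j * a $ j) = 0"
  shows "(c *s cwave L k) \<bullet> a = 0"
proof -
  have "(c *s cwave L k) \<bullet> a = Re (\<Sum>j\<in>UNIV. c * cwave L k $ j * cnj (a $ j))"
    by (simp add: inner_vec_def inner_complex_def algebra_simps)
  also have "(\<Sum>j\<in>UNIV. c * cwave L k $ j * cnj (a $ j)) = c * cnj (\<Sum>j\<in>UNIV. cwave L k $ j * a $ j)"
    by (simp add: sum_distrib_left cwave_def algebra_simps)
  finally show ?thesis using assms by simp
qed

text \<open>The part removed by the projection is a multiple of the wave vector and hence orthogonal
  to divergence-free amplitudes: solenoidal test fields do not feel the pressure.\<close>

lemma leray_inner: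
  assumes "(\<Sum>j\<in>UNIV. cwave L k $ j * a $ j) = 0" "k \<noteq> 0"
  shows "leray L k z \<bullet> a = z \<bullet> a"
  using assms inner_smult_cwave[OF assms(1)] by (simp add: leray_def inner_diff_left)

lemma cwave_minus: "cwave L (- k) = - cwave L k"
  by (simp add: cwave_def wave_minus vec_eq_iff)

lemma leray_cnj: "leray L (- k) (\<chi> i. cnj (z $ i)) = (\<chi> i. cnj (leray L k z $ i))"
  by (simp add: leray_def cwave_minus wave_minus vec_eq_iff sum_negf) (simp add: cwave_def)

section \<open>The bilinear estimate for the advection term\<close>

lemma norm_advection_le:
  "norm (advection L w u k l) \<le> norm (w (k - l)) * (norm (wave L l) * norm (u l))"
  using mult_right_mono[OF norm_sum_mult_le[of "w (k - l)" "cwave L l"], of "norm (u l)"]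
  by (simp add: advection_def norm_smult_vec norm_mult mult.assoc)

text \<open>The three frequencies of a product are the sides of a triangle, so the ratio of two of the
  weights is controlled by the third; what remains is an absolutely summable lattice weight.\<close>

lemma advection_weight_le:
  assumes "L > 0" "\<alpha> \<ge> 0" "w 0 = 0" "k \<noteq> 0"
  shows "norm (wave L k) powr (\<alpha> - 1) * (norm (w (k - l)) * (norm (wave L l) * norm (u l)))
    \<le> 2 powr (1 + \<alpha>) * (((norm (wave L (k - l)) powr (1 + \<alpha>) * norm (w (k - l))) * (norm (wave L l) powr \<alpha> * norm (u l)))
        * (norm (wave L (k - l)) powr - (1 + \<alpha>) + norm (wave L l) powr - (1 + \<alpha>) + norm (wave L k) powr - (1 + \<alpha>)))"
proof (cases "l = 0 \<or> k - l = 0")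
  case False
  define x y z where "x = norm (wave L (k - l))" and "y = norm (wave L l)" and "z = norm (wave L k)"
  define p where "p = 1 + \<alpha>"
  define W U where "W = norm (w (k - l))" and "U = norm (u l)"
  have nn: "W \<ge> 0" "U \<ge> 0" by (auto simp: W_def U_def)
  have pos: "x > 0" "y > 0" "z > 0"
    using norm_wave_pos[OF assms(1)] False assms(4) by (auto simp: x_def y_def z_def)
  have "y \<le> x + z" "z \<le> x + y"
    using norm_triangle_ineq4[of "wave L k" "wave L (k - l)"] norm_triangle_ineq[of "wave L (k - l)" "wave L l"]
    by (auto simp: x_def y_def z_def wave_diff)
  from bilinear_kernel_bound[OF pos this assms(2)]
  have le: "(x powr p * W * (y powr \<alpha> * U) * x powr - p) * (y powr (1 - \<alpha>) * z powr (\<alpha> - 1))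
      \<le> (x powr p * W * (y powr \<alpha> * U) * x powr - p) * (2 powr p * (1 + (x / y) powr p + (x / z) powr p))"
    unfolding p_def using nn by (intro mult_left_mono) auto
  have "(x powr p * W * (y powr \<alpha> * U) * x powr - p) * (y powr (1 - \<alpha>) * z powr (\<alpha> - 1))
      = (x powr p * x powr - p) * (y powr \<alpha> * y powr (1 - \<alpha>)) * (z powr (\<alpha> - 1) * (W * U))"
    by (simp only: mult_ac)
  also have "x powr p * x powr - p = 1" using pos by (simp flip: powr_add)
  also have "y powr \<alpha> * y powr (1 - \<alpha>) = y" using pos by (simp flip: powr_add)
  finally have e1: "(x powr p * W * (y powr \<alpha> * U) * x powr - p) * (y powr (1 - \<alpha>) * z powr (\<alpha> - 1))
      = z powr (\<alpha> - 1) * (W * (y * U))"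
    by (simp add: mult_ac)
  have e2: "(x powr p * W * (y powr \<alpha> * U) * x powr - p) * (2 powr p * (1 + (x / y) powr p + (x / z) powr p))
      = 2 powr p * ((x powr p * W * (y powr \<alpha> * U)) * (x powr - p * (1 + (x / y) powr p + (x / z) powr p)))"
    by (simp only: mult_ac)
  have e3: "x powr - p * (1 + (x / y) powr p + (x / z) powr p) = x powr - p + y powr - p + z powr - p"
    using pos by (simp add: powr_divide powr_minus field_simps)
  show ?thesis
    using le unfolding e1 e2 e3 unfolding x_def y_def z_def W_def U_def p_def .
qed (use assms in auto)

lemma sq_add_le_ennreal: "(x + y)\<^sup>2 \<le> 2 * x\<^sup>2 + 2 * y\<^sup>2" for x y :: ennreal
proof -
  have "(x + y)\<^sup>2 = x\<^sup>2 + y\<^sup>2 + 2 * x * y" by (simp add: power2_eq_square distrib_left distrib_right mult_2 mult.commute[of y x] add_ac)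
  also have "\<dots> \<le> x\<^sup>2 + y\<^sup>2 + (x\<^sup>2 + y\<^sup>2)"
    by (intro add_left_mono sum_of_squares_ge_ennreal)
  finally show ?thesis by (simp add: mult_2 algebra_simps)
qed

lemma nn_integral_count_space_diff:
  fixes g :: "'a :: ab_group_add \<Rightarrow> ennreal"
  shows "(\<integral>\<^sup>+l. g (k - l) \<partial>count_space UNIV) = (\<integral>\<^sup>+l. g l \<partial>count_space UNIV)"
  by (rule nn_integral_bij_count_space) (rule bij_betw_byWitness[where f' = "\<lambda>l. k - l"], auto)

lemma nn_integral_count_space_diff':
  fixes g :: "'a :: ab_group_add \<Rightarrow> ennreal"
  shows "(\<integral>\<^sup>+k. g (k - l) \<partial>count_space UNIV) = (\<integral>\<^sup>+k. g k \<partial>count_space UNIV)"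
  by (rule nn_integral_bij_count_space) (rule bij_betw_byWitness[where f' = "\<lambda>k. k + l"], auto)

definition lattice_sum :: "real \<Rightarrow> real \<Rightarrow> ennreal" where
  "lattice_sum L p = (\<integral>\<^sup>+k. ennreal (norm (wave L k) powr (- 2 * p)) \<partial>count_space UNIV)"

text \<open>Of the three lattice weights, the two that depend on \<open>l\<close> are collected in
  \<open>g\<close> and separated from the product of \<open>a\<close> and \<open>b\<close> by
  Cauchy-Schwarz. The third, \<open>r k\<close>, leaves the sum and multiplies the plain convolution
  \<open>J\<close>, which Cauchy-Schwarz bounds by the two energies uniformly in \<open>k\<close>.
  Both resulting terms can still be summed over \<open>k\<close>: the first by Tonelli, the second
  because \<open>r\<close> is square summable.\<close>

lemma advection_sum_sq_le:
  fixes w u :: coeffs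
  assumes "L > 0" "\<alpha> \<ge> 0" "w 0 = 0" "k \<noteq> 0"
  defines "a \<equiv> \<lambda>k. ennreal (norm (wave L k) powr (1 + \<alpha>) * norm (w k))"
    and "b \<equiv> \<lambda>k. ennreal (norm (wave L k) powr \<alpha> * norm (u k))"
  shows "(ennreal (norm (wave L k) powr (\<alpha> - 1)) * (\<integral>\<^sup>+l. ennreal (norm (advection L w u k l)) \<partial>count_space UNIV))\<^sup>2
    \<le> ennreal (2 powr (2 * (1 + \<alpha>))) * (8 * lattice_sum L (1 + \<alpha>) * (\<integral>\<^sup>+l. (a (k - l))\<^sup>2 * (b l)\<^sup>2 \<partial>count_space UNIV)
        + 2 * ennreal (norm (wave L k) powr (- 2 * (1 + \<alpha>))) * (energy L (1 + \<alpha>) w * energy L \<alpha> u))"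
proof -
  define p where "p = 1 + \<alpha>"
  define r where "r = (\<lambda>k. ennreal (norm (wave L k) powr - p))"
  have r2: "(r k)\<^sup>2 = ennreal (norm (wave L k) powr (- 2 * p))" for k
    by (simp add: r_def ennreal_power) (simp add: power2_eq_square flip: powr_add)
  \<comment> \<open>Each of the two translates of \<open>r\<close> contributes a full lattice sum,
    and squaring their sum costs a factor 2; hence the constant 4 below and the 8 of the
    statement.\<close>
  define g where "g = (\<lambda>l. r (k - l) + r l)"
  define I where "I = (\<integral>\<^sup>+l. (a (k - l) * b l) * g l \<partial>count_space UNIV)"
  define J where "J = (\<integral>\<^sup>+l. a (k - l) * b l \<partial>count_space UNIV)"
  have "ennreal (norm (wave L k) powr (\<alpha> - 1)) * (\<integral>\<^sup>+l. ennreal (norm (advection L w u k l)) \<partial>count_space UNIV)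
      = (\<integral>\<^sup>+l. ennreal (norm (wave L k) powr (\<alpha> - 1)) * ennreal (norm (advection L w u k l)) \<partial>count_space UNIV)"
    by (simp add: nn_integral_cmult)
  also have "\<dots> \<le> (\<integral>\<^sup>+l. ennreal (2 powr p) * ((a (k - l) * b l) * g l + r k * (a (k - l) * b l)) \<partial>count_space UNIV)"
  proof (rule nn_integral_mono)
    fix l
    have "ennreal (norm (wave L k) powr (\<alpha> - 1)) * ennreal (norm (advection L w u k l))
        \<le> ennreal (norm (wave L k) powr (\<alpha> - 1) * (norm (w (k - l)) * (norm (wave L l) * norm (u l))))"
      by (subst ennreal_mult[symmetric]) (auto intro!: ennreal_leI mult_left_mono norm_advection_le)
    also have "\<dots> \<le> ennreal (2 powr p * (((norm (wave L (k - l)) powr p * norm (w (k - l))) * (norm (wave L l) powr \<alpha> * norm (u l)))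
        * (norm (wave L (k - l)) powr - p + norm (wave L l) powr - p + norm (wave L k) powr - p)))"
      unfolding p_def using assms(1-4) by (intro ennreal_leI advection_weight_le)
    also have "\<dots> = ennreal (2 powr p) * ((a (k - l) * b l) * (g l + r k))"
      unfolding a_def b_def g_def r_def p_def[symmetric] by (simp add: ennreal_mult)
    finally show "ennreal (norm (wave L k) powr (\<alpha> - 1)) * ennreal (norm (advection L w u k l))
        \<le> ennreal (2 powr p) * ((a (k - l) * b l) * g l + r k * (a (k - l) * b l))"
      by (simp add: algebra_simps)
  qed
  also have "\<dots> = ennreal (2 powr p) * (I + r k * J)"
    unfolding I_def J_def by (simp add: nn_integral_cmult nn_integral_add)
  finally have "(ennreal (norm (wave L k) powr (\<alpha> - 1)) * (\<integral>\<^sup>+l. ennreal (norm (advection L w u k l)) \<partial>count_space UNIV))\<^sup>2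
      \<le> (ennreal (2 powr p) * (I + r k * J))\<^sup>2"
    by (rule power_mono) simp
  also have "\<dots> = ennreal (2 powr (2 * p)) * (I + r k * J)\<^sup>2"
    by (simp add: power_mult_distrib ennreal_power) (simp add: power2_eq_square flip: powr_add)
  also have "\<dots> \<le> ennreal (2 powr (2 * p)) * (2 * I\<^sup>2 + 2 * (r k)\<^sup>2 * J\<^sup>2)"
    using sq_add_le_ennreal[of I "r k * J"] by (intro mult_left_mono) (auto simp: power_mult_distrib mult.assoc)
  also have "\<dots> \<le> ennreal (2 powr (2 * p)) * (2 * (4 * lattice_sum L p * (\<integral>\<^sup>+l. (a (k - l))\<^sup>2 * (b l)\<^sup>2 \<partial>count_space UNIV))
      + 2 * (r k)\<^sup>2 * (energy L p w * energy L \<alpha> u))"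
  proof (intro mult_left_mono add_mono)
    have "(\<integral>\<^sup>+l. (g l)\<^sup>2 \<partial>count_space UNIV) \<le> (\<integral>\<^sup>+l. 2 * (r (k - l))\<^sup>2 + 2 * (r l)\<^sup>2 \<partial>count_space UNIV)"
      unfolding g_def by (intro nn_integral_mono sq_add_le_ennreal)
    also have "\<dots> = 4 * lattice_sum L p"
      using nn_integral_count_space_diff[of "\<lambda>l. (r l)\<^sup>2" k]
      by (simp add: nn_integral_add nn_integral_cmult r2 lattice_sum_def flip: distrib_right)
    finally have G: "(\<integral>\<^sup>+l. (g l)\<^sup>2 \<partial>count_space UNIV) \<le> 4 * lattice_sum L p" .
    have "I\<^sup>2 \<le> (\<integral>\<^sup>+l. (a (k - l) * b l)\<^sup>2 \<partial>count_space UNIV) * (\<integral>\<^sup>+l. (g l)\<^sup>2 \<partial>count_space UNIV)"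
      unfolding I_def by (rule Cauchy_Schwarz_nn_integral) auto
    also have "\<dots> \<le> (\<integral>\<^sup>+l. (a (k - l) * b l)\<^sup>2 \<partial>count_space UNIV) * (4 * lattice_sum L p)"
      using G by (intro mult_left_mono) auto
    finally show "I\<^sup>2 \<le> 4 * lattice_sum L p * (\<integral>\<^sup>+l. (a (k - l))\<^sup>2 * (b l)\<^sup>2 \<partial>count_space UNIV)"
      by (simp add: power_mult_distrib mult_ac)
    have "J\<^sup>2 \<le> (\<integral>\<^sup>+l. (a (k - l))\<^sup>2 \<partial>count_space UNIV) * (\<integral>\<^sup>+l. (b l)\<^sup>2 \<partial>count_space UNIV)"
      unfolding J_def by (rule Cauchy_Schwarz_nn_integral) auto
    also have "(\<integral>\<^sup>+l. (a (k - l))\<^sup>2 \<partial>count_space UNIV) = energy L p w"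
      using nn_integral_count_space_diff[of "\<lambda>l. (a l)\<^sup>2" k]
      by (simp add: a_def p_def energy_def ennreal_power)
    also have "(\<integral>\<^sup>+l. (b l)\<^sup>2 \<partial>count_space UNIV) = energy L \<alpha> u"
      by (simp add: b_def energy_def ennreal_power)
    finally show "J\<^sup>2 \<le> energy L p w * energy L \<alpha> u" .
  qed auto
  finally show ?thesis
    unfolding r2 p_def by (simp add: mult_ac)
qed

text \<open>Summing \<open>advection_sum_sq_le\<close> over \<open>k\<close> produces the product of
  the two energies twice: once through Tonelli and translation invariance of the lattice, once
  through the convergent sum of the weights in \<open>k\<close>.\<close>

lemma energy_Bhat_le:
  assumes "L > 0" "\<alpha> > 1 / 2"
  obtains C where "C > 0"
    "\<And>w u. w 0 = 0 \<Longrightarrow> energy L (\<alpha> - 1) (Bhat L w u) \<le> ennreal C * (energy L (1 + \<alpha>) w * energy L \<alpha> u)"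
proof -
  define S where "S = lattice_sum L (1 + \<alpha>)"
  have S: "S < \<infinity>"
    unfolding S_def lattice_sum_def using assms by (intro wave_powr_summable) auto
  \<comment> \<open>4 is the square of the norm bound for the Leray projection, 10 adds the 8 and
    the 2 of the pointwise estimate, and the final 1 makes the constant positive.\<close>
  define C where "C = 4 * (2 powr (2 * (1 + \<alpha>)) * (10 * enn2real S)) + 1"
  show ?thesis
  proof
    show "C > 0" by (simp add: C_def add_nonneg_pos)
    fix w u :: coeffs assume w0: "w 0 = 0"
    define a where "a = (\<lambda>k. ennreal (norm (wave L k) powr (1 + \<alpha>) * norm (w k)))"
    define b where "b = (\<lambda>k. ennreal (norm (wave L k) powr \<alpha> * norm (u k)))"
    define A B where "A = energy L (1 + \<alpha>) w" and "B = energy L \<alpha> u"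
    have ab: "A = (\<integral>\<^sup>+k. (a k)\<^sup>2 \<partial>count_space UNIV)" "B = (\<integral>\<^sup>+k. (b k)\<^sup>2 \<partial>count_space UNIV)"
      by (simp_all add: A_def B_def a_def b_def energy_def ennreal_power)
    have "energy L (\<alpha> - 1) (Bhat L w u)
        \<le> (\<integral>\<^sup>+k. 4 * (ennreal (2 powr (2 * (1 + \<alpha>))) * (8 * S * (\<integral>\<^sup>+l. (a (k - l))\<^sup>2 * (b l)\<^sup>2 \<partial>count_space UNIV)
        + 2 * ennreal (norm (wave L k) powr (- 2 * (1 + \<alpha>))) * (A * B))) \<partial>count_space UNIV)"
      unfolding energy_def
    proof (rule nn_integral_mono)
      fix k :: "int ^ 3"
      let ?\<rho> = "norm (wave L k) powr (\<alpha> - 1)"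
      let ?T = "\<integral>\<^sup>+l. ennreal (norm (advection L w u k l)) \<partial>count_space UNIV"
      show "ennreal ((?\<rho> * norm (Bhat L w u k))\<^sup>2)
          \<le> 4 * (ennreal (2 powr (2 * (1 + \<alpha>))) * (8 * S * (\<integral>\<^sup>+l. (a (k - l))\<^sup>2 * (b l)\<^sup>2 \<partial>count_space UNIV)
        + 2 * ennreal (norm (wave L k) powr (- 2 * (1 + \<alpha>))) * (A * B)))"
      proof (cases "k = 0")
        case False
        have "ennreal (norm (Bhat L w u k)) \<le> 2 * ennreal (norm (LINT l|count_space UNIV. advection L w u k l))"
          unfolding Bhat_def using norm_leray_le by (metis ennreal_leI ennreal_mult' ennreal_numeral zero_le_numeral)
        also have "\<dots> \<le> 2 * ?T"
        proof (cases "integrable (count_space UNIV) (advection L w u k)")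
          case True
          then show ?thesis by (intro mult_left_mono integral_norm_bound_ennreal) auto
        qed (simp add: not_integrable_integral_eq)
        finally have "ennreal ?\<rho> * ennreal (norm (Bhat L w u k)) \<le> ennreal ?\<rho> * (2 * ?T)"
          by (intro mult_left_mono) auto
        then have "(ennreal ?\<rho> * ennreal (norm (Bhat L w u k)))\<^sup>2 \<le> (ennreal ?\<rho> * (2 * ?T))\<^sup>2"
          by (intro power_mono) auto
        then have "ennreal ((?\<rho> * norm (Bhat L w u k))\<^sup>2) \<le> 4 * (ennreal ?\<rho> * ?T)\<^sup>2"
          by (simp add: ennreal_mult power_mult_distrib mult_ac ennreal_power)
        also have "\<dots> \<le> 4 * (ennreal (2 powr (2 * (1 + \<alpha>))) * (8 * S * (\<integral>\<^sup>+l. (a (k - l))\<^sup>2 * (b l)\<^sup>2 \<partial>count_space UNIV)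
            + 2 * ennreal (norm (wave L k) powr (- 2 * (1 + \<alpha>))) * (A * B)))"
          using advection_sum_sq_le[of L \<alpha> w k u] assms w0 False
          unfolding a_def b_def S_def A_def B_def by (intro mult_left_mono) auto
        finally show ?thesis .
      qed simp
    qed
    also have "\<dots> = 4 * (ennreal (2 powr (2 * (1 + \<alpha>))) * (8 * S * (\<integral>\<^sup>+k. \<integral>\<^sup>+l. (a (k - l))\<^sup>2 * (b l)\<^sup>2 \<partial>count_space UNIV \<partial>count_space UNIV)
        + 2 * S * (A * B)))"
      by (simp add: nn_integral_cmult nn_integral_multc nn_integral_add S_def lattice_sum_def)
    also have "(\<integral>\<^sup>+k. \<integral>\<^sup>+l. (a (k - l))\<^sup>2 * (b l)\<^sup>2 \<partial>count_space UNIV \<partial>count_space UNIV)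
        = (\<integral>\<^sup>+l. \<integral>\<^sup>+k. (a (k - l))\<^sup>2 * (b l)\<^sup>2 \<partial>count_space UNIV \<partial>count_space UNIV)"
      by (rule nn_integral_count_space_nn_integral) auto
    also have "\<dots> = A * B"
      using nn_integral_count_space_diff'[of "\<lambda>l. (a l)\<^sup>2"] by (simp add: nn_integral_multc nn_integral_cmult ab)
    also have "4 * (ennreal (2 powr (2 * (1 + \<alpha>))) * (8 * S * (A * B) + 2 * S * (A * B)))
        = 4 * (ennreal (2 powr (2 * (1 + \<alpha>))) * (10 * S)) * (A * B)"
      by (simp add: mult.assoc flip: distrib_right)
    also have "\<dots> \<le> ennreal C * (A * B)"
    proof (rule mult_right_mono)
      have "4 * (ennreal (2 powr (2 * (1 + \<alpha>))) * (10 * S)) = ennreal (4 * (2 powr (2 * (1 + \<alpha>)) * (10 * enn2real S)))"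
        using S by (simp add: ennreal_mult mult.left_commute[of _ 10] flip: mult.assoc[of 4 10])
      also have "\<dots> \<le> ennreal C" by (rule ennreal_leI) (simp add: C_def)
      finally show "4 * (ennreal (2 powr (2 * (1 + \<alpha>))) * (10 * S)) \<le> ennreal C" .
    qed simp
    finally show "energy L (\<alpha> - 1) (Bhat L w u) \<le> ennreal C * (energy L (1 + \<alpha>) w * energy L \<alpha> u)"
      by (simp add: A_def B_def)
  qed
qed

text \<open>At a fixed frequency the right side of \<open>advection_sum_sq_le\<close> is finite,
  since each \<open>a (k - l)\<close> squared is at most the whole energy of \<open>w\<close>.
  Linearity of \<open>Bhat\<close> depends on this, because the Bochner integral is additive only on
  integrable functions.\<close>

lemma integrable_advection:
  assumes "L > 0" "\<alpha> > 1 / 2" "w 0 = 0" "k \<noteq> 0" "energy L (1 + \<alpha>) w < \<infinity>" "energy L \<alpha> u < \<infinity>"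
  shows "integrable (count_space UNIV) (advection L w u k)"
proof (rule integrableI_bounded)
  define a where "a = (\<lambda>k. ennreal (norm (wave L k) powr (1 + \<alpha>) * norm (w k)))"
  define b where "b = (\<lambda>k. ennreal (norm (wave L k) powr \<alpha> * norm (u k)))"
  define T where "T = (\<integral>\<^sup>+l. ennreal (norm (advection L w u k l)) \<partial>count_space UNIV)"
  have S: "lattice_sum L (1 + \<alpha>) < \<infinity>"
    unfolding lattice_sum_def using assms by (intro wave_powr_summable) auto
  have "(\<integral>\<^sup>+l. (a (k - l))\<^sup>2 * (b l)\<^sup>2 \<partial>count_space UNIV) \<le> (\<integral>\<^sup>+l. energy L (1 + \<alpha>) w * (b l)\<^sup>2 \<partial>count_space UNIV)"
    unfolding a_def ennreal_power[OF mult_nonneg_nonneg[OF powr_ge_zero norm_ge_zero]]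
    by (intro nn_integral_mono mult_right_mono norm_coeff_le_energy) auto
  also have "\<dots> = energy L (1 + \<alpha>) w * energy L \<alpha> u"
    by (simp add: nn_integral_cmult b_def energy_def ennreal_power)
  finally have ab: "(\<integral>\<^sup>+l. (a (k - l))\<^sup>2 * (b l)\<^sup>2 \<partial>count_space UNIV) < \<infinity>"
    using assms by (auto simp: ennreal_mult_less_top intro: order_le_less_trans)
  have "(ennreal (norm (wave L k) powr (\<alpha> - 1)) * T)\<^sup>2 < \<infinity>"
    unfolding T_def
    by (rule order_le_less_trans[OF advection_sum_sq_le[where w = w and u = u]])
       (use assms S ab in \<open>auto simp: ennreal_mult_less_top a_def b_def\<close>)
  moreover have "ennreal (norm (wave L k) powr (\<alpha> - 1)) > 0"
    using norm_wave_pos[OF assms(1,4)] by simp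
  ultimately show "(\<integral>\<^sup>+l. ennreal (norm (advection L w u k l)) \<partial>count_space UNIV) < \<infinity>"
    by (auto simp: power_less_top_ennreal ennreal_mult_less_top T_def)
qed simp

section \<open>Symmetry, linearity and measurability of the advection term\<close>

lemma integral_vec_cnj:
  fixes f :: "'a \<Rightarrow> complex ^ 'n"
  shows "(LINT x|M. (\<chi> i. cnj (f x $ i))) = (\<chi> i. cnj ((LINT x|M. f x) $ i))"
proof -
  have "bounded_linear (\<lambda>z :: complex ^ 'n. (\<chi> i. cnj (z $ i)))"
    by (rule bounded_linear_intro[where K = 1]) (simp_all add: vec_eq_iff norm_cnj_vec)
  from integral_bounded_linear'[OF this this, of M f] show ?thesis by simp
qed

lemma advection_minus:
  assumes "solenoidal L w" "solenoidal L u"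
  shows "advection L w u (- k) (- l) = (\<chi> i. cnj (advection L w u k l $ i))"
proof -
  have "- k - - l = - (k - l)" by simp
  then have "w (- k - - l) = (\<chi> i. cnj (w (k - l) $ i))" "u (- l) = (\<chi> i. cnj (u l $ i))"
    using assms unfolding solenoidal_def by metis+
  then show ?thesis
    by (simp add: advection_def cwave_minus vec_eq_iff sum_negf) (simp add: cwave_def)
qed

lemma solenoidal_Bhat:
  assumes "L > 0" "solenoidal L w" "solenoidal L u"
  shows "solenoidal L (Bhat L w u)"
  unfolding solenoidal_def
proof (intro conjI allI)
  show "Bhat L w u 0 = 0" by (simp add: Bhat_def leray_def)
  fix k
  show "(\<Sum>i\<in>UNIV. complex_of_real (wave L k $ i) * Bhat L w u k $ i) = 0"
    using leray_divergence_free[OF assms(1), of k] by (simp add: Bhat_def cwave_def)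
  have "(LINT l|count_space UNIV. advection L w u (- k) l) = (LINT l|count_space UNIV. advection L w u (- k) (- l))"
    by (rule integral_bij_count_space[symmetric]) (rule bij_betw_byWitness[where f' = uminus], auto)
  also have "\<dots> = (\<chi> i. cnj ((LINT l|count_space UNIV. advection L w u k l) $ i))"
    unfolding advection_minus[OF assms(2,3)] by (rule integral_vec_cnj)
  finally show "Bhat L w u (- k) = (\<chi> i. cnj (Bhat L w u k $ i))"
    by (simp add: Bhat_def leray_cnj)
qed

lemma Bhat_diff_right:
  assumes "L > 0" "\<alpha> > 1 / 2" "w 0 = 0" "energy L (1 + \<alpha>) w < \<infinity>" "energy L \<alpha> u < \<infinity>" "energy L \<alpha> v < \<infinity>"
  shows "Bhat L w (\<lambda>k. u k - v k) = (\<lambda>k. Bhat L w u k - Bhat L w v k)"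
proof
  fix k
  interpret bounded_linear "leray L k" by (rule bounded_linear_leray)
  show "Bhat L w (\<lambda>k. u k - v k) k = Bhat L w u k - Bhat L w v k"
  proof (cases "k = 0")
    case False
    have "advection L w (\<lambda>k. u k - v k) k = (\<lambda>l. advection L w u k l - advection L w v k l)"
      by (simp add: advection_def vec_eq_iff algebra_simps fun_eq_iff)
    then show ?thesis
      using assms False by (simp add: Bhat_def integrable_advection[where \<alpha> = \<alpha>] diff[symmetric])
  qed (simp add: Bhat_def leray_def)
qed

lemma Bhat_diff_left:
  assumes "L > 0" "\<alpha> > 1 / 2" "w 0 = 0" "v 0 = 0"
    "energy L (1 + \<alpha>) w < \<infinity>" "energy L (1 + \<alpha>) v < \<infinity>" "energy L \<alpha> u < \<infinity>"
  shows "Bhat L (\<lambda>k. w k - v k) u = (\<lambda>k. Bhat L w u k - Bhat L v u k)"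
proof
  fix k
  interpret bounded_linear "leray L k" by (rule bounded_linear_leray)
  show "Bhat L (\<lambda>k. w k - v k) u k = Bhat L w u k - Bhat L v u k"
  proof (cases "k = 0")
    case False
    have "advection L (\<lambda>k. w k - v k) u k = (\<lambda>l. advection L w u k l - advection L v u k l)"
      by (simp add: advection_def vec_eq_iff algebra_simps fun_eq_iff sum_subtractf)
    then show ?thesis
      using assms False by (simp add: Bhat_def integrable_advection[where \<alpha> = \<alpha>] diff[symmetric])
  qed (simp add: Bhat_def leray_def)
qed

lemma borel_measurable_Bhat:
  assumes "\<And>k. (\<lambda>t. w t k) \<in> borel_measurable M" "\<And>k. (\<lambda>t. u t k) \<in> borel_measurable M"
  shows "(\<lambda>t. Bhat L (w t) (u t) k) \<in> borel_measurable M"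
proof -
  have adv: "(\<lambda>t. advection L (w t) (u t) k l) \<in> borel_measurable M" for l
    unfolding advection_def vector_scalar_mult_def
    by (rule borel_measurable_continuous_Pair[OF assms(1)[of "k - l"] assms(2)[of l]])
       (intro continuous_intros)
  have "(\<lambda>t. LINT l|count_space UNIV. advection L (w t) (u t) k l) \<in> borel_measurable M"
    by (rule borel_measurable_integral_count_space) (rule adv)
  then show ?thesis
    unfolding Bhat_def
    by (rule borel_measurable_continuous_on[OF linear_continuous_on[OF bounded_linear_leray], rotated])
qed

section \<open>Trigonometric polynomials\<close>

definition fmode :: "real \<Rightarrow> int ^ 3 \<Rightarrow> real ^ 3 \<Rightarrow> complex" where
  "fmode L k x = exp (\<i> * complex_of_real (x \<bullet> wave L k))"

lemma fmode_add: "fmode L (k + l) x = fmode L k x * fmode L l x"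
  by (simp add: fmode_def wave_add inner_add_right algebra_simps exp_add)

lemma cnj_fmode: "cnj (fmode L k x) = fmode L (- k) x"
  by (simp add: fmode_def wave_minus exp_cnj)

lemma continuous_on_fmode [continuous_intros]: "continuous_on A (fmode L k)"
  unfolding fmode_def by (intro continuous_intros)

lemma integral_exp_period:
  fixes n :: int
  assumes "L > 0" "n \<noteq> 0"
  shows "(LINT t|lborel. indicator {0..L} t *\<^sub>R exp (\<i> * complex_of_real (t * (2 * pi / L * real_of_int n)))) = 0"
proof -
  define c where "c = 2 * pi / L * real_of_int n"
  have c: "c \<noteq> 0" using assms by (simp add: c_def)
  define F where "F = (\<lambda>t. exp (\<i> * complex_of_real (t * c)) / (\<i> * complex_of_real c))"
  have "(LINT t|lborel. indicator {0..L} t *\<^sub>R exp (\<i> * complex_of_real (t * c))) = F L - F 0"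
  proof (rule integral_FTC_Icc)
    fix t :: real
    have "((\<lambda>z. exp (\<i> * (z * complex_of_real c)) / (\<i> * complex_of_real c)) has_field_derivative exp (\<i> * (complex_of_real t * complex_of_real c))) (at (complex_of_real t))"
      using c by (auto intro!: derivative_eq_intros simp: mult_ac)
    from has_vector_derivative_real_field[OF this]
    show "(F has_vector_derivative exp (\<i> * complex_of_real (t * c))) (at t within {0..L})"
      by (simp add: F_def o_def has_vector_derivative_at_within)
  qed (use assms in \<open>auto intro!: continuous_intros\<close>)
  also have "F L = F 0"
  proof -
    have "L * c = 2 * pi * real_of_int n" using assms by (simp add: c_def)
    then have "exp (\<i> * complex_of_real (L * c)) = exp (2 * complex_of_real pi * complex_of_int n * \<i>)"
      by (simp add: mult_ac)
    then have "exp (\<i> * complex_of_real (L * c)) = 1"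
      using exp_integer_2pi[of "of_int n"] by (simp add: mult_ac)
    then show ?thesis by (simp add: F_def)
  qed
  finally show ?thesis by (simp add: c_def)
qed

text \<open>The exponential factorizes over the coordinates, and a single nonzero component of
  \<open>k\<close> already makes one factor an integral over full periods, which is 0.\<close>

lemma integral_fmode:
  assumes "L > 0"
  shows "(LINT x|lebesgue_on (cbox 0 (\<chi> i. L)). fmode L k x) = (if k = 0 then complex_of_real (L ^ 3) else 0)"
proof -
  let ?C = "cbox 0 (\<chi> i. L) :: (real ^ 3) set"
  define g where "g = (\<lambda>(b :: real ^ 3) t. indicator {0..L} t *\<^sub>R exp (\<i> * complex_of_real (t * (wave L k \<bullet> b))))"
  interpret product_sigma_finite "\<lambda>_ :: real ^ 3. lborel :: real measure" ..
  have gint: "integrable lborel (g b)" for b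
    unfolding g_def by (rule borel_integrable_compact) (auto intro!: continuous_intros)
  have in1: "(\<chi> i. L) \<bullet> b = L" if "b \<in> Basis" for b :: "real ^ 3"
    using that by (auto simp: Basis_vec_def inner_axis)
  have prod: "indicator ?C (\<Sum>b\<in>Basis. z b *\<^sub>R b) *\<^sub>R fmode L k (\<Sum>b\<in>Basis. z b *\<^sub>R b) = (\<Prod>b\<in>Basis. g b (z b))"
    for z :: "real ^ 3 \<Rightarrow> real"
  proof -
    have comp: "(\<Sum>b\<in>Basis. z b *\<^sub>R b) \<bullet> b = z b" if "b \<in> Basis" for b
      using that by simp
    have 1: "(indicator ?C (\<Sum>b\<in>Basis. z b *\<^sub>R b) :: real) = (\<Prod>b\<in>Basis. indicator {0..L} (z b))"
      by (auto simp: indicator_def mem_box comp in1 split: if_splits)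
    have "(\<Sum>b\<in>Basis. z b *\<^sub>R b) \<bullet> wave L k = (\<Sum>b\<in>Basis. z b * (wave L k \<bullet> b))"
      by (simp add: inner_sum_left inner_commute[of "wave L k"])
    then have 2: "fmode L k (\<Sum>b\<in>Basis. z b *\<^sub>R b) = (\<Prod>b\<in>Basis. exp (\<i> * complex_of_real (z b * (wave L k \<bullet> b))))"
      by (simp add: fmode_def sum_distrib_left exp_sum)
    show ?thesis unfolding 1 2 g_def
      by (simp add: scaleR_conv_of_real prod.distrib)
  qed
  have meas: "(\<lambda>x. indicator ?C x *\<^sub>R fmode L k x) \<in> borel_measurable borel"
    by (rule borel_measurable_scaleR, rule borel_measurable_indicator, simp, rule borel_measurable_continuous_onI, rule continuous_on_fmode)
  have "(LINT x|lebesgue_on ?C. fmode L k x) = (LINT x|lebesgue. indicator ?C x *\<^sub>R fmode L k x)"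
    by (rule integral_restrict_space) simp
  also have "\<dots> = (LINT x|lborel. indicator ?C x *\<^sub>R fmode L k x)"
    using meas by (intro integral_completion) simp
  also have "\<dots> = (LINT z|(\<Pi>\<^sub>M b\<in>Basis. lborel). indicator ?C (\<Sum>b\<in>Basis. z b *\<^sub>R b) *\<^sub>R fmode L k (\<Sum>b\<in>Basis. z b *\<^sub>R b))"
    by (subst lborel_eq, rule integral_distr) (use meas in simp_all)
  also have "\<dots> = (\<Prod>b\<in>Basis. LINT t|lborel. g b t)"
    unfolding prod by (rule product_integral_prod) (auto intro: gint)
  also have "\<dots> = (if k = 0 then complex_of_real (L ^ 3) else 0)"
  proof (cases "k = 0")
    case True
    have "(LINT t|lborel. g b t) = complex_of_real L" for b
      using True assms by (simp add: g_def of_real_def)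
    then show ?thesis using True by simp
  next
    case False
    then obtain i where i: "k $ i \<noteq> 0" by (auto simp: vec_eq_iff)
    have "(LINT t|lborel. g (axis i 1) t) = 0"
      using integral_exp_period[OF assms i] by (simp add: g_def inner_axis wave_def)
    then have "(\<Prod>b\<in>Basis. LINT t|lborel. g b t) = 0"
      by (intro prod_zero) (auto intro!: bexI[of _ "axis i 1"] simp: axis_in_Basis_iff)
    then show ?thesis using False by simp
  qed
  finally show ?thesis .
qed

text \<open>Conjugation symmetry makes the sum real. The argument runs over the exact support, which
  is closed under negation, because \<open>K\<close> itself need not be.\<close>

lemma of_real_Re_fourier_sum:
  assumes "\<And>k. c (- k) = cnj (c k)" "finite K" "{k. c k \<noteq> 0} \<subseteq> K"
  shows "complex_of_real (Re (\<Sum>k\<in>K. fmode L k x * c k)) = (\<Sum>k\<in>K. fmode L k x * c k)"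
proof -
  let ?S = "{k. c k \<noteq> 0}"
  have S: "(\<Sum>k\<in>K. fmode L k x * c k) = (\<Sum>k\<in>?S. fmode L k x * c k)"
    using assms by (intro sum.mono_neutral_right) auto
  have "cnj (\<Sum>k\<in>?S. fmode L k x * c k) = (\<Sum>k\<in>?S. fmode L (- k) x * c (- k))"
    by (simp add: cnj_fmode assms(1))
  also have "\<dots> = (\<Sum>k\<in>?S. fmode L k x * c k)"
    by (rule sum.reindex_bij_witness[where i = uminus and j = uminus]) (auto simp: assms(1))
  finally have "(\<Sum>k\<in>?S. fmode L k x * c k) \<in> \<real>" by (simp add: Reals_cnj_iff)
  then show ?thesis unfolding S by (rule of_real_Re)
qed

lemma trig_polysD:
  assumes "u \<in> trig_polys L"
  shows "solenoidal L u" "finite {k. u k \<noteq> 0}" "u (- k) $ i = cnj (u k $ i)"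
  using assms by (auto simp: trig_polys_def V_iff solenoidal_def)

lemma field_of_eq:
  assumes "u \<in> trig_polys L" "finite K" "{k. u k \<noteq> 0} \<subseteq> K"
  shows "field_of L u x $ i = Re (\<Sum>k\<in>K. fmode L k x * u k $ i)"
proof -
  have "(\<Sum>k | u k \<noteq> 0. fmode L k x * u k $ i) = (\<Sum>k\<in>K. fmode L k x * u k $ i)"
    using assms by (intro sum.mono_neutral_left) auto
  then show ?thesis unfolding field_of_def fmode_def[symmetric] by (simp only: vec_lambda_beta)
qed

lemma of_real_field_of:
  assumes "u \<in> trig_polys L" "finite K" "{k. u k \<noteq> 0} \<subseteq> K"
  shows "complex_of_real (field_of L u x $ i) = (\<Sum>k\<in>K. fmode L k x * u k $ i)"
  unfolding field_of_eq[OF assms]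
  using assms trig_polysD(3)[OF assms(1)] by (intro of_real_Re_fourier_sum) (auto simp: vec_eq_iff)

lemma of_real_partial_deriv_field_of:
  assumes "v \<in> trig_polys L" "finite K" "{k. v k \<noteq> 0} \<subseteq> K"
  shows "complex_of_real (partial_deriv j (\<lambda>y. field_of L v y $ i) x)
    = (\<Sum>k\<in>K. fmode L k x * (\<i> * cwave L k $ j * v k $ i))"
proof -
  define F where "F = (\<lambda>h. \<Sum>k\<in>K. fmode L k (x + h *\<^sub>R axis j 1) * v k $ i)"
  define F' where "F' = (\<Sum>k\<in>K. fmode L k x * (\<i> * cwave L k $ j * v k $ i))"
  have "(F has_vector_derivative F') (at 0)"
    unfolding F_def F'_def
  proof (rule has_vector_derivative_sum)
    fix k assume "k \<in> K"
    have "((\<lambda>z. exp (\<i> * (complex_of_real (x \<bullet> wave L k) + z * cwave L k $ j)) * v k $ i) has_field_derivative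
        exp (\<i> * complex_of_real (x \<bullet> wave L k)) * (\<i> * cwave L k $ j * v k $ i)) (at (complex_of_real 0))"
      by (auto intro!: derivative_eq_intros)
    from has_vector_derivative_real_field[OF this]
    show "((\<lambda>h. fmode L k (x + h *\<^sub>R axis j 1) * v k $ i) has_vector_derivative fmode L k x * (\<i> * cwave L k $ j * v k $ i)) (at 0)"
      by (simp add: fmode_def o_def inner_add_left inner_axis' cwave_def)
  qed
  then have "((\<lambda>h. Re (F h)) has_vector_derivative Re F') (at 0)"
    by (rule bounded_linear.has_vector_derivative[OF bounded_linear_Re])
  then have "deriv (\<lambda>h. Re (F h)) 0 = Re F'"
    by (intro DERIV_imp_deriv) (simp add: has_real_derivative_iff_has_vector_derivative)
  then have "partial_deriv j (\<lambda>y. field_of L v y $ i) x = Re F'"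
    unfolding partial_deriv_def field_of_eq[OF assms] F_def by simp
  moreover have "complex_of_real (Re F') = F'"
    unfolding F'_def
    using assms trig_polysD(3)[OF assms(1)]
    by (intro of_real_Re_fourier_sum) (auto simp: cwave_minus vec_eq_iff, auto simp: cwave_def)
  ultimately show ?thesis by (simp add: F'_def)
qed

lemma sum_mult_3:
  fixes a :: "'a \<Rightarrow> 'd :: comm_semiring_0"
  shows "sum a A * sum b B * sum c C = (\<Sum>k\<in>A. \<Sum>l\<in>B. \<Sum>m\<in>C. a k * b l * c m)"
proof -
  have "sum a A * sum b B * sum c C = (\<Sum>k\<in>A. \<Sum>l\<in>B. a k * b l * sum c C)"
    unfolding sum_product[of a A b B] by (simp only: sum_distrib_right)
  then show ?thesis by (simp only: sum_distrib_left)
qed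

lemma sum_swap_5:
  "(\<Sum>m\<in>C. \<Sum>l\<in>B. \<Sum>k\<in>A. \<Sum>i\<in>I. \<Sum>j\<in>J. f k l m i j) = (\<Sum>i\<in>I. \<Sum>j\<in>J. \<Sum>k\<in>A. \<Sum>l\<in>B. \<Sum>m\<in>C. f k l m i j)"
proof -
  have push: "(\<Sum>x\<in>X. \<Sum>m\<in>C. \<Sum>l\<in>B. \<Sum>k\<in>A. g x k l m) = (\<Sum>m\<in>C. \<Sum>l\<in>B. \<Sum>k\<in>A. \<Sum>x\<in>X. g x k l m)" for X :: "'x set" and g
  proof -
    have "(\<Sum>x\<in>X. \<Sum>m\<in>C. \<Sum>l\<in>B. \<Sum>k\<in>A. g x k l m) = (\<Sum>m\<in>C. \<Sum>x\<in>X. \<Sum>l\<in>B. \<Sum>k\<in>A. g x k l m)"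
      by (rule sum.swap)
    also have "\<dots> = (\<Sum>m\<in>C. \<Sum>l\<in>B. \<Sum>x\<in>X. \<Sum>k\<in>A. g x k l m)"
      by (intro sum.cong refl sum.swap)
    also have "\<dots> = (\<Sum>m\<in>C. \<Sum>l\<in>B. \<Sum>k\<in>A. \<Sum>x\<in>X. g x k l m)"
      by (intro sum.cong refl sum.swap)
    finally show ?thesis .
  qed
  have "(\<Sum>m\<in>C. \<Sum>l\<in>B. \<Sum>k\<in>A. \<Sum>i\<in>I. \<Sum>j\<in>J. f k l m i j) = (\<Sum>i\<in>I. \<Sum>m\<in>C. \<Sum>l\<in>B. \<Sum>k\<in>A. \<Sum>j\<in>J. f k l m i j)"
    by (rule push[symmetric])
  also have "\<dots> = (\<Sum>i\<in>I. \<Sum>j\<in>J. \<Sum>m\<in>C. \<Sum>l\<in>B. \<Sum>k\<in>A. f k l m i j)"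
    by (intro sum.cong refl push[symmetric])
  also have "\<dots> = (\<Sum>i\<in>I. \<Sum>j\<in>J. \<Sum>k\<in>A. \<Sum>l\<in>B. \<Sum>m\<in>C. f k l m i j)"
  proof (intro sum.cong refl)
    fix i j
    have "(\<Sum>m\<in>C. \<Sum>l\<in>B. \<Sum>k\<in>A. f k l m i j) = (\<Sum>m\<in>C. \<Sum>k\<in>A. \<Sum>l\<in>B. f k l m i j)"
      by (intro sum.cong refl sum.swap)
    also have "\<dots> = (\<Sum>k\<in>A. \<Sum>m\<in>C. \<Sum>l\<in>B. f k l m i j)"
      by (rule sum.swap)
    also have "\<dots> = (\<Sum>k\<in>A. \<Sum>l\<in>B. \<Sum>m\<in>C. f k l m i j)"
      by (intro sum.cong refl sum.swap)
    finally show "(\<Sum>m\<in>C. \<Sum>l\<in>B. \<Sum>k\<in>A. f k l m i j) = (\<Sum>k\<in>A. \<Sum>l\<in>B. \<Sum>m\<in>C. f k l m i j)" .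
  qed
  finally show ?thesis .
qed

text \<open>Expanding the three fields into exponentials and integrating leaves only triples of
  frequencies with zero sum.\<close>

lemma of_real_b_trig:
  assumes "L > 0" "finite K"
    and "u \<in> trig_polys L" "{k. u k \<noteq> 0} \<subseteq> K"
    and "v \<in> trig_polys L" "{k. v k \<noteq> 0} \<subseteq> K"
    and "w \<in> trig_polys L" "{k. w k \<noteq> 0} \<subseteq> K"
  shows "complex_of_real (b_trig L u v w) = complex_of_real (L ^ 3) *
    (\<Sum>i\<in>UNIV. \<Sum>j\<in>UNIV. \<Sum>k\<in>K. \<Sum>l\<in>K. \<Sum>m\<in>K.
      if k + l + m = 0 then u k $ j * (\<i> * cwave L l $ j * v l $ i) * w m $ i else 0)"
proof -
  let ?M = "lebesgue_on (cbox 0 (\<chi> i. L)) :: (real ^ 3) measure"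
  have int: "integrable ?M (\<lambda>x. c * fmode L k x)" for c k
    by (intro continuous_imp_integrable continuous_intros)
  have "complex_of_real (LINT x|?M. field_of L u x $ j * partial_deriv j (\<lambda>y. field_of L v y $ i) x * field_of L w x $ i)
     = complex_of_real (L ^ 3) * (\<Sum>k\<in>K. \<Sum>l\<in>K. \<Sum>m\<in>K.
      if k + l + m = 0 then u k $ j * (\<i> * cwave L l $ j * v l $ i) * w m $ i else 0)" for i j
  proof -
    let ?c = "\<lambda>k l m. u k $ j * (\<i> * cwave L l $ j * v l $ i) * w m $ i"
    have "complex_of_real (LINT x|?M. field_of L u x $ j * partial_deriv j (\<lambda>y. field_of L v y $ i) x * field_of L w x $ i)
      = (LINT x|?M. complex_of_real (field_of L u x $ j * partial_deriv j (\<lambda>y. field_of L v y $ i) x * field_of L w x $ i))"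
      by (rule integral_complex_of_real[symmetric])
    also have "\<dots> = (LINT x|?M. (\<Sum>k\<in>K. \<Sum>l\<in>K. \<Sum>m\<in>K. ?c k l m * fmode L (k + l + m) x))"
      unfolding of_real_mult of_real_field_of[OF assms(3,2,4)] of_real_field_of[OF assms(7,2,8)]
        of_real_partial_deriv_field_of[OF assms(5,2,6)]
      unfolding sum_mult_3 by (simp add: fmode_add mult_ac)
    also have "\<dots> = (\<Sum>k\<in>K. \<Sum>l\<in>K. \<Sum>m\<in>K. ?c k l m * (LINT x|?M. fmode L (k + l + m) x))"
      by (simp add: int)
    also have "\<dots> = (\<Sum>k\<in>K. \<Sum>l\<in>K. \<Sum>m\<in>K. complex_of_real (L ^ 3) * (if k + l + m = 0 then ?c k l m else 0))"
      unfolding integral_fmode[OF assms(1)] by (intro sum.cong refl) simp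
    finally show ?thesis by (simp add: sum_distrib_left)
  qed
  then show ?thesis
    by (simp add: b_trig_def sum_distrib_left)
qed

lemma integral_count_space_eq_sum:
  assumes "finite K" "\<And>l. l \<notin> K \<Longrightarrow> f l = 0"
  shows "(LINT l|count_space UNIV. f l) = (\<Sum>l\<in>K. f l)"
proof -
  have sub: "{l. f l \<noteq> 0} \<subseteq> K" using assms(2) by auto
  then have "finite {l \<in> UNIV. f l \<noteq> 0}" using assms(1) by (simp add: finite_subset)
  then have "(LINT l|count_space UNIV. f l) = (\<Sum>l | f l \<noteq> 0. f l)"
    by (simp add: lebesgue_integral_count_space_finite_support)
  also have "\<dots> = (\<Sum>l\<in>K. f l)"
    using sub assms(1) by (intro sum.mono_neutral_left) auto
  finally show ?thesis .
qed

lemma pairing_finite_support: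
  assumes "finite K" "{k. v k \<noteq> 0} \<subseteq> K"
  shows "pairing L u v = L ^ 3 * (\<Sum>k\<in>K. u k \<bullet> v k)"
proof -
  have "(\<Sum>\<^sub>\<infinity>k. u k \<bullet> v k) = (\<Sum>\<^sub>\<infinity>k\<in>K. u k \<bullet> v k)"
  proof (rule infsum_cong_neutral)
    fix k assume "k \<in> UNIV - K"
    then have "v k = 0" using assms(2) by blast
    then show "u k \<bullet> v k = 0" by simp
  qed auto
  then show ?thesis using assms(1) by (simp add: pairing_def)
qed

lemma inner_eq_Re_sum: "x \<bullet> y = Re (\<Sum>i\<in>UNIV. x $ i * cnj (y $ i))" for x y :: "complex ^ 'n"
  by (simp add: inner_vec_def inner_complex_def)

text \<open>Parseval's identity for the trilinear form. Since \<open>w (- m)\<close> is the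
  conjugate of \<open>w m\<close>, the real inner product with \<open>w m\<close> is the real part
  of a bilinear expression in \<open>w (- m)\<close>; replacing \<open>m\<close> by its negative
  gives the condition that the frequencies add up to 0.\<close>

lemma b_trig_eq_pairing:
  assumes L: "L > 0" and u: "u \<in> trig_polys L" and v: "v \<in> trig_polys L" and w: "w \<in> trig_polys L"
  shows "b_trig L u v w = pairing L (Bhat L u v) w"
proof -
  define K where "K = {k. u k \<noteq> 0} \<union> {k. v k \<noteq> 0} \<union> {k. w k \<noteq> 0}"
  have fin: "finite K" using trig_polysD(2)[OF u] trig_polysD(2)[OF v] trig_polysD(2)[OF w] by (simp add: K_def)
  have sub: "{k. u k \<noteq> 0} \<subseteq> K" "{k. v k \<noteq> 0} \<subseteq> K" "{k. w k \<noteq> 0} \<subseteq> K" by (auto simp: K_def)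
  have symK: "- k \<in> K" if "k \<in> K" for k
  proof -
    have "z (- k) = 0 \<longleftrightarrow> z k = 0" if "z \<in> trig_polys L" for z
      using trig_polysD(3)[OF that, of k] by (auto simp: vec_eq_iff)
    then show ?thesis using that u v w by (auto simp: K_def)
  qed
  let ?c = "\<lambda>k l m i j. u k $ j * (\<i> * cwave L l $ j * v l $ i) * w m $ i"
  have inner: "Bhat L u v m \<bullet> w m = Re (\<Sum>l\<in>K. \<Sum>i\<in>UNIV. \<Sum>j\<in>UNIV. ?c (m - l) l (- m) i j)" for m
  proof (cases "m = 0")
    case False
    have "(\<Sum>j\<in>UNIV. cwave L m $ j * w m $ j) = 0"
      using trig_polysD(1)[OF w] by (simp add: solenoidal_def cwave_def)
    from leray_inner[OF this False]
    have "Bhat L u v m \<bullet> w m = (LINT l|count_space UNIV. advection L u v m l) \<bullet> w m"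
      by (simp add: Bhat_def)
    also have "(LINT l|count_space UNIV. advection L u v m l) = (\<Sum>l\<in>K. advection L u v m l)"
      using fin by (rule integral_count_space_eq_sum) (use sub in \<open>auto simp: advection_def\<close>)
    also have "(\<Sum>l\<in>K. advection L u v m l) \<bullet> w m = (\<Sum>l\<in>K. Re (\<Sum>i\<in>UNIV. advection L u v m l $ i * cnj (w m $ i)))"
      unfolding inner_sum_left by (simp only: inner_eq_Re_sum)
    also have "\<dots> = Re (\<Sum>l\<in>K. \<Sum>i\<in>UNIV. \<Sum>j\<in>UNIV. ?c (m - l) l (- m) i j)"
      unfolding Re_sum[symmetric] advection_def trig_polysD(3)[OF w]
      by (simp add: sum_distrib_left sum_distrib_right mult_ac del: Re_sum)
    finally show ?thesis .
  next
    case True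
    then have "w m = 0" "w (- m) = 0" using trig_polysD(1)[OF w] by (simp_all add: solenoidal_def)
    then show ?thesis by simp
  qed
  have "pairing L (Bhat L u v) w = L ^ 3 * (\<Sum>m\<in>K. Bhat L u v m \<bullet> w m)"
    using fin sub(3) by (rule pairing_finite_support)
  also have "(\<Sum>m\<in>K. Bhat L u v m \<bullet> w m) = Re (\<Sum>m\<in>K. \<Sum>l\<in>K. \<Sum>i\<in>UNIV. \<Sum>j\<in>UNIV. ?c (m - l) l (- m) i j)"
    unfolding inner Re_sum[symmetric] ..
  also have "(\<Sum>m\<in>K. \<Sum>l\<in>K. \<Sum>i\<in>UNIV. \<Sum>j\<in>UNIV. ?c (m - l) l (- m) i j)
      = (\<Sum>m\<in>K. \<Sum>l\<in>K. \<Sum>i\<in>UNIV. \<Sum>j\<in>UNIV. ?c (- m - l) l m i j)"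
    by (rule sum.reindex_bij_witness[where i = uminus and j = uminus]) (auto simp: symK)
  \<comment> \<open>An extra sum over \<open>k\<close>, constrained by \<open>k = - m - l\<close>,
    is inserted to match the shape of \<open>of_real_b_trig\<close>. If \<open>- m - l\<close> lies
    outside \<open>K\<close>, then \<open>u\<close> vanishes there and nothing is lost.\<close>
  also have "\<dots> = (\<Sum>m\<in>K. \<Sum>l\<in>K. \<Sum>k\<in>K. \<Sum>i\<in>UNIV. \<Sum>j\<in>UNIV. if k = - m - l then ?c k l m i j else 0)"
  proof (intro sum.cong refl)
    fix m l
    have "(\<Sum>k\<in>K. \<Sum>i\<in>UNIV. \<Sum>j\<in>UNIV. if k = - m - l then ?c k l m i j else 0)
        = (\<Sum>k\<in>K. if k = - m - l then \<Sum>i\<in>UNIV. \<Sum>j\<in>UNIV. ?c k l m i j else 0)"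
      by (intro sum.cong) auto
    also have "\<dots> = (if - m - l \<in> K then \<Sum>i\<in>UNIV. \<Sum>j\<in>UNIV. ?c (- m - l) l m i j else 0)"
      using fin by (rule sum.delta)
    also have "\<dots> = (\<Sum>i\<in>UNIV. \<Sum>j\<in>UNIV. ?c (- m - l) l m i j)"
    proof (cases "- m - l \<in> K")
      case False
      then have "u (- m - l) = 0" using sub(1) by blast
      then show ?thesis using False by simp
    qed simp
    finally show "(\<Sum>i\<in>UNIV. \<Sum>j\<in>UNIV. ?c (- m - l) l m i j)
        = (\<Sum>k\<in>K. \<Sum>i\<in>UNIV. \<Sum>j\<in>UNIV. if k = - m - l then ?c k l m i j else 0)" ..
  qed
  also have "\<dots> = (\<Sum>m\<in>K. \<Sum>l\<in>K. \<Sum>k\<in>K. \<Sum>i\<in>UNIV. \<Sum>j\<in>UNIV. if k + l + m = 0 then ?c k l m i j else 0)"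
    by (intro sum.cong refl if_cong) (auto simp: algebra_simps eq_neg_iff_add_eq_0)
  also have "\<dots> = (\<Sum>i\<in>UNIV. \<Sum>j\<in>UNIV. \<Sum>k\<in>K. \<Sum>l\<in>K. \<Sum>m\<in>K. if k + l + m = 0 then ?c k l m i j else 0)"
    by (rule sum_swap_5)
  also have "L ^ 3 * Re \<dots> = b_trig L u v w"
    using arg_cong[OF of_real_b_trig[OF L fin u sub(1) v sub(2) w sub(3)], of Re]
    unfolding Re_complex_of_real times_complex.sel by (simp del: Re_sum)
  finally show ?thesis ..
qed

section \<open>The extended bilinear operator\<close>

definition renergy :: "real \<Rightarrow> real \<Rightarrow> coeffs \<Rightarrow> real" where
  "renergy L s u = enn2real (energy L s u)"

lemma renergy_nonneg [simp]: "renergy L s u \<ge> 0"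
  by (simp add: renergy_def)

lemma ennreal_renergy: "energy L s u < \<infinity> \<Longrightarrow> ennreal (renergy L s u) = energy L s u"
  by (simp add: renergy_def)

lemma renergy_leI:
  assumes "energy L s u \<le> ennreal c" "c \<ge> 0"
  shows "renergy L s u \<le> c"
  using enn2real_mono[OF assms(1)] assms(2) by (simp add: renergy_def)

lemma renergy_add_le:
  assumes "energy L s u < \<infinity>" "energy L s v < \<infinity>"
  shows "renergy L s (\<lambda>k. u k + v k) \<le> 2 * renergy L s u + 2 * renergy L s v"
proof (rule renergy_leI)
  show "energy L s (\<lambda>k. u k + v k) \<le> ennreal (2 * renergy L s u + 2 * renergy L s v)"
    using energy_add_le[of L s u v] assms by (simp add: ennreal_mult ennreal_renergy)
qed simp

lemma renergy_exponent_le: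
  assumes "L > 0" "s \<le> s'" "energy L s' u < \<infinity>"
  shows "renergy L s u \<le> (2 * pi / L) powr (2 * (s - s')) * renergy L s' u"
proof (rule renergy_leI)
  show "energy L s u \<le> ennreal ((2 * pi / L) powr (2 * (s - s')) * renergy L s' u)"
    using energy_exponent_le[OF assms(1,2), of u] assms(3) by (simp add: ennreal_mult ennreal_renergy)
qed simp

lemma energy_Bhat_finite:
  assumes "L > 0" "\<alpha> > 1 / 2" "w 0 = 0" "energy L (1 + \<alpha>) w < \<infinity>" "energy L \<alpha> u < \<infinity>"
  shows "energy L (\<alpha> - 1) (Bhat L w u) < \<infinity>"
proof -
  obtain C where "C > 0" and C: "\<And>w u. w 0 = 0 \<Longrightarrow> energy L (\<alpha> - 1) (Bhat L w u) \<le> ennreal C * (energy L (1 + \<alpha>) w * energy L \<alpha> u)"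
    using energy_Bhat_le[OF assms(1,2)] by blast
  show ?thesis
    by (rule order_le_less_trans[OF C[of w u]]) (use assms(3-5) in \<open>simp_all add: ennreal_mult_less_top\<close>)
qed

text \<open>Cauchy-Schwarz after inserting the weight of exponent \<open>- s\<close> at
  \<open>g\<close> and its inverse at \<open>w\<close>. The factor \<open>L ^ 6\<close> is the
  square of the \<open>L ^ 3\<close> carried by \<open>pairing\<close>, since the energies carry no
  such factor.\<close>

lemma
  assumes "L > 0" "g 0 = 0" "energy L (- s) g < \<infinity>" "energy L s w < \<infinity>"
  shows integrable_pairing: "integrable (count_space UNIV) (\<lambda>k. g k \<bullet> w k)"
    and pairing_sq_le: "(pairing L g w)\<^sup>2 \<le> L ^ 6 * (renergy L (- s) g * renergy L s w)"
proof -
  let ?I = "\<integral>\<^sup>+k. ennreal (norm (g k \<bullet> w k)) \<partial>count_space UNIV"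
  have "?I \<le> (\<integral>\<^sup>+k. ennreal (norm (wave L k) powr (- s) * norm (g k)) * ennreal (norm (wave L k) powr s * norm (w k)) \<partial>count_space UNIV)"
  proof (rule nn_integral_mono)
    fix k
    show "ennreal (norm (g k \<bullet> w k)) \<le> ennreal (norm (wave L k) powr (- s) * norm (g k)) * ennreal (norm (wave L k) powr s * norm (w k))"
    proof (cases "wave L k = 0")
      case True
      then have "g k = 0" using assms(1,2) by (simp add: wave_eq_0_iff)
      then show ?thesis by simp
    next
      case False
      then have "norm (wave L k) powr (- s) * norm (wave L k) powr s = 1"
        by (simp flip: powr_add)
      then have eq: "(norm (wave L k) powr (- s) * norm (g k)) * (norm (wave L k) powr s * norm (w k)) = norm (g k) * norm (w k)"
      proof -
        have "(norm (wave L k) powr (- s) * norm (g k)) * (norm (wave L k) powr s * norm (w k))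
            = (norm (wave L k) powr (- s) * norm (wave L k) powr s) * (norm (g k) * norm (w k))"
          by (simp only: mult_ac)
        then show ?thesis unfolding \<open>_ = 1\<close> by simp
      qed
      have "ennreal (norm (g k \<bullet> w k)) \<le> ennreal ((norm (wave L k) powr (- s) * norm (g k)) * (norm (wave L k) powr s * norm (w k)))"
        unfolding eq real_norm_def by (intro ennreal_leI Cauchy_Schwarz_ineq2)
      then show ?thesis by (simp add: ennreal_mult)
    qed
  qed
  then have "?I\<^sup>2 \<le> (\<integral>\<^sup>+k. ennreal (norm (wave L k) powr (- s) * norm (g k)) * ennreal (norm (wave L k) powr s * norm (w k)) \<partial>count_space UNIV)\<^sup>2"
    by (intro power_mono) auto
  also have "\<dots> \<le> energy L (- s) g * energy L s w"
    using Cauchy_Schwarz_nn_integral[of "\<lambda>k. ennreal (norm (wave L k) powr (- s) * norm (g k))" "count_space UNIV" "\<lambda>k. ennreal (norm (wave L k) powr s * norm (w k))"]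
    by (simp add: energy_def ennreal_power)
  finally have le: "?I\<^sup>2 \<le> energy L (- s) g * energy L s w" .
  then have "?I\<^sup>2 < \<infinity>"
    using assms(3,4) by (auto simp: ennreal_mult_less_top intro: order_le_less_trans)
  then have fin: "?I < \<infinity>"
    by (simp add: power_less_top_ennreal)
  then show int: "integrable (count_space UNIV) (\<lambda>k. g k \<bullet> w k)"
    by (intro integrableI_bounded) auto
  have "ennreal (norm (LINT k|count_space UNIV. g k \<bullet> w k)) \<le> ?I"
    using int by (rule integral_norm_bound_ennreal)
  then have "(ennreal (norm (LINT k|count_space UNIV. g k \<bullet> w k)))\<^sup>2 \<le> ?I\<^sup>2"
    by (intro power_mono) auto
  also note le
  finally have "ennreal ((LINT k|count_space UNIV. g k \<bullet> w k)\<^sup>2) \<le> ennreal (renergy L (- s) g * renergy L s w)"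
    using assms(3,4) by (simp add: ennreal_power ennreal_mult ennreal_renergy)
  then have "(LINT k|count_space UNIV. g k \<bullet> w k)\<^sup>2 \<le> renergy L (- s) g * renergy L s w"
    by (simp add: ennreal_le_iff)
  then show "(pairing L g w)\<^sup>2 \<le> L ^ 6 * (renergy L (- s) g * renergy L s w)"
    unfolding pairing_def infsum_eq_integral_count_space[OF int]
    by (simp add: power_mult_distrib mult_left_mono flip: power_mult)
qed

lemma pairing_diff_left:
  assumes "L > 0" "g 0 = 0" "h 0 = 0" "energy L (- s) g < \<infinity>" "energy L (- s) h < \<infinity>" "energy L s w < \<infinity>"
  shows "pairing L (\<lambda>k. g k - h k) w = pairing L g w - pairing L h w"
proof -
  have int: "integrable (count_space UNIV) (\<lambda>k. g k \<bullet> w k)" "integrable (count_space UNIV) (\<lambda>k. h k \<bullet> w k)"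
    using assms by (auto intro: integrable_pairing[of L _ s])
  then have "integrable (count_space UNIV) (\<lambda>k. (g k - h k) \<bullet> w k)"
    by (simp add: inner_diff_left)
  from infsum_eq_integral_count_space[OF this] int show ?thesis
    by (simp add: pairing_def infsum_eq_integral_count_space inner_diff_left right_diff_distrib)
qed

lemma pairing_diff_right:
  assumes "L > 0" "g 0 = 0" "energy L (- s) g < \<infinity>" "energy L s w < \<infinity>" "energy L s v < \<infinity>"
  shows "pairing L g (\<lambda>k. w k - v k) = pairing L g w - pairing L g v"
proof -
  have int: "integrable (count_space UNIV) (\<lambda>k. g k \<bullet> w k)" "integrable (count_space UNIV) (\<lambda>k. g k \<bullet> v k)"
    using assms by (auto intro: integrable_pairing[of L _ s])
  then have "integrable (count_space UNIV) (\<lambda>k. g k \<bullet> (w k - v k))"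
    by (simp add: inner_diff_right)
  from infsum_eq_integral_count_space[OF this] int show ?thesis
    by (simp add: pairing_def infsum_eq_integral_count_space inner_diff_right right_diff_distrib)
qed

lemma Bhat_zero_mode [simp]: "Bhat L u v 0 = 0"
  by (simp add: Bhat_def leray_def)

text \<open>The difference is telescoped into one term with \<open>wn - w\<close>, one with
  \<open>un - u\<close> and one with \<open>vn - v\<close>. Each is controlled by the bilinear
  estimate, the advection term being paired as an element of V^(\<alpha>-1) with V^(1-\<alpha>). The
  constants \<open>c1\<close> and \<open>c2\<close> belong to the embeddings of V^(1+\<alpha>) into
  V^\<alpha> and V^(1-\<alpha>).\<close>

lemma pairing_Bhat_tendsto:
  assumes L: "L > 0" and a: "\<alpha> > 1 / 2"
    and u0: "u 0 = 0" "\<And>n. un n 0 = 0"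
    and fin: "energy L (1 + \<alpha>) u < \<infinity>" "energy L (1 + \<alpha>) v < \<infinity>" "energy L (1 + \<alpha>) w < \<infinity>"
      "\<And>n :: nat. energy L (1 + \<alpha>) (un n) < \<infinity>" "\<And>n. energy L (1 + \<alpha>) (vn n) < \<infinity>"
      "\<And>n. energy L (1 + \<alpha>) (wn n) < \<infinity>"
    and lim: "(\<lambda>n. renergy L (1 + \<alpha>) (\<lambda>k. un n k - u k)) \<longlonglongrightarrow> 0"
      "(\<lambda>n. renergy L (1 + \<alpha>) (\<lambda>k. vn n k - v k)) \<longlonglongrightarrow> 0"
      "(\<lambda>n. renergy L (1 + \<alpha>) (\<lambda>k. wn n k - w k)) \<longlonglongrightarrow> 0"
  shows "(\<lambda>n. pairing L (Bhat L (un n) (vn n)) (wn n)) \<longlonglongrightarrow> pairing L (Bhat L u v) w"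
proof -
  obtain C where C: "C > 0"
    and CB: "\<And>w u. w 0 = 0 \<Longrightarrow> energy L (\<alpha> - 1) (Bhat L w u) \<le> ennreal C * (energy L (1 + \<alpha>) w * energy L \<alpha> u)"
    using energy_Bhat_le[OF L a] by blast
  define c1 where "c1 = (2 * pi / L) powr (2 * (\<alpha> - (1 + \<alpha>)))"
  define c2 where "c2 = (2 * pi / L) powr (2 * ((1 - \<alpha>) - (1 + \<alpha>)))"
  have c: "c1 \<ge> 0" "c2 \<ge> 0" by (simp_all add: c1_def c2_def)
  let ?E = "renergy L (1 + \<alpha>)"
  have lo: "energy L \<alpha> z < \<infinity>" "energy L (1 - \<alpha>) z < \<infinity>" "renergy L \<alpha> z \<le> c1 * ?E z" "renergy L (1 - \<alpha>) z \<le> c2 * ?E z"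
    if "energy L (1 + \<alpha>) z < \<infinity>" for z
  proof -
    show "energy L \<alpha> z < \<infinity>" "energy L (1 - \<alpha>) z < \<infinity>"
      by (rule energy_exponent_finite[OF L _ that], use a in simp)+
    show "renergy L \<alpha> z \<le> c1 * ?E z"
      unfolding c1_def by (rule renergy_exponent_le[OF L _ that]) simp
    show "renergy L (1 - \<alpha>) z \<le> c2 * ?E z"
      unfolding c2_def by (rule renergy_exponent_le[OF L _ that]) (use a in simp)
  qed
  have rB: "energy L (\<alpha> - 1) (Bhat L x y) < \<infinity>" "renergy L (\<alpha> - 1) (Bhat L x y) \<le> C * (?E x * (c1 * ?E y))"
    if "x 0 = 0" "energy L (1 + \<alpha>) x < \<infinity>" "energy L (1 + \<alpha>) y < \<infinity>" for x y
  proof -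
    show "energy L (\<alpha> - 1) (Bhat L x y) < \<infinity>"
      using energy_Bhat_finite[OF L a that(1,2) lo(1)[OF that(3)]] .
    have "renergy L (\<alpha> - 1) (Bhat L x y) \<le> C * (?E x * renergy L \<alpha> y)"
      using CB[of x y] C that lo(1)[OF that(3)]
      by (intro renergy_leI) (simp_all add: ennreal_mult ennreal_renergy)
    also have "\<dots> \<le> C * (?E x * (c1 * ?E y))"
      using C lo(3)[OF that(3)] by (intro mult_left_mono) auto
    finally show "renergy L (\<alpha> - 1) (Bhat L x y) \<le> C * (?E x * (c1 * ?E y))" .
  qed
  define x y z where "x = (\<lambda>n. ?E (\<lambda>k. un n k - u k))" and "y = (\<lambda>n. ?E (\<lambda>k. vn n k - v k))"
    and "z = (\<lambda>n. ?E (\<lambda>k. wn n k - w k))"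
  define X Y Z where "X = ?E u" and "Y = ?E v" and "Z = ?E w"
  have nn: "x n \<ge> 0" "y n \<ge> 0" "z n \<ge> 0" "X \<ge> 0" "Y \<ge> 0" "Z \<ge> 0" for n
    by (simp_all add: x_def y_def z_def X_def Y_def Z_def)
  have xb: "?E (un n) \<le> 2 * x n + 2 * X" and yb: "?E (vn n) \<le> 2 * y n + 2 * Y" for n
    using renergy_add_le[OF energy_diff_finite[OF fin(4) fin(1)] fin(1), of n]
      renergy_add_le[OF energy_diff_finite[OF fin(5) fin(2)] fin(2), of n]
    by (simp_all add: x_def y_def X_def Y_def)
  \<comment> \<open>Bounding the norms of \<open>un\<close> and \<open>vn\<close> by those of their
    limits and the distances makes \<open>R\<close> an explicit polynomial in the null sequences
    \<open>x\<close>, \<open>y\<close>, \<open>z\<close>, each of whose terms contains one of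
    them.\<close>
  define R where "R = (\<lambda>n. 2 * (L ^ 6 * ((C * ((2 * x n + 2 * X) * (c1 * (2 * y n + 2 * Y)))) * (c2 * z n)))
    + 2 * (L ^ 6 * ((2 * (C * (x n * (c1 * (2 * y n + 2 * Y)))) + 2 * (C * (X * (c1 * y n)))) * (c2 * Z))))"
  have "(pairing L (Bhat L (un n) (vn n)) (wn n) - pairing L (Bhat L u v) w)\<^sup>2 \<le> R n" for n
  proof -
    let ?D = "\<lambda>k. Bhat L (un n) (vn n) k - Bhat L u v k"
    have D: "?D = (\<lambda>k. Bhat L (\<lambda>k. un n k - u k) (vn n) k + Bhat L u (\<lambda>k. vn n k - v k) k)"
      using Bhat_diff_left[OF L a u0(2) u0(1) fin(4) fin(1) lo(1)[OF fin(5)], of n n]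
        Bhat_diff_right[OF L a u0(1) fin(1) lo(1)[OF fin(5)] lo(1)[OF fin(2)], of n]
      by (simp add: fun_eq_iff)
    note dfin = energy_diff_finite[OF fin(4) fin(1), of n] energy_diff_finite[OF fin(5) fin(2), of n]
      energy_diff_finite[OF fin(6) fin(3), of n]
    have b1: "energy L (\<alpha> - 1) (Bhat L (un n) (vn n)) < \<infinity>" "energy L (\<alpha> - 1) (Bhat L u v) < \<infinity>"
      using rB(1) u0 fin by blast+
    have Dfin: "energy L (\<alpha> - 1) ?D < \<infinity>" using energy_diff_finite[OF b1] .
    have "renergy L (\<alpha> - 1) ?D \<le> 2 * renergy L (\<alpha> - 1) (Bhat L (\<lambda>k. un n k - u k) (vn n))
        + 2 * renergy L (\<alpha> - 1) (Bhat L u (\<lambda>k. vn n k - v k))"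
      unfolding D using dfin fin u0 by (intro renergy_add_le rB(1)) auto
    also have "\<dots> \<le> 2 * (C * (x n * (c1 * ?E (vn n)))) + 2 * (C * (X * (c1 * y n)))"
      unfolding x_def y_def X_def using dfin fin u0 by (intro add_mono mult_left_mono rB(2)) auto
    also have "\<dots> \<le> 2 * (C * (x n * (c1 * (2 * y n + 2 * Y)))) + 2 * (C * (X * (c1 * y n)))"
      using C c nn yb by (intro add_mono mult_left_mono) auto
    finally have rD: "renergy L (\<alpha> - 1) ?D \<le> 2 * (C * (x n * (c1 * (2 * y n + 2 * Y)))) + 2 * (C * (X * (c1 * y n)))" .
    have "renergy L (\<alpha> - 1) (Bhat L (un n) (vn n)) \<le> C * (?E (un n) * (c1 * ?E (vn n)))"
      using rB(2) u0 fin by blast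
    also have "\<dots> \<le> C * ((2 * x n + 2 * X) * (c1 * (2 * y n + 2 * Y)))"
      using C c nn xb yb by (intro mult_left_mono mult_mono) auto
    finally have rb: "renergy L (\<alpha> - 1) (Bhat L (un n) (vn n)) \<le> C * ((2 * x n + 2 * X) * (c1 * (2 * y n + 2 * Y)))" .
    have eq: "pairing L (Bhat L (un n) (vn n)) (wn n) - pairing L (Bhat L u v) w
        = pairing L (Bhat L (un n) (vn n)) (\<lambda>k. wn n k - w k) + pairing L ?D w"
      using pairing_diff_right[OF L, of "Bhat L (un n) (vn n)" "1 - \<alpha>" "wn n" w]
        pairing_diff_left[OF L, of "Bhat L (un n) (vn n)" "Bhat L u v" "1 - \<alpha>" w]
        b1 lo(2)[OF fin(6)[of n]] lo(2)[OF fin(3)] by simp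
    have "(pairing L (Bhat L (un n) (vn n)) (\<lambda>k. wn n k - w k))\<^sup>2
        \<le> L ^ 6 * (renergy L (\<alpha> - 1) (Bhat L (un n) (vn n)) * renergy L (1 - \<alpha>) (\<lambda>k. wn n k - w k))"
      using pairing_sq_le[OF L, of "Bhat L (un n) (vn n)" "1 - \<alpha>" "\<lambda>k. wn n k - w k"] b1 lo(2)[OF dfin(3)]
      by simp
    also have "\<dots> \<le> L ^ 6 * ((C * ((2 * x n + 2 * X) * (c1 * (2 * y n + 2 * Y)))) * (c2 * z n))"
      unfolding z_def using lo(4)[OF dfin(3)] rb L C c nn by (intro mult_left_mono mult_mono) auto
    finally have p1: "(pairing L (Bhat L (un n) (vn n)) (\<lambda>k. wn n k - w k))\<^sup>2 \<le> \<dots>" .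
    have "(pairing L ?D w)\<^sup>2 \<le> L ^ 6 * (renergy L (\<alpha> - 1) ?D * renergy L (1 - \<alpha>) w)"
      using pairing_sq_le[OF L, of ?D "1 - \<alpha>" w] Dfin lo(2)[OF fin(3)] by simp
    also have "\<dots> \<le> L ^ 6 * ((2 * (C * (x n * (c1 * (2 * y n + 2 * Y)))) + 2 * (C * (X * (c1 * y n)))) * (c2 * Z))"
      unfolding Z_def using lo(4)[OF fin(3)] rD L C c nn by (intro mult_left_mono mult_mono) auto
    finally have p2: "(pairing L ?D w)\<^sup>2 \<le> \<dots>" .
    show ?thesis
      unfolding eq R_def using p1 p2
        sum_sq_le_2[of "pairing L (Bhat L (un n) (vn n)) (\<lambda>k. wn n k - w k)" "pairing L ?D w"] by simp
  qed
  moreover have "R \<longlonglongrightarrow> 2 * (L ^ 6 * ((C * ((2 * 0 + 2 * X) * (c1 * (2 * 0 + 2 * Y)))) * (c2 * 0)))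
    + 2 * (L ^ 6 * ((2 * (C * (0 * (c1 * (2 * 0 + 2 * Y)))) + 2 * (C * (X * (c1 * 0)))) * (c2 * Z)))"
    unfolding R_def using lim by (intro tendsto_intros) (simp_all add: x_def y_def z_def)
  then have "R \<longlonglongrightarrow> 0" by simp
  ultimately have "(\<lambda>n. (pairing L (Bhat L (un n) (vn n)) (wn n) - pairing L (Bhat L u v) w)\<^sup>2) \<longlonglongrightarrow> 0"
    by (intro tendsto_sandwich[OF _ _ tendsto_const \<open>R \<longlonglongrightarrow> 0\<close>]) auto
  then have "(\<lambda>n. pairing L (Bhat L (un n) (vn n)) (wn n) - pairing L (Bhat L u v) w) \<longlonglongrightarrow> 0"
    by (simp add: power_tendsto_0_iff)
  then show ?thesis by (simp add: LIM_zero_iff)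
qed

section \<open>Density of trigonometric polynomials and identification of
  \<open>B_op\<close>\<close>

definition ftrunc :: "nat \<Rightarrow> coeffs \<Rightarrow> coeffs" where
  "ftrunc n u k = (if \<forall>i. \<bar>k $ i\<bar> \<le> int n then u k else 0)"

lemma finite_int_vec_box: "finite {k :: int ^ 'n. \<forall>i. \<bar>k $ i\<bar> \<le> c}"
proof (rule finite_subset)
  show "{k :: int ^ 'n. \<forall>i. \<bar>k $ i\<bar> \<le> c} \<subseteq> vec_lambda ` (\<Pi>\<^sub>E i\<in>UNIV. {- c..c})"
  proof
    fix k :: "int ^ 'n" assume "k \<in> {k. \<forall>i. \<bar>k $ i\<bar> \<le> c}"
    then have "vec_nth k \<in> (\<Pi>\<^sub>E i\<in>UNIV. {- c..c})" by (auto simp: abs_le_iff minus_le_iff)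
    then show "k \<in> vec_lambda ` (\<Pi>\<^sub>E i\<in>UNIV. {- c..c})"
      by (metis image_eqI vec_nth_inverse)
  qed
qed (intro finite_imageI finite_PiE, auto)

lemma energy_finite_support:
  assumes "finite {k. u k \<noteq> 0}"
  shows "energy L s u < \<infinity>"
proof -
  have "energy L s u = (\<integral>\<^sup>+k. ennreal ((norm (wave L k) powr s * norm (u k))\<^sup>2) \<partial>count_space {k. u k \<noteq> 0})"
    unfolding energy_def by (rule nn_integral_count_space_eq) auto
  also have "\<dots> < \<infinity>"
    using assms by (simp add: nn_integral_count_space_finite)
  finally show ?thesis .
qed

lemma ftrunc_trig_polys:
  assumes "solenoidal L u"
  shows "ftrunc n u \<in> trig_polys L"
proof -
  have fin: "finite {k. ftrunc n u k \<noteq> 0}"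
    by (rule finite_subset[OF _ finite_int_vec_box[of "int n"]]) (auto simp: ftrunc_def split: if_splits)
  have "solenoidal L (ftrunc n u)"
    using assms by (auto simp: solenoidal_def ftrunc_def vec_eq_iff)
  then show ?thesis using fin energy_finite_support[OF fin, of L 0] by (simp add: trig_polys_def V_iff)
qed

lemma ftrunc_tendsto: "(\<lambda>n. ftrunc n u k) \<longlonglongrightarrow> u k"
proof (rule tendsto_eventually, rule eventually_sequentiallyI)
  fix n assume n: "n \<ge> nat (\<Sum>i\<in>UNIV. \<bar>k $ i\<bar>)"
  have "\<bar>k $ i\<bar> \<le> int n" for i
  proof -
    have "\<bar>k $ i\<bar> \<le> (\<Sum>i\<in>UNIV. \<bar>k $ i\<bar>)" by (rule member_le_sum) auto
    then show ?thesis using n by linarith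
  qed
  then show "ftrunc n u k = u k" by (simp add: ftrunc_def)
qed

lemma energy_ftrunc_tendsto:
  assumes "energy L s u < \<infinity>"
  shows "(\<lambda>n. energy L s (\<lambda>k. ftrunc n u k - u k)) \<longlonglongrightarrow> 0"
proof (rule energy_dominated_convergence[where D = "\<lambda>k. norm (u k)"])
  show "norm (ftrunc n u k) \<le> norm (u k)" for n k by (simp add: ftrunc_def)
qed (use assms in \<open>simp_all add: energy_def ftrunc_tendsto\<close>)

text \<open>The description in \<open>b_form\<close> quantifies over all approximating sequences.
  Continuity of the pairing shows that the value qualifies; that no other value does requires at
  least one such sequence, and the Fourier truncations supply it.\<close>

lemma b_form_eq_pairing:
  assumes L: "L > 0" and a: "\<alpha> > 1 / 2" and "u \<in> V L (1 + \<alpha>)" "v \<in> V L (1 + \<alpha>)" "w \<in> V L (1 + \<alpha>)"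
  shows "b_form L (1 + \<alpha>) \<alpha> (1 + \<alpha>) u v w = pairing L (Bhat L u v) w"
proof -
  let ?s = "1 + \<alpha>"
  have fin: "energy L ?s u < \<infinity>" "energy L ?s v < \<infinity>" "energy L ?s w < \<infinity>"
    and sol: "solenoidal L u" "solenoidal L v" "solenoidal L w"
    using assms by (auto simp: V_iff)
  have tp: "solenoidal L z" "energy L ?s z < \<infinity>" "z 0 = 0" if "z \<in> trig_polys L" for z
    using trig_polysD[OF that] energy_finite_support by (auto simp: solenoidal_def)
  define P where "P = (\<lambda>un vn wn. (\<forall>n::nat. un n \<in> trig_polys L \<and> vn n \<in> trig_polys L \<and> wn n \<in> trig_polys L)
     \<and> (\<lambda>n. sdist L ?s (un n) u) \<longlonglongrightarrow> 0 \<and> (\<lambda>n. sdist L (\<alpha> + 1) (vn n) v) \<longlonglongrightarrow> 0 \<and> (\<lambda>n. sdist L ?s (wn n) w) \<longlonglongrightarrow> 0)"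
  have lim: "(\<lambda>n. renergy L ?s (\<lambda>k. zn n k - z k)) \<longlonglongrightarrow> 0"
    if "(\<lambda>n. sdist L ?s (zn n) z) \<longlonglongrightarrow> 0" "\<And>n. zn n \<in> trig_polys L" "energy L ?s z < \<infinity>" for zn z
  proof -
    have "(\<lambda>n. energy L ?s (\<lambda>k. zn n k - z k)) \<longlonglongrightarrow> 0"
      using that(1) energy_diff_finite[OF tp(2)[OF that(2)] that(3)]
      by (subst sdist_tendsto_0_iff[OF L, symmetric]) simp_all
    then show ?thesis
      unfolding renergy_def using tendsto_enn2real[of "\<lambda>n. energy L ?s (\<lambda>k. zn n k - z k)" 0 sequentially] by simp
  qed
  have conv: "(\<lambda>n. b_trig L (un n) (vn n) (wn n)) \<longlonglongrightarrow> pairing L (Bhat L u v) w" if "P un vn wn" for un vn wn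
  proof -
    have "(\<lambda>n. pairing L (Bhat L (un n) (vn n)) (wn n)) \<longlonglongrightarrow> pairing L (Bhat L u v) w"
      by (rule pairing_Bhat_tendsto[OF L a])
         (use that fin sol tp lim in \<open>auto simp: P_def solenoidal_def add.commute[of \<alpha> 1]\<close>)
    moreover have "b_trig L (un n) (vn n) (wn n) = pairing L (Bhat L (un n) (vn n)) (wn n)" for n
      using that by (intro b_trig_eq_pairing[OF L]) (auto simp: P_def)
    ultimately show ?thesis by simp
  qed
  have "(\<lambda>n. sdist L ?s (ftrunc n z) z) \<longlonglongrightarrow> 0" if "energy L ?s z < \<infinity>" "solenoidal L z" for z
    using energy_ftrunc_tendsto[OF that(1)] energy_diff_finite[OF tp(2)[OF ftrunc_trig_polys[OF that(2)]] that(1)]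
    by (subst sdist_tendsto_0_iff[OF L]) simp_all
  then have ex: "P (\<lambda>n. ftrunc n u) (\<lambda>n. ftrunc n v) (\<lambda>n. ftrunc n w)"
    unfolding P_def using fin sol ftrunc_trig_polys by (auto simp: add.commute[of \<alpha> 1])
  show ?thesis
    unfolding b_form_def
  proof (rule the_equality)
    show "\<forall>un vn wn. (\<forall>n. un n \<in> trig_polys L \<and> vn n \<in> trig_polys L \<and> wn n \<in> trig_polys L)
     \<and> (\<lambda>n. sdist L ?s (un n) u) \<longlonglongrightarrow> 0 \<and> (\<lambda>n. sdist L (\<alpha> + 1) (vn n) v) \<longlonglongrightarrow> 0 \<and> (\<lambda>n. sdist L ?s (wn n) w) \<longlonglongrightarrow> 0
     \<longrightarrow> (\<lambda>n. b_trig L (un n) (vn n) (wn n)) \<longlonglongrightarrow> pairing L (Bhat L u v) w"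
      using conv unfolding P_def by blast
  next
    fix l assume A: "\<forall>un vn wn. (\<forall>n. un n \<in> trig_polys L \<and> vn n \<in> trig_polys L \<and> wn n \<in> trig_polys L)
     \<and> (\<lambda>n. sdist L ?s (un n) u) \<longlonglongrightarrow> 0 \<and> (\<lambda>n. sdist L (\<alpha> + 1) (vn n) v) \<longlonglongrightarrow> 0 \<and> (\<lambda>n. sdist L ?s (wn n) w) \<longlonglongrightarrow> 0
     \<longrightarrow> (\<lambda>n. b_trig L (un n) (vn n) (wn n)) \<longlonglongrightarrow> l"
    have "(\<lambda>n. b_trig L (ftrunc n u) (ftrunc n v) (ftrunc n w)) \<longlonglongrightarrow> l"
      using mp[OF spec[OF spec[OF spec[OF A, of "\<lambda>n. ftrunc n u"], of "\<lambda>n. ftrunc n v"], of "\<lambda>n. ftrunc n w"] ex[unfolded P_def]] .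
    then show "l = pairing L (Bhat L u v) w"
      using conv[OF ex] LIMSEQ_unique by blast
  qed
qed

text \<open>The mirror coefficient at \<open>- k\<close> makes the field real. Testing against this
  field isolates the coefficient at \<open>k\<close>.\<close>

definition cmode :: "int ^ 3 \<Rightarrow> complex ^ 3 \<Rightarrow> coeffs" where
  "cmode k a = (\<lambda>m. if m = k then a else if m = - k then (\<chi> i. cnj (a $ i)) else 0)"

lemma int_vec_neq_minus: "k \<noteq> 0 \<Longrightarrow> k \<noteq> - k" for k :: "int ^ 'n"
  by (auto simp: vec_eq_iff)

lemma cmode_in_V:
  assumes "k \<noteq> 0" "(\<Sum>i\<in>UNIV. complex_of_real (wave L k $ i) * a $ i) = 0"
  shows "cmode k a \<in> V L s"
proof -
  have "finite {m. cmode k a m \<noteq> 0}"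
    by (rule finite_subset[of _ "{k, - k}"]) (auto simp: cmode_def)
  moreover have "solenoidal L (cmode k a)"
  proof -
    have "(\<Sum>i\<in>UNIV. complex_of_real (wave L (- k) $ i) * cnj (a $ i))
        = - cnj (\<Sum>i\<in>UNIV. complex_of_real (wave L k $ i) * a $ i)"
      by (simp add: wave_minus sum_negf)
    then have 1: "(\<Sum>i\<in>UNIV. complex_of_real (wave L (- k) $ i) * cnj (a $ i)) = 0" using assms(2) by simp
    have z: "(\<chi> i. cnj ((0 :: complex ^ 3) $ i)) = 0" "(\<chi> i. cnj ((\<chi> i. cnj (a $ i)) $ i)) = a"
      by (simp_all add: vec_eq_iff)
    show ?thesis
      unfolding solenoidal_def
    proof (intro conjI allI)
      show "cmode k a 0 = 0" using assms(1) by (simp add: cmode_def)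
      fix m
      show "cmode k a (- m) = (\<chi> i. cnj (cmode k a m $ i))"
        using int_vec_neq_minus[OF assms(1)] z
        by (simp add: cmode_def minus_equation_iff[of m k] eq_commute[of "- k" m])
      show "(\<Sum>i\<in>UNIV. complex_of_real (wave L m $ i) * cmode k a m $ i) = 0"
        using 1 assms(2) by (simp add: cmode_def)
    qed
  qed
  ultimately show ?thesis using energy_finite_support by (simp only: V_iff)
qed

lemma pairing_cmode:
  assumes "k \<noteq> 0" "solenoidal L u"
  shows "pairing L u (cmode k a) = 2 * L ^ 3 * (u k \<bullet> a)"
proof -
  have "pairing L u (cmode k a) = L ^ 3 * (\<Sum>m\<in>{k, - k}. u m \<bullet> cmode k a m)"
    by (rule pairing_finite_support) (auto simp: cmode_def)
  also have "(\<Sum>m\<in>{k, - k}. u m \<bullet> cmode k a m) = u k \<bullet> a + u (- k) \<bullet> (\<chi> i. cnj (a $ i))"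
    using int_vec_neq_minus[OF assms(1)] by (simp add: cmode_def)
  also have "u (- k) = (\<chi> i. cnj (u k $ i))"
    using assms(2) by (simp add: solenoidal_def)
  finally show ?thesis by (simp add: inner_cnj)
qed

text \<open>A representing functional is determined by its single modes: the difference
  \<open>d\<close> of two candidates at \<open>k\<close> is divergence free, so the mode with
  amplitude \<open>d\<close> itself is an admissible test field and yields
  \<open>d \<bullet> d = 0\<close>.\<close>

lemma B_op_eq_Bhat:
  assumes L: "L > 0" and a: "\<alpha> > 1 / 2" and u: "u \<in> V L (1 + \<alpha>)" and v: "v \<in> V L (1 + \<alpha>)"
  shows "B_op L (1 + \<alpha>) \<alpha> (1 + \<alpha>) u v = Bhat L u v"
  unfolding B_op_def
proof (rule the_equality)
  have sol: "solenoidal L (Bhat L u v)"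
    using u v by (intro solenoidal_Bhat L) (auto simp: V_iff)
  have "v \<in> V L \<alpha>" using v by (rule V_antimono[OF L, rotated]) simp
  then have "energy L (\<alpha> - 1) (Bhat L u v) < \<infinity>"
    using u by (intro energy_Bhat_finite[OF L a]) (auto simp: V_iff solenoidal_def)
  then have "Bhat L u v \<in> V L (\<alpha> - 1)" using sol by (simp add: V_iff)
  then have "Bhat L u v \<in> V L (- (1 + \<alpha>))" by (rule V_antimono[OF L, rotated]) (use a in simp)
  then show "Bhat L u v \<in> V L (- (1 + \<alpha>)) \<and> (\<forall>w\<in>V L (1 + \<alpha>). pairing L (Bhat L u v) w = b_form L (1 + \<alpha>) \<alpha> (1 + \<alpha>) u v w)"
    using b_form_eq_pairing[OF L a u v] by simp
  fix g assume g: "g \<in> V L (- (1 + \<alpha>)) \<and> (\<forall>w\<in>V L (1 + \<alpha>). pairing L g w = b_form L (1 + \<alpha>) \<alpha> (1 + \<alpha>) u v w)"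
  then have gsol: "solenoidal L g" by (simp add: V_iff)
  show "g = Bhat L u v"
  proof
    fix k
    show "g k = Bhat L u v k"
    proof (cases "k = 0")
      case False
      define d where "d = g k - Bhat L u v k"
      have "(\<Sum>i\<in>UNIV. complex_of_real (wave L k $ i) * d $ i) = 0"
        using solenoidal_diff[OF gsol sol] by (simp add: solenoidal_def d_def)
      then have "cmode k d \<in> V L (1 + \<alpha>)" by (rule cmode_in_V[OF False])
      then have "pairing L g (cmode k d) = pairing L (Bhat L u v) (cmode k d)"
        using g b_form_eq_pairing[OF L a u v] by simp
      then have "g k \<bullet> d = Bhat L u v k \<bullet> d"
        using L by (simp add: pairing_cmode[OF False gsol] pairing_cmode[OF False sol])
      then have "d \<bullet> d = 0" by (simp add: d_def inner_diff_left)
      then show ?thesis by (simp add: d_def)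
    qed (use gsol in \<open>simp add: solenoidal_def\<close>)
  qed
qed

section \<open>Duhamel integrals and absolutely continuous functions\<close>

lemma measurable_lebesgue_on_ident [measurable]:
  "(\<lambda>x. x) \<in> lebesgue_on S \<rightarrow>\<^sub>M (borel :: 'a :: euclidean_space measure)"
  using id_borel_measurable_lebesgue_on[of S] by (simp add: id_def)

lemma lebesgue_on_measurable_mono:
  assumes "f \<in> borel_measurable (lebesgue_on S)" "T \<subseteq> S"
  shows "f \<in> borel_measurable (lebesgue_on T)"
  using assms by (rule measurable_restrict_mono)

lemma finite_measure_lebesgue_on_Icc: "finite_measure (lebesgue_on {a..b :: real})"
  by (rule finite_measure_lebesgue_on) (simp add: lmeasurable_interval)

lemma nn_integral_lebesgue_on_indicator:
  assumes "S \<subseteq> T" "S \<in> sets lebesgue" "T \<in> sets lebesgue"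
  shows "(\<integral>\<^sup>+x. f x * indicator S x \<partial>lebesgue_on T) = (\<integral>\<^sup>+x. f x \<partial>lebesgue_on S)"
proof -
  have "(\<integral>\<^sup>+x. f x * indicator S x \<partial>lebesgue_on T) = (\<integral>\<^sup>+x. f x * indicator S x * indicator T x \<partial>lebesgue)"
    using assms by (simp add: nn_integral_restrict_space)
  also have "\<dots> = (\<integral>\<^sup>+x. f x * indicator S x \<partial>lebesgue)"
    using assms(1) by (intro nn_integral_cong) (auto simp: indicator_def)
  also have "\<dots> = (\<integral>\<^sup>+x. f x \<partial>lebesgue_on S)"
    using assms by (simp add: nn_integral_restrict_space)
  finally show ?thesis .
qed

lemma nn_integral_lebesgue_on_mono:
  assumes "S \<subseteq> T" "S \<in> sets lebesgue" "T \<in> sets lebesgue"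
  shows "(\<integral>\<^sup>+x. f x \<partial>lebesgue_on S) \<le> (\<integral>\<^sup>+x. f x \<partial>lebesgue_on T)"
  unfolding nn_integral_lebesgue_on_indicator[OF assms, symmetric]
  by (intro nn_integral_mono) (auto simp: indicator_def)

lemma nn_integral_lebesgue_on_FTC:
  fixes F f :: "real \<Rightarrow> real"
  assumes "f \<in> borel_measurable borel" "\<And>x. a \<le> x \<Longrightarrow> x \<le> b \<Longrightarrow> DERIV F x :> f x"
    "\<And>x. a \<le> x \<Longrightarrow> x \<le> b \<Longrightarrow> 0 \<le> f x" "a \<le> b"
  shows "(\<integral>\<^sup>+x. ennreal (f x) \<partial>lebesgue_on {a..b}) = ennreal (F b - F a)"
proof -
  have "(\<integral>\<^sup>+x. ennreal (f x) \<partial>lebesgue_on {a..b}) = (\<integral>\<^sup>+x. ennreal (f x) * indicator {a..b} x \<partial>lebesgue)"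
    by (simp add: nn_integral_restrict_space)
  also have "\<dots> = (\<integral>\<^sup>+x. ennreal (f x) * indicator {a..b} x \<partial>lborel)"
    by (rule nn_integral_completion)
  also have "\<dots> = ennreal (F b - F a)"
    using assms by (intro nn_integral_FTC_Icc) auto
  finally show ?thesis .
qed

section \<open>The Duhamel integral of the scalar equation y' + c y = H\<close>

definition duhamel :: "real \<Rightarrow> (real \<Rightarrow> 'a :: euclidean_space) \<Rightarrow> real \<Rightarrow> 'a" where
  "duhamel c H t = (LINT s|lebesgue_on {0..t}. exp (- (c * (t - s))) *\<^sub>R H s)"

lemma nn_integral_exp_decay:
  assumes "c > 0" "t \<ge> 0"
  shows "(\<integral>\<^sup>+s. ennreal (exp (- (c * (t - s)))) \<partial>lebesgue_on {0..t}) \<le> ennreal (1 / c)"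
proof -
  have "(\<integral>\<^sup>+s. ennreal (exp (- (c * (t - s)))) \<partial>lebesgue_on {0..t}) = ennreal (exp (- (c * (t - t))) / c - exp (- (c * (t - 0))) / c)"
    using assms by (intro nn_integral_lebesgue_on_FTC[where F = "\<lambda>s. exp (- (c * (t - s))) / c"])
      (auto intro!: derivative_eq_intros)
  also have "\<dots> \<le> ennreal (1 / c)" using assms by (intro ennreal_leI) simp
  finally show ?thesis .
qed

lemma nn_integral_exp_decay':
  assumes "c > 0" "0 \<le> s" "s \<le> T"
  shows "(\<integral>\<^sup>+t. ennreal (exp (- (c * (t - s)))) \<partial>lebesgue_on {s..T}) \<le> ennreal (1 / c)"
proof -
  have "(\<integral>\<^sup>+t. ennreal (exp (- (c * (t - s)))) \<partial>lebesgue_on {s..T}) = ennreal (- exp (- (c * (T - s))) / c - (- exp (- (c * (s - s))) / c))"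
    using assms by (intro nn_integral_lebesgue_on_FTC[where F = "\<lambda>t. - exp (- (c * (t - s))) / c"])
      (auto intro!: derivative_eq_intros)
  also have "\<dots> \<le> ennreal (1 / c)" using assms by (intro ennreal_leI) simp
  finally show ?thesis .
qed

text \<open>Cauchy-Schwarz after splitting the exponential kernel into two square roots, one of
  which integrates to at most 1/c. With \<open>c\<close> equal to \<nu> times the squared wave
  number, this factor is the gain of one derivative, uniformly in time.\<close>

lemma duhamel_sq_le:
  assumes c: "c > 0" and t: "t \<ge> 0" and H [measurable]: "H \<in> borel_measurable (lebesgue_on {0..t})"
  shows "ennreal ((norm (duhamel c H t))\<^sup>2)
    \<le> ennreal (1 / c) * (\<integral>\<^sup>+s. ennreal (exp (- (c * (t - s)))) * ennreal ((norm (H s))\<^sup>2) \<partial>lebesgue_on {0..t})"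
proof -
  let ?M = "lebesgue_on {0..t}"
  let ?r = "\<lambda>s. ennreal (exp (- (c * (t - s) / 2)))"
  have r2: "?r s * ?r s = ennreal (exp (- (c * (t - s))))" for s
    by (simp add: ennreal_mult[symmetric] exp_add[symmetric])
  have "ennreal (norm (duhamel c H t)) \<le> (\<integral>\<^sup>+s. ennreal (norm (exp (- (c * (t - s))) *\<^sub>R H s)) \<partial>?M)"
    unfolding duhamel_def
  proof (cases "integrable ?M (\<lambda>s. exp (- (c * (t - s))) *\<^sub>R H s)")
    case True
    then show "ennreal (norm (LINT s|?M. exp (- (c * (t - s))) *\<^sub>R H s)) \<le> (\<integral>\<^sup>+s. ennreal (norm (exp (- (c * (t - s))) *\<^sub>R H s)) \<partial>?M)"
      by (rule integral_norm_bound_ennreal)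
  qed (simp add: not_integrable_integral_eq)
  also have "\<dots> = (\<integral>\<^sup>+s. ?r s * (?r s * ennreal (norm (H s))) \<partial>?M)"
    by (subst mult.assoc[symmetric], subst r2) (simp add: ennreal_mult)
  finally have "(ennreal (norm (duhamel c H t)))\<^sup>2 \<le> (\<integral>\<^sup>+s. ?r s * (?r s * ennreal (norm (H s))) \<partial>?M)\<^sup>2"
    by (intro power_mono) auto
  also have "\<dots> \<le> (\<integral>\<^sup>+s. (?r s)\<^sup>2 \<partial>?M) * (\<integral>\<^sup>+s. (?r s * ennreal (norm (H s)))\<^sup>2 \<partial>?M)"
    by (rule Cauchy_Schwarz_nn_integral) measurable
  also have "\<dots> \<le> ennreal (1 / c) * (\<integral>\<^sup>+s. (?r s * ennreal (norm (H s)))\<^sup>2 \<partial>?M)"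
    using nn_integral_exp_decay[OF c t] by (intro mult_right_mono) (auto simp: power2_eq_square r2)
  also have "(\<lambda>s. (?r s * ennreal (norm (H s)))\<^sup>2) = (\<lambda>s. ennreal (exp (- (c * (t - s)))) * ennreal ((norm (H s))\<^sup>2))"
    by (simp add: power_mult_distrib ennreal_power[symmetric] power2_eq_square[of "?r _"] r2 del: ennreal_power)
  finally show ?thesis by (simp add: ennreal_power)
qed

lemma duhamel_sq_le_simple:
  assumes "c > 0" "t \<ge> 0" "H \<in> borel_measurable (lebesgue_on {0..t})"
  shows "ennreal ((norm (duhamel c H t))\<^sup>2) \<le> ennreal (1 / c) * (\<integral>\<^sup>+s. ennreal ((norm (H s))\<^sup>2) \<partial>lebesgue_on {0..t})"
proof -
  have "(\<integral>\<^sup>+s. ennreal (exp (- (c * (t - s)))) * ennreal ((norm (H s))\<^sup>2) \<partial>lebesgue_on {0..t})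
      \<le> (\<integral>\<^sup>+s. 1 * ennreal ((norm (H s))\<^sup>2) \<partial>lebesgue_on {0..t})"
    using assms(1) by (intro nn_integral_mono mult_right_mono) auto
  then show ?thesis
    by (intro order_trans[OF duhamel_sq_le[OF assms]] mult_left_mono) simp_all
qed

text \<open>Integrating \<open>duhamel_sq_le\<close> in \<open>t\<close> and exchanging the order of
  integration produces a second factor 1/c, a gain of two derivatives in the square mean over
  time.\<close>

lemma duhamel_L2_le:
  assumes c: "c > 0" and H [measurable]: "H \<in> borel_measurable (lebesgue_on {0..T})"
  shows "(\<integral>\<^sup>+t. ennreal ((norm (duhamel c H t))\<^sup>2) \<partial>lebesgue_on {0..T})
    \<le> ennreal (1 / c\<^sup>2) * (\<integral>\<^sup>+s. ennreal ((norm (H s))\<^sup>2) \<partial>lebesgue_on {0..T})"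
proof -
  let ?M = "lebesgue_on {0..T}"
  interpret finite_measure ?M by (rule finite_measure_lebesgue_on_Icc)
  interpret P: pair_sigma_finite ?M ?M ..
  let ?h = "\<lambda>s. ennreal ((norm (H s))\<^sup>2)"
  let ?k = "\<lambda>t s. if s \<le> t then ennreal (exp (- (c * (t - s)))) else 0"
  have "(\<integral>\<^sup>+t. ennreal ((norm (duhamel c H t))\<^sup>2) \<partial>?M) \<le> (\<integral>\<^sup>+t. ennreal (1 / c) * (\<integral>\<^sup>+s. ?k t s * ?h s \<partial>?M) \<partial>?M)"
  proof (rule nn_integral_mono)
    fix t assume "t \<in> space ?M"
    then have t: "0 \<le> t" "t \<le> T" by auto
    have "ennreal ((norm (duhamel c H t))\<^sup>2) \<le> ennreal (1 / c) * (\<integral>\<^sup>+s. ennreal (exp (- (c * (t - s)))) * ?h s \<partial>lebesgue_on {0..t})"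
      using t by (intro duhamel_sq_le c lebesgue_on_measurable_mono[OF H]) auto
    also have "(\<integral>\<^sup>+s. ennreal (exp (- (c * (t - s)))) * ?h s \<partial>lebesgue_on {0..t})
        = (\<integral>\<^sup>+s. (ennreal (exp (- (c * (t - s)))) * ?h s) * indicator {0..t} s \<partial>?M)"
      using t by (intro nn_integral_lebesgue_on_indicator[symmetric]) auto
    also have "\<dots> = (\<integral>\<^sup>+s. ?k t s * ?h s \<partial>?M)"
      by (intro nn_integral_cong) (auto simp: indicator_def)
    finally show "ennreal ((norm (duhamel c H t))\<^sup>2) \<le> ennreal (1 / c) * (\<integral>\<^sup>+s. ?k t s * ?h s \<partial>?M)" .
  qed
  also have "\<dots> = ennreal (1 / c) * (\<integral>\<^sup>+t. \<integral>\<^sup>+s. ?k t s * ?h s \<partial>?M \<partial>?M)"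
    by (rule nn_integral_cmult) measurable
  also have "(\<integral>\<^sup>+t. \<integral>\<^sup>+s. ?k t s * ?h s \<partial>?M \<partial>?M) = (\<integral>\<^sup>+s. \<integral>\<^sup>+t. ?k t s * ?h s \<partial>?M \<partial>?M)"
    by (rule P.Fubini'[symmetric]) measurable
  also have "\<dots> \<le> (\<integral>\<^sup>+s. ennreal (1 / c) * ?h s \<partial>?M)"
  proof (rule nn_integral_mono)
    fix s assume "s \<in> space ?M"
    then have s: "0 \<le> s" "s \<le> T" by auto
    have "(\<integral>\<^sup>+t. ?k t s * ?h s \<partial>?M) = (\<integral>\<^sup>+t. ennreal (exp (- (c * (t - s)))) * indicator {s..T} t \<partial>?M) * ?h s"
      by (subst nn_integral_multc[symmetric], measurable) (auto intro!: nn_integral_cong simp: indicator_def)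
    also have "(\<integral>\<^sup>+t. ennreal (exp (- (c * (t - s)))) * indicator {s..T} t \<partial>?M)
        = (\<integral>\<^sup>+t. ennreal (exp (- (c * (t - s)))) \<partial>lebesgue_on {s..T})"
      using s by (intro nn_integral_lebesgue_on_indicator) auto
    also have "\<dots> * ?h s \<le> ennreal (1 / c) * ?h s"
      using nn_integral_exp_decay'[OF c s] by (rule mult_right_mono) simp
    finally show "(\<integral>\<^sup>+t. ?k t s * ?h s \<partial>?M) \<le> ennreal (1 / c) * ?h s" .
  qed
  also have "\<dots> = ennreal (1 / c) * (\<integral>\<^sup>+s. ?h s \<partial>?M)"
    by (rule nn_integral_cmult) measurable
  finally have "(\<integral>\<^sup>+t. ennreal ((norm (duhamel c H t))\<^sup>2) \<partial>?M) \<le> ennreal (1 / c) * (ennreal (1 / c) * (\<integral>\<^sup>+s. ?h s \<partial>?M))"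
    by (simp add: mult_left_mono)
  then show ?thesis
    using c by (simp add: ennreal_mult[symmetric] power2_eq_square flip: mult.assoc)
qed

lemma integrable_exp_scaleR:
  fixes H :: "real \<Rightarrow> 'a :: euclidean_space"
  assumes "integrable (lebesgue_on {a..b}) H"
  shows "integrable (lebesgue_on {a..b}) (\<lambda>s. exp (c * s + d) *\<^sub>R H s)"
proof (rule Bochner_Integration.integrable_bound)
  have [measurable]: "H \<in> borel_measurable (lebesgue_on {a..b})" using assms by auto
  show "(\<lambda>s. exp (c * s + d) *\<^sub>R H s) \<in> borel_measurable (lebesgue_on {a..b})" by measurable
  show "integrable (lebesgue_on {a..b}) (\<lambda>s. exp (\<bar>c\<bar> * max \<bar>a\<bar> \<bar>b\<bar> + d) *\<^sub>R H s)"
    using assms by simp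
  have "c * s \<le> \<bar>c\<bar> * max \<bar>a\<bar> \<bar>b\<bar>" if "a \<le> s" "s \<le> b" for s
  proof -
    have "c * s \<le> \<bar>c\<bar> * \<bar>s\<bar>" by (metis abs_ge_self abs_mult)
    also have "\<dots> \<le> \<bar>c\<bar> * max \<bar>a\<bar> \<bar>b\<bar>" using that by (intro mult_left_mono) auto
    finally show ?thesis .
  qed
  then show "AE s in lebesgue_on {a..b}. norm (exp (c * s + d) *\<^sub>R H s) \<le> norm (exp (\<bar>c\<bar> * max \<bar>a\<bar> \<bar>b\<bar> + d) *\<^sub>R H s)"
    by (intro AE_I2) (simp add: mult_right_mono)
qed

lemma continuous_on_indefinite_integral:
  fixes f :: "real \<Rightarrow> 'a :: euclidean_space"
  assumes "integrable (lebesgue_on {0..T}) f"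
  shows "continuous_on {0..T} (\<lambda>t. LINT s|lebesgue_on {0..t}. f s)"
proof -
  have "continuous_on {0..T} (\<lambda>t. integral {0..t} f)"
    using assms by (intro indefinite_integral_continuous_1 integrable_on_lebesgue_on) auto
  moreover have "integral {0..t} f = (LINT s|lebesgue_on {0..t}. f s)" if "t \<in> {0..T}" for t
    using that by (intro lebesgue_integral_eq_integral[symmetric] integrable_subinterval[OF assms]) auto
  ultimately show ?thesis by (rule continuous_on_eq)
qed

lemma duhamel_eq_exp:
  "duhamel c H t = exp (- (c * t)) *\<^sub>R (LINT s|lebesgue_on {0..t}. exp (c * s) *\<^sub>R H s)"
proof -
  have "exp (- (c * (t - s))) = exp (- (c * t)) * exp (c * s)" for s
    by (simp add: algebra_simps flip: exp_add)
  then show ?thesis unfolding duhamel_def by (simp flip: scaleR_scaleR)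
qed

lemma continuous_on_duhamel:
  assumes "integrable (lebesgue_on {0..T}) H"
  shows "continuous_on {0..T} (duhamel c H)"
proof -
  have "integrable (lebesgue_on {0..T}) (\<lambda>s. exp (c * s) *\<^sub>R H s)"
    using integrable_exp_scaleR[OF assms, of c 0] by simp
  then show ?thesis
    unfolding duhamel_eq_exp[abs_def] by (intro continuous_intros continuous_on_indefinite_integral)
qed

section \<open>Product rule and Volterra inequalities with integrable kernels\<close>

lemma integral_lebesgue_on_indicator:
  fixes f :: "real \<Rightarrow> 'a :: euclidean_space"
  assumes "S \<subseteq> T" "S \<in> sets lebesgue" "T \<in> sets lebesgue"
  shows "(LINT x|lebesgue_on T. indicator S x *\<^sub>R f x) = (LINT x|lebesgue_on S. f x)"
  using integral_restrict[OF assms, of f] by (simp add: indicator_scaleR_eq_if)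

text \<open>The product rule for absolutely continuous functions, in integrated form: split the square
  \<open>[0,T]\<^sup>2\<close> along its diagonal.\<close>

lemma integral_product_rule:
  fixes p q :: "real \<Rightarrow> real"
  assumes p: "integrable (lebesgue_on {0..T}) p" and q: "integrable (lebesgue_on {0..T}) q"
  defines "P \<equiv> \<lambda>t. LINT s|lebesgue_on {0..t}. p s" and "Q \<equiv> \<lambda>t. LINT s|lebesgue_on {0..t}. q s"
  shows "integrable (lebesgue_on {0..T}) (\<lambda>t. p t * Q t)" (is ?I1)
    and "integrable (lebesgue_on {0..T}) (\<lambda>t. P t * q t)" (is ?I2)
    and "P T * Q T = (LINT t|lebesgue_on {0..T}. p t * Q t) + (LINT t|lebesgue_on {0..T}. P t * q t)" (is ?eq)
proof -
  let ?M = "lebesgue_on {0..T}"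
  have [measurable]: "p \<in> borel_measurable ?M" "q \<in> borel_measurable ?M" using p q by auto
  interpret finite_measure ?M by (rule finite_measure_lebesgue_on_Icc)
  interpret pair_sigma_finite ?M ?M ..
  have int: "integrable (?M \<Otimes>\<^sub>M ?M) (\<lambda>(x, y). p x * q y)"
  proof (rule Fubini_integrable)
    show "integrable ?M (\<lambda>x. LINT y|?M. norm (case (x, y) of (x, y) \<Rightarrow> p x * q y))"
      using p by (simp add: abs_mult)
    show "AE x in ?M. integrable ?M (\<lambda>y. case (x, y) of (x, y) \<Rightarrow> p x * q y)"
      using q by simp
  qed measurable
  have int1: "integrable (?M \<Otimes>\<^sub>M ?M) (\<lambda>(x, y). (if y \<le> x then p x * q y else 0))"
    by (rule Bochner_Integration.integrable_bound[OF int]) auto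
  have int2: "integrable (?M \<Otimes>\<^sub>M ?M) (\<lambda>(x, y). (if y \<le> x then 0 else p x * q y))"
    by (rule Bochner_Integration.integrable_bound[OF int]) auto
  have Q: "(LINT y|?M. (if y \<le> x then p x * q y else 0)) = p x * Q x" if "x \<in> {0..T}" for x
  proof -
    have "(LINT y|?M. (if y \<le> x then p x * q y else 0)) = (LINT y|?M. indicator {0..x} y *\<^sub>R (p x * q y))"
      by (intro Bochner_Integration.integral_cong) (auto simp: indicator_def)
    also have "\<dots> = (LINT y|lebesgue_on {0..x}. p x * q y)"
      using that by (intro integral_lebesgue_on_indicator) auto
    finally show ?thesis by (simp add: Q_def)
  qed
  have P: "(LINT x|?M. (if y \<le> x then 0 else p x * q y)) = P y * q y" if "y \<in> {0..T}" for y
  proof -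
    have "(LINT x|?M. (if y \<le> x then 0 else p x * q y)) = (LINT x|?M. indicator {0..y} x *\<^sub>R (p x * q y))"
    \<comment> \<open>The diagonal was assigned to the other triangle, so this section differs from
      the closed interval in the single point \<open>y\<close>.\<close>
    proof (rule integral_cong_AE)
      have "AE x in ?M. x \<noteq> y"
        using AE_completion[OF AE_lborel_singleton[of y]] by (auto simp: AE_restrict_space_iff elim: eventually_mono)
      then show "AE x in ?M. (if y \<le> x then 0 else p x * q y) = indicator {0..y} x *\<^sub>R (p x * q y)"
        by (rule AE_mp) (intro AE_I2, auto simp: indicator_def)
    qed measurable
    also have "\<dots> = (LINT x|lebesgue_on {0..y}. p x * q y)"
      using that by (intro integral_lebesgue_on_indicator) auto
    finally show ?thesis by (simp add: P_def)
  qed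
  have i1: "integrable ?M (\<lambda>x. LINT y|?M. (if y \<le> x then p x * q y else 0))"
    using integrable_fst[OF int1] by simp
  then show ?I1 by (rule iffD1[OF Bochner_Integration.integrable_cong, rotated 2]) (use Q in auto)
  have i2: "integrable ?M (\<lambda>y. LINT x|?M. (if y \<le> x then 0 else p x * q y))"
    using integrable_snd[OF int2] by simp
  then show ?I2 by (rule iffD1[OF Bochner_Integration.integrable_cong, rotated 2]) (use P in auto)
  have "P T * Q T = (LINT x|?M. LINT y|?M. p x * q y)"
    by (simp add: P_def Q_def)
  also have "\<dots> = (LINT z|(?M \<Otimes>\<^sub>M ?M). (case z of (x, y) \<Rightarrow> p x * q y))"
    using integral_fst[OF int] by simp
  also have "\<dots> = (LINT z|(?M \<Otimes>\<^sub>M ?M). (case z of (x, y) \<Rightarrow> if y \<le> x then p x * q y else 0) + (case z of (x, y) \<Rightarrow> if y \<le> x then 0 else p x * q y))"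
    by (intro Bochner_Integration.integral_cong) auto
  also have "\<dots> = (LINT z|(?M \<Otimes>\<^sub>M ?M). (case z of (x, y) \<Rightarrow> if y \<le> x then p x * q y else 0)) + (LINT z|(?M \<Otimes>\<^sub>M ?M). (case z of (x, y) \<Rightarrow> if y \<le> x then 0 else p x * q y))"
    using int1 int2 by (rule Bochner_Integration.integral_add)
  also have "\<dots> = (LINT x|?M. LINT y|?M. (if y \<le> x then p x * q y else 0)) + (LINT y|?M. LINT x|?M. (if y \<le> x then 0 else p x * q y))"
    using integral_fst[OF int1] integral_snd[OF int2] by simp
  also have "\<dots> = (LINT t|?M. p t * Q t) + (LINT t|?M. P t * q t)"
    using P Q by (intro arg_cong2[where f = "(+)"] Bochner_Integration.integral_cong) auto
  finally show ?eq .
qed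

text \<open>\<open>W\<close> is only absolutely continuous, so the power rule is obtained by
  induction from the product rule: applied to \<open>W\<close> and the previous integral, it says
  that the wanted integral times 1 + 1/(n+1) equals \<open>W\<close> to the power n + 2 divided by n
  + 1.\<close>

lemma integral_power_primitive:
  fixes e :: "real \<Rightarrow> real"
  assumes "integrable (lebesgue_on {0..T}) e" "t \<in> {0..T}"
  defines "W \<equiv> \<lambda>t. LINT s|lebesgue_on {0..t}. e s"
  shows "integrable (lebesgue_on {0..t}) (\<lambda>s. e s * W s ^ n)"
    and "(LINT s|lebesgue_on {0..t}. e s * W s ^ n) = W t ^ Suc n / Suc n"
  using assms(2)
proof (induction n arbitrary: t)
  case 0
  { case 1 then show ?case using integrable_subinterval[OF assms(1), of 0 t] by auto }
  { case 2 then show ?case by (simp add: W_def) }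
next
  case (Suc n)
  have e: "integrable (lebesgue_on {0..t}) e" and s: "integrable (lebesgue_on {0..t}) (\<lambda>s. e s * W s ^ n)" if "t \<in> {0..T}" for t
    using integrable_subinterval[OF assms(1), of 0 t] Suc.IH(1)[OF that] that by auto
  note r = integral_product_rule[OF e s, folded W_def]
  have eq: "e s * (LINT r|lebesgue_on {0..s}. e r * W r ^ n) = e s * W s ^ Suc n / Suc n" if "s \<in> {0..T}" for s
    using Suc.IH(2)[OF that] by simp
  { case 1
    have "integrable (lebesgue_on {0..t}) (\<lambda>s. e s * (LINT r|lebesgue_on {0..s}. e r * W r ^ n))"
      using r(1)[OF 1 1] .
    moreover have "e s * (LINT r|lebesgue_on {0..s}. e r * W r ^ n) = e s * W s ^ Suc n / Suc n" if "s \<in> {0..t}" for s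
      using eq[of s] 1 that by (simp del: power_Suc)
    then have "integrable (lebesgue_on {0..t}) (\<lambda>s. e s * (LINT r|lebesgue_on {0..s}. e r * W r ^ n))
        \<longleftrightarrow> integrable (lebesgue_on {0..t}) (\<lambda>s. e s * W s ^ Suc n / Suc n)"
      by (intro Bochner_Integration.integrable_cong refl) auto
    ultimately have "integrable (lebesgue_on {0..t}) (\<lambda>s. e s * W s ^ Suc n / Suc n)" by blast
    then have "integrable (lebesgue_on {0..t}) (\<lambda>s. Suc n * (e s * W s ^ Suc n / Suc n))"
      by (rule Bochner_Integration.integrable_mult_right)
    then show ?case by simp }
  { case 2
    have "W t * (LINT s|lebesgue_on {0..t}. e s * W s ^ n)
        = (LINT s|lebesgue_on {0..t}. e s * (LINT r|lebesgue_on {0..s}. e r * W r ^ n)) + (LINT s|lebesgue_on {0..t}. W s * (e s * W s ^ n))"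
      using integral_product_rule(3)[OF e[OF 2] s[OF 2]] by (simp only: W_def)
    also have "(LINT s|lebesgue_on {0..t}. e s * (LINT r|lebesgue_on {0..s}. e r * W r ^ n)) = (LINT s|lebesgue_on {0..t}. e s * W s ^ Suc n / Suc n)"
      using eq 2 by (intro Bochner_Integration.integral_cong) auto
    also have "\<dots> = (LINT s|lebesgue_on {0..t}. e s * W s ^ Suc n) / Suc n" by simp
    also have "(LINT s|lebesgue_on {0..t}. W s * (e s * W s ^ n)) = (LINT s|lebesgue_on {0..t}. e s * W s ^ Suc n)"
      by (simp add: mult_ac)
    finally show ?case using Suc.IH(2)[OF 2] by (simp add: field_simps) }
qed

text \<open>Each application integrates \<open>e\<close> against a power of its own primitive, which
  divides by the next integer. These divisors build the factorial, so the bound is summable for a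
  drift of any size on an interval of any length.\<close>

lemma volterra_iteration:
  fixes e :: "real \<Rightarrow> real" and x :: "nat \<Rightarrow> real \<Rightarrow> ennreal"
  assumes e: "integrable (lebesgue_on {0..T}) e" "\<And>s. e s \<ge> 0" and nn: "C \<ge> 0" "M \<ge> 0"
    and x0: "\<And>t. t \<in> {0..T} \<Longrightarrow> x 0 t \<le> ennreal M"
    and xS: "\<And>n t. t \<in> {0..T} \<Longrightarrow> x (Suc n) t \<le> ennreal C * (\<integral>\<^sup>+s. ennreal (e s) * x n s \<partial>lebesgue_on {0..t})"
    and t: "t \<in> {0..T}"
  shows "x n t \<le> ennreal (M * (C * (LINT s|lebesgue_on {0..t}. e s)) ^ n / fact n)"
  using t
proof (induction n arbitrary: t)
  case 0
  then show ?case using x0 by simp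
next
  case (Suc n)
  define W where "W = (\<lambda>t. LINT s|lebesgue_on {0..t}. e s)"
  have W: "W t \<ge> 0" for t unfolding W_def using e(2) by simp
  define K where "K = M * C ^ n / fact n"
  have K: "K \<ge> 0" using nn by (simp add: K_def)
  have "(\<integral>\<^sup>+s. ennreal (e s) * x n s \<partial>lebesgue_on {0..t}) \<le> (\<integral>\<^sup>+s. ennreal (K * (e s * W s ^ n)) \<partial>lebesgue_on {0..t})"
  proof (rule nn_integral_mono)
    fix s assume "s \<in> space (lebesgue_on {0..t})"
    then have "x n s \<le> ennreal (M * (C * W s) ^ n / fact n)"
      using Suc.IH[of s] Suc.prems by (simp add: W_def)
    then have "ennreal (e s) * x n s \<le> ennreal (e s) * ennreal (M * (C * W s) ^ n / fact n)"
      by (rule mult_left_mono) simp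
    also have "\<dots> = ennreal (K * (e s * W s ^ n))"
      using e(2) by (subst ennreal_mult'[symmetric]) (simp_all add: K_def power_mult_distrib mult_ac)
    finally show "ennreal (e s) * x n s \<le> ennreal (K * (e s * W s ^ n))" .
  qed
  also have "\<dots> = ennreal (LINT s|lebesgue_on {0..t}. K * (e s * W s ^ n))"
    using integral_power_primitive(1)[OF e(1) Suc.prems, of n] K W e(2)
    by (intro nn_integral_eq_integral) (auto simp: W_def)
  also have "(LINT s|lebesgue_on {0..t}. K * (e s * W s ^ n)) = K * (W t ^ Suc n / Suc n)"
    using integral_power_primitive(2)[OF e(1) Suc.prems, of n] by (simp add: W_def)
  finally have "ennreal C * (\<integral>\<^sup>+s. ennreal (e s) * x n s \<partial>lebesgue_on {0..t}) \<le> ennreal C * ennreal (K * (W t ^ Suc n / Suc n))"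
    by (rule mult_left_mono) simp
  also have "\<dots> = ennreal (C * (K * (W t ^ Suc n / Suc n)))"
    using nn by (intro ennreal_mult'[symmetric]) auto
  also have "C * (K * (W t ^ Suc n / Suc n)) = M * (C * W t) ^ Suc n / fact (Suc n)"
    by (simp add: K_def power_mult_distrib field_simps)
  finally show ?case
    using xS[OF Suc.prems, of n] by (simp add: W_def)
qed

section \<open>Test functions\<close>

definition smooth :: "(real \<Rightarrow> real) \<Rightarrow> bool" where
  "smooth f \<longleftrightarrow> (\<forall>n x. (deriv ^^ n) f field_differentiable at x)"

text \<open>Iterated derivatives of products and of flat functions have no convenient closed form. A
  family of differentiable functions that is closed under \<open>deriv\<close> contains all of them,
  so only the general shape of the derivatives has to be guessed.\<close>

lemma smooth_coinduct:
  assumes "f \<in> X" "\<And>f x. f \<in> X \<Longrightarrow> f field_differentiable at x" "\<And>f. f \<in> X \<Longrightarrow> deriv f \<in> X"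
  shows "smooth f"
proof -
  have "(deriv ^^ n) f \<in> X" for n
    by (induction n) (auto intro: assms)
  then show ?thesis unfolding smooth_def using assms(2) by blast
qed

lemma smooth_DERIV: "smooth f \<Longrightarrow> (f has_field_derivative deriv f x) (at x)"
  unfolding smooth_def by (metis DERIV_deriv_iff_field_differentiable funpow_0)

lemma smooth_deriv: "smooth f \<Longrightarrow> smooth (deriv f)"
  unfolding smooth_def by (metis comp_apply funpow_Suc_right)

lemma smooth_continuous: "smooth f \<Longrightarrow> continuous_on A f"
  using smooth_DERIV by (meson DERIV_isCont continuous_at_imp_continuous_on)

lemma smooth_primitive:
  assumes "\<And>x. (F has_field_derivative f x) (at x)" "smooth f"
  shows "smooth F"
proof (rule smooth_coinduct[where X = "insert F (Collect smooth)"])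
  fix g x assume "g \<in> insert F (Collect smooth)"
  then show "g field_differentiable at x"
    using assms smooth_DERIV by (auto simp: field_differentiable_def)
next
  have "deriv F = f" using assms(1) by (auto intro: DERIV_imp_deriv)
  then show "deriv g \<in> insert F (Collect smooth)" if "g \<in> insert F (Collect smooth)" for g
    using that assms(2) smooth_deriv by auto
qed simp

text \<open>The family is that of finite sums of products of smooth functions, encoded by lists of
  pairs; the Leibniz rule replaces every pair by two.\<close>

lemma smooth_mult:
  assumes "smooth f" "smooth g"
  shows "smooth (\<lambda>x. f x * g x)"
proof (rule smooth_coinduct)
  let ?S = "\<lambda>ps :: ((real \<Rightarrow> real) \<times> (real \<Rightarrow> real)) list. \<lambda>x. \<Sum>p\<leftarrow>ps. fst p x * snd p x"
  let ?X = "{?S ps |ps. \<forall>p\<in>set ps. smooth (fst p) \<and> smooth (snd p)}"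
  show "(\<lambda>x. f x * g x) \<in> ?X"
    using assms by (auto intro!: exI[of _ "[(f, g)]"])
  define D where "D = (\<lambda>ps. concat (map (\<lambda>p :: (real \<Rightarrow> real) \<times> (real \<Rightarrow> real). [(deriv (fst p), snd p), (fst p, deriv (snd p))]) ps))"
  have der: "(?S ps has_field_derivative ?S (D ps) x) (at x)" if "\<forall>p\<in>set ps. smooth (fst p) \<and> smooth (snd p)" for ps x
    using that
  proof (induction ps)
    case (Cons p ps)
    have "((\<lambda>x. fst p x * snd p x) has_field_derivative deriv (fst p) x * snd p x + fst p x * deriv (snd p) x) (at x)"
      using Cons.prems smooth_DERIV by (auto intro!: derivative_eq_intros)
    moreover have "(?S ps has_field_derivative ?S (D ps) x) (at x)" using Cons by simp
    ultimately have "((\<lambda>x. fst p x * snd p x + ?S ps x) has_field_derivative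
        (deriv (fst p) x * snd p x + fst p x * deriv (snd p) x) + ?S (D ps) x) (at x)"
      by (rule DERIV_add)
    then show ?case by (simp add: D_def add.assoc)
  qed (simp add: D_def)
  have DX: "\<forall>p\<in>set (D ps). smooth (fst p) \<and> smooth (snd p)" if "\<forall>p\<in>set ps. smooth (fst p) \<and> smooth (snd p)" for ps
    using that smooth_deriv by (auto simp: D_def)
  fix h assume "h \<in> ?X"
  then obtain ps where ps: "h = ?S ps" "\<forall>p\<in>set ps. smooth (fst p) \<and> smooth (snd p)" by auto
  show "h field_differentiable at x" for x
    using der[OF ps(2)] ps(1) by (auto simp: field_differentiable_def)
  have "deriv h = ?S (D ps)"
    using der[OF ps(2)] ps(1) by (auto intro: DERIV_imp_deriv)
  then show "deriv h \<in> ?X" using DX[OF ps(2)] by blast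
qed

lemma smooth_affine:
  assumes "smooth f"
  shows "smooth (\<lambda>x. f (a + c * x))"
proof (rule smooth_coinduct)
  let ?X = "{\<lambda>x. d * f (a + c * x) |d f. smooth f}"
  show "(\<lambda>x. f (a + c * x)) \<in> ?X"
    using assms by (auto intro!: exI[of _ 1] exI[of _ f])
  fix h assume "h \<in> ?X"
  then obtain d f where h: "h = (\<lambda>x. d * f (a + c * x))" and f: "smooth f" by auto
  have der: "(h has_field_derivative (d * c) * deriv f (a + c * x)) (at x)" for x
  proof -
    have "((\<lambda>x. f (a + c * x)) has_field_derivative deriv f (a + c * x) * c) (at x)"
      by (rule DERIV_chain2[OF smooth_DERIV[OF f]]) (auto intro!: derivative_eq_intros)
    from DERIV_cmult[OF this, of d] show ?thesis by (simp add: h mult_ac)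
  qed
  show "h field_differentiable at x" for x
    using der by (auto simp: field_differentiable_def)
  have "deriv h = (\<lambda>x. (d * c) * deriv f (a + c * x))"
    using der by (auto intro: DERIV_imp_deriv)
  then show "deriv h \<in> ?X" using smooth_deriv[OF f] by blast
qed

lemma smooth_exp: "smooth (\<lambda>x. exp (c * x))"
proof (rule smooth_coinduct)
  let ?X = "{\<lambda>x. d * exp (c * x) |d. True}"
  show "(\<lambda>x. exp (c * x)) \<in> ?X" by (auto intro!: exI[of _ 1])
  fix h assume "h \<in> ?X"
  then obtain d where h: "h = (\<lambda>x. d * exp (c * x))" by auto
  have der: "(h has_field_derivative (d * c) * exp (c * x)) (at x)" for x
    unfolding h by (auto intro!: derivative_eq_intros)
  show "h field_differentiable at x" for x
    using der by (auto simp: field_differentiable_def)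
  have "deriv h = (\<lambda>x. (d * c) * exp (c * x))"
    using der by (auto intro: DERIV_imp_deriv)
  then show "deriv h \<in> ?X" by blast
qed

lemma smooth_diff:
  assumes "smooth f" "smooth g"
  shows "smooth (\<lambda>x. f x - g x)"
proof (rule smooth_coinduct)
  let ?X = "{\<lambda>x. f x - g x |f g. smooth f \<and> smooth g}"
  show "(\<lambda>x. f x - g x) \<in> ?X" using assms by blast
  fix h assume "h \<in> ?X"
  then obtain f g where h: "h = (\<lambda>x. f x - g x)" and fg: "smooth f" "smooth g" by auto
  have der: "(h has_field_derivative deriv f x - deriv g x) (at x)" for x
    unfolding h by (intro DERIV_diff smooth_DERIV fg)
  show "h field_differentiable at x" for x
    using der by (auto simp: field_differentiable_def)
  have "deriv h = (\<lambda>x. deriv f x - deriv g x)"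
    using der by (auto intro: DERIV_imp_deriv)
  then show "deriv h \<in> ?X" using smooth_deriv fg by blast
qed

section \<open>Flat functions, a bump and its primitive\<close>

definition flat :: "real poly \<Rightarrow> real \<Rightarrow> real" where
  "flat p x = (if x > 0 then poly p (inverse x) * exp (- inverse x) else 0)"

lemma poly_exp_tendsto_0: "((\<lambda>x. poly p x * exp (- x)) \<longlongrightarrow> 0) at_top" for p :: "real poly"
proof -
  have "((\<lambda>x. \<Sum>i\<le>degree p. coeff p i * (x ^ i / exp x)) \<longlongrightarrow> (\<Sum>i\<le>degree p. coeff p i * 0)) at_top"
    by (intro tendsto_sum tendsto_mult tendsto_const tendsto_power_div_exp_0)
  then show ?thesis
    by (simp add: poly_altdef exp_minus sum_distrib_right divide_inverse mult.assoc)
qed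

text \<open>The polynomial in 1/x makes the family closed under differentiation: the chain rule
  contributes the square of 1/x, the exponential contributes \<open>p\<close> and the polynomial
  contributes \<open>- pderiv p\<close>.\<close>

lemma DERIV_flat: "(flat p has_field_derivative flat (monom 1 2 * (p - pderiv p)) x) (at x)"
proof -
  let ?g = "\<lambda>x. poly p (inverse x) * exp (- inverse x)"
  consider "x > 0" | "x < 0" | "x = 0" by linarith
  then show ?thesis
  proof cases
    case 1
    have "(?g has_field_derivative flat (monom 1 2 * (p - pderiv p)) x) (at x)"
      using 1 by (auto intro!: derivative_eq_intros DERIV_chain2[OF poly_DERIV]
          simp: flat_def poly_monom power2_eq_square algebra_simps divide_inverse)
    then show ?thesis
      using 1 by (subst DERIV_cong_ev[OF refl _ refl, where g = ?g])
        (auto simp: flat_def eventually_nhds intro!: exI[of _ "{0<..}"])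
  next
    case 2
    then show ?thesis
      by (subst DERIV_cong_ev[OF refl _ refl, where g = "\<lambda>_. 0"])
        (auto simp: flat_def eventually_nhds intro!: exI[of _ "{..<0}"])
  next
    case 3
    \<comment> \<open>The difference quotient at 0 from the right is again of flat type, with one
      more factor 1/h in the polynomial, and the exponential beats every polynomial.\<close>
    have "((\<lambda>h. poly (monom 1 1 * p) (inverse h) * exp (- inverse h)) \<longlongrightarrow> 0) (at_right 0)"
      by (rule filterlim_compose[OF poly_exp_tendsto_0 filterlim_inverse_at_top_right])
    then have "((\<lambda>h. (flat p (0 + h) - flat p 0) / h) \<longlongrightarrow> 0) (at_right 0)"
      by (rule Lim_transform_eventually)
        (auto simp: flat_def poly_monom divide_inverse mult_ac eventually_at_filter)
    moreover have "((\<lambda>h. (flat p (0 + h) - flat p 0) / h) \<longlongrightarrow> 0) (at_left 0)"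
      by (rule tendsto_eventually) (auto simp: flat_def eventually_at_filter)
    ultimately have "((\<lambda>h. (flat p (0 + h) - flat p 0) / h) \<longlongrightarrow> 0) (at 0)"
      by (rule filterlim_split_at[rotated])
    then show ?thesis using 3 by (simp add: DERIV_def flat_def)
  qed
qed

lemma smooth_flat: "smooth (flat p)"
proof (rule smooth_coinduct)
  show "flat p \<in> range flat" by simp
  fix h assume "h \<in> range flat"
  then obtain q where h: "h = flat q" by auto
  show "h field_differentiable at x" for x
    using DERIV_flat h by (auto simp: field_differentiable_def)
  have "deriv h = flat (monom 1 2 * (q - pderiv q))"
    unfolding h using DERIV_flat by (auto intro: DERIV_imp_deriv)
  then show "deriv h \<in> range flat" by simp
qed

definition bump :: "real \<Rightarrow> real" where
  "bump x = flat 1 x * flat 1 (1 - x)"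

lemma smooth_bump: "smooth bump"
  unfolding bump_def[abs_def]
proof (rule smooth_mult[OF smooth_flat])
  have "smooth (\<lambda>x. flat 1 (1 + (- 1) * x))" by (rule smooth_affine[OF smooth_flat])
  then show "smooth (\<lambda>x. flat 1 (1 - x))" by simp
qed

lemma bump_nonneg: "bump x \<ge> 0"
  by (simp add: bump_def flat_def)

lemma bump_pos: "0 < x \<Longrightarrow> x < 1 \<Longrightarrow> bump x > 0"
  by (simp add: bump_def flat_def)

lemma bump_eq_0: "x \<le> 0 \<or> x \<ge> 1 \<Longrightarrow> bump x = 0"
  by (auto simp: bump_def flat_def)

lemma bump_primitive:
  obtains F where "\<And>x. (F has_field_derivative bump x) (at x)" "\<And>x. x \<le> 0 \<Longrightarrow> F x = 0"
    "\<And>x. x \<ge> 1 \<Longrightarrow> F x = F 1" "F 1 > 0"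
proof -
  \<comment> \<open>The lower limit -1 keeps every nonnegative point in the interior of the interval
    of integration, so the derivative at 0 is two-sided.\<close>
  define F where "F = (\<lambda>x. integral {- 1..x} bump)"
  have F0: "F x = 0" if "x \<le> 0" for x
  proof -
    have "integral {- 1..x} bump = integral {- 1..x} (\<lambda>_. 0)"
      using that by (intro Henstock_Kurzweil_Integration.integral_cong) (auto simp: bump_eq_0)
    then show ?thesis by (simp add: F_def)
  qed
  have der: "(F has_field_derivative bump x) (at x)" for x
  proof (cases "x < 0")
    case True
    have "((\<lambda>_. 0) has_field_derivative bump x) (at x)" using True by (simp add: bump_eq_0)
    moreover have "\<forall>\<^sub>F y in nhds x. F y = 0"
      unfolding eventually_nhds using True F0 by (intro exI[of _ "{..<0}"]) auto
    ultimately show ?thesis by (subst DERIV_cong_ev[OF refl _ refl])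
  next
    case False
    have "(F has_real_derivative bump x) (at x within {- 1..x + 1})"
      unfolding F_def by (rule integral_has_real_derivative[OF smooth_continuous[OF smooth_bump]]) (use False in simp)
    moreover have "at x within {- 1..x + 1} = at x"
      by (rule at_within_interior) (use False in simp)
    ultimately show ?thesis by (simp only:)
  qed
  have F1: "F x = F 1" if "x \<ge> 1" for x
  proof (cases "x = 1")
    case False
    show ?thesis
    proof (rule DERIV_isconst_end[of 1 x F])
      show "1 < x" using that False by simp
      show "continuous_on {1..x} F" using der by (meson DERIV_isCont continuous_at_imp_continuous_on)
      show "DERIV F y :> 0" if "1 < y" "y < x" for y using der[of y] that by (simp add: bump_eq_0)
    qed
  qed simp
  have "F 0 < F 1"
  proof (rule DERIV_pos_imp_increasing_open[of 0 1 F])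
    show "\<exists>y. DERIV F x :> y \<and> 0 < y" if "0 < x" "x < 1" for x
      using der[of x] bump_pos[OF that] by blast
    show "continuous_on {0..1} F" using der by (meson DERIV_isCont continuous_at_imp_continuous_on)
  qed simp
  then have "F 1 > 0" by (simp add: F0)
  then show ?thesis using that[OF der F0 F1] by blast
qed

section \<open>Membership in the class of test functions\<close>

lemma test_functionsI:
  assumes "smooth \<xi>" "\<And>t. \<xi> t \<noteq> 0 \<Longrightarrow> a \<le> t \<and> t \<le> b" "0 < a" "b < T"
  shows "\<xi> \<in> test_functions T"
proof -
  have "closure {r. \<xi> r \<noteq> 0} \<subseteq> {a..b}"
    using assms(2) by (intro closure_minimal) auto
  moreover have "{a..b} \<subseteq> {0<..<T}" using assms(3,4) by auto
  ultimately show ?thesis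
    using assms(1) by (simp add: test_functions_def smooth_def)
qed

lemma test_functionsD:
  assumes "\<xi> \<in> test_functions T"
  shows "smooth \<xi>" "t \<le> 0 \<Longrightarrow> \<xi> t = 0" "t \<ge> T \<Longrightarrow> \<xi> t = 0"
proof -
  have "{r. \<xi> r \<noteq> 0} \<subseteq> closure {r. \<xi> r \<noteq> 0}" by (rule closure_subset)
  also have "\<dots> \<subseteq> {0<..<T}" using assms by (simp add: test_functions_def)
  finally have "{r. \<xi> r \<noteq> 0} \<subseteq> {0<..<T}" .
  then show "t \<le> 0 \<Longrightarrow> \<xi> t = 0" "t \<ge> T \<Longrightarrow> \<xi> t = 0" by force+
  show "smooth \<xi>" using assms by (simp add: test_functions_def smooth_def)
qed

lemma test_functions_mult_exp:
  assumes "\<xi> \<in> test_functions T"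
  shows "(\<lambda>t. exp (c * t) * \<xi> t) \<in> test_functions T"
proof -
  have "smooth (\<lambda>t. exp (c * t) * \<xi> t)"
    using assms by (intro smooth_mult smooth_exp test_functionsD)
  moreover have "{r. exp (c * r) * \<xi> r \<noteq> 0} = {r. \<xi> r \<noteq> 0}" by simp
  ultimately show ?thesis using assms by (simp add: test_functions_def smooth_def)
qed

lemma integral_lebesgue_on_FTC:
  fixes F f :: "real \<Rightarrow> real"
  assumes "a \<le> b" "\<And>x. (F has_field_derivative f x) (at x)" "continuous_on {a..b} f"
  shows "(LINT x|lebesgue_on {a..b}. f x) = F b - F a"
proof -
  have "(LINT x|lebesgue_on {a..b}. f x) = integral {a..b} f"
    using assms by (intro lebesgue_integral_eq_integral continuous_imp_integrable_real) auto
  also have "\<dots> = F b - F a"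
    using assms by (intro integral_unique fundamental_theorem_of_calculus)
      (auto simp flip: has_real_derivative_iff_has_vector_derivative intro: has_field_derivative_at_within)
  finally show ?thesis .
qed

text \<open>To compare \<open>Y\<close> at two points, take as test function the primitive of the
  difference of two equal bumps placed just to the right of them. The difference has total mass 0,
  so the primitive has compact support, and the hypothesis says that the two local averages of
  \<open>Y\<close> agree. Continuity turns averages into values, and it also carries the constant to
  the end point 0, where \<open>Y\<close> vanishes.\<close>

lemma du_Bois_Reymond:
  fixes Y :: "real \<Rightarrow> real"
  assumes T: "T > 0" and cont: "continuous_on {0..T} Y" and Y0: "Y 0 = 0"
    and test: "\<And>\<xi>. \<xi> \<in> test_functions T \<Longrightarrow> (LINT r|lebesgue_on {0..T}. Y r * deriv \<xi> r) = 0"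
    and t: "t \<in> {0..T}"
  shows "Y t = 0"
proof -
  obtain F where F: "\<And>x. (F has_field_derivative bump x) (at x)" "\<And>x. x \<le> 0 \<Longrightarrow> F x = 0"
    "\<And>x. x \<ge> 1 \<Longrightarrow> F x = F 1" "F 1 > 0"
    using bump_primitive by blast
  have eq: "Y a = Y b" if ab: "0 < a" "a < b" "b < T" for a b
  proof (rule ccontr)
    assume neq: "Y a \<noteq> Y b"
    \<comment> \<open>One third of the gap: the two averages differ from the two values by at most
      \<open>m\<close> each, which leaves 3m \<le> 2m.\<close>
    define m where "m = \<bar>Y a - Y b\<bar> / 3"
    have m: "m > 0" using neq by (simp add: m_def)
    have cd: "\<exists>d>0. \<forall>s\<in>{0..T}. \<bar>s - c\<bar> < d \<longrightarrow> \<bar>Y s - Y c\<bar> < m" if "c \<in> {0..T}" for c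
      using cont m that unfolding continuous_on_iff dist_real_def by blast
    obtain d1 where d1: "d1 > 0" "\<And>s. s \<in> {0..T} \<Longrightarrow> \<bar>s - a\<bar> < d1 \<Longrightarrow> \<bar>Y s - Y a\<bar> < m"
      using cd[of a] ab by auto
    obtain d2 where d2: "d2 > 0" "\<And>s. s \<in> {0..T} \<Longrightarrow> \<bar>s - b\<bar> < d2 \<Longrightarrow> \<bar>Y s - Y b\<bar> < m"
      using cd[of b] ab by auto
    \<comment> \<open>The common width of both bumps: within the moduli of continuity at
      \<open>a\<close> and \<open>b\<close>, and small enough that the right bump ends before
      \<open>T\<close>.\<close>
    define \<delta> where "\<delta> = min (min d1 d2) (T - b) / 2"
    have \<delta>: "\<delta> > 0" "\<delta> < d1" "\<delta> < d2" "b + \<delta> < T" using d1(1) d2(1) ab by (auto simp: \<delta>_def min_def field_simps)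
    define \<eta> where "\<eta> = (\<lambda>c t. bump (- c / \<delta> + (1 / \<delta>) * t))"
    have sm: "smooth (\<eta> c)" for c unfolding \<eta>_def by (rule smooth_affine[OF smooth_bump])
    have arg: "- c / \<delta> + (1 / \<delta>) * t = (t - c) / \<delta>" for c t by (simp add: diff_divide_distrib)
    have \<eta>0: "\<eta> c t = 0" if "t \<le> c \<or> t \<ge> c + \<delta>" for c t
      unfolding \<eta>_def arg using that \<delta>(1) by (intro bump_eq_0) (auto simp: field_simps)
    have \<eta>nn: "\<eta> c t \<ge> 0" for c t by (simp add: \<eta>_def bump_nonneg)
    define G where "G = (\<lambda>c t. \<delta> * F (- c / \<delta> + (1 / \<delta>) * t))"
    have G: "(G c has_field_derivative \<eta> c t) (at t)" for c t
    proof -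
      have "((\<lambda>t. F (- c / \<delta> + (1 / \<delta>) * t)) has_field_derivative bump (- c / \<delta> + (1 / \<delta>) * t) * (1 / \<delta>)) (at t)"
        by (rule DERIV_chain2[OF F(1)]) (use \<delta>(1) in \<open>auto intro!: derivative_eq_intros\<close>)
      from DERIV_cmult[OF this, of \<delta>] show ?thesis
        using less_imp_neq[OF \<delta>(1), symmetric] by (simp add: G_def \<eta>_def)
    qed
    have G0: "G c t = 0" if "t \<le> c" for c t
      unfolding G_def arg using that \<delta>(1) by (subst F(2)) (auto simp: field_simps)
    have G1: "G c t = \<delta> * F 1" if "t \<ge> c + \<delta>" for c t
      unfolding G_def arg using that \<delta>(1) by (subst F(3)) (auto simp: field_simps)
    have smG: "smooth (G c)" for c by (rule smooth_primitive[OF G sm])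
    define \<xi> where "\<xi> = (\<lambda>t. G a t - G b t)"
    have "\<xi> \<in> test_functions T"
    proof (rule test_functionsI[where a = a and b = "b + \<delta>"])
      show "smooth \<xi>" unfolding \<xi>_def by (intro smooth_diff smG)
      show "a \<le> t \<and> t \<le> b + \<delta>" if "\<xi> t \<noteq> 0" for t
        using that G0[of t a] G0[of t b] G1[of a t] G1[of b t] ab \<delta> by (force simp: \<xi>_def)
    qed (use ab \<delta> in auto)
    moreover have "deriv \<xi> = (\<lambda>t. \<eta> a t - \<eta> b t)"
      unfolding \<xi>_def by (intro ext DERIV_imp_deriv DERIV_diff G)
    ultimately have test0: "(LINT r|lebesgue_on {0..T}. Y r * (\<eta> a r - \<eta> b r)) = 0"
      using test by metis
    have N: "(LINT r|lebesgue_on {0..T}. \<eta> c r) = \<delta> * F 1" if "c = a \<or> c = b" for c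
    proof -
      have "(LINT r|lebesgue_on {0..T}. \<eta> c r) = G c T - G c 0"
        using T by (intro integral_lebesgue_on_FTC G smooth_continuous sm) auto
      then show ?thesis using that ab \<delta> G0[of 0 c] G1[of c T] by auto
    qed
    have int: "integrable (lebesgue_on {0..T}) (\<lambda>r. Y r * \<eta> c r)" "integrable (lebesgue_on {0..T}) (\<eta> c)"
      "integrable (lebesgue_on {0..T}) (\<lambda>r. (Y r - Y c) * \<eta> c r)" for c
      by (intro continuous_imp_integrable_real continuous_intros cont smooth_continuous sm)+
    have est: "\<bar>(LINT r|lebesgue_on {0..T}. Y r * \<eta> c r) - Y c * (\<delta> * F 1)\<bar> \<le> m * (\<delta> * F 1)"
      if c: "c = a \<or> c = b" for c
    proof -
      have "(LINT r|lebesgue_on {0..T}. Y r * \<eta> c r) - Y c * (\<delta> * F 1) = (LINT r|lebesgue_on {0..T}. (Y r - Y c) * \<eta> c r)"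
        using int[of c] N[OF c] by (simp add: left_diff_distrib)
      also have "\<bar>\<dots>\<bar> \<le> (LINT r|lebesgue_on {0..T}. m * \<eta> c r)"
        unfolding real_norm_def[symmetric]
      proof (rule Bochner_Integration.integral_norm_bound_integral)
        fix r assume r: "r \<in> space (lebesgue_on {0..T})"
        show "norm ((Y r - Y c) * \<eta> c r) \<le> m * \<eta> c r"
        proof (cases "\<eta> c r = 0")
          case False
          then have "c < r" "r < c + \<delta>" using \<eta>0[of r c] by force+
          then have "\<bar>Y r - Y c\<bar> < m" using c r d1(2)[of r] d2(2)[of r] \<delta> by auto
          then show ?thesis using \<eta>nn[of c r] by (simp add: abs_mult mult_right_mono)
        qed simp
      qed (use int in auto)
      also have "\<dots> = m * (\<delta> * F 1)" using N[OF c] by simp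
      finally show ?thesis .
    qed
    have "(LINT r|lebesgue_on {0..T}. Y r * \<eta> a r) = (LINT r|lebesgue_on {0..T}. Y r * \<eta> b r)"
      using test0 int by (simp add: right_diff_distrib)
    then have "\<bar>Y a * (\<delta> * F 1) - Y b * (\<delta> * F 1)\<bar> \<le> 2 * m * (\<delta> * F 1)"
      using est[of a] est[of b] by simp
    then have "\<bar>Y a - Y b\<bar> * (\<delta> * F 1) \<le> 2 * m * (\<delta> * F 1)"
      using \<delta>(1) F(4) by (simp add: abs_mult flip: left_diff_distrib)
    then have "\<bar>Y a - Y b\<bar> \<le> 2 * m" using \<delta>(1) F(4) by (simp add: mult_le_cancel_right)
    then show False using m by (simp add: m_def)
  qed
  have const: "Y s = Y (T / 2)" if "s \<in> {0<..<T}" for s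
  proof (cases s "T / 2" rule: linorder_cases)
    case less
    then show ?thesis using that T by (intro eq) auto
  next
    case greater
    then show ?thesis using that T by (intro eq[symmetric]) auto
  next
    case equal
    then show ?thesis by (rule arg_cong)
  qed
  have cl: "closure {0<..<T} = {0..T}" using T by simp
  have "Y s = Y (T / 2)" if "s \<in> {0..T}" for s
  proof (rule continuous_constant_on_closure[of "{0<..<T}" Y "Y (T / 2)" s])
    show "continuous_on (closure {0<..<T}) Y" "s \<in> closure {0<..<T}" using cont that by (simp_all only: cl)
  qed (rule const)
  from this[of 0] this[of t] show ?thesis using Y0 t T by simp
qed

section \<open>Weak and mild forms of the scalar equation\<close>

lemma integral_by_parts_test:
  assumes T: "T > 0" and p: "integrable (lebesgue_on {0..T}) p" and \<xi>: "\<xi> \<in> test_functions T"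
  shows "(LINT t|lebesgue_on {0..T}. (LINT s|lebesgue_on {0..t}. p s) * deriv \<xi> t) = - (LINT t|lebesgue_on {0..T}. p t * \<xi> t)"
proof -
  have sm: "smooth \<xi>" using test_functionsD[OF \<xi>] by simp
  have q: "integrable (lebesgue_on {0..T}) (deriv \<xi>)"
    by (intro continuous_imp_integrable_real smooth_continuous smooth_deriv sm)
  have Q: "(LINT s|lebesgue_on {0..t}. deriv \<xi> s) = \<xi> t" if "t \<in> {0..T}" for t
    using integral_lebesgue_on_FTC[of 0 t \<xi> "deriv \<xi>"] that smooth_DERIV[OF sm]
      smooth_continuous[OF smooth_deriv[OF sm]] test_functionsD(2)[OF \<xi>, of 0] by auto
  have "(LINT t|lebesgue_on {0..T}. p t * (LINT s|lebesgue_on {0..t}. deriv \<xi> s)) = (LINT t|lebesgue_on {0..T}. p t * \<xi> t)"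
    using Q by (intro Bochner_Integration.integral_cong) auto
  then show ?thesis
    using integral_product_rule(3)[OF p q] Q[of T] test_functionsD(3)[OF \<xi>, of T] T by simp
qed

text \<open>Integrating factor: for \<open>\<xi>\<close> equal to exp(-ct) times
  \<open>\<psi>\<close>, the combination of \<open>deriv \<psi>\<close> and \<open>\<psi>\<close> in
  the claim is exp(ct) times \<open>deriv \<xi>\<close>. The exponentials cancel against the mild
  formula, and integration by parts against a plain primitive remains.\<close>

lemma mild_imp_weak:
  fixes y g :: "real \<Rightarrow> real"
  assumes T: "T > 0" and g: "integrable (lebesgue_on {0..T}) g"
    and y: "\<And>t. t \<in> {0..T} \<Longrightarrow> y t = exp (- (c * t)) * y0 + duhamel c g t"
    and \<psi>: "\<psi> \<in> test_functions T"
  shows "(LINT t|lebesgue_on {0..T}. y t * deriv \<psi> t) = c * (LINT t|lebesgue_on {0..T}. y t * \<psi> t) - (LINT t|lebesgue_on {0..T}. g t * \<psi> t)"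
proof -
  let ?M = "lebesgue_on {0..T}"
  define \<xi> where "\<xi> = (\<lambda>t. exp (- c * t) * \<psi> t)"
  have \<xi>: "\<xi> \<in> test_functions T" unfolding \<xi>_def by (rule test_functions_mult_exp[OF \<psi>])
  have sm: "smooth \<psi>" "smooth \<xi>" using test_functionsD \<psi> \<xi> by blast+
  define P where "P = (\<lambda>t. LINT s|lebesgue_on {0..t}. exp (c * s) * g s)"
  have eg: "integrable ?M (\<lambda>s. exp (c * s) * g s)"
    using integrable_exp_scaleR[OF g, of c 0] by simp
  have yP: "y t = exp (- (c * t)) * (y0 + P t)" if "t \<in> {0..T}" for t
    using y[OF that] by (simp add: duhamel_eq_exp P_def algebra_simps)
  have der: "deriv \<xi> t = exp (- c * t) * deriv \<psi> t - c * (exp (- c * t) * \<psi> t)" for t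
    unfolding \<xi>_def by (intro DERIV_imp_deriv) (auto intro!: derivative_eq_intros smooth_DERIV sm)
  have Pc: "continuous_on {0..T} P"
    unfolding P_def by (rule continuous_on_indefinite_integral[OF eg])
  have int: "integrable ?M (\<lambda>t. y t * deriv \<psi> t)" "integrable ?M (\<lambda>t. y t * \<psi> t)"
  proof -
    have "integrable ?M (\<lambda>t. exp (- (c * t)) * (y0 + P t) * deriv \<psi> t)" "integrable ?M (\<lambda>t. exp (- (c * t)) * (y0 + P t) * \<psi> t)"
      by (intro continuous_imp_integrable_real continuous_intros Pc smooth_continuous smooth_deriv sm)+
    note i = this
    show "integrable ?M (\<lambda>t. y t * deriv \<psi> t)"
      by (rule iffD1[OF Bochner_Integration.integrable_cong[OF refl] i(1)]) (simp add: yP)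
    show "integrable ?M (\<lambda>t. y t * \<psi> t)"
      by (rule iffD1[OF Bochner_Integration.integrable_cong[OF refl] i(2)]) (simp add: yP)
  qed
  have "(LINT t|?M. y t * deriv \<psi> t) - c * (LINT t|?M. y t * \<psi> t) = (LINT t|?M. y t * deriv \<psi> t - c * (y t * \<psi> t))"
    using int by simp
  also have "\<dots> = (LINT t|?M. y0 * deriv \<xi> t + P t * deriv \<xi> t)"
    by (intro Bochner_Integration.integral_cong) (auto simp: yP der algebra_simps)
  also have "\<dots> = y0 * (LINT t|?M. deriv \<xi> t) + (LINT t|?M. P t * deriv \<xi> t)"
  proof -
    have "integrable ?M (deriv \<xi>)" "integrable ?M (\<lambda>t. P t * deriv \<xi> t)"
      by (intro continuous_imp_integrable_real continuous_intros Pc smooth_continuous smooth_deriv sm)+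
    then show ?thesis by simp
  qed
  also have "(LINT t|?M. deriv \<xi> t) = 0"
    using integral_lebesgue_on_FTC[of 0 T \<xi> "deriv \<xi>"] T smooth_DERIV[OF sm(2)]
      smooth_continuous[OF smooth_deriv[OF sm(2)]] test_functionsD(2)[OF \<xi>, of 0] test_functionsD(3)[OF \<xi>, of T] by simp
  also have "(LINT t|?M. P t * deriv \<xi> t) = - (LINT t|?M. exp (c * t) * g t * \<xi> t)"
    unfolding P_def by (rule integral_by_parts_test[OF T eg \<xi>])
  also have "(LINT t|?M. exp (c * t) * g t * \<xi> t) = (LINT t|?M. g t * \<psi> t)"
    by (intro Bochner_Integration.integral_cong) (auto simp: \<xi>_def exp_minus)
  finally show ?thesis by simp
qed

text \<open>The same integrating factor in the opposite direction: the function \<open>Y\<close>,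
  which is exp(ct) y minus its expected value, is annihilated by derivatives of test functions and
  starts at 0, so it vanishes identically.\<close>

lemma weak_imp_mild:
  fixes y g :: "real \<Rightarrow> real"
  assumes T: "T > 0" and y: "continuous_on {0..T} y" and g: "integrable (lebesgue_on {0..T}) g"
    and weak: "\<And>\<psi>. \<psi> \<in> test_functions T \<Longrightarrow>
      (LINT t|lebesgue_on {0..T}. y t * deriv \<psi> t) = c * (LINT t|lebesgue_on {0..T}. y t * \<psi> t) - (LINT t|lebesgue_on {0..T}. g t * \<psi> t)"
    and t: "t \<in> {0..T}"
  shows "y t = exp (- (c * t)) * y 0 + duhamel c g t"
proof -
  let ?M = "lebesgue_on {0..T}"
  define P where "P = (\<lambda>t. LINT s|lebesgue_on {0..t}. exp (c * s) * g s)"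
  have eg: "integrable ?M (\<lambda>s. exp (c * s) * g s)"
    using integrable_exp_scaleR[OF g, of c 0] by simp
  have Pc: "continuous_on {0..T} P"
    unfolding P_def by (rule continuous_on_indefinite_integral[OF eg])
  define Y where "Y = (\<lambda>t. exp (c * t) * y t - y 0 - P t)"
  have "Y t = 0"
  proof (rule du_Bois_Reymond[OF T _ _ _ t])
    show "continuous_on {0..T} Y" unfolding Y_def by (intro continuous_intros y Pc)
    have "P 0 = 0"
    proof -
      have "(LINT s|lebesgue_on {0..0 :: real}. exp (c * s) * g s) = integral {0..0} (\<lambda>s. exp (c * s) * g s)"
        using T by (intro lebesgue_integral_eq_integral integrable_subinterval[OF eg]) auto
      then show ?thesis by (simp add: P_def)
    qed
    then show "Y 0 = 0" by (simp add: Y_def)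
    fix \<xi> assume \<xi>: "\<xi> \<in> test_functions T"
    define \<psi> where "\<psi> = (\<lambda>t. exp (c * t) * \<xi> t)"
    have \<psi>: "\<psi> \<in> test_functions T" unfolding \<psi>_def by (rule test_functions_mult_exp[OF \<xi>])
    have sm: "smooth \<psi>" "smooth \<xi>" using test_functionsD \<psi> \<xi> by blast+
    have der: "deriv \<psi> t = exp (c * t) * deriv \<xi> t + c * \<psi> t" for t
      unfolding \<psi>_def by (intro DERIV_imp_deriv) (auto intro!: derivative_eq_intros smooth_DERIV sm)
    have int: "integrable ?M (\<lambda>t. y t * deriv \<psi> t)" "integrable ?M (\<lambda>t. y t * \<psi> t)" "integrable ?M (deriv \<xi>)"
        "integrable ?M (\<lambda>t. P t * deriv \<xi> t)" "integrable ?M (\<lambda>t. exp (c * t) * y t * deriv \<xi> t)"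
      by (intro continuous_imp_integrable_real continuous_intros Pc y smooth_continuous smooth_deriv sm)+
    have "(LINT t|?M. deriv \<xi> t) = 0"
      using integral_lebesgue_on_FTC[of 0 T \<xi> "deriv \<xi>"] T smooth_DERIV[OF sm(2)]
        smooth_continuous[OF smooth_deriv[OF sm(2)]] test_functionsD(2)[OF \<xi>, of 0] test_functionsD(3)[OF \<xi>, of T] by simp
    moreover have "(LINT t|?M. exp (c * t) * y t * deriv \<xi> t) = - (LINT t|?M. g t * \<psi> t)"
    proof -
      have "(LINT t|?M. exp (c * t) * y t * deriv \<xi> t) = (LINT t|?M. y t * deriv \<psi> t - c * (y t * \<psi> t))"
        by (intro Bochner_Integration.integral_cong) (auto simp: der algebra_simps)
      also have "\<dots> = (LINT t|?M. y t * deriv \<psi> t) - c * (LINT t|?M. y t * \<psi> t)"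
        using int by simp
      finally show ?thesis using weak[OF \<psi>] by simp
    qed
    moreover have "(LINT t|?M. P t * deriv \<xi> t) = - (LINT t|?M. g t * \<psi> t)"
      unfolding P_def integral_by_parts_test[OF T eg \<xi>] by (simp add: \<psi>_def mult_ac)
    ultimately show "(LINT r|?M. Y r * deriv \<xi> r) = 0"
      using int by (simp add: Y_def left_diff_distrib)
  qed
  then have "exp (c * t) * y t = y 0 + P t" by (simp add: Y_def)
  then have "exp (- (c * t)) * (exp (c * t) * y t) = exp (- (c * t)) * (y 0 + P t)" by simp
  then show ?thesis
    by (simp add: duhamel_eq_exp P_def distrib_left mult_exp_exp flip: mult.assoc)
qed

section \<open>The Stokes semigroup\<close>

definition duh :: "real \<Rightarrow> real \<Rightarrow> (real \<Rightarrow> coeffs) \<Rightarrow> real \<Rightarrow> coeffs" where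
  "duh L \<nu> H t k = duhamel (\<nu> * (norm (wave L k))\<^sup>2) (\<lambda>s. H s k) t"

definition heat :: "real \<Rightarrow> real \<Rightarrow> coeffs \<Rightarrow> real \<Rightarrow> coeffs" where
  "heat L \<nu> u0 t k = exp (- (\<nu> * (norm (wave L k))\<^sup>2 * t)) *\<^sub>R u0 k"

definition modes_measurable :: "real set \<Rightarrow> (real \<Rightarrow> coeffs) \<Rightarrow> bool" where
  "modes_measurable S u \<longleftrightarrow> (\<forall>k. (\<lambda>t. u t k) \<in> borel_measurable (lebesgue_on S))"

lemma modes_measurable_mono: "modes_measurable S u \<Longrightarrow> T \<subseteq> S \<Longrightarrow> modes_measurable T u"
  unfolding modes_measurable_def using lebesgue_on_measurable_mono by blast

lemma modes_measurable_diff: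
  "modes_measurable S u \<Longrightarrow> modes_measurable S v \<Longrightarrow> modes_measurable S (\<lambda>t k. u t k - v t k)"
  unfolding modes_measurable_def by (simp add: borel_measurable_diff)

lemma modes_measurable_Bhat:
  "modes_measurable S w \<Longrightarrow> modes_measurable S u \<Longrightarrow> modes_measurable S (\<lambda>t. Bhat L (w t) (u t))"
  unfolding modes_measurable_def by (simp add: borel_measurable_Bhat)

lemma measurable_energy:
  "modes_measurable S u \<Longrightarrow> (\<lambda>t. energy L s (u t)) \<in> borel_measurable (lebesgue_on S)"
  unfolding modes_measurable_def by (intro borel_measurable_energy) auto

lemma energy_eq_0_iff:
  assumes "L > 0"
  shows "energy L s u = 0 \<longleftrightarrow> (\<forall>k. k \<noteq> 0 \<longrightarrow> u k = 0)"
proof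
  assume "energy L s u = 0"
  then have "ennreal ((norm (wave L k) powr s * norm (u k))\<^sup>2) = 0" for k
    using norm_coeff_le_energy[of L k s u] by simp
  then have "norm (wave L k) powr s * norm (u k) = 0" for k
    by (simp add: ennreal_eq_0_iff)
  then show "\<forall>k. k \<noteq> 0 \<longrightarrow> u k = 0"
    using wave_eq_0_iff[OF assms] by auto
next
  assume *: "\<forall>k. k \<noteq> 0 \<longrightarrow> u k = 0"
  have "energy L s u = energy L s (\<lambda>k. 0)"
    by (rule energy_cong) (use * in simp)
  then show "energy L s u = 0" by simp
qed

lemma powr_sq_shift:
  fixes r \<nu> s :: real
  assumes "r > 0" "\<nu> > 0"
  shows "(r powr s)\<^sup>2 * (1 / (\<nu> * r\<^sup>2)) = (1 / \<nu>) * (r powr (s - 1))\<^sup>2"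
proof -
  have "r powr s = r powr (s - 1) * r"
    using assms by (simp add: powr_diff)
  then show ?thesis using assms by (simp add: power_mult_distrib field_simps)
qed

section \<open>Smoothing estimates for the Duhamel integral and the heat flow\<close>

lemma energy_duh_le:
  assumes L: "L > 0" and \<nu>: "\<nu> > 0" and t: "t \<ge> 0" and H: "modes_measurable {0..t} H"
  shows "energy L s (duh L \<nu> H t) \<le> ennreal (1 / \<nu>) * (\<integral>\<^sup>+r. energy L (s - 1) (H r) \<partial>lebesgue_on {0..t})"
proof -
  have [measurable]: "(\<lambda>r. H r k) \<in> borel_measurable (lebesgue_on {0..t})" for k
    using H by (simp add: modes_measurable_def)
  have "energy L s (duh L \<nu> H t)
      \<le> (\<integral>\<^sup>+k. ennreal (1 / \<nu>) * (\<integral>\<^sup>+r. ennreal ((norm (wave L k) powr (s - 1) * norm (H r k))\<^sup>2) \<partial>lebesgue_on {0..t}) \<partial>count_space UNIV)"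
    unfolding energy_def
  proof (rule nn_integral_mono)
    fix k :: "int ^ 3"
    show "ennreal ((norm (wave L k) powr s * norm (duh L \<nu> H t k))\<^sup>2)
      \<le> ennreal (1 / \<nu>) * (\<integral>\<^sup>+r. ennreal ((norm (wave L k) powr (s - 1) * norm (H r k))\<^sup>2) \<partial>lebesgue_on {0..t})"
    proof (cases "k = 0")
      case False
      define r where "r = norm (wave L k)"
      have r: "r > 0" using norm_wave_pos[OF L False] by (simp add: r_def)
      let ?I = "\<integral>\<^sup>+r. ennreal ((norm (H r k))\<^sup>2) \<partial>lebesgue_on {0..t}"
      have "ennreal ((norm (duh L \<nu> H t k))\<^sup>2) \<le> ennreal (1 / (\<nu> * r\<^sup>2)) * ?I"
        unfolding duh_def r_def[symmetric] using \<nu> r t by (intro duhamel_sq_le_simple) auto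
      then have "ennreal ((r powr s)\<^sup>2) * ennreal ((norm (duh L \<nu> H t k))\<^sup>2) \<le> ennreal ((r powr s)\<^sup>2) * (ennreal (1 / (\<nu> * r\<^sup>2)) * ?I)"
        by (rule mult_left_mono) simp
      also have "\<dots> = ennreal ((r powr s)\<^sup>2 * (1 / (\<nu> * r\<^sup>2))) * ?I"
        using \<nu> by (subst ennreal_mult) (auto simp: mult.assoc)
      also have "\<dots> = ennreal (1 / \<nu>) * (ennreal ((r powr (s - 1))\<^sup>2) * ?I)"
        unfolding powr_sq_shift[OF r \<nu>] using \<nu> by (subst ennreal_mult) (auto simp: mult.assoc)
      also have "ennreal ((r powr (s - 1))\<^sup>2) * ?I = (\<integral>\<^sup>+q. ennreal ((r powr (s - 1) * norm (H q k))\<^sup>2) \<partial>lebesgue_on {0..t})"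
        by (subst nn_integral_cmult[symmetric]) (auto simp: power_mult_distrib ennreal_mult)
      finally show ?thesis
        by (simp add: power_mult_distrib ennreal_mult r_def)
    qed simp
  qed
  also have "\<dots> = ennreal (1 / \<nu>) * (\<integral>\<^sup>+r. energy L (s - 1) (H r) \<partial>lebesgue_on {0..t})"
    unfolding energy_def by (simp add: nn_integral_cmult nn_integral_count_space_nn_integral)
  finally show ?thesis .
qed

text \<open>Here the scalar bound provides 1/c squared, the fourth inverse power of the wave number,
  which lowers the exponent of the weight from s + 1 to s - 1.\<close>

lemma energy_duh_L2_le:
  assumes L: "L > 0" and \<nu>: "\<nu> > 0" and H: "modes_measurable {0..T} H"
    and D: "modes_measurable {0..T} (duh L \<nu> H)"
  shows "(\<integral>\<^sup>+t. energy L (s + 1) (duh L \<nu> H t) \<partial>lebesgue_on {0..T})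
    \<le> ennreal (1 / \<nu>\<^sup>2) * (\<integral>\<^sup>+r. energy L (s - 1) (H r) \<partial>lebesgue_on {0..T})"
proof -
  have [measurable]: "(\<lambda>r. H r k) \<in> borel_measurable (lebesgue_on {0..T})" "(\<lambda>r. duh L \<nu> H r k) \<in> borel_measurable (lebesgue_on {0..T})" for k
    using H D by (simp_all add: modes_measurable_def)
  have "(\<integral>\<^sup>+t. energy L (s + 1) (duh L \<nu> H t) \<partial>lebesgue_on {0..T})
      = (\<integral>\<^sup>+k. (\<integral>\<^sup>+t. ennreal ((norm (wave L k) powr (s + 1) * norm (duh L \<nu> H t k))\<^sup>2) \<partial>lebesgue_on {0..T}) \<partial>count_space UNIV)"
    unfolding energy_def by (simp add: nn_integral_count_space_nn_integral)
  also have "\<dots> \<le> (\<integral>\<^sup>+k. ennreal (1 / \<nu>\<^sup>2) * (\<integral>\<^sup>+r. ennreal ((norm (wave L k) powr (s - 1) * norm (H r k))\<^sup>2) \<partial>lebesgue_on {0..T}) \<partial>count_space UNIV)"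
  proof (rule nn_integral_mono)
    fix k :: "int ^ 3"
    show "(\<integral>\<^sup>+t. ennreal ((norm (wave L k) powr (s + 1) * norm (duh L \<nu> H t k))\<^sup>2) \<partial>lebesgue_on {0..T})
      \<le> ennreal (1 / \<nu>\<^sup>2) * (\<integral>\<^sup>+r. ennreal ((norm (wave L k) powr (s - 1) * norm (H r k))\<^sup>2) \<partial>lebesgue_on {0..T})"
    proof (cases "k = 0")
      case False
      define r where "r = norm (wave L k)"
      have r: "r > 0" using norm_wave_pos[OF L False] by (simp add: r_def)
      let ?I = "\<integral>\<^sup>+r. ennreal ((norm (H r k))\<^sup>2) \<partial>lebesgue_on {0..T}"
      have "(\<integral>\<^sup>+t. ennreal ((r powr (s + 1) * norm (duh L \<nu> H t k))\<^sup>2) \<partial>lebesgue_on {0..T})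
          = ennreal ((r powr (s + 1))\<^sup>2) * (\<integral>\<^sup>+t. ennreal ((norm (duh L \<nu> H t k))\<^sup>2) \<partial>lebesgue_on {0..T})"
        by (subst nn_integral_cmult[symmetric]) (auto simp: power_mult_distrib ennreal_mult)
      also have "\<dots> \<le> ennreal ((r powr (s + 1))\<^sup>2) * (ennreal (1 / (\<nu> * r\<^sup>2)\<^sup>2) * ?I)"
        unfolding duh_def r_def[symmetric] using \<nu> r by (intro mult_left_mono duhamel_L2_le) auto
      also have "\<dots> = ennreal ((r powr (s + 1))\<^sup>2 * (1 / (\<nu> * r\<^sup>2)\<^sup>2)) * ?I"
        using \<nu> by (subst ennreal_mult) (auto simp: mult.assoc)
      also have "(r powr (s + 1))\<^sup>2 * (1 / (\<nu> * r\<^sup>2)\<^sup>2) = 1 / \<nu>\<^sup>2 * (r powr (s - 1))\<^sup>2"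
      proof -
        have "r powr (s + 1) = r powr (s - 1) * r\<^sup>2"
          using r by (simp add: powr_diff powr_add power2_eq_square)
        then show ?thesis using r \<nu> by (simp add: power_mult_distrib field_simps)
      qed
      also have "ennreal (1 / \<nu>\<^sup>2 * (r powr (s - 1))\<^sup>2) * ?I = ennreal (1 / \<nu>\<^sup>2) * (ennreal ((r powr (s - 1))\<^sup>2) * ?I)"
        using \<nu> by (subst ennreal_mult) (auto simp: mult.assoc)
      also have "ennreal ((r powr (s - 1))\<^sup>2) * ?I = (\<integral>\<^sup>+q. ennreal ((r powr (s - 1) * norm (H q k))\<^sup>2) \<partial>lebesgue_on {0..T})"
        by (subst nn_integral_cmult[symmetric]) (auto simp: power_mult_distrib ennreal_mult)
      finally show ?thesis by (simp add: r_def)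
    qed simp
  qed
  also have "\<dots> = ennreal (1 / \<nu>\<^sup>2) * (\<integral>\<^sup>+r. energy L (s - 1) (H r) \<partial>lebesgue_on {0..T})"
    unfolding energy_def by (simp add: nn_integral_cmult nn_integral_count_space_nn_integral)
  finally show ?thesis .
qed

lemma norm_heat_le: "\<nu> \<ge> 0 \<Longrightarrow> t \<ge> 0 \<Longrightarrow> norm (heat L \<nu> u0 t k) \<le> norm (u0 k)"
  by (simp add: heat_def mult_left_le_one_le)

lemma energy_heat_le: "\<nu> \<ge> 0 \<Longrightarrow> t \<ge> 0 \<Longrightarrow> energy L s (heat L \<nu> u0 t) \<le> energy L s u0"
  by (intro energy_mono norm_heat_le)

lemma continuous_on_heat: "continuous_on A (\<lambda>t. heat L \<nu> u0 t k)"
  unfolding heat_def by (intro continuous_intros)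

text \<open>The square of the heat factor integrates over time to at most half of 1 / (\<nu>
  |\<zeta>|^2), a gain of one derivative in the square mean over time.\<close>

lemma energy_heat_L2_le:
  assumes L: "L > 0" and \<nu>: "\<nu> > 0"
  shows "(\<integral>\<^sup>+t. energy L (s + 1) (heat L \<nu> u0 t) \<partial>lebesgue_on {0..T}) \<le> ennreal (1 / \<nu>) * energy L s u0"
proof -
  have [measurable]: "(\<lambda>t. heat L \<nu> u0 t k) \<in> borel_measurable (lebesgue_on {0..T})" for k
    by (intro continuous_imp_measurable_on_sets_lebesgue continuous_on_heat) auto
  have "(\<integral>\<^sup>+t. energy L (s + 1) (heat L \<nu> u0 t) \<partial>lebesgue_on {0..T})
      = (\<integral>\<^sup>+k. (\<integral>\<^sup>+t. ennreal ((norm (wave L k) powr (s + 1) * norm (heat L \<nu> u0 t k))\<^sup>2) \<partial>lebesgue_on {0..T}) \<partial>count_space UNIV)"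
    unfolding energy_def by (simp add: nn_integral_count_space_nn_integral)
  also have "\<dots> \<le> (\<integral>\<^sup>+k. ennreal (1 / \<nu>) * ennreal ((norm (wave L k) powr s * norm (u0 k))\<^sup>2) \<partial>count_space UNIV)"
  proof (rule nn_integral_mono)
    fix k :: "int ^ 3"
    show "(\<integral>\<^sup>+t. ennreal ((norm (wave L k) powr (s + 1) * norm (heat L \<nu> u0 t k))\<^sup>2) \<partial>lebesgue_on {0..T})
      \<le> ennreal (1 / \<nu>) * ennreal ((norm (wave L k) powr s * norm (u0 k))\<^sup>2)"
    proof (cases "k = 0 \<or> T < 0")
      case False
      define r where "r = norm (wave L k)"
      have r: "r > 0" using norm_wave_pos[OF L] False by (simp add: r_def)
      define a where "a = (r powr (s + 1) * norm (u0 k))\<^sup>2"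
      have "(\<integral>\<^sup>+t. ennreal ((r powr (s + 1) * norm (heat L \<nu> u0 t k))\<^sup>2) \<partial>lebesgue_on {0..T})
          = (\<integral>\<^sup>+t. ennreal a * ennreal (exp (- (2 * \<nu> * r\<^sup>2 * (t - 0)))) \<partial>lebesgue_on {0..T})"
      proof (rule nn_integral_cong)
        fix t
        have "(exp (- (\<nu> * r\<^sup>2 * t)))\<^sup>2 = exp (- (2 * \<nu> * r\<^sup>2 * (t - 0)))"
          by (simp add: power2_eq_square[of "exp _"] flip: exp_add)
        then show "ennreal ((r powr (s + 1) * norm (heat L \<nu> u0 t k))\<^sup>2) = ennreal a * ennreal (exp (- (2 * \<nu> * r\<^sup>2 * (t - 0))))"
          unfolding a_def heat_def r_def[symmetric]
          by (subst ennreal_mult[symmetric]) (auto simp: power_mult_distrib mult_ac)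
      qed
      also have "\<dots> = ennreal a * (\<integral>\<^sup>+t. ennreal (exp (- (2 * \<nu> * r\<^sup>2 * (t - 0)))) \<partial>lebesgue_on {0..T})"
        by (rule nn_integral_cmult) measurable
      also have "\<dots> \<le> ennreal a * ennreal (1 / (2 * \<nu> * r\<^sup>2))"
        using r \<nu> False by (intro mult_left_mono nn_integral_exp_decay') auto
      also have "\<dots> = ennreal (a * (1 / (2 * \<nu> * r\<^sup>2)))"
        using \<nu> by (intro ennreal_mult'[symmetric]) (simp add: a_def)
      also have "\<dots> \<le> ennreal (1 / \<nu> * (r powr s * norm (u0 k))\<^sup>2)"
      proof (rule ennreal_leI)
        have "r powr (s + 1) = r powr s * r" using r by (simp add: powr_add)
        then have "a * (1 / (2 * \<nu> * r\<^sup>2)) = (1 / (2 * \<nu>)) * (r powr s * norm (u0 k))\<^sup>2"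
          using r \<nu> by (simp add: a_def power_mult_distrib field_simps)
        also have "\<dots> \<le> 1 / \<nu> * (r powr s * norm (u0 k))\<^sup>2"
          using \<nu> by (intro mult_right_mono) (auto simp: field_simps)
        finally show "a * (1 / (2 * \<nu> * r\<^sup>2)) \<le> 1 / \<nu> * (r powr s * norm (u0 k))\<^sup>2" .
      qed
      also have "\<dots> = ennreal (1 / \<nu>) * ennreal ((r powr s * norm (u0 k))\<^sup>2)"
        using \<nu> by (intro ennreal_mult) auto
      finally show ?thesis by (simp add: r_def)
    next
      case True
      then show ?thesis
      proof
        assume "T < 0"
        then have "space (lebesgue_on {0..T}) = {}" by simp
        then show ?thesis by (simp add: nn_integral_empty)
      qed simp
    qed
  qed
  also have "\<dots> = ennreal (1 / \<nu>) * energy L s u0"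
    unfolding energy_def by (simp add: nn_integral_cmult)
  finally show ?thesis .
qed

text \<open>A square integrable energy controls every nonzero mode in L2 of time, hence in L1 on a
  bounded interval through x \<le> 1 + x^2.\<close>

lemma integrable_mode:
  assumes L: "L > 0" and H: "modes_measurable {0..T} H"
    and fin: "(\<integral>\<^sup>+r. energy L s (H r) \<partial>lebesgue_on {0..T}) < \<infinity>" and k: "k \<noteq> 0"
  shows "integrable (lebesgue_on {0..T}) (\<lambda>r. H r k)"
    and "(\<integral>\<^sup>+r. ennreal ((norm (H r k))\<^sup>2) \<partial>lebesgue_on {0..T}) < \<infinity>"
proof -
  have Hm [measurable]: "(\<lambda>r. H r k) \<in> borel_measurable (lebesgue_on {0..T})"
    using H by (simp add: modes_measurable_def)
  define r where "r = norm (wave L k)"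
  have r: "r > 0" using norm_wave_pos[OF L k] by (simp add: r_def)
  have "ennreal ((r powr s)\<^sup>2) * (\<integral>\<^sup>+q. ennreal ((norm (H q k))\<^sup>2) \<partial>lebesgue_on {0..T})
      = (\<integral>\<^sup>+q. ennreal ((r powr s * norm (H q k))\<^sup>2) \<partial>lebesgue_on {0..T})"
    by (subst nn_integral_cmult[symmetric]) (auto simp: power_mult_distrib ennreal_mult)
  also have "\<dots> \<le> (\<integral>\<^sup>+q. energy L s (H q) \<partial>lebesgue_on {0..T})"
    unfolding r_def by (intro nn_integral_mono norm_coeff_le_energy)
  also note fin
  finally show sq: "(\<integral>\<^sup>+r. ennreal ((norm (H r k))\<^sup>2) \<partial>lebesgue_on {0..T}) < \<infinity>"
    using r by (auto simp: ennreal_mult_less_top)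
  interpret finite_measure "lebesgue_on {0..T}" by (rule finite_measure_lebesgue_on_Icc)
  show "integrable (lebesgue_on {0..T}) (\<lambda>r. H r k)"
  proof (rule integrableI_bounded)
    have "(\<integral>\<^sup>+q. ennreal (norm (H q k)) \<partial>lebesgue_on {0..T}) \<le> (\<integral>\<^sup>+q. 1 + ennreal ((norm (H q k))\<^sup>2) \<partial>lebesgue_on {0..T})"
    proof (rule nn_integral_mono)
      fix q
      have "x \<le> 1 + x\<^sup>2" if "x \<ge> 0" for x :: real
        using zero_le_power2[of "x - 1"] that by (simp add: power2_eq_square algebra_simps)
      then have "ennreal (norm (H q k)) \<le> ennreal (1 + (norm (H q k))\<^sup>2)" by (intro ennreal_leI) simp
      then show "ennreal (norm (H q k)) \<le> 1 + ennreal ((norm (H q k))\<^sup>2)" by simp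
    qed
    also have "\<dots> = emeasure (lebesgue_on {0..T}) (space (lebesgue_on {0..T})) + (\<integral>\<^sup>+q. ennreal ((norm (H q k))\<^sup>2) \<partial>lebesgue_on {0..T})"
      by (subst nn_integral_add) auto
    also have "\<dots> < \<infinity>" using sq by (simp add: less_top[symmetric])
    finally show "(\<integral>\<^sup>+q. ennreal (norm (H q k)) \<partial>lebesgue_on {0..T}) < \<infinity>" .
  qed measurable
qed

section \<open>Preserved constraints and continuity in time\<close>

lemma solenoidal_heat: "solenoidal L u0 \<Longrightarrow> solenoidal L (heat L \<nu> u0 t)"
  by (auto simp: solenoidal_def heat_def vec_eq_iff wave_minus mult_scaleR_right simp flip: scaleR_sum_right)

lemma duhamel_vec_cnj:
  fixes H :: "real \<Rightarrow> complex ^ 'n"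
  shows "duhamel c (\<lambda>s. (\<chi> i. cnj (H s $ i))) t = (\<chi> i. cnj (duhamel c H t $ i))"
proof -
  have "exp x *\<^sub>R (\<chi> i. cnj (z $ i)) = (\<chi> i. cnj ((exp x *\<^sub>R z) $ i))" for x and z :: "complex ^ 'n"
    by (simp add: vec_eq_iff)
  then show ?thesis unfolding duhamel_def by (simp only: integral_vec_cnj)
qed

text \<open>Conjugation is invertible and commutes with the Bochner integral unconditionally. The
  divergence functional commutes with it only for an integrable integrand, which is the purpose of
  the first hypothesis.\<close>

lemma solenoidal_duh:
  assumes int: "\<And>k. k \<noteq> 0 \<Longrightarrow> integrable (lebesgue_on {0..t}) (\<lambda>s. H s k)"
    and sol: "\<And>s. s \<in> {0..t} \<Longrightarrow> solenoidal L (H s)"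
  shows "solenoidal L (duh L \<nu> H t)"
proof -
  have cong: "duhamel c G t = duhamel c G' t" if "\<And>s. s \<in> {0..t} \<Longrightarrow> G s = G' s" for c and G G' :: "real \<Rightarrow> complex ^ 3"
    unfolding duhamel_def by (intro Bochner_Integration.integral_cong) (auto simp: that)
  show ?thesis
    unfolding solenoidal_def
  proof (intro conjI allI)
    have "duh L \<nu> H t 0 = duhamel (\<nu> * (norm (wave L 0))\<^sup>2) (\<lambda>s. 0) t"
      unfolding duh_def using sol by (intro cong) (auto simp: solenoidal_def)
    then show z: "duh L \<nu> H t 0 = 0" by (simp add: duhamel_def)
    fix k
    have "duh L \<nu> H t (- k) = duhamel (\<nu> * (norm (wave L k))\<^sup>2) (\<lambda>s. (\<chi> i. cnj (H s k $ i))) t"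
      unfolding duh_def wave_minus norm_minus_cancel using sol by (intro cong) (auto simp: solenoidal_def)
    then show "duh L \<nu> H t (- k) = (\<chi> i. cnj (duh L \<nu> H t k $ i))"
      unfolding duhamel_vec_cnj by (simp add: duh_def)
    show "(\<Sum>i\<in>UNIV. complex_of_real (wave L k $ i) * duh L \<nu> H t k $ i) = 0"
    proof (cases "k = 0")
      case False
      let ?c = "\<nu> * (norm (wave L k))\<^sup>2"
      let ?T = "\<lambda>z :: complex ^ 3. \<Sum>i\<in>UNIV. complex_of_real (wave L k $ i) * z $ i"
      have lin: "bounded_linear ?T"
        by (intro bounded_linear_sum bounded_linear_mult_right[THEN bounded_linear_compose] bounded_linear_vec_nth)
      have "integrable (lebesgue_on {0..t}) (\<lambda>s. exp (- (?c * (t - s))) *\<^sub>R H s k)"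
        using integrable_exp_scaleR[OF int[OF False], of ?c "- ?c * t"] by (simp add: algebra_simps)
      from integral_bounded_linear[OF lin this]
      have "?T (duh L \<nu> H t k) = (LINT s|lebesgue_on {0..t}. ?T (exp (- (?c * (t - s))) *\<^sub>R H s k))"
        by (simp add: duh_def duhamel_def)
      also have "\<dots> = (LINT s|lebesgue_on {0..t}. 0)"
        using sol by (intro Bochner_Integration.integral_cong)
          (auto simp: solenoidal_def mult_scaleR_right simp flip: scaleR_sum_right)
      finally show ?thesis by simp
    qed simp
  qed
qed

lemma continuous_on_duh:
  assumes "L > 0" "modes_measurable {0..T} H" "(\<integral>\<^sup>+r. energy L s (H r) \<partial>lebesgue_on {0..T}) < \<infinity>" "k \<noteq> 0"
  shows "continuous_on {0..T} (\<lambda>t. duh L \<nu> H t k)"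
  unfolding duh_def by (rule continuous_on_duhamel) (rule integrable_mode[OF assms])

text \<open>Strong continuity in \<open>V\<^sup>s\<close>: the modes are continuous and the Duhamel bound gives a square summable
  majorant that does not depend on time.\<close>

lemma energy_mild_tendsto:
  assumes L: "L > 0" and \<nu>: "\<nu> > 0" and u0: "energy L s u0 < \<infinity>" and H: "modes_measurable {0..T} H"
    and fin: "(\<integral>\<^sup>+r. energy L (s - 1) (H r) \<partial>lebesgue_on {0..T}) < \<infinity>"
    and u: "\<And>t k. t \<in> {0..T} \<Longrightarrow> k \<noteq> 0 \<Longrightarrow> u t k = heat L \<nu> u0 t k + duh L \<nu> H t k"
    and t: "t \<in> {0..T}"
  shows "((\<lambda>r. energy L s (\<lambda>k. u r k - u t k)) \<longlongrightarrow> 0) (at t within {0..T})"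
proof -
  define I where "I = (\<lambda>k. \<integral>\<^sup>+r. ennreal ((norm (H r k))\<^sup>2) \<partial>lebesgue_on {0..T})"
  define c where "c = (\<lambda>k. ennreal (1 / (\<nu> * (norm (wave L k))\<^sup>2)) * I k)"
  have c: "c k < \<infinity>" if "k \<noteq> 0" for k
    using integrable_mode(2)[OF L H fin that] by (simp add: c_def I_def ennreal_mult_less_top)
  define D where "D = (\<lambda>k. norm (u0 k) + sqrt (enn2real (c k)))"
  have Hm [measurable]: "(\<lambda>r. H r k) \<in> borel_measurable (lebesgue_on {0..T})" for k
    using H by (simp add: modes_measurable_def)
  have le: "norm (u r k) \<le> D k" if "r \<in> {0..T}" "k \<noteq> 0" for r k
  proof -
    have "ennreal ((norm (duh L \<nu> H r k))\<^sup>2) \<le> ennreal (1 / (\<nu> * (norm (wave L k))\<^sup>2)) * (\<integral>\<^sup>+q. ennreal ((norm (H q k))\<^sup>2) \<partial>lebesgue_on {0..r})"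
      unfolding duh_def using \<nu> that norm_wave_pos[OF L that(2)]
      by (intro duhamel_sq_le_simple lebesgue_on_measurable_mono[OF Hm]) auto
    also have "\<dots> \<le> c k"
      unfolding c_def I_def using that by (intro mult_left_mono nn_integral_lebesgue_on_mono) auto
    finally have "ennreal ((norm (duh L \<nu> H r k))\<^sup>2) \<le> ennreal (enn2real (c k))"
      using c[OF that(2)] by simp
    then have "(norm (duh L \<nu> H r k))\<^sup>2 \<le> enn2real (c k)"
      by (simp add: ennreal_le_iff)
    then have "norm (duh L \<nu> H r k) \<le> sqrt (enn2real (c k))"
      using real_le_rsqrt by blast
    moreover have "norm (heat L \<nu> u0 r k) \<le> norm (u0 k)"
      using \<nu> that by (intro norm_heat_le) auto
    ultimately show ?thesis
      using u[OF that] norm_triangle_ineq[of "heat L \<nu> u0 r k" "duh L \<nu> H r k"] by (simp add: D_def)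
  qed
  have Dfin: "(\<integral>\<^sup>+k. ennreal ((norm (wave L k) powr s * D k)\<^sup>2) \<partial>count_space UNIV) < \<infinity>"
  proof -
    have "(\<integral>\<^sup>+k. ennreal ((norm (wave L k) powr s * D k)\<^sup>2) \<partial>count_space UNIV)
        \<le> (\<integral>\<^sup>+k. 2 * ennreal ((norm (wave L k) powr s * norm (u0 k))\<^sup>2)
          + 2 * (ennreal (1 / \<nu>) * (\<integral>\<^sup>+r. ennreal ((norm (wave L k) powr (s - 1) * norm (H r k))\<^sup>2) \<partial>lebesgue_on {0..T})) \<partial>count_space UNIV)"
    proof (rule nn_integral_mono)
      fix k :: "int ^ 3"
      show "ennreal ((norm (wave L k) powr s * D k)\<^sup>2) \<le> 2 * ennreal ((norm (wave L k) powr s * norm (u0 k))\<^sup>2)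
          + 2 * (ennreal (1 / \<nu>) * (\<integral>\<^sup>+r. ennreal ((norm (wave L k) powr (s - 1) * norm (H r k))\<^sup>2) \<partial>lebesgue_on {0..T}))"
      proof (cases "k = 0")
        case False
        define r where "r = norm (wave L k)"
        have r: "r > 0" using norm_wave_pos[OF L False] by (simp add: r_def)
        have "(r powr s * D k)\<^sup>2 \<le> 2 * (r powr s * norm (u0 k))\<^sup>2 + 2 * ((r powr s)\<^sup>2 * enn2real (c k))"
          using sum_sq_le_2[of "r powr s * norm (u0 k)" "r powr s * sqrt (enn2real (c k))"]
          by (simp add: D_def distrib_left power_mult_distrib)
        then have "ennreal ((r powr s * D k)\<^sup>2) \<le> ennreal (2 * (r powr s * norm (u0 k))\<^sup>2 + 2 * ((r powr s)\<^sup>2 * enn2real (c k)))"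
          by (rule ennreal_leI)
        also have "\<dots> = 2 * ennreal ((r powr s * norm (u0 k))\<^sup>2) + 2 * (ennreal ((r powr s)\<^sup>2) * c k)"
          using c[OF False] by (simp add: ennreal_mult)
        also have "ennreal ((r powr s)\<^sup>2) * c k = ennreal ((r powr s)\<^sup>2 * (1 / (\<nu> * r\<^sup>2))) * I k"
          unfolding c_def r_def[symmetric] using \<nu> by (subst ennreal_mult) (auto simp: mult.assoc)
        also have "\<dots> = ennreal (1 / \<nu>) * (ennreal ((r powr (s - 1))\<^sup>2) * I k)"
          unfolding powr_sq_shift[OF r \<nu>] using \<nu> by (subst ennreal_mult) (auto simp: mult.assoc)
        also have "ennreal ((r powr (s - 1))\<^sup>2) * I k = (\<integral>\<^sup>+q. ennreal ((r powr (s - 1) * norm (H q k))\<^sup>2) \<partial>lebesgue_on {0..T})"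
          unfolding I_def by (subst nn_integral_cmult[symmetric]) (auto simp: power_mult_distrib ennreal_mult)
        finally show ?thesis by (simp add: r_def)
      qed simp
    qed
    also have "\<dots> = 2 * energy L s u0 + 2 * (ennreal (1 / \<nu>) * (\<integral>\<^sup>+r. energy L (s - 1) (H r) \<partial>lebesgue_on {0..T}))"
      unfolding energy_def
      by (subst nn_integral_add) (auto simp: nn_integral_cmult nn_integral_count_space_nn_integral)
    also have "\<dots> < \<infinity>" using u0 fin by (simp add: ennreal_mult_less_top)
    finally show ?thesis .
  qed
  have cont: "continuous_on {0..T} (\<lambda>r. u r k)" if "k \<noteq> 0" for k
  proof -
    have "continuous_on {0..T} (\<lambda>r. heat L \<nu> u0 r k + duh L \<nu> H r k)"
      by (intro continuous_intros continuous_on_heat continuous_on_duh[OF L H fin that])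
    then show ?thesis by (rule continuous_on_eq) (use u that in simp)
  qed
  show ?thesis
    \<comment> \<open>The dominated convergence lemma speaks of sequences, so the limit in time is
      tested along sequences.\<close>
    unfolding tendsto_at_iff_sequentially o_def
  proof (intro allI impI)
    fix X :: "nat \<Rightarrow> real" assume X: "\<forall>i. X i \<in> {0..T} - {t}" "X \<longlonglongrightarrow> t"
    show "(\<lambda>i. energy L s (\<lambda>k. u (X i) k - u t k)) \<longlonglongrightarrow> 0"
    proof (rule energy_dominated_convergence[OF Dfin])
      show "norm (u (X n) k) \<le> D k" if "k \<noteq> 0" for n k using X(1) that by (intro le) auto
      show "(\<lambda>n. u (X n) k) \<longlonglongrightarrow> u t k" if "k \<noteq> 0" for k
        using continuous_on_tendsto_compose[OF cont[OF that] X(2) t] X(1) by simp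
    qed
  qed
qed

section \<open>Series of coefficient families\<close>

lemma two_mult_le_sum: "2 * (x * y) \<le> x\<^sup>2 + y\<^sup>2" for x y :: real
  using zero_le_power2[of "x - y"] by (simp add: power2_eq_square algebra_simps)

text \<open>Repeated use of \<open>energy_add_le\<close> would accumulate factors 2. Instead the
  series is split by Cauchy-Schwarz against the geometric weights 2^-(n+1), which sum to 1; the
  price is the weight 2^(n+1) on the bounds.\<close>

lemma
  fixes d :: "nat \<Rightarrow> coeffs"
  assumes L: "L > 0" and d: "\<And>n. energy L s (d n) \<le> ennreal (b n)" and b: "\<And>n. b n \<ge> 0"
    and sm: "summable (\<lambda>n. 2 ^ n * b n)"
  shows summable_norm_modes: "\<And>k. k \<noteq> 0 \<Longrightarrow> summable (\<lambda>n. norm (d n k))"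
    and energy_suminf_le: "energy L s (\<lambda>k. \<Sum>n. d n k) \<le> ennreal (\<Sum>n. 2 * (2 ^ n * b n))"
proof -
  show summ: "summable (\<lambda>n. norm (d n k))" if k: "k \<noteq> 0" for k
  proof -
    define r where "r = norm (wave L k) powr s"
    have r: "r > 0" using norm_wave_pos[OF L k] by (simp add: r_def)
    have "norm (d n k) \<le> (1 / r) * ((1 / 2) ^ n + 2 ^ n * b n)" for n
    proof -
      have "ennreal ((r * norm (d n k))\<^sup>2) \<le> ennreal (b n)"
        using norm_coeff_le_energy[of L k s "d n"] d[of n] unfolding r_def by (rule order_trans)
      then have "(r * norm (d n k))\<^sup>2 \<le> b n" using b by (simp add: ennreal_le_iff)
      then have "r * norm (d n k) \<le> sqrt (b n)" using real_le_rsqrt by blast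
      also have "sqrt (b n) \<le> (1 / 2) ^ n + 2 ^ n * b n"
      proof -
        \<comment> \<open>The geometric mean of 2^-n and 2^n b(n) is the square root of b(n), so it
          is bounded by their sum, whose two parts are summable.\<close>
        define x y :: real where "x = sqrt ((1 / 2) ^ n)" and "y = sqrt (2 ^ n * b n)"
        have "x * y = sqrt (b n)"
          by (simp add: x_def y_def power_one_over flip: real_sqrt_mult)
        moreover have "x\<^sup>2 = (1 / 2) ^ n" "y\<^sup>2 = 2 ^ n * b n" using b by (simp_all add: x_def y_def)
        ultimately show ?thesis using two_mult_le_sum[of x y] b[of n] real_sqrt_ge_zero[of "b n"] by linarith
      qed
      finally show ?thesis using r by (simp add: field_simps)
    qed
    then have le: "norm (norm (d n k)) \<le> (1 / r) * ((1 / 2) ^ n + 2 ^ n * b n)" if "n \<ge> 0" for n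
      by simp
    have "summable (\<lambda>n. (1 / r) * ((1 / 2) ^ n + 2 ^ n * b n))"
      by (intro summable_mult summable_add sm summable_geometric) simp
    then show ?thesis using le by (rule summable_comparison_test')
  qed
  have "energy L s (\<lambda>k. \<Sum>n. d n k)
      \<le> (\<integral>\<^sup>+k. (\<integral>\<^sup>+n. ennreal (2 * 2 ^ n) * ennreal ((norm (wave L k) powr s * norm (d n k))\<^sup>2) \<partial>count_space UNIV) \<partial>count_space UNIV)"
    unfolding energy_def
  proof (rule nn_integral_mono)
    fix k :: "int ^ 3"
    show "ennreal ((norm (wave L k) powr s * norm (\<Sum>n. d n k))\<^sup>2)
      \<le> (\<integral>\<^sup>+n. ennreal (2 * 2 ^ n) * ennreal ((norm (wave L k) powr s * norm (d n k))\<^sup>2) \<partial>count_space UNIV)"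
    proof (cases "k = 0")
      case False
      let ?r = "norm (wave L k) powr s"
      let ?f = "\<lambda>n :: nat. ennreal (sqrt ((1 / 2) ^ Suc n))" and ?g = "\<lambda>n :: nat. ennreal (sqrt (2 * 2 ^ n) * (?r * norm (d n k)))"
      have fg: "?f n * ?g n = ennreal (?r * norm (d n k))" for n
        by (subst ennreal_mult[symmetric]) (simp_all add: power_one_over flip: mult.assoc real_sqrt_mult)
      have "?r * norm (\<Sum>n. d n k) \<le> (\<Sum>n. ?r * norm (d n k))"
        using summable_norm[OF summ[OF False]] by (simp add: suminf_mult summ[OF False] mult_left_mono)
      then have "ennreal (?r * norm (\<Sum>n. d n k)) \<le> ennreal (\<Sum>n. ?r * norm (d n k))" by (rule ennreal_leI)
      also have "\<dots> = (\<Sum>n. ennreal (?r * norm (d n k)))"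
        by (intro suminf_ennreal2[symmetric] summable_mult summ[OF False]) simp
      also have "\<dots> = (\<integral>\<^sup>+n. ?f n * ?g n \<partial>count_space UNIV)"
        unfolding fg by (rule nn_integral_count_space_nat[symmetric])
      finally have "(ennreal (?r * norm (\<Sum>n. d n k)))\<^sup>2 \<le> (\<integral>\<^sup>+n. ?f n * ?g n \<partial>count_space UNIV)\<^sup>2"
        by (intro power_mono) auto
      also have "\<dots> \<le> (\<integral>\<^sup>+n. (?f n)\<^sup>2 \<partial>count_space UNIV) * (\<integral>\<^sup>+n. (?g n)\<^sup>2 \<partial>count_space UNIV)"
        by (rule Cauchy_Schwarz_nn_integral) auto
      also have "(\<integral>\<^sup>+n. (?f n)\<^sup>2 \<partial>count_space UNIV) = (\<Sum>n. ennreal ((1 / 2) ^ Suc n))"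
        by (simp only: nn_integral_count_space_nat ennreal_power real_sqrt_ge_zero real_sqrt_pow2 zero_le_power zero_le_divide_1_iff zero_le_numeral)
      also have "\<dots> = ennreal 1"
        using power_half_series by (intro suminf_ennreal_eq) auto
      also have "ennreal 1 * (\<integral>\<^sup>+n. (?g n)\<^sup>2 \<partial>count_space UNIV)
          = (\<integral>\<^sup>+n. ennreal (2 * 2 ^ n) * ennreal ((?r * norm (d n k))\<^sup>2) \<partial>count_space UNIV)"
        unfolding ennreal_1 mult_1
        by (intro nn_integral_cong) (simp add: ennreal_power power_mult_distrib flip: ennreal_mult)
      finally show ?thesis by (simp add: ennreal_power)
    qed simp
  qed
  also have "\<dots> = (\<integral>\<^sup>+n. \<integral>\<^sup>+k. ennreal (2 * 2 ^ n) * ennreal ((norm (wave L k) powr s * norm (d n k))\<^sup>2) \<partial>count_space UNIV \<partial>count_space UNIV)"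
    by (rule nn_integral_count_space_nn_integral) auto
  also have "\<dots> = (\<integral>\<^sup>+n. ennreal (2 * 2 ^ n) * energy L s (d n) \<partial>count_space UNIV)"
    by (simp add: nn_integral_cmult energy_def)
  also have "\<dots> \<le> (\<integral>\<^sup>+n. ennreal (2 * (2 ^ n * b n)) \<partial>count_space UNIV)"
  proof (rule nn_integral_mono)
    fix n
    have "ennreal (2 * 2 ^ n) * energy L s (d n) \<le> ennreal (2 * 2 ^ n) * ennreal (b n)"
      by (intro mult_left_mono d) simp
    then show "ennreal (2 * 2 ^ n) * energy L s (d n) \<le> ennreal (2 * (2 ^ n * b n))"
      using b[of n] by (simp add: mult.assoc flip: ennreal_mult)
  qed
  also have "\<dots> = ennreal (\<Sum>n. 2 * (2 ^ n * b n))"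
    unfolding nn_integral_count_space_nat using b sm by (intro suminf_ennreal2 summable_mult) auto
  finally show "energy L s (\<lambda>k. \<Sum>n. d n k) \<le> ennreal (\<Sum>n. 2 * (2 ^ n * b n))" .
qed

lemma solenoidal_suminf:
  assumes "\<And>n. solenoidal L (d n)" "\<And>k. k \<noteq> 0 \<Longrightarrow> summable (\<lambda>n. d n k)"
  shows "solenoidal L (\<lambda>k. \<Sum>n. d n k)"
  unfolding solenoidal_def
proof (intro conjI allI)
  have d0: "d n 0 = 0" for n using assms(1) by (simp add: solenoidal_def)
  then show "(\<Sum>n. d n 0) = 0" by simp
  fix k
  have sm: "summable (\<lambda>n. d n k)" using assms(2)[of k] d0 by (cases "k = 0") auto
  have lin: "bounded_linear (\<lambda>z :: complex ^ 3. (\<chi> i. cnj (z $ i)))"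
    by (rule bounded_linear_intro[where K = 1]) (simp_all add: vec_eq_iff norm_cnj_vec)
  have "(\<chi> i. cnj ((\<Sum>n. d n k) $ i)) = (\<Sum>n. \<chi> i. cnj (d n k $ i))"
    by (rule bounded_linear.suminf[OF lin sm])
  then show "(\<Sum>n. d n (- k)) = (\<chi> i. cnj ((\<Sum>n. d n k) $ i))"
    using assms(1) by (simp add: solenoidal_def)
  have lin2: "bounded_linear (\<lambda>z :: complex ^ 3. \<Sum>i\<in>UNIV. complex_of_real (wave L k $ i) * z $ i)"
    by (intro bounded_linear_sum bounded_linear_mult_right[THEN bounded_linear_compose] bounded_linear_vec_nth)
  have "(\<Sum>i\<in>UNIV. complex_of_real (wave L k $ i) * (\<Sum>n. d n k) $ i)
      = (\<Sum>n. \<Sum>i\<in>UNIV. complex_of_real (wave L k $ i) * d n k $ i)"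
    by (rule bounded_linear.suminf[OF lin2 sm])
  then show "(\<Sum>i\<in>UNIV. complex_of_real (wave L k $ i) * (\<Sum>n. d n k) $ i) = 0"
    using assms(1) by (simp add: solenoidal_def)
qed

section \<open>The linear equation with prescribed drift\<close>

locale navier_stokes =
  fixes L \<nu> \<alpha> :: real and f :: coeffs
  assumes L: "L > 0" and \<nu>: "\<nu> > 0" and \<alpha>: "\<alpha> > 1 / 2" and f: "f \<in> V L (\<alpha> - 1)"
begin

definition bilC :: real where
  "bilC = (SOME C. C > 0 \<and> (\<forall>w u. w 0 = 0 \<longrightarrow>
     energy L (\<alpha> - 1) (Bhat L w u) \<le> ennreal C * (energy L (1 + \<alpha>) w * energy L \<alpha> u)))"

lemma bilC: "bilC > 0"
  and energy_Bhat_bilC: "w 0 = 0 \<Longrightarrow> energy L (\<alpha> - 1) (Bhat L w u) \<le> ennreal bilC * (energy L (1 + \<alpha>) w * energy L \<alpha> u)"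
proof -
  obtain C where "C > 0" "\<And>w u. w 0 = 0 \<Longrightarrow> energy L (\<alpha> - 1) (Bhat L w u) \<le> ennreal C * (energy L (1 + \<alpha>) w * energy L \<alpha> u)"
    using energy_Bhat_le[OF L \<alpha>] by blast
  then have ex: "\<exists>C. C > 0 \<and> (\<forall>w u. w 0 = 0 \<longrightarrow>
     energy L (\<alpha> - 1) (Bhat L w u) \<le> ennreal C * (energy L (1 + \<alpha>) w * energy L \<alpha> u))"
    by blast
  from someI_ex[OF ex] show "bilC > 0"
    "w 0 = 0 \<Longrightarrow> energy L (\<alpha> - 1) (Bhat L w u) \<le> ennreal bilC * (energy L (1 + \<alpha>) w * energy L \<alpha> u)"
    unfolding bilC_def by blast+
qed

text \<open>The class of prescribed transporting velocities. Values in V^(1+\<alpha>) are required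
  at every time, not just at almost every time, so that the bilinear estimate applies
  pointwise.\<close>

definition drift :: "real \<Rightarrow> (real \<Rightarrow> coeffs) \<Rightarrow> bool" where
  "drift T w \<longleftrightarrow> (\<forall>t. w t \<in> V L (1 + \<alpha>)) \<and> modes_measurable {0..T} w
     \<and> (\<integral>\<^sup>+t. energy L (1 + \<alpha>) (w t) \<partial>lebesgue_on {0..T}) < \<infinity>"

definition state :: "real \<Rightarrow> (real \<Rightarrow> coeffs) \<Rightarrow> bool" where
  "state T u \<longleftrightarrow> (\<forall>t\<in>{0..T}. u t \<in> V L \<alpha>) \<and> modes_measurable {0..T} u
     \<and> (\<exists>M. \<forall>t\<in>{0..T}. energy L \<alpha> (u t) \<le> ennreal M)"

text \<open>Square integrable in time with values in V^(\<alpha>-1). The energy may be infinite on a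
  null set, but the algebraic conditions hold at every time, so the Duhamel integral stays
  solenoidal.\<close>

definition forcing :: "real \<Rightarrow> (real \<Rightarrow> coeffs) \<Rightarrow> bool" where
  "forcing T H \<longleftrightarrow> (\<forall>t\<in>{0..T}. solenoidal L (H t)) \<and> modes_measurable {0..T} H
     \<and> (\<integral>\<^sup>+t. energy L (\<alpha> - 1) (H t) \<partial>lebesgue_on {0..T}) < \<infinity>"

lemma drift_mono: "drift T w \<Longrightarrow> t \<le> T \<Longrightarrow> drift t w"
  unfolding drift_def
  using modes_measurable_mono[of "{0..T}" w "{0..t}"]
    nn_integral_lebesgue_on_mono[of "{0..t}" "{0..T}" "\<lambda>t. energy L (1 + \<alpha>) (w t)"]
  by (auto intro: order_le_less_trans)

lemma driftD:
  assumes "drift T w"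
  shows "w t 0 = 0" "energy L (1 + \<alpha>) (w t) < \<infinity>" "solenoidal L (w t)" "w t \<in> V L (1 + \<alpha>)"
  using assms unfolding drift_def by (auto simp: V_iff solenoidal_def)

lemma stateD:
  assumes "state T u" "t \<in> {0..T}"
  shows "energy L \<alpha> (u t) < \<infinity>" "solenoidal L (u t)" "u t 0 = 0"
  using assms unfolding state_def by (auto simp: V_iff solenoidal_def)

lemma state_diff:
  assumes "state T u" "state T v"
  shows "state T (\<lambda>t k. u t k - v t k)"
proof -
  obtain M N where M: "\<And>t. t \<in> {0..T} \<Longrightarrow> energy L \<alpha> (u t) \<le> ennreal M" and N: "\<And>t. t \<in> {0..T} \<Longrightarrow> energy L \<alpha> (v t) \<le> ennreal N"
    using assms unfolding state_def by blast
  \<comment> \<open>\<open>M\<close> and \<open>N\<close> may be negative, since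
    \<open>ennreal\<close> truncates at 0; hence the maxima with 0.\<close>
  have "energy L \<alpha> (\<lambda>k. u t k - v t k) \<le> ennreal (2 * max 0 M + 2 * max 0 N)" if "t \<in> {0..T}" for t
  proof -
    have "energy L \<alpha> (\<lambda>k. u t k - v t k) \<le> 2 * energy L \<alpha> (u t) + 2 * energy L \<alpha> (v t)" by (rule energy_diff_le)
    also have "\<dots> \<le> 2 * ennreal (max 0 M) + 2 * ennreal (max 0 N)"
      using M[OF that] N[OF that]
      by (intro add_mono mult_left_mono) (auto intro: order_trans ennreal_leI)
    finally show ?thesis by (simp add: ennreal_mult)
  qed
  moreover have "(\<lambda>k. u t k - v t k) \<in> V L \<alpha>" if "t \<in> {0..T}" for t
    unfolding V_iff using solenoidal_diff energy_diff_finite stateD[OF assms(1) that] stateD[OF assms(2) that] by blast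
  ultimately show ?thesis
    using assms modes_measurable_diff unfolding state_def by blast
qed

lemma state_add_heat_duh:
  assumes u0: "u0 \<in> V L \<alpha>" and H: "forcing T H"
  shows "state T (\<lambda>t k. heat L \<nu> u0 t k + duh L \<nu> H t k)"
proof -
  have Hm: "modes_measurable {0..T} H" and Hf: "(\<integral>\<^sup>+t. energy L (\<alpha> - 1) (H t) \<partial>lebesgue_on {0..T}) < \<infinity>"
    and Hs: "\<And>t. t \<in> {0..T} \<Longrightarrow> solenoidal L (H t)"
    using H by (auto simp: forcing_def)
  have sd: "solenoidal L (duh L \<nu> H t)" if "t \<in> {0..T}" for t
  proof (rule solenoidal_duh)
    show "integrable (lebesgue_on {0..t}) (\<lambda>s. H s k)" if "k \<noteq> 0" for k
      by (rule integrable_subinterval[OF integrable_mode(1)[OF L Hm Hf that]]) (use \<open>t \<in> {0..T}\<close> in auto)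
  qed (use that Hs in auto)
  have sol: "solenoidal L (\<lambda>k. heat L \<nu> u0 t k + duh L \<nu> H t k)" if "t \<in> {0..T}" for t
    using u0 sd[OF that] by (intro solenoidal_add solenoidal_heat) (auto simp: V_iff)
  define M where "M = 2 * energy L \<alpha> u0 + 2 * (ennreal (1 / \<nu>) * (\<integral>\<^sup>+t. energy L (\<alpha> - 1) (H t) \<partial>lebesgue_on {0..T}))"
  have M: "M < \<infinity>" using u0 Hf by (simp add: M_def ennreal_mult_less_top V_iff)
  have E: "energy L \<alpha> (\<lambda>k. heat L \<nu> u0 t k + duh L \<nu> H t k) \<le> M" if "t \<in> {0..T}" for t
  proof -
    have "energy L \<alpha> (duh L \<nu> H t) \<le> ennreal (1 / \<nu>) * (\<integral>\<^sup>+r. energy L (\<alpha> - 1) (H r) \<partial>lebesgue_on {0..t})"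
      using that by (intro energy_duh_le L \<nu> modes_measurable_mono[OF Hm]) auto
    also have "\<dots> \<le> ennreal (1 / \<nu>) * (\<integral>\<^sup>+r. energy L (\<alpha> - 1) (H r) \<partial>lebesgue_on {0..T})"
      using that by (intro mult_left_mono nn_integral_lebesgue_on_mono) auto
    finally have d: "energy L \<alpha> (duh L \<nu> H t) \<le> \<dots>" .
    have "energy L \<alpha> (heat L \<nu> u0 t) \<le> energy L \<alpha> u0" using that \<nu> by (intro energy_heat_le) auto
    then show ?thesis
      unfolding M_def using d by (intro order_trans[OF energy_add_le] add_mono mult_left_mono) auto
  qed
  have "modes_measurable {0..T} (\<lambda>t k. heat L \<nu> u0 t k + duh L \<nu> H t k)"
    unfolding modes_measurable_def
  proof
    fix k
    have "continuous_on {0..T} (\<lambda>t. heat L \<nu> u0 t k + duh L \<nu> H t k)"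
    proof (cases "k = 0")
      case True
      have "continuous_on {0..T} (\<lambda>t. 0 :: complex ^ 3)" by simp
      then show ?thesis by (rule continuous_on_eq) (use sol True in \<open>simp add: solenoidal_def\<close>)
    next
      case False
      then show ?thesis by (intro continuous_intros continuous_on_heat continuous_on_duh[OF L Hm Hf])
    qed
    then show "(\<lambda>t. heat L \<nu> u0 t k + duh L \<nu> H t k) \<in> borel_measurable (lebesgue_on {0..T})"
      by (rule continuous_imp_measurable_on_sets_lebesgue) simp
  qed
  moreover have "energy L \<alpha> (\<lambda>k. heat L \<nu> u0 t k + duh L \<nu> H t k) \<le> ennreal (enn2real M)" if "t \<in> {0..T}" for t
    using E[OF that] M by simp
  moreover have "(\<lambda>k. heat L \<nu> u0 t k + duh L \<nu> H t k) \<in> V L \<alpha>" if "t \<in> {0..T}" for t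
    unfolding V_iff using sol[OF that] E[OF that] M by (auto intro: order_le_less_trans)
  ultimately show ?thesis unfolding state_def by blast
qed

lemma state_duh:
  assumes "forcing T H"
  shows "state T (duh L \<nu> H)"
  using state_add_heat_duh[of "\<lambda>k. 0" T H] assms by (simp add: V_iff heat_def cong: if_cong)

lemma forcing_const: "forcing T (\<lambda>t. f)"
proof -
  interpret finite_measure "lebesgue_on {0..T}" by (rule finite_measure_lebesgue_on_Icc)
  show ?thesis
    using f emeasure_finite[of "{0..T}"]
    by (simp add: forcing_def modes_measurable_def V_iff ennreal_mult_less_top less_top[symmetric] ennreal_mult_eq_top_iff)
qed

lemma forcing_diff:
  assumes "forcing T H" "forcing T G"
  shows "forcing T (\<lambda>t k. H t k - G t k)"
proof -
  have m: "(\<lambda>t. energy L (\<alpha> - 1) (H t)) \<in> borel_measurable (lebesgue_on {0..T})" "(\<lambda>t. energy L (\<alpha> - 1) (G t)) \<in> borel_measurable (lebesgue_on {0..T})"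
    using assms by (auto simp: forcing_def intro: measurable_energy)
  have "(\<integral>\<^sup>+t. energy L (\<alpha> - 1) (\<lambda>k. H t k - G t k) \<partial>lebesgue_on {0..T})
      \<le> (\<integral>\<^sup>+t. 2 * energy L (\<alpha> - 1) (H t) + 2 * energy L (\<alpha> - 1) (G t) \<partial>lebesgue_on {0..T})"
    by (intro nn_integral_mono energy_diff_le)
  also have "\<dots> = 2 * (\<integral>\<^sup>+t. energy L (\<alpha> - 1) (H t) \<partial>lebesgue_on {0..T}) + 2 * (\<integral>\<^sup>+t. energy L (\<alpha> - 1) (G t) \<partial>lebesgue_on {0..T})"
    using m by (simp add: nn_integral_add nn_integral_cmult)
  also have "\<dots> < \<infinity>" using assms by (simp add: forcing_def ennreal_mult_less_top)
  finally show ?thesis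
    using assms by (auto simp: forcing_def intro: solenoidal_diff modes_measurable_diff)
qed

lemma forcing_Bhat:
  assumes w: "drift T w" and u: "state T u"
  shows "forcing T (\<lambda>t. Bhat L (w t) (u t))"
proof -
  obtain M where M: "\<And>t. t \<in> {0..T} \<Longrightarrow> energy L \<alpha> (u t) \<le> ennreal M"
    using u unfolding state_def by blast
  have wm: "modes_measurable {0..T} w" using w by (simp add: drift_def)
  have "(\<integral>\<^sup>+t. energy L (\<alpha> - 1) (Bhat L (w t) (u t)) \<partial>lebesgue_on {0..T})
      \<le> (\<integral>\<^sup>+t. ennreal bilC * ennreal M * energy L (1 + \<alpha>) (w t) \<partial>lebesgue_on {0..T})"
  proof (rule nn_integral_mono)
    fix t assume "t \<in> space (lebesgue_on {0..T})"
    then have "energy L (1 + \<alpha>) (w t) * energy L \<alpha> (u t) \<le> energy L (1 + \<alpha>) (w t) * ennreal M"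
      using M by (intro mult_left_mono) auto
    then have "ennreal bilC * (energy L (1 + \<alpha>) (w t) * energy L \<alpha> (u t)) \<le> ennreal bilC * (energy L (1 + \<alpha>) (w t) * ennreal M)"
      by (rule mult_left_mono) simp
    then show "energy L (\<alpha> - 1) (Bhat L (w t) (u t)) \<le> ennreal bilC * ennreal M * energy L (1 + \<alpha>) (w t)"
      using order_trans[OF energy_Bhat_bilC[of "w t" "u t"]] driftD(1)[OF w] by (simp add: mult_ac)
  qed
  also have "\<dots> = ennreal bilC * ennreal M * (\<integral>\<^sup>+t. energy L (1 + \<alpha>) (w t) \<partial>lebesgue_on {0..T})"
    using wm by (intro nn_integral_cmult measurable_energy)
  also have "\<dots> < \<infinity>" using w by (simp add: drift_def ennreal_mult_less_top)
  finally show ?thesis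
    using wm u stateD(2)[OF u] driftD(3)[OF w]
    by (auto simp: forcing_def state_def intro!: solenoidal_Bhat L modes_measurable_Bhat)
qed

lemma forcing_minus: "forcing T H \<Longrightarrow> forcing T (\<lambda>t k. - H t k)"
proof -
  assume H: "forcing T H"
  have "forcing T (\<lambda>t k. 0)" by (simp add: forcing_def modes_measurable_def)
  from forcing_diff[OF this H] show ?thesis by simp
qed

lemma duh_diff:
  assumes "forcing T H" "forcing T G" "t \<in> {0..T}" "k \<noteq> 0"
  shows "duh L \<nu> (\<lambda>s k. H s k - G s k) t k = duh L \<nu> H t k - duh L \<nu> G t k"
proof -
  let ?c = "\<nu> * (norm (wave L k))\<^sup>2"
  have "integrable (lebesgue_on {0..t}) (\<lambda>s. exp (- (?c * (t - s))) *\<^sub>R F s k)" if "forcing T F" for F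
  proof -
    have "integrable (lebesgue_on {0..T}) (\<lambda>s. F s k)"
      using that assms(4) by (intro integrable_mode(1)[OF L, where s = "\<alpha> - 1"]) (auto simp: forcing_def)
    then have "integrable (lebesgue_on {0..t}) (\<lambda>s. F s k)"
      by (rule integrable_subinterval) (use assms(3) in auto)
    from integrable_exp_scaleR[OF this, of ?c "- ?c * t"] show ?thesis by (simp add: algebra_simps)
  qed
  with assms(1,2) show ?thesis
    by (simp add: duh_def duhamel_def scaleR_diff_right)
qed

section \<open>The Volterra inequality\<close>

definition drift_energy :: "(real \<Rightarrow> coeffs) \<Rightarrow> real \<Rightarrow> real" where
  "drift_energy w s = renergy L (1 + \<alpha>) (w s)"

lemma integrable_drift_energy:
  assumes "drift T w"
  shows "integrable (lebesgue_on {0..T}) (drift_energy w)"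
proof (rule integrableI_bounded)
  have [measurable]: "(\<lambda>t. energy L (1 + \<alpha>) (w t)) \<in> borel_measurable (lebesgue_on {0..T})"
    using assms by (intro measurable_energy) (simp add: drift_def)
  show "drift_energy w \<in> borel_measurable (lebesgue_on {0..T})"
    unfolding drift_energy_def[abs_def] renergy_def by measurable
  show "(\<integral>\<^sup>+t. ennreal (norm (drift_energy w t)) \<partial>lebesgue_on {0..T}) < \<infinity>"
    using assms driftD(2)[OF assms] by (simp add: drift_energy_def ennreal_renergy drift_def)
qed

lemma drift_energy_nonneg: "drift_energy w s \<ge> 0"
  by (simp add: drift_energy_def)

text \<open>The derivative lost by \<open>Bhat\<close> is regained by \<open>duh\<close>, so the
  estimate closes in V^\<alpha>. What remains of the drift is an integrable kernel in time.\<close>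

lemma energy_duh_Bhat_le:
  assumes w: "drift T w" and d: "modes_measurable {0..T} d" and t: "t \<in> {0..T}"
  shows "energy L \<alpha> (duh L \<nu> (\<lambda>s k. - Bhat L (w s) (d s) k) t)
    \<le> ennreal (bilC / \<nu>) * (\<integral>\<^sup>+s. ennreal (drift_energy w s) * energy L \<alpha> (d s) \<partial>lebesgue_on {0..t})"
proof -
  have wm: "modes_measurable {0..t} w" "modes_measurable {0..t} d"
    using w d t by (auto simp: drift_def intro: modes_measurable_mono)
  have "modes_measurable {0..t} (\<lambda>s. Bhat L (w s) (d s))" by (rule modes_measurable_Bhat[OF wm])
  then have m: "modes_measurable {0..t} (\<lambda>s k. - Bhat L (w s) (d s) k)"
    by (simp add: modes_measurable_def borel_measurable_uminus)
  have "energy L \<alpha> (duh L \<nu> (\<lambda>s k. - Bhat L (w s) (d s) k) t)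
      \<le> ennreal (1 / \<nu>) * (\<integral>\<^sup>+s. energy L (\<alpha> - 1) (\<lambda>k. - Bhat L (w s) (d s) k) \<partial>lebesgue_on {0..t})"
    using t by (intro energy_duh_le L \<nu> m) auto
  also have "\<dots> \<le> ennreal (1 / \<nu>) * (\<integral>\<^sup>+s. ennreal bilC * (ennreal (drift_energy w s) * energy L \<alpha> (d s)) \<partial>lebesgue_on {0..t})"
  proof (intro mult_left_mono nn_integral_mono)
    fix s
    have "energy L (\<alpha> - 1) (\<lambda>k. - Bhat L (w s) (d s) k) = energy L (\<alpha> - 1) (Bhat L (w s) (d s))"
      by (rule energy_cong) simp
    then show "energy L (\<alpha> - 1) (\<lambda>k. - Bhat L (w s) (d s) k) \<le> ennreal bilC * (ennreal (drift_energy w s) * energy L \<alpha> (d s))"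
      using energy_Bhat_bilC[of "w s" "d s"] driftD(1,2)[OF w] by (simp add: drift_energy_def ennreal_renergy)
  qed simp
  also have "(\<integral>\<^sup>+s. ennreal bilC * (ennreal (drift_energy w s) * energy L \<alpha> (d s)) \<partial>lebesgue_on {0..t})
      = ennreal bilC * (\<integral>\<^sup>+s. ennreal (drift_energy w s) * energy L \<alpha> (d s) \<partial>lebesgue_on {0..t})"
  proof -
    have [measurable]: "drift_energy w \<in> borel_measurable (lebesgue_on {0..t})"
      using integrable_drift_energy[OF drift_mono[OF w, of t]] t by auto
    have [measurable]: "(\<lambda>s. energy L \<alpha> (d s)) \<in> borel_measurable (lebesgue_on {0..t})"
      by (rule measurable_energy[OF wm(2)])
    show ?thesis by (rule nn_integral_cmult) measurable
  qed
  also have "ennreal (1 / \<nu>) * (ennreal bilC * (\<integral>\<^sup>+s. ennreal (drift_energy w s) * energy L \<alpha> (d s) \<partial>lebesgue_on {0..t}))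
      = ennreal (bilC / \<nu>) * (\<integral>\<^sup>+s. ennreal (drift_energy w s) * energy L \<alpha> (d s) \<partial>lebesgue_on {0..t})"
    using bilC \<nu> by (simp add: ennreal_mult[symmetric] flip: mult.assoc)
  finally show ?thesis .
qed

text \<open>The drift energy is integrated up to \<open>T\<close> to make the bound uniform in
  \<open>t\<close>. The lemma serves twice: for the terms of the Picard series, and for a constant
  sequence in the uniqueness proof.\<close>

lemma volterra_energy:
  assumes w: "drift T w" and M: "M \<ge> 0"
    and d: "\<And>n. modes_measurable {0..T} (d n)"
    and d0: "\<And>t. t \<in> {0..T} \<Longrightarrow> energy L \<alpha> (d 0 t) \<le> ennreal M"
    and dS: "\<And>n t. t \<in> {0..T} \<Longrightarrow> d (Suc n) t = duh L \<nu> (\<lambda>s k. - Bhat L (w s) (d n s) k) t"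
    and t: "t \<in> {0..T}"
  shows "energy L \<alpha> (d n t) \<le> ennreal (M * (bilC / \<nu> * (LINT s|lebesgue_on {0..T}. drift_energy w s)) ^ n / fact n)"
proof -
  have "energy L \<alpha> (d n t) \<le> ennreal (M * (bilC / \<nu> * (LINT s|lebesgue_on {0..t}. drift_energy w s)) ^ n / fact n)"
  proof (rule volterra_iteration[where x = "\<lambda>n t. energy L \<alpha> (d n t)" and C = "bilC / \<nu>" and e = "drift_energy w" and T = T and M = M, OF integrable_drift_energy[OF w] drift_energy_nonneg _ M d0 _ t])
    show "bilC / \<nu> \<ge> 0" using bilC \<nu> by simp
    show "energy L \<alpha> (d (Suc n) t) \<le> ennreal (bilC / \<nu>) * (\<integral>\<^sup>+s. ennreal (drift_energy w s) * energy L \<alpha> (d n s) \<partial>lebesgue_on {0..t})"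
      if "t \<in> {0..T}" for n t
      unfolding dS[OF that] by (rule energy_duh_Bhat_le[OF w d that])
  qed
  also have "\<dots> \<le> ennreal (M * (bilC / \<nu> * (LINT s|lebesgue_on {0..T}. drift_energy w s)) ^ n / fact n)"
  proof -
    have "(LINT s|lebesgue_on {0..t}. drift_energy w s) = (LINT s|lebesgue_on {0..T}. indicator {0..t} s *\<^sub>R drift_energy w s)"
      using t by (intro integral_lebesgue_on_indicator[symmetric]) auto
    also have "\<dots> \<le> (LINT s|lebesgue_on {0..T}. drift_energy w s)"
      using integrable_drift_energy[OF w] t
      by (intro integral_mono integrable_mult_indicator) (auto simp: indicator_def drift_energy_nonneg sets_restrict_space_iff)
    finally show ?thesis
      using M bilC \<nu> drift_energy_nonneg
      by (intro ennreal_leI divide_right_mono mult_left_mono power_mono) auto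
  qed
  finally show ?thesis .
qed

primrec dser :: "(real \<Rightarrow> coeffs) \<Rightarrow> coeffs \<Rightarrow> nat \<Rightarrow> real \<Rightarrow> coeffs" where
  "dser w u0 0 = (\<lambda>t k. heat L \<nu> u0 t k + duh L \<nu> (\<lambda>_. f) t k)"
| "dser w u0 (Suc n) = duh L \<nu> (\<lambda>s k. - Bhat L (w s) (dser w u0 n s) k)"

text \<open>The terms are the successive differences of the Picard iterates, started from the
  solution without advection.\<close>

definition lin_sol :: "(real \<Rightarrow> coeffs) \<Rightarrow> coeffs \<Rightarrow> real \<Rightarrow> coeffs" where
  "lin_sol w u0 t k = (\<Sum>n. dser w u0 n t k)"

lemma state_dser:
  assumes "drift T w" "u0 \<in> V L \<alpha>"
  shows "state T (dser w u0 n)"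
  by (induction n) (auto intro!: state_add_heat_duh forcing_const state_duh forcing_minus forcing_Bhat assms)

lemma dser_bound:
  assumes w: "drift T w" and u0: "u0 \<in> V L \<alpha>"
  obtains b where "\<And>n. b n \<ge> 0" "summable (\<lambda>n. 2 ^ n * b n)"
    "\<And>n t. t \<in> {0..T} \<Longrightarrow> energy L \<alpha> (dser w u0 n t) \<le> ennreal (b n)"
proof -
  obtain M where M: "\<And>t. t \<in> {0..T} \<Longrightarrow> energy L \<alpha> (dser w u0 0 t) \<le> ennreal M"
    using state_dser[OF assms, of 0] unfolding state_def by blast
  define x where "x = bilC / \<nu> * (LINT s|lebesgue_on {0..T}. drift_energy w s)"
  have x: "x \<ge> 0" using bilC \<nu> drift_energy_nonneg by (simp add: x_def)
  define b where "b = (\<lambda>n. max 0 M * x ^ n / fact n)"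
  have "energy L \<alpha> (dser w u0 n t) \<le> ennreal (b n)" if "t \<in> {0..T}" for n t
    unfolding b_def x_def
  proof (rule volterra_energy[OF w])
    show "modes_measurable {0..T} (dser w u0 n)" for n
      using state_dser[OF assms] by (simp add: state_def)
    show "energy L \<alpha> (dser w u0 0 t) \<le> ennreal (max 0 M)" if "t \<in> {0..T}" for t
      using M[OF that] by (rule order_trans) (simp add: ennreal_leI)
  qed (use that in auto)
  \<comment> \<open>The weight 2^n demanded by the lemma on series is absorbed by the factorial: it
    merely replaces x by 2x in the exponential series.\<close>
  moreover have "summable (\<lambda>n. max 0 M * ((2 * x) ^ n /\<^sub>R fact n))"
    by (intro summable_mult summable_exp_generic)
  then have "summable (\<lambda>n. 2 ^ n * b n)"
    by (simp add: b_def power_mult_distrib divide_inverse mult_ac)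
  moreover have "b n \<ge> 0" for n using x by (simp add: b_def)
  ultimately show ?thesis using that by blast
qed

text \<open>The delicate point is to pass the operator \<open>K\<close>, Duhamel integral after
  advection, through the infinite sum. It is linear, so finitely many terms can be peeled off; it is
  continuous on V^\<alpha>, so the contribution of the remainder tends to 0 because the remainders
  do so uniformly in time.\<close>

lemma
  assumes w: "drift T w" and u0: "u0 \<in> V L \<alpha>"
  shows state_lin_sol: "state T (lin_sol w u0)"
    and lin_sol_mild: "\<And>t k. t \<in> {0..T} \<Longrightarrow> k \<noteq> 0 \<Longrightarrow>
      lin_sol w u0 t k = heat L \<nu> u0 t k + duh L \<nu> (\<lambda>s k. f k - Bhat L (w s) (lin_sol w u0 s) k) t k"
proof -
  obtain b where b: "\<And>n. b n \<ge> 0" "summable (\<lambda>n. 2 ^ n * b n)"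
    and bd: "\<And>n t. t \<in> {0..T} \<Longrightarrow> energy L \<alpha> (dser w u0 n t) \<le> ennreal (b n)"
    using dser_bound[OF w u0] by blast
  note sd = state_dser[OF w u0]
  have sm: "summable (\<lambda>n. dser w u0 n t k)" if "t \<in> {0..T}" for t k
  proof (cases "k = 0")
    case True
    then show ?thesis using stateD(3)[OF sd that] by simp
  next
    case False
    then have "summable (\<lambda>n. norm (dser w u0 n t k))"
      using summable_norm_modes[OF L bd[OF that] b(1) b(2), of k] by simp
    then show ?thesis by (rule summable_norm_cancel)
  qed
  show st: "state T (lin_sol w u0)"
    unfolding state_def
  proof (intro conjI ballI exI)
    show E: "energy L \<alpha> (lin_sol w u0 t) \<le> ennreal (\<Sum>n. 2 * (2 ^ n * b n))" if "t \<in> {0..T}" for t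
      using energy_suminf_le[OF L bd[OF that] b(1) b(2)] by (simp add: lin_sol_def[abs_def])
    show "lin_sol w u0 t \<in> V L \<alpha>" if "t \<in> {0..T}" for t
      unfolding V_iff
    proof
      show "solenoidal L (lin_sol w u0 t)"
        unfolding lin_sol_def[abs_def] by (rule solenoidal_suminf) (auto intro: stateD(2)[OF sd that] sm[OF that])
      show "energy L \<alpha> (lin_sol w u0 t) < \<infinity>" by (rule order_le_less_trans[OF E[OF that]]) simp
    qed
    show "modes_measurable {0..T} (lin_sol w u0)"
      using sd unfolding modes_measurable_def lin_sol_def state_def by (auto intro!: borel_measurable_suminf)
  qed
  define r where "r = (\<lambda>n t k. lin_sol w u0 t k - (\<Sum>j<n. dser w u0 j t k))"
  have r0: "r 0 = lin_sol w u0" by (simp add: r_def fun_eq_iff)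
  have rS: "r (Suc n) = (\<lambda>t k. r n t k - dser w u0 n t k)" for n by (simp add: r_def fun_eq_iff)
  have rst: "state T (r n)" for n
    by (induction n) (use st sd in \<open>auto simp: r0 rS intro: state_diff\<close>)
  \<comment> \<open>The tail alone would carry the weight 2^n; the larger weight 2^(n+N) makes
    \<open>\<epsilon> N\<close> a tail of one fixed convergent series, so that it tends to
    0.\<close>
  define \<epsilon> where "\<epsilon> = (\<lambda>N. \<Sum>n. 2 * (2 ^ (n + N) * b (n + N)))"
  have sm2: "summable (\<lambda>n. 2 * (2 ^ n * b n))" using b(2) by (rule summable_mult)
  have \<epsilon>0: "\<epsilon> \<longlonglongrightarrow> 0"
    unfolding \<epsilon>_def using suminf_exist_split2[OF sm2] by simp
  have \<epsilon>nn: "\<epsilon> N \<ge> 0" for N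
    unfolding \<epsilon>_def using b(1) summable_ignore_initial_segment[OF sm2, of N] by (intro suminf_nonneg) auto
  have rE: "energy L \<alpha> (r N t) \<le> ennreal (\<epsilon> N)" if t: "t \<in> {0..T}" for N t
  proof -
    have "r N t = (\<lambda>k. \<Sum>n. dser w u0 (n + N) t k)"
      using suminf_minus_initial_segment[OF sm[OF t], of N] by (auto simp: r_def lin_sol_def fun_eq_iff)
    then have "energy L \<alpha> (r N t) \<le> ennreal (\<Sum>n. 2 * (2 ^ n * b (n + N)))"
    proof (simp only:, intro energy_suminf_le[OF L bd[OF t] b(1)])
      have "summable (\<lambda>n. 2 ^ (n + N) * b (n + N))" using summable_ignore_initial_segment[OF b(2)] .
      then have "summable (\<lambda>n. (1 / 2 ^ N) * (2 ^ (n + N) * b (n + N)))" by (rule summable_mult)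
      then show "summable (\<lambda>n. 2 ^ n * b (n + N))" by (simp add: power_add)
    qed
    also have "\<dots> \<le> ennreal (\<epsilon> N)"
      unfolding \<epsilon>_def
    proof (intro ennreal_leI suminf_le)
      show "summable (\<lambda>n. 2 * (2 ^ (n + N) * b (n + N)))" using summable_ignore_initial_segment[OF sm2] .
      show le: "2 * (2 ^ n * b (n + N)) \<le> 2 * (2 ^ (n + N) * b (n + N))" for n
        using b(1) by (intro mult_left_mono mult_right_mono power_increasing) auto
      have "norm (2 * (2 ^ n * b (n + N))) \<le> 2 * (2 ^ (n + N) * b (n + N))" if "n \<ge> 0" for n
        using le b(1) by simp
      with summable_ignore_initial_segment[OF sm2, of N]
      show "summable (\<lambda>n. 2 * (2 ^ n * b (n + N)))"
        by (rule summable_comparison_test')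
    qed
    finally show ?thesis .
  qed
  define K where "K = (\<lambda>x. duh L \<nu> (\<lambda>s k. - Bhat L (w s) (x s) k))"
  fix t k assume t: "t \<in> {0..T}" and k: "k \<noteq> (0 :: int ^ 3)"
  have fB: "forcing T (\<lambda>s k. - Bhat L (w s) (x s) k)" if "state T x" for x
    by (rule forcing_minus[OF forcing_Bhat[OF w that]])
  have duh_cong: "duh L \<nu> H t k = duh L \<nu> G t k" if "\<And>s. s \<in> {0..T} \<Longrightarrow> H s k = G s k" for H G
    unfolding duh_def duhamel_def using that t by (intro Bochner_Integration.integral_cong) auto
  have Kdiff: "K (\<lambda>s k. x s k - y s k) t k = K x t k - K y t k" if x: "state T x" and y: "state T y" for x y
  proof -
    have "K (\<lambda>s k. x s k - y s k) t k = duh L \<nu> (\<lambda>s k. (- Bhat L (w s) (x s) k) - (- Bhat L (w s) (y s) k)) t k"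
      unfolding K_def
    proof (rule duh_cong)
      fix s assume s: "s \<in> {0..T}"
      show "- Bhat L (w s) (\<lambda>k. x s k - y s k) k = - Bhat L (w s) (x s) k - - Bhat L (w s) (y s) k"
        using Bhat_diff_right[OF L \<alpha> driftD(1)[OF w] driftD(2)[OF w] stateD(1)[OF x s] stateD(1)[OF y s]] by simp
    qed
    also have "\<dots> = K x t k - K y t k"
      unfolding K_def by (rule duh_diff[OF fB[OF x] fB[OF y] t k])
    finally show ?thesis .
  qed
  \<comment> \<open>\<open>K\<close> maps each term of the series to the next one, so splitting off
    one more term shifts the remainder by one.\<close>
  have Ksum: "K (lin_sol w u0) t k = (\<Sum>n<N. dser w u0 (Suc n) t k) + K (r N) t k" for N
  proof (induction N)
    case (Suc N)
    have "K (r (Suc N)) t k = K (r N) t k - K (dser w u0 N) t k"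
      unfolding rS by (rule Kdiff[OF rst sd])
    also have "K (dser w u0 N) t k = dser w u0 (Suc N) t k" by (simp add: K_def)
    finally show ?case using Suc by simp
  qed (simp add: r0)
  \<comment> \<open>A uniform bound on the energy of the remainder gets multiplied by the finite
    integral of the drift energy; reading off the single mode \<open>k\<close> costs only the
    positive weight \<open>\<rho>\<close>.\<close>
  have Kr: "(\<lambda>N. K (r N) t k) \<longlonglongrightarrow> 0"
  proof -
    define W where "W = (LINT s|lebesgue_on {0..t}. drift_energy w s)"
    define \<rho> where "\<rho> = norm (wave L k) powr \<alpha>"
    have \<rho>: "\<rho> > 0" using norm_wave_pos[OF L k] by (simp add: \<rho>_def)
    have iW: "integrable (lebesgue_on {0..t}) (drift_energy w)"
      using integrable_drift_energy[OF drift_mono[OF w, of t]] t by simp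
    have W: "W \<ge> 0" using drift_energy_nonneg by (simp add: W_def)
    have le: "(\<rho> * norm (K (r N) t k))\<^sup>2 \<le> bilC / \<nu> * (W * \<epsilon> N)" for N
    proof -
      have "ennreal ((\<rho> * norm (K (r N) t k))\<^sup>2) \<le> energy L \<alpha> (K (r N) t)"
        unfolding \<rho>_def by (rule norm_coeff_le_energy)
      also have "\<dots> \<le> ennreal (bilC / \<nu>) * (\<integral>\<^sup>+s. ennreal (drift_energy w s) * energy L \<alpha> (r N s) \<partial>lebesgue_on {0..t})"
        unfolding K_def using rst[of N] t by (intro energy_duh_Bhat_le[OF w]) (auto simp: state_def)
      also have "\<dots> \<le> ennreal (bilC / \<nu>) * (\<integral>\<^sup>+s. ennreal (drift_energy w s) * ennreal (\<epsilon> N) \<partial>lebesgue_on {0..t})"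
        using t by (intro mult_left_mono nn_integral_mono rE) auto
      also have "(\<integral>\<^sup>+s. ennreal (drift_energy w s) * ennreal (\<epsilon> N) \<partial>lebesgue_on {0..t}) = ennreal W * ennreal (\<epsilon> N)"
        unfolding W_def using iW drift_energy_nonneg
        by (simp add: nn_integral_multc nn_integral_eq_integral)
      also have "ennreal (bilC / \<nu>) * (ennreal W * ennreal (\<epsilon> N)) = ennreal (bilC / \<nu> * (W * \<epsilon> N))"
        using bilC \<nu> W \<epsilon>nn by (simp add: ennreal_mult[symmetric])
      finally show ?thesis using bilC \<nu> W \<epsilon>nn by (simp add: ennreal_le_iff)
    qed
    have "(\<lambda>N. bilC / \<nu> * (W * \<epsilon> N)) \<longlonglongrightarrow> bilC / \<nu> * (W * 0)"
      by (intro tendsto_mult_left \<epsilon>0)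
    then have lim: "(\<lambda>N. bilC / \<nu> * (W * \<epsilon> N)) \<longlonglongrightarrow> 0" by simp
    have "(\<lambda>N. (\<rho> * norm (K (r N) t k))\<^sup>2) \<longlonglongrightarrow> 0"
      by (rule Lim_null_comparison[OF always_eventually lim]) (use le in simp)
    then have "(\<lambda>N. \<rho> * norm (K (r N) t k)) \<longlonglongrightarrow> 0" by (simp add: power_tendsto_0_iff)
    then have "(\<lambda>N. (1 / \<rho>) * (\<rho> * norm (K (r N) t k))) \<longlonglongrightarrow> (1 / \<rho>) * 0" by (rule tendsto_mult_left)
    then show ?thesis using \<rho> by (simp add: tendsto_norm_zero_iff)
  qed
  have "(\<lambda>N. \<Sum>n<N. dser w u0 (Suc n) t k) \<longlonglongrightarrow> (\<Sum>n. dser w u0 (Suc n) t k)"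
    by (rule summable_LIMSEQ[OF iffD2[OF summable_Suc_iff[of "\<lambda>n. dser w u0 n t k"] sm[OF t]]])
  from tendsto_add[OF this Kr]
  have "(\<lambda>N. K (lin_sol w u0) t k) \<longlonglongrightarrow> (\<Sum>n. dser w u0 (Suc n) t k) + 0"
    unfolding Ksum[symmetric] .
  then have "K (lin_sol w u0) t k = (\<Sum>n. dser w u0 (Suc n) t k)"
    by (simp add: LIMSEQ_const_iff)
  moreover have "lin_sol w u0 t k = dser w u0 0 t k + (\<Sum>n. dser w u0 (Suc n) t k)"
    unfolding lin_sol_def using suminf_split_head[OF sm[OF t, of k]] by simp
  ultimately have "lin_sol w u0 t k = heat L \<nu> u0 t k + duh L \<nu> (\<lambda>_. f) t k + K (lin_sol w u0) t k" by simp
  also have "K (lin_sol w u0) t k = duh L \<nu> (\<lambda>s k. f k - Bhat L (w s) (lin_sol w u0 s) k) t k - duh L \<nu> (\<lambda>_. f) t k"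
  proof -
    have "duh L \<nu> (\<lambda>s k. (f k - Bhat L (w s) (lin_sol w u0 s) k) - f k) t k
        = duh L \<nu> (\<lambda>s k. f k - Bhat L (w s) (lin_sol w u0 s) k) t k - duh L \<nu> (\<lambda>_. f) t k"
      by (rule duh_diff[OF forcing_diff[OF forcing_const forcing_Bhat[OF w st]] forcing_const t k])
    then show ?thesis by (simp add: K_def)
  qed
  finally show "lin_sol w u0 t k = heat L \<nu> u0 t k + duh L \<nu> (\<lambda>s k. f k - Bhat L (w s) (lin_sol w u0 s) k) t k"
    by simp
qed

text \<open>The difference of two solutions is a fixed point of the homogeneous Duhamel map, so the
  constant sequence satisfies the Volterra recursion. Its energy is then below every term x^n / n!
  of an exponential series, up to a constant factor.\<close>

lemma mild_unique:
  assumes w: "drift T w" and u: "state T u" and v: "state T v"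
    and mu: "\<And>t k. t \<in> {0..T} \<Longrightarrow> k \<noteq> 0 \<Longrightarrow> u t k = heat L \<nu> u0 t k + duh L \<nu> (\<lambda>s k. f k - Bhat L (w s) (u s) k) t k"
    and mv: "\<And>t k. t \<in> {0..T} \<Longrightarrow> k \<noteq> 0 \<Longrightarrow> v t k = heat L \<nu> u0 t k + duh L \<nu> (\<lambda>s k. f k - Bhat L (w s) (v s) k) t k"
    and t: "t \<in> {0..T}"
  shows "u t = v t"
proof -
  define d where "d = (\<lambda>t k. u t k - v t k)"
  have d: "state T d" unfolding d_def by (rule state_diff[OF u v])
  have fd: "forcing T (\<lambda>s k. - Bhat L (w s) (d s) k)" by (rule forcing_minus[OF forcing_Bhat[OF w d]])
  have eq: "d t = duh L \<nu> (\<lambda>s k. - Bhat L (w s) (d s) k) t" if t: "t \<in> {0..T}" for t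
  proof
    fix k
    show "d t k = duh L \<nu> (\<lambda>s k. - Bhat L (w s) (d s) k) t k"
    proof (cases "k = 0")
      case True
      then show ?thesis using stateD(3)[OF d t] stateD(3)[OF state_duh[OF fd] t] by simp
    next
      case False
      have "d t k = duh L \<nu> (\<lambda>s k. (f k - Bhat L (w s) (u s) k) - (f k - Bhat L (w s) (v s) k)) t k"
        unfolding d_def mu[OF t False] mv[OF t False]
        by (subst duh_diff[OF forcing_diff[OF forcing_const forcing_Bhat[OF w u]] forcing_diff[OF forcing_const forcing_Bhat[OF w v]] t False]) simp
      also have "\<dots> = duh L \<nu> (\<lambda>s k. - Bhat L (w s) (d s) k) t k"
        unfolding duh_def duhamel_def
      proof (intro Bochner_Integration.integral_cong refl)
        fix s assume "s \<in> space (lebesgue_on {0..t})"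
        then have s: "s \<in> {0..T}" using t by auto
        have "Bhat L (w s) (d s) k = Bhat L (w s) (u s) k - Bhat L (w s) (v s) k"
          using Bhat_diff_right[OF L \<alpha> driftD(1)[OF w] driftD(2)[OF w] stateD(1)[OF u s] stateD(1)[OF v s]]
          by (simp add: d_def)
        then show "exp (- (\<nu> * (norm (wave L k))\<^sup>2 * (t - s))) *\<^sub>R ((f k - Bhat L (w s) (u s) k) - (f k - Bhat L (w s) (v s) k))
          = exp (- (\<nu> * (norm (wave L k))\<^sup>2 * (t - s))) *\<^sub>R (- Bhat L (w s) (d s) k)" by simp
      qed
      finally show ?thesis .
    qed
  qed
  obtain M where M: "\<And>t. t \<in> {0..T} \<Longrightarrow> energy L \<alpha> (d t) \<le> ennreal M"
    using d unfolding state_def by blast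
  define x where "x = bilC / \<nu> * (LINT s|lebesgue_on {0..T}. drift_energy w s)"
  have le: "energy L \<alpha> (d t) \<le> ennreal (max 0 M * x ^ n / fact n)" for n
    unfolding x_def
  proof (rule volterra_energy[OF w, where d = "\<lambda>_. d"])
    show "energy L \<alpha> (d t) \<le> ennreal (max 0 M)" if "t \<in> {0..T}" for t
      using M[OF that] by (rule order_trans) (simp add: ennreal_leI)
  qed (use d eq t in \<open>auto simp: state_def\<close>)
  have "(\<lambda>n. max 0 M * (x ^ n / fact n)) \<longlonglongrightarrow> max 0 M * 0"
    using summable_LIMSEQ_zero[OF summable_exp_generic[of x]] by (intro tendsto_mult_left) (simp add: divide_inverse mult.commute)
  then have "(\<lambda>n. ennreal (max 0 M * x ^ n / fact n)) \<longlonglongrightarrow> ennreal 0"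
    by (intro tendsto_ennrealI) simp
  then have "energy L \<alpha> (d t) \<le> ennreal 0"
    by (rule LIMSEQ_le_const) (use le in blast)
  then have "\<forall>k. k \<noteq> 0 \<longrightarrow> d t k = 0"
    using energy_eq_0_iff[OF L, of \<alpha> "d t"] by simp
  then show ?thesis
    using stateD(3)[OF u t] stateD(3)[OF v t] by (auto simp: d_def fun_eq_iff) (metis right_minus_eq)
qed

end

section \<open>Measurability and continuity of vector-valued functions\<close>

lemma borel_measurable_lebesgue_on_AE:
  fixes f g :: "real \<Rightarrow> 'b :: euclidean_space"
  assumes "f \<in> borel_measurable (lebesgue_on S)" "AE x in lebesgue_on S. f x = g x" "S \<in> sets lebesgue"
  shows "g \<in> borel_measurable (lebesgue_on S)"
proof -
  have "(\<lambda>x. indicator S x *\<^sub>R f x) \<in> borel_measurable lebesgue"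
    using assms(1,3) by (subst borel_measurable_restrict_space_iff[symmetric]) auto
  moreover have "AE x in lebesgue. indicator S x *\<^sub>R f x = indicator S x *\<^sub>R g x"
    using assms(2,3) by (auto simp: AE_restrict_space_iff indicator_def)
  ultimately have "(\<lambda>x. indicator S x *\<^sub>R g x) \<in> borel_measurable lebesgue"
    by (rule borel_measurable_AE)
  then show ?thesis using assms(3) by (subst borel_measurable_restrict_space_iff) auto
qed

lemma integral_cong_AE_lebesgue_on:
  fixes f g :: "real \<Rightarrow> 'b :: euclidean_space"
  assumes "f \<in> borel_measurable (lebesgue_on S)" "AE x in lebesgue_on S. f x = g x" "S \<in> sets lebesgue"
  shows "(LINT x|lebesgue_on S. f x) = (LINT x|lebesgue_on S. g x)"
  using assms borel_measurable_lebesgue_on_AE[OF assms] by (intro integral_cong_AE)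

section \<open>Open against closed intervals, and translations\<close>

lemma AE_lebesgue_open_iff_closed: "AE x in lebesgue. x \<in> {a<..<b :: real} \<longleftrightarrow> x \<in> {a..b}"
proof -
  have "AE x in lebesgue. x \<noteq> a" "AE x in lebesgue. x \<noteq> b"
    by (rule AE_completion[OF AE_lborel_singleton])+
  then show ?thesis by eventually_elim auto
qed

lemma borel_measurable_open_iff_closed:
  fixes f :: "real \<Rightarrow> 'b :: euclidean_space"
  shows "f \<in> borel_measurable (lebesgue_on {a<..<b}) \<longleftrightarrow> f \<in> borel_measurable (lebesgue_on {a..b})"
proof -
  have 1: "AE x in lebesgue. indicator {a<..<b} x *\<^sub>R f x = indicator {a..b} x *\<^sub>R f x"
    using AE_lebesgue_open_iff_closed[of a b] by eventually_elim (simp add: indicator_def)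
  have 2: "AE x in lebesgue. indicator {a..b} x *\<^sub>R f x = indicator {a<..<b} x *\<^sub>R f x"
    using AE_lebesgue_open_iff_closed[of a b] by eventually_elim (simp add: indicator_def)
  have "(\<lambda>x. indicator {a<..<b} x *\<^sub>R f x) \<in> borel_measurable lebesgue \<longleftrightarrow> (\<lambda>x. indicator {a..b} x *\<^sub>R f x) \<in> borel_measurable lebesgue"
    using borel_measurable_AE[OF _ 1] borel_measurable_AE[OF _ 2] by (rule iffI)
  then show ?thesis by (simp add: borel_measurable_restrict_space_iff)
qed

lemma nn_integral_open_eq_closed:
  "(\<integral>\<^sup>+x. f x \<partial>lebesgue_on {a<..<b :: real}) = (\<integral>\<^sup>+x. f x \<partial>lebesgue_on {a..b})"
proof -
  have "AE x in lebesgue. f x * indicator {a<..<b} x = f x * indicator {a..b} x"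
    using AE_lebesgue_open_iff_closed[of a b] by eventually_elim (simp add: indicator_def)
  then show ?thesis by (simp add: nn_integral_restrict_space) (rule nn_integral_cong_AE)
qed

lemma AE_open_iff_closed:
  "(AE x in lebesgue_on {a<..<b :: real}. P x) \<longleftrightarrow> (AE x in lebesgue_on {a..b}. P x)"
proof -
  have "(AE x in lebesgue. x \<in> {a<..<b} \<longrightarrow> P x) \<longleftrightarrow> (AE x in lebesgue. x \<in> {a..b} \<longrightarrow> P x)"
    by (intro iffI; rule AE_mp[OF AE_lebesgue_open_iff_closed[of a b]], elim AE_mp, intro AE_I2) auto
  then show ?thesis by (simp add: AE_restrict_space_iff)
qed

lemma AE_lebesgue_translate:
  assumes "AE x in lebesgue. P x"
  shows "AE x in lebesgue. P (c + x :: real)"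
proof -
  have "{x. \<not> P x} \<in> null_sets lebesgue"
    using assms by (simp add: completion.AE_iff_null_sets)
  then have "negligible {x. \<not> P x}" by (simp add: negligible_iff_null_sets)
  then have "negligible ((+) (- c) ` {x. \<not> P x})" by (rule negligible_translation)
  moreover have "(+) (- c) ` {x. \<not> P x} = {x. \<not> P (c + x)}"
    by (force simp: image_iff)
  ultimately show ?thesis
    by (simp add: completion.AE_iff_null_sets negligible_iff_null_sets)
qed

lemma lebesgue_translation_measurable: "(\<lambda>x. c + x :: real) \<in> lebesgue \<rightarrow>\<^sub>M lebesgue"
  using lebesgue_affine_measurable[where c = "\<lambda>_::real. 1" and t = c] by simp

lemma borel_measurable_translate:
  fixes f :: "real \<Rightarrow> 'b :: euclidean_space"
  assumes "f \<in> borel_measurable (lebesgue_on {a..b})"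
  shows "(\<lambda>x. f (c + x)) \<in> borel_measurable (lebesgue_on {a - c..b - c})"
proof -
  have "(\<lambda>x. indicator {a..b} x *\<^sub>R f x) \<in> borel_measurable lebesgue"
    using assms by (subst borel_measurable_restrict_space_iff[symmetric]) auto
  from measurable_compose[OF lebesgue_translation_measurable[of c] this]
  have "(\<lambda>x. indicator {a..b} (c + x) *\<^sub>R f (c + x)) \<in> borel_measurable lebesgue" .
  also have "(\<lambda>x. indicator {a..b} (c + x) *\<^sub>R f (c + x)) = (\<lambda>x. indicator {a - c..b - c} x *\<^sub>R f (c + x))"
    by (auto simp: indicator_def fun_eq_iff)
  finally show ?thesis by (subst borel_measurable_restrict_space_iff) auto
qed

lemma AE_translate:
  assumes "AE x in lebesgue_on {a..b}. P x"
  shows "AE x in lebesgue_on {a - c..b - c}. P (c + x :: real)"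
  using AE_lebesgue_translate[of "\<lambda>x. x \<in> {a..b} \<longrightarrow> P x" c] assms
  by (simp add: AE_restrict_space_iff algebra_simps)

lemma nn_integral_translate:
  fixes f :: "real \<Rightarrow> ennreal"
  assumes "f \<in> borel_measurable (lebesgue_on {a..b})"
  shows "(\<integral>\<^sup>+x. f (c + x) \<partial>lebesgue_on {a - c..b - c}) = (\<integral>\<^sup>+x. f x \<partial>lebesgue_on {a..b})"
proof -
  have m: "(\<lambda>x. f x * indicator {a..b} x) \<in> borel_measurable lebesgue"
    using assms by (subst borel_measurable_restrict_space_iff_ennreal[symmetric]) auto
  have "(\<integral>\<^sup>+x. f x \<partial>lebesgue_on {a..b}) = (\<integral>\<^sup>+x. f x * indicator {a..b} x \<partial>lebesgue)"
    by (simp add: nn_integral_restrict_space)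
  also have "\<dots> = (\<integral>\<^sup>+x. f (c + x) * indicator {a..b} (c + x) \<partial>lebesgue)"
    using nn_integral_real_affine_lebesgue[OF m, of 1 c] by simp
  also have "\<dots> = (\<integral>\<^sup>+x. f (c + x) * indicator {a - c..b - c} x \<partial>lebesgue)"
    by (intro nn_integral_cong) (auto simp: indicator_def)
  also have "\<dots> = (\<integral>\<^sup>+x. f (c + x) \<partial>lebesgue_on {a - c..b - c})"
    by (simp add: nn_integral_restrict_space)
  finally show ?thesis ..
qed

section \<open>Bochner measurability expressed by the Fourier modes\<close>

definition sol_proj :: "real \<Rightarrow> coeffs \<Rightarrow> coeffs" where
  "sol_proj L z k = (1 / 2) *\<^sub>R (leray L k (z k) + (\<chi> i. cnj (leray L (- k) (z (- k)) $ i)))"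

lemma leray_eq_self:
  assumes "(\<Sum>i\<in>UNIV. complex_of_real (wave L k $ i) * z $ i) = 0" "k \<noteq> 0"
  shows "leray L k z = z"
  unfolding leray_def using assms by (simp add: cwave_def)

lemma cnj_cnj_vec: "(\<chi> i. cnj ((\<chi> i. cnj (z $ i)) $ i)) = (z :: complex ^ 'n)"
  by (simp add: vec_eq_iff)

lemma sol_proj_solenoidal:
  assumes "L > 0"
  shows "solenoidal L (sol_proj L z)"
  unfolding solenoidal_def
proof (intro conjI allI)
  show "sol_proj L z 0 = 0" by (simp add: sol_proj_def leray_def vec_eq_iff)
  fix k
  show "sol_proj L z (- k) = (\<chi> i. cnj (sol_proj L z k $ i))"
    by (simp add: sol_proj_def vec_eq_iff add.commute)
  have 1: "(\<Sum>i\<in>UNIV. complex_of_real (wave L k $ i) * leray L k (z k) $ i) = 0" for k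
    using leray_divergence_free[OF assms, of k] by (simp add: cwave_def)
  have "(\<Sum>i\<in>UNIV. complex_of_real (wave L k $ i) * cnj (leray L (- k) (z (- k)) $ i))
      = - cnj (\<Sum>i\<in>UNIV. complex_of_real (wave L (- k) $ i) * leray L (- k) (z (- k)) $ i)"
    by (simp add: wave_minus sum_negf)
  then have 2: "(\<Sum>i\<in>UNIV. complex_of_real (wave L k $ i) * cnj (leray L (- k) (z (- k)) $ i)) = 0"
    unfolding 1 by simp
  have "(\<Sum>i\<in>UNIV. complex_of_real (wave L k $ i) * sol_proj L z k $ i)
      = (1 / 2) *\<^sub>R ((\<Sum>i\<in>UNIV. complex_of_real (wave L k $ i) * leray L k (z k) $ i)
        + (\<Sum>i\<in>UNIV. complex_of_real (wave L k $ i) * cnj (leray L (- k) (z (- k)) $ i)))"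
    by (simp add: sol_proj_def mult_scaleR_right distrib_left sum.distrib flip: scaleR_sum_right)
  then show "(\<Sum>i\<in>UNIV. complex_of_real (wave L k $ i) * sol_proj L z k $ i) = 0"
    unfolding 1 2 by simp
qed

lemma sol_proj_eq_self:
  assumes "solenoidal L u"
  shows "sol_proj L u = u"
proof
  fix k
  show "sol_proj L u k = u k"
  proof (cases "k = 0")
    case True
    have "(\<chi> i. cnj ((0 :: complex ^ 3) $ i)) = 0" by (simp add: vec_eq_iff)
    then show ?thesis unfolding True using assms by (simp add: sol_proj_def leray_def solenoidal_def)
  next
    case False
    have div: "(\<Sum>i\<in>UNIV. complex_of_real (wave L k $ i) * u k $ i) = 0" for k
      using assms by (simp add: solenoidal_def)
    have "leray L k (u k) = u k" "leray L (- k) (u (- k)) = u (- k)"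
      using False by (auto intro!: leray_eq_self[OF div])
    moreover have "(\<chi> i. cnj (u (- k) $ i)) = u k"
      using assms cnj_cnj_vec[of "u k"] by (simp add: solenoidal_def)
    ultimately show ?thesis by (simp add: sol_proj_def flip: scaleR_2)
  qed
qed

lemma norm_sol_proj_le: "norm (sol_proj L z k) \<le> norm (z k) + norm (z (- k))"
proof -
  have "norm (sol_proj L z k) \<le> (1 / 2) * (norm (leray L k (z k)) + norm (leray L (- k) (z (- k))))"
    unfolding sol_proj_def norm_scaleR
    using norm_triangle_ineq[of "leray L k (z k)" "\<chi> i. cnj (leray L (- k) (z (- k)) $ i)"] by (simp add: norm_cnj_vec)
  then show ?thesis
    using norm_leray_le[of L k "z k"] norm_leray_le[of L "- k" "z (- k)"] by simp
qed

lemma sol_proj_tendsto: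
  assumes "\<And>k. (\<lambda>n. z n k) \<longlonglongrightarrow> u k"
  shows "(\<lambda>n. sol_proj L (z n) k) \<longlonglongrightarrow> sol_proj L u k"
proof -
  have lin: "bounded_linear (\<lambda>z :: complex ^ 3. (\<chi> i. cnj (z $ i)))"
    by (rule bounded_linear_intro[where K = 1]) (simp_all add: vec_eq_iff norm_cnj_vec)
  show ?thesis
    unfolding sol_proj_def
    by (intro tendsto_intros bounded_linear.tendsto[OF bounded_linear_leray] bounded_linear.tendsto[OF lin] assms)
qed

lemma bochner_measurable_imp_modes:
  assumes L: "L > 0" and u: "bochner_measurable L s a b u"
  shows "modes_measurable {a<..<b} u"
  unfolding modes_measurable_def
proof
  fix k
  let ?M = "lebesgue_on {a<..<b}"
  obtain g where g: "\<And>n. simple_function ?M (g n)" "\<And>n t. g n t \<in> V L s"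
    and lim: "AE t in ?M. (\<lambda>n. sdist L s (g n t) (u t)) \<longlonglongrightarrow> 0"
    and V: "AE t in ?M. u t \<in> V L s"
    using u unfolding bochner_measurable_def by auto
  have gm: "(\<lambda>t. g n t k) \<in> borel_measurable ?M" for n
    using simple_function_compose1[OF g(1)[of n], of "\<lambda>z. z k"] by (rule borel_measurable_simple_function)
  have AE: "AE t in ?M. lim (\<lambda>n. g n t k) = u t k"
    using lim V
  proof eventually_elim
    case (elim t)
    have fin: "energy L s (\<lambda>k. g n t k - u t k) < \<infinity>" for n
      using g(2)[of n t] elim(2) by (intro energy_diff_finite) (auto simp: V_iff)
    have "(\<lambda>n. energy L s (\<lambda>k. g n t k - u t k)) \<longlonglongrightarrow> 0"
      using elim(1) fin by (subst (asm) sdist_tendsto_0_iff[OF L]) auto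
    then have "(\<lambda>n. renergy L s (\<lambda>k. g n t k - u t k)) \<longlonglongrightarrow> 0"
      unfolding renergy_def using tendsto_enn2real[of "\<lambda>n. energy L s (\<lambda>k. g n t k - u t k)" 0 sequentially] by simp
    then have sq: "(\<lambda>n. sqrt (renergy L s (\<lambda>k. g n t k - u t k))) \<longlonglongrightarrow> 0"
      using tendsto_real_sqrt by fastforce
    have "(\<lambda>n. g n t k) \<longlonglongrightarrow> u t k"
    proof (cases "k = 0")
      case True
      then show ?thesis using g(2) elim(2) by (simp add: V_iff solenoidal_def)
    next
      case False
      define r where "r = norm (wave L k) powr s"
      have r: "r > 0" using norm_wave_pos[OF L False] by (simp add: r_def)
      have le: "norm (g n t k - u t k) \<le> (1 / r) * sqrt (renergy L s (\<lambda>k. g n t k - u t k))" for n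
      proof -
        have "ennreal ((r * norm (g n t k - u t k))\<^sup>2) \<le> ennreal (renergy L s (\<lambda>k. g n t k - u t k))"
          unfolding r_def ennreal_renergy[OF fin] by (rule norm_coeff_le_energy)
        then have "(r * norm (g n t k - u t k))\<^sup>2 \<le> renergy L s (\<lambda>k. g n t k - u t k)" by (simp add: ennreal_le_iff)
        then have "r * norm (g n t k - u t k) \<le> sqrt (renergy L s (\<lambda>k. g n t k - u t k))" using real_le_rsqrt by blast
        then show ?thesis using r by (simp add: field_simps)
      qed
      have "(\<lambda>n. (1 / r) * sqrt (renergy L s (\<lambda>k. g n t k - u t k))) \<longlonglongrightarrow> (1 / r) * 0"
        by (intro tendsto_mult_left sq)
      then have lim: "(\<lambda>n. (1 / r) * sqrt (renergy L s (\<lambda>k. g n t k - u t k))) \<longlonglongrightarrow> 0" by simp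
      have "(\<lambda>n. g n t k - u t k) \<longlonglongrightarrow> 0"
        by (rule Lim_null_comparison[OF always_eventually lim]) (use le in simp)
      then show ?thesis by (simp add: LIM_zero_iff)
    qed
    then show ?case by (rule limI)
  qed
  have "(\<lambda>t. lim (\<lambda>n. g n t k)) \<in> borel_measurable ?M"
    by (rule borel_measurable_lim_metric) (rule gm)
  then show "(\<lambda>t. u t k) \<in> borel_measurable ?M"
    by (rule borel_measurable_lebesgue_on_AE[OF _ AE]) simp
qed

lemma simple_function_coeffs:
  fixes g :: "'a \<Rightarrow> coeffs"
  assumes K: "finite K" and s: "\<And>k. simple_function M (\<lambda>t. z t k)"
    and g: "\<And>t. g t = G (\<lambda>k. if k \<in> K then z t k else 0)"
  shows "simple_function M g"
proof -
  have "simple_function M (\<lambda>t k. if k \<in> K then z t k else 0)"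
    using K
  proof (induction K)
    case empty
    then show ?case by simp
  next
    case (insert m K)
    have "(\<lambda>t k. if k \<in> insert m K then z t k else 0) = (\<lambda>t. (\<lambda>k. if k \<in> K then z t k else 0)(m := z t m))"
      by (auto simp: fun_eq_iff)
    then show ?case
      using simple_function_compose2[OF insert.IH s[of m], of "\<lambda>h v. h(m := v)"] by simp
  qed
  from simple_function_compose1[OF this, of G] show ?thesis by (simp only: g[symmetric])
qed

text \<open>Every mode is approximated by simple functions dominated by twice its norm. Cutting off
  to a growing box leaves finitely many modes, hence finitely many values, and dominated convergence
  over the lattice then gives convergence in V^s.\<close>

lemma modes_imp_bochner_measurable:
  assumes L: "L > 0" and u: "modes_measurable {a<..<b} u" and V: "AE t in lebesgue_on {a<..<b}. u t \<in> V L s"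
  shows "bochner_measurable L s a b u"
  unfolding bochner_measurable_def
proof (intro conjI V)
  let ?M = "lebesgue_on {a<..<b}"
  have "\<exists>F. (\<forall>i. simple_function ?M (F i)) \<and> (\<forall>t\<in>space ?M. (\<lambda>i. F i t) \<longlonglongrightarrow> u t k)
      \<and> (\<forall>i. \<forall>t\<in>space ?M. dist (F i t) 0 \<le> 2 * dist (u t k) 0)" for k
    by (rule borel_measurable_implies_sequence_metric) (use u in \<open>simp add: modes_measurable_def\<close>)
  then have "\<exists>F. \<forall>k. (\<forall>i. simple_function ?M (F k i)) \<and> (\<forall>t\<in>space ?M. (\<lambda>i. F k i t) \<longlonglongrightarrow> u t k)
      \<and> (\<forall>i. \<forall>t\<in>space ?M. dist (F k i t) 0 \<le> 2 * dist (u t k) 0)"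
    by (intro choice) blast
  then obtain F where F: "\<And>k i. simple_function ?M (F k i)" "\<And>k t. t \<in> space ?M \<Longrightarrow> (\<lambda>i. F k i t) \<longlonglongrightarrow> u t k"
    "\<And>k i t. t \<in> space ?M \<Longrightarrow> norm (F k i t) \<le> 2 * norm (u t k)"
    unfolding dist_norm diff_0_right by blast
  define Z where "Z = (\<lambda>n t k. if k \<in> {k :: int ^ 3. \<forall>i. \<bar>k $ i\<bar> \<le> int n} then F k n t else 0)"
  \<comment> \<open>Approximating the modes independently breaks the reality and divergence
    constraints. The projection restores them and fixes the limit; it adds the contributions of
    \<open>k\<close> and \<open>- k\<close>, so the majorant is 4 times the norm of the
    mode.\<close>
  define g where "g = (\<lambda>n t. sol_proj L (Z n t))"
  have Zeq: "Z n t = ftrunc n (\<lambda>k. F k n t)" for n t by (simp add: Z_def ftrunc_def fun_eq_iff)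
  show "\<exists>g. (\<forall>n::nat. simple_function ?M (g n) \<and> (\<forall>t. g n t \<in> V L s)) \<and> (AE t in ?M. (\<lambda>n. sdist L s (g n t) (u t)) \<longlonglongrightarrow> 0)"
  proof (intro exI[of _ g] conjI allI)
    show "simple_function ?M (g n)" for n
      by (rule simple_function_coeffs[OF finite_int_vec_box[of "int n"] F(1), where G = "sol_proj L"])
        (simp add: g_def Z_def)
    show gV: "g n t \<in> V L s" for n t
    proof -
      have "finite {k. g n t k \<noteq> 0}"
      proof (rule finite_subset[OF _ finite_int_vec_box[of "int n"]], safe)
        fix k i assume "g n t k \<noteq> 0"
        then have "Z n t k \<noteq> 0 \<or> Z n t (- k) \<noteq> 0"
          using norm_sol_proj_le[of L "Z n t" k] by (auto simp: g_def)
        then show "\<bar>k $ i\<bar> \<le> int n" by (auto simp: Z_def split: if_splits)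
      qed
      then show ?thesis
        using sol_proj_solenoidal[OF L] energy_finite_support by (simp only: V_iff g_def)
    qed
    show "AE t in ?M. (\<lambda>n. sdist L s (g n t) (u t)) \<longlonglongrightarrow> 0"
      using V AE_space[of ?M]
    proof eventually_elim
      case (elim t)
      have sol: "solenoidal L (u t)" and fin: "energy L s (u t) < \<infinity>" using elim(1) by (auto simp: V_iff)
      have "(\<lambda>n. energy L s (\<lambda>k. g n t k - u t k)) \<longlonglongrightarrow> 0"
      proof (rule energy_dominated_convergence[where D = "\<lambda>k. 4 * norm (u t k)"])
        have "(\<integral>\<^sup>+k. ennreal ((norm (wave L k) powr s * (4 * norm (u t k)))\<^sup>2) \<partial>count_space UNIV) = energy L s (\<lambda>k. 4 *\<^sub>R u t k)"
          by (simp add: energy_def)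
        then show "(\<integral>\<^sup>+k. ennreal ((norm (wave L k) powr s * (4 * norm (u t k)))\<^sup>2) \<partial>count_space UNIV) < \<infinity>"
          using fin by (simp add: energy_scaleR ennreal_mult_less_top)
        have nZ: "norm (Z n t k) \<le> 2 * norm (u t k)" for n k
          using F(3)[OF elim(2), of k n] by (simp add: Z_def)
        show "norm (g n t k) \<le> 4 * norm (u t k)" for n k
          using norm_sol_proj_le[of L "Z n t" k] nZ[of n k] nZ[of n "- k"] solenoidal_norm_minus[OF sol, of k]
          by (simp add: g_def)
        have ZL: "(\<lambda>n. Z n t k) \<longlonglongrightarrow> u t k" for k
        proof (rule Lim_transform_eventually[OF F(2)[OF elim(2)]])
          have "eventually (\<lambda>n. \<forall>i. \<bar>k $ i\<bar> \<le> int n) sequentially"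
          proof (rule eventually_sequentiallyI)
            fix n assume n: "n \<ge> nat (\<Sum>i\<in>UNIV. \<bar>k $ i\<bar>)"
            show "\<forall>i. \<bar>k $ i\<bar> \<le> int n"
            proof
              fix i
              have "\<bar>k $ i\<bar> \<le> (\<Sum>i\<in>UNIV. \<bar>k $ i\<bar>)" by (rule member_le_sum) auto
              then show "\<bar>k $ i\<bar> \<le> int n" using n by linarith
            qed
          qed
          then show "\<forall>\<^sub>F n in sequentially. F k n t = Z n t k"
            by eventually_elim (simp add: Z_def)
        qed
        show "(\<lambda>n. g n t k) \<longlonglongrightarrow> u t k" for k
          using sol_proj_tendsto[of "\<lambda>n. Z n t" "u t" L k, OF ZL] by (simp add: g_def sol_proj_eq_self[OF sol])
      qed
      moreover have "energy L s (\<lambda>k. g n t k - u t k) < \<infinity>" for n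
        using gV[of n t] fin by (intro energy_diff_finite) (auto simp: V_iff)
      ultimately show ?case by (subst sdist_tendsto_0_iff[OF L]) auto
    qed
  qed
qed

text \<open>A Pettis-type criterion: with countably many modes, strong measurability reduces to
  measurability of the coefficients. Square integrability then becomes a nonnegative integral that
  can be estimated freely.\<close>

lemma L2_funs_iff:
  assumes L: "L > 0"
  shows "u \<in> L2_funs L s a b \<longleftrightarrow> (AE t in lebesgue_on {a..b}. u t \<in> V L s) \<and> modes_measurable {a..b} u
    \<and> (\<integral>\<^sup>+t. energy L s (u t) \<partial>lebesgue_on {a..b}) < \<infinity>"
proof -
  let ?M = "lebesgue_on {a<..<b}"
  have mm: "modes_measurable {a<..<b} u \<longleftrightarrow> modes_measurable {a..b} u"
    by (simp add: modes_measurable_def borel_measurable_open_iff_closed)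
  have bm: "bochner_measurable L s a b u \<longleftrightarrow> (AE t in ?M. u t \<in> V L s) \<and> modes_measurable {a<..<b} u"
  proof
    assume "bochner_measurable L s a b u"
    then show "(AE t in ?M. u t \<in> V L s) \<and> modes_measurable {a<..<b} u"
      using bochner_measurable_imp_modes[OF L] unfolding bochner_measurable_def by blast
  qed (use modes_imp_bochner_measurable[OF L] in blast)
  have "integrable ?M (\<lambda>t. (snorm L s (u t))\<^sup>2) \<longleftrightarrow> (\<integral>\<^sup>+t. energy L s (u t) \<partial>?M) < \<infinity>"
    if V: "AE t in ?M. u t \<in> V L s" and m: "modes_measurable {a<..<b} u"
  proof -
    have [measurable]: "(\<lambda>t. energy L s (u t)) \<in> borel_measurable ?M" by (rule measurable_energy[OF m])
    have sq: "(snorm L s (u t))\<^sup>2 = L ^ 3 * enn2real (energy L s (u t))" for t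
      using L by (simp add: snorm_eq)
    have "(\<integral>\<^sup>+t. ennreal (norm ((snorm L s (u t))\<^sup>2)) \<partial>?M) = (\<integral>\<^sup>+t. ennreal (L ^ 3) * energy L s (u t) \<partial>?M)"
      using V by (intro nn_integral_cong_AE, eventually_elim) (use L in \<open>auto simp: sq ennreal_mult V_iff\<close>)
    also have "\<dots> = ennreal (L ^ 3) * (\<integral>\<^sup>+t. energy L s (u t) \<partial>?M)" by (rule nn_integral_cmult) measurable
    finally have "(\<integral>\<^sup>+t. ennreal (norm ((snorm L s (u t))\<^sup>2)) \<partial>?M) < \<infinity> \<longleftrightarrow> (\<integral>\<^sup>+t. energy L s (u t) \<partial>?M) < \<infinity>"
      using L by (auto simp: ennreal_mult_less_top)
    moreover have "(\<lambda>t. (snorm L s (u t))\<^sup>2) \<in> borel_measurable ?M"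
      unfolding sq by measurable
    ultimately show ?thesis by (simp only: integrable_iff_bounded simp_thms)
  qed
  then show ?thesis
    unfolding L2_funs_def mem_Collect_eq bm mm[symmetric] AE_open_iff_closed[symmetric] nn_integral_open_eq_closed[symmetric]
    by blast
qed

section \<open>Consequences of continuity in V^s\<close>

lemma mode_tendsto:
  assumes L: "L > 0" and k: "k \<noteq> 0" and fin: "\<forall>\<^sub>F n in F. energy L s (\<lambda>k. u n k - v k) < \<infinity>"
    and lim: "((\<lambda>n. energy L s (\<lambda>k. u n k - v k)) \<longlongrightarrow> 0) F"
  shows "((\<lambda>n. u n k) \<longlongrightarrow> v k) F"
proof -
  have "((\<lambda>n. renergy L s (\<lambda>k. u n k - v k)) \<longlongrightarrow> 0) F"
    unfolding renergy_def using tendsto_enn2real[of "\<lambda>n. energy L s (\<lambda>k. u n k - v k)" 0 F] lim by simp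
  then have sq: "((\<lambda>n. sqrt (renergy L s (\<lambda>k. u n k - v k))) \<longlongrightarrow> 0) F"
    using tendsto_real_sqrt by fastforce
  define r where "r = norm (wave L k) powr s"
  have r: "r > 0" using norm_wave_pos[OF L k] by (simp add: r_def)
  have le: "\<forall>\<^sub>F n in F. norm (u n k - v k) \<le> (1 / r) * sqrt (renergy L s (\<lambda>k. u n k - v k))"
    using fin
  proof eventually_elim
    case (elim n)
    have "ennreal ((r * norm (u n k - v k))\<^sup>2) \<le> ennreal (renergy L s (\<lambda>k. u n k - v k))"
      unfolding r_def ennreal_renergy[OF elim] by (rule norm_coeff_le_energy)
    then have "(r * norm (u n k - v k))\<^sup>2 \<le> renergy L s (\<lambda>k. u n k - v k)" by (simp add: ennreal_le_iff)
    then have "r * norm (u n k - v k) \<le> sqrt (renergy L s (\<lambda>k. u n k - v k))" using real_le_rsqrt by blast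
    then show ?case using r by (simp add: field_simps)
  qed
  have "((\<lambda>n. (1 / r) * sqrt (renergy L s (\<lambda>k. u n k - v k))) \<longlongrightarrow> (1 / r) * 0) F"
    by (intro tendsto_mult_left sq)
  then have "((\<lambda>n. (1 / r) * sqrt (renergy L s (\<lambda>k. u n k - v k))) \<longlongrightarrow> 0) F" by simp
  with le have "((\<lambda>n. u n k - v k) \<longlongrightarrow> 0) F" by (rule Lim_null_comparison)
  then show ?thesis by (simp add: LIM_zero_iff)
qed

lemma V_continuous_on_iff:
  assumes L: "L > 0"
  shows "V_continuous_on L s {a..b} u \<longleftrightarrow>
    (\<forall>t\<in>{a..b}. u t \<in> V L s \<and> ((\<lambda>r. energy L s (\<lambda>k. u r k - u t k)) \<longlongrightarrow> 0) (at t within {a..b}))"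
proof -
  have "((\<lambda>r. sdist L s (u r) (u t)) \<longlongrightarrow> 0) (at t within {a..b}) \<longleftrightarrow> ((\<lambda>r. energy L s (\<lambda>k. u r k - u t k)) \<longlongrightarrow> 0) (at t within {a..b})"
    if V: "\<And>t. t \<in> {a..b} \<Longrightarrow> u t \<in> V L s" and t: "t \<in> {a..b}" for t
  proof (rule sdist_tendsto_0_iff[OF L])
    have "energy L s (\<lambda>k. u r k - u t k) < \<infinity>" if "r \<in> {a..b}" for r
      using V[OF that] V[OF t] by (intro energy_diff_finite) (auto simp: V_iff)
    then show "\<forall>\<^sub>F r in at t within {a..b}. energy L s (\<lambda>k. u r k - u t k) < \<infinity>"
      unfolding eventually_at_filter by (intro always_eventually) blast
  qed
  then show ?thesis unfolding V_continuous_on_def by blast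
qed

lemma V_continuous_on_modes:
  assumes L: "L > 0" and u: "V_continuous_on L s {a..b} u"
  shows "continuous_on {a..b} (\<lambda>t. u t k)"
proof (cases "k = 0")
  case True
  have "continuous_on {a..b} (\<lambda>t. 0 :: complex ^ 3)" by simp
  then show ?thesis
    by (rule continuous_on_eq) (use True u in \<open>auto simp: V_continuous_on_def V_iff solenoidal_def\<close>)
next
  case False
  note u' = u[unfolded V_continuous_on_iff[OF L]]
  show ?thesis
    unfolding continuous_on_def
  proof
    fix t assume t: "t \<in> {a..b}"
    have "energy L s (\<lambda>k. u r k - u t k) < \<infinity>" if "r \<in> {a..b}" for r
      using u' that t by (intro energy_diff_finite) (auto simp: V_iff)
    then have "\<forall>\<^sub>F r in at t within {a..b}. energy L s (\<lambda>k. u r k - u t k) < \<infinity>"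
      unfolding eventually_at_filter by (intro always_eventually) blast
    then show "((\<lambda>t. u t k) \<longlongrightarrow> u t k) (at t within {a..b})"
      by (rule mode_tendsto[OF L False]) (use u' t in blast)
  qed
qed

text \<open>Sequential compactness of the interval: along a sequence of times with unbounded
  energies that converges to \<open>l\<close>, the distance to \<open>u l\<close> tends to 0, and
  \<open>energy_add_le\<close> bounds the energies by 2 + 2c.\<close>

lemma V_continuous_on_bounded:
  assumes L: "L > 0" and u: "V_continuous_on L s {a..b} u"
  shows "\<exists>M. \<forall>t\<in>{a..b}. energy L s (u t) \<le> ennreal M"
proof (rule ccontr)
  assume "\<not> ?thesis"
  then have "\<forall>n :: nat. \<exists>t\<in>{a..b}. \<not> energy L s (u t) \<le> ennreal (real n)" by blast
  then obtain t where t: "\<And>n :: nat. t n \<in> {a..b}" "\<And>n. \<not> energy L s (u (t n)) \<le> ennreal (real n)" by metis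
  obtain l r where l: "l \<in> {a..b}" and r: "strict_mono r" "(t \<circ> r) \<longlonglongrightarrow> l"
    using compact_Icc[of a b] t(1) unfolding compact_def by blast
  note u' = u[unfolded V_continuous_on_iff[OF L]]
  define h where "h = (\<lambda>r. energy L s (\<lambda>k. u r k - u l k))"
  have "continuous (at l within {a..b}) h"
    using u' l by (simp add: continuous_within h_def)
  from continuous_within_tendsto_compose'[OF this _ r(2)]
  have "(\<lambda>n. h (t (r n))) \<longlonglongrightarrow> h l" using t(1) by (simp add: o_def)
  then have "(\<lambda>n. h (t (r n))) \<longlonglongrightarrow> 0" by (simp add: h_def)
  then have ev: "\<forall>\<^sub>F n in sequentially. h (t (r n)) < 1"
    by (rule order_tendstoD) simp
  define c where "c = enn2real (energy L s (u l))"
  have c: "energy L s (u l) = ennreal c" using u' l by (simp add: c_def V_iff)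
  have c0: "c \<ge> 0" by (simp add: c_def)
  obtain N :: nat where N: "real N \<ge> 2 + 2 * c" using real_arch_simple by blast
  from ev eventually_ge_at_top[of N] have "\<forall>\<^sub>F n in sequentially. False"
  proof eventually_elim
    case (elim n)
    have "energy L s (u (t (r n))) = energy L s (\<lambda>k. (u (t (r n)) k - u l k) + u l k)" by simp
    also have "\<dots> \<le> 2 * h (t (r n)) + 2 * energy L s (u l)" unfolding h_def by (rule energy_add_le)
    also have "\<dots> \<le> 2 * 1 + 2 * ennreal c"
      unfolding c using elim(1) by (intro add_mono mult_left_mono) auto
    also have "\<dots> = ennreal (2 + 2 * c)" using c0 by (simp add: ennreal_mult)
    also have "\<dots> \<le> ennreal (real (r n))"
    proof (rule ennreal_leI)
      have "real N \<le> real (r n)" using elim(2) seq_suble[OF r(1), of n] by simp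
      then show "2 + 2 * c \<le> real (r n)" using N by linarith
    qed
    finally show False using t(2) by blast
  qed
  then show False by simp
qed

section \<open>Pairings integrated in time\<close>

lemma duhamel_inner:
  fixes h :: "real \<Rightarrow> 'a :: euclidean_space"
  assumes "integrable (lebesgue_on {0..t}) h"
  shows "duhamel c (\<lambda>s. h s \<bullet> a) t = duhamel c h t \<bullet> a"
proof -
  have "integrable (lebesgue_on {0..t}) (\<lambda>s. exp (- (c * (t - s))) *\<^sub>R h s)"
    using integrable_exp_scaleR[OF assms, of c "- c * t"] by (simp add: algebra_simps)
  from integral_inner_left[OF this, of a] show ?thesis
    by (simp add: duhamel_def)
qed

lemma pairing_stokes:
  "pairing L (stokes_pow L (1 / 2) u) (stokes_pow L (1 / 2) v) = pairing L (\<lambda>k. (norm (wave L k))\<^sup>2 *\<^sub>R u k) v"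
  by (simp add: pairing_def stokes_pow_def power2_eq_square mult.assoc)

lemma energy_laplace:
  assumes "L > 0"
  shows "energy L s (\<lambda>k. (norm (wave L k))\<^sup>2 *\<^sub>R u k) = energy L (s + 2) u"
  unfolding energy_def
proof (rule nn_integral_cong)
  fix k :: "int ^ 3"
  show "ennreal ((norm (wave L k) powr s * norm ((norm (wave L k))\<^sup>2 *\<^sub>R u k))\<^sup>2) = ennreal ((norm (wave L k) powr (s + 2) * norm (u k))\<^sup>2)"
  proof (cases "k = 0")
    case False
    then have "norm (wave L k) powr (s + 2) = norm (wave L k) powr s * (norm (wave L k))\<^sup>2"
      using norm_wave_pos[OF assms False] by (simp add: powr_add)
    then show ?thesis by (simp add: mult.assoc)
  qed simp
qed

lemma integrable_mult_continuous:
  fixes p \<xi> :: "real \<Rightarrow> real"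
  assumes p: "integrable (lebesgue_on {0..T}) p" and c: "continuous_on {0..T} \<xi>"
  shows "integrable (lebesgue_on {0..T}) (\<lambda>r. p r * \<xi> r)"
proof -
  have "bounded (\<xi> ` {0..T})" using c by (intro compact_imp_bounded compact_continuous_image) auto
  then obtain M where M: "\<And>r. r \<in> {0..T} \<Longrightarrow> \<bar>\<xi> r\<bar> \<le> M" unfolding bounded_iff real_norm_def by blast
  have [measurable]: "p \<in> borel_measurable (lebesgue_on {0..T})" using p by auto
  have [measurable]: "\<xi> \<in> borel_measurable (lebesgue_on {0..T})"
    by (rule continuous_imp_measurable_on_sets_lebesgue[OF c]) simp
  show ?thesis
  proof (rule Bochner_Integration.integrable_bound)
    show "integrable (lebesgue_on {0..T}) (\<lambda>r. p r * M)" using p by simp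
    show "AE r in lebesgue_on {0..T}. norm (p r * \<xi> r) \<le> norm (p r * M)"
    proof (rule AE_I2)
      fix r assume "r \<in> space (lebesgue_on {0..T})"
      then have "\<bar>\<xi> r\<bar> \<le> \<bar>M\<bar>" using M[of r] by force
      then show "norm (p r * \<xi> r) \<le> norm (p r * M)" by (simp add: abs_mult mult_left_mono)
    qed
  qed measurable
qed

text \<open>Fubini between the lattice and the time interval, with the majorant given by the sum of
  the two weighted squares. \<open>pairing\<close> agrees with the lattice integral only where the
  energy of \<open>G\<close> is finite, hence the passage through almost every time.\<close>

lemma
  fixes \<xi> :: "real \<Rightarrow> real"
  assumes L: "L > 0" and G: "modes_measurable {0..T} G"
    and fin: "(\<integral>\<^sup>+r. energy L (- s) (G r) \<partial>lebesgue_on {0..T}) < \<infinity>"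
    and v: "energy L s v < \<infinity>" "v 0 = 0" and \<xi>: "continuous_on {0..T} \<xi>"
  shows integrable_mode_pairing: "integrable (count_space UNIV) (\<lambda>k. LINT r|lebesgue_on {0..T}. (G r k \<bullet> v k) * \<xi> r)"
    and integral_pairing: "(LINT r|lebesgue_on {0..T}. pairing L (G r) v * \<xi> r)
      = L ^ 3 * (LINT k|count_space UNIV. LINT r|lebesgue_on {0..T}. (G r k \<bullet> v k) * \<xi> r)"
proof -
  let ?N = "lebesgue_on {0..T}" and ?M = "count_space (UNIV :: (int ^ 3) set)"
  interpret N: finite_measure ?N by (rule finite_measure_lebesgue_on_Icc)
  interpret M: sigma_finite_measure ?M by (rule sigma_finite_measure_count_space)
  interpret P: pair_sigma_finite ?M ?N ..
  have Gm [measurable]: "(\<lambda>r. G r k) \<in> borel_measurable ?N" for k using G by (simp add: modes_measurable_def)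
  have [measurable]: "\<xi> \<in> borel_measurable ?N"
    by (rule continuous_imp_measurable_on_sets_lebesgue[OF \<xi>]) simp
  have Em [measurable]: "(\<lambda>r. energy L (- s) (G r)) \<in> borel_measurable ?N" by (rule measurable_energy[OF G])
  have "bounded (\<xi> ` {0..T})" using \<xi> by (intro compact_imp_bounded compact_continuous_image) auto
  then obtain B where B: "\<And>r. r \<in> {0..T} \<Longrightarrow> \<bar>\<xi> r\<bar> \<le> B" unfolding bounded_iff real_norm_def by blast
  let ?F = "\<lambda>k r. (G r k \<bullet> v k) * \<xi> r"
  have pt: "ennreal \<bar>G r k \<bullet> v k\<bar> \<le> ennreal ((norm (wave L k) powr (- s) * norm (G r k))\<^sup>2) + ennreal ((norm (wave L k) powr s * norm (v k))\<^sup>2)" for r k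
  proof (cases "k = 0")
    case False
    let ?a = "norm (wave L k) powr (- s) * norm (G r k)" and ?b = "norm (wave L k) powr s * norm (v k)"
    have "norm (wave L k) powr (- s) * norm (wave L k) powr s = 1"
      using norm_wave_pos[OF L False] by (simp flip: powr_add)
    then have ab: "?a * ?b = norm (G r k) * norm (v k)"
      by (metis (no_types, opaque_lifting) mult.assoc mult.left_commute mult_1)
    have "\<bar>G r k \<bullet> v k\<bar> \<le> norm (G r k) * norm (v k)" by (rule Cauchy_Schwarz_ineq2)
    also have "\<dots> \<le> 2 * (norm (G r k) * norm (v k))" by simp
    also have "\<dots> \<le> ?a\<^sup>2 + ?b\<^sup>2" unfolding ab[symmetric] by (rule two_mult_le_sum)
    finally have "ennreal \<bar>G r k \<bullet> v k\<bar> \<le> ennreal (?a\<^sup>2 + ?b\<^sup>2)" by (rule ennreal_leI)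
    then show ?thesis by simp
  qed (simp add: v)
  have row: "(\<integral>\<^sup>+k. ennreal \<bar>G r k \<bullet> v k\<bar> \<partial>?M) \<le> energy L (- s) (G r) + energy L s v" for r
  proof -
    have "(\<integral>\<^sup>+k. ennreal \<bar>G r k \<bullet> v k\<bar> \<partial>?M) \<le> (\<integral>\<^sup>+k. ennreal ((norm (wave L k) powr (- s) * norm (G r k))\<^sup>2) + ennreal ((norm (wave L k) powr s * norm (v k))\<^sup>2) \<partial>?M)"
      by (intro nn_integral_mono pt)
    also have "\<dots> = energy L (- s) (G r) + energy L s v"
      unfolding energy_def by (subst nn_integral_add) auto
    finally show ?thesis .
  qed
  have meas [measurable]: "(\<lambda>(k, r). ?F k r) \<in> borel_measurable (?M \<Otimes>\<^sub>M ?N)"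
    by (rule measurable_pair_measure_countable1) auto
  have int: "integrable (?M \<Otimes>\<^sub>M ?N) (\<lambda>(k, r). ?F k r)"
  proof (rule integrableI_bounded)
    have "(\<integral>\<^sup>+z. ennreal (norm (case z of (k, r) \<Rightarrow> ?F k r)) \<partial>(?M \<Otimes>\<^sub>M ?N)) = (\<integral>\<^sup>+r. \<integral>\<^sup>+k. ennreal (norm (?F k r)) \<partial>?M \<partial>?N)"
      by (subst P.nn_integral_snd[symmetric]) auto
    also have "\<dots> \<le> (\<integral>\<^sup>+r. ennreal \<bar>B\<bar> * (energy L (- s) (G r) + energy L s v) \<partial>?N)"
    proof (rule nn_integral_mono)
      fix r assume "r \<in> space ?N"
      then have "\<bar>\<xi> r\<bar> \<le> \<bar>B\<bar>" using B[of r] by force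
      then have "(\<integral>\<^sup>+k. ennreal (norm (?F k r)) \<partial>?M) \<le> (\<integral>\<^sup>+k. ennreal \<bar>B\<bar> * ennreal \<bar>G r k \<bullet> v k\<bar> \<partial>?M)"
        by (intro nn_integral_mono) (auto simp: abs_mult mult_right_mono mult.commute[of _ "\<bar>\<xi> r\<bar>"] intro!: ennreal_leI simp flip: ennreal_mult)
      also have "\<dots> \<le> ennreal \<bar>B\<bar> * (energy L (- s) (G r) + energy L s v)"
        using row[of r] by (simp add: nn_integral_cmult mult_left_mono)
      finally show "(\<integral>\<^sup>+k. ennreal (norm (?F k r)) \<partial>?M) \<le> ennreal \<bar>B\<bar> * (energy L (- s) (G r) + energy L s v)" .
    qed
    also have "\<dots> = ennreal \<bar>B\<bar> * ((\<integral>\<^sup>+r. energy L (- s) (G r) \<partial>?N) + energy L s v * emeasure ?N (space ?N))"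
      by (subst nn_integral_cmult) (auto simp: nn_integral_add)
    also have "\<dots> < \<infinity>"
      using fin v N.emeasure_finite[of "space ?N"] by (simp add: ennreal_mult_less_top less_top[symmetric] ennreal_mult_eq_top_iff)
    finally show "(\<integral>\<^sup>+z. ennreal (norm (case z of (k, r) \<Rightarrow> ?F k r)) \<partial>(?M \<Otimes>\<^sub>M ?N)) < \<infinity>" .
  qed measurable
  show "integrable ?M (\<lambda>k. LINT r|?N. ?F k r)" using P.integrable_fst[OF int] by simp
  have "AE r in ?N. energy L (- s) (G r) \<noteq> \<infinity>"
    using fin by (intro nn_integral_PInf_AE) auto
  then have AE: "AE r in ?N. (L ^ 3 * (LINT k|?M. ?F k r)) = pairing L (G r) v * \<xi> r"
  proof eventually_elim
    case (elim r)
    have "(\<integral>\<^sup>+k. ennreal (norm (G r k \<bullet> v k)) \<partial>?M) < \<infinity>"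
      unfolding real_norm_def by (rule order_le_less_trans[OF row]) (use elim v(1) in \<open>simp add: less_top[symmetric]\<close>)
    then have "integrable ?M (\<lambda>k. G r k \<bullet> v k)" by (intro integrableI_bounded) auto
    from infsum_eq_integral_count_space[OF this] show ?case by (simp add: pairing_def)
  qed
  have "integrable ?N (\<lambda>r. LINT k|?M. ?F k r)" using P.integrable_snd[OF int] by simp
  then have "(\<lambda>r. L ^ 3 * (LINT k|?M. ?F k r)) \<in> borel_measurable ?N" by auto
  from integral_cong_AE_lebesgue_on[OF this AE]
  have "(LINT r|?N. pairing L (G r) v * \<xi> r) = (LINT r|?N. L ^ 3 * (LINT k|?M. ?F k r))" by simp
  also have "\<dots> = L ^ 3 * (LINT k|?M. LINT r|?N. ?F k r)"
    using P.Fubini_integral[OF int] by simp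
  finally show "(LINT r|?N. pairing L (G r) v * \<xi> r) = L ^ 3 * (LINT k|?M. LINT r|?N. ?F k r)" .
qed

lemma zero_in_V [simp]: "(\<lambda>k. 0) \<in> V L s"
  by (simp add: V_iff)

section \<open>Weak solutions are mild solutions\<close>

locale delay_navier_stokes = navier_stokes +
  fixes \<mu> :: real
  assumes \<mu>: "\<mu> > 0"
begin

text \<open>An L2 function takes values in V^(1+\<alpha>) only almost everywhere, while
  \<open>drift\<close> asks for it at every time. Resetting the exceptional values to zero changes
  no integral over time.\<close>

definition vfix :: "(real \<Rightarrow> coeffs) \<Rightarrow> real \<Rightarrow> coeffs" where
  "vfix u t = (if u t \<in> V L (1 + \<alpha>) then u t else (\<lambda>k. 0))"

definition delayed :: "(real \<Rightarrow> coeffs) \<Rightarrow> real \<Rightarrow> coeffs" where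
  "delayed u t = vfix u (t - \<mu>)"

abbreviation mild_forcing :: "(real \<Rightarrow> coeffs) \<Rightarrow> real \<Rightarrow> coeffs" where
  "mild_forcing u \<equiv> (\<lambda>s k. f k - Bhat L (delayed u s) (u s) k)"

definition mild :: "coeffs \<Rightarrow> real \<Rightarrow> (real \<Rightarrow> coeffs) \<Rightarrow> bool" where
  "mild u0 T u \<longleftrightarrow> (\<forall>t\<in>{0..T}. \<forall>k. k \<noteq> 0 \<longrightarrow> u t k = heat L \<nu> u0 t k + duh L \<nu> (mild_forcing u) t k)"

lemma L2_fun_drift:
  assumes u: "u \<in> L2_funs L (1 + \<alpha>) (- \<mu>) T"
  shows "AE r in lebesgue_on {0..T}. u (r - \<mu>) \<in> V L (1 + \<alpha>)" and "drift T (delayed u)"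
proof -
  note u' = u[unfolded L2_funs_iff[OF L]]
  have "AE r in lebesgue_on {- \<mu> - - \<mu>..T - - \<mu>}. u (- \<mu> + r) \<in> V L (1 + \<alpha>)"
    using u' by (intro AE_translate) blast
  moreover have "{- \<mu> - - \<mu>..T - - \<mu>} = {0..T + \<mu>}" by simp
  ultimately have "AE r in lebesgue_on {0..T + \<mu>}. u (r - \<mu>) \<in> V L (1 + \<alpha>)"
    by (simp only: add.commute[of "- \<mu>"] diff_conv_add_uminus)
  then show "AE r in lebesgue_on {0..T}. u (r - \<mu>) \<in> V L (1 + \<alpha>)"
    using \<mu> by (simp add: AE_restrict_space_iff) (elim AE_mp, intro AE_I2, auto)
  have AE: "AE t in lebesgue_on {- \<mu>..T}. u t = vfix u t"
    using conjunct1[OF u'] by eventually_elim (simp add: vfix_def)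
  have vm: "(\<lambda>t. vfix u t k) \<in> borel_measurable (lebesgue_on {- \<mu>..T})" for k
    by (rule borel_measurable_lebesgue_on_AE[where f = "\<lambda>t. u t k"])
       (use u' AE in \<open>auto simp: modes_measurable_def elim: eventually_mono\<close>)
  have em: "(\<lambda>t. energy L (1 + \<alpha>) (vfix u t)) \<in> borel_measurable (lebesgue_on {- \<mu>..T})"
    by (rule measurable_energy) (simp add: modes_measurable_def vm)
  show "drift T (delayed u)"
    unfolding drift_def
  proof (intro conjI allI)
    show "delayed u t \<in> V L (1 + \<alpha>)" for t by (simp add: delayed_def vfix_def)
    show "modes_measurable {0..T} (delayed u)"
      unfolding modes_measurable_def
    proof
      fix k
      have "(\<lambda>t. vfix u (- \<mu> + t) k) \<in> borel_measurable (lebesgue_on {- \<mu> - - \<mu>..T - - \<mu>})"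
        by (rule borel_measurable_translate[OF vm])
      moreover have "{- \<mu> - - \<mu>..T - - \<mu>} = {0..T + \<mu>}" by simp
      ultimately have "(\<lambda>t. delayed u t k) \<in> borel_measurable (lebesgue_on {0..T + \<mu>})"
        unfolding delayed_def by (simp only: add.commute[of "- \<mu>"] diff_conv_add_uminus)
      then show "(\<lambda>t. delayed u t k) \<in> borel_measurable (lebesgue_on {0..T})"
        by (rule lebesgue_on_measurable_mono) (use \<mu> in auto)
    qed
    have "(\<integral>\<^sup>+t. energy L (1 + \<alpha>) (delayed u t) \<partial>lebesgue_on {0..T}) \<le> (\<integral>\<^sup>+t. energy L (1 + \<alpha>) (delayed u t) \<partial>lebesgue_on {0..T + \<mu>})"
      using \<mu> by (intro nn_integral_lebesgue_on_mono) auto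
    also have "\<dots> = (\<integral>\<^sup>+t. energy L (1 + \<alpha>) (vfix u (- \<mu> + t)) \<partial>lebesgue_on {- \<mu> - - \<mu>..T - - \<mu>})"
      by (simp add: delayed_def)
    also have "\<dots> = (\<integral>\<^sup>+t. energy L (1 + \<alpha>) (vfix u t) \<partial>lebesgue_on {- \<mu>..T})"
      by (rule nn_integral_translate[OF em])
    also have "\<dots> \<le> (\<integral>\<^sup>+t. energy L (1 + \<alpha>) (u t) \<partial>lebesgue_on {- \<mu>..T})"
      by (intro nn_integral_mono) (simp add: vfix_def)
    also have "\<dots> < \<infinity>" using u' by blast
    finally show "(\<integral>\<^sup>+t. energy L (1 + \<alpha>) (delayed u t) \<partial>lebesgue_on {0..T}) < \<infinity>" .
  qed
qed

lemma state_V_continuous: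
  assumes u: "V_continuous_on L \<alpha> {0..T} u"
  shows "state T u"
proof -
  have "modes_measurable {0..T} u"
    unfolding modes_measurable_def
    by (auto intro!: continuous_imp_measurable_on_sets_lebesgue V_continuous_on_modes[OF L u])
  then show ?thesis
    using V_continuous_on_bounded[OF L u] u unfolding state_def V_continuous_on_def by blast
qed

lemma forcing_mild:
  assumes "u \<in> L2_funs L (1 + \<alpha>) (- \<mu>) T" "V_continuous_on L \<alpha> {0..T} u"
  shows "forcing T (mild_forcing u)"
  by (intro forcing_diff forcing_const forcing_Bhat L2_fun_drift(2) state_V_continuous assms)

lemma AE_B_op_eq:
  assumes u: "u \<in> L2_funs L (1 + \<alpha>) (- \<mu>) T"
  shows "AE r in lebesgue_on {0..T}. B_op L (1 + \<alpha>) \<alpha> (1 + \<alpha>) (u (r - \<mu>)) (u r) = Bhat L (delayed u r) (u r)"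
proof -
  have "AE r in lebesgue_on {0..T}. u r \<in> V L (1 + \<alpha>)"
    using conjunct1[OF u[unfolded L2_funs_iff[OF L]]] \<mu>
    by (simp add: AE_restrict_space_iff) (elim AE_mp, intro AE_I2, auto)
  with L2_fun_drift(1)[OF u] show ?thesis
    by eventually_elim (simp add: B_op_eq_Bhat[OF L \<alpha>] delayed_def vfix_def)
qed

lemma weak_solution_imp_mild:
  assumes T: "T > 0" and u: "weak_solution L \<mu> \<nu> \<alpha> f \<phi> u0 T u"
  shows "mild u0 T u"
  unfolding mild_def
proof (intro ballI allI impI)
  have uL: "u \<in> L2_funs L (1 + \<alpha>) (- \<mu>) T" and uV: "V_continuous_on L \<alpha> {0..T} u" and u0: "u 0 = u0"
    using u by (auto simp: weak_solution_def)
  note weak = u[unfolded weak_solution_def, THEN conjunct2, THEN conjunct2, THEN conjunct2, THEN conjunct2, rule_format]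
  note st = state_V_continuous[OF uV]
  note fc = forcing_mild[OF uL uV]
  have u0V: "u0 \<in> V L \<alpha>" using uV u0 T by (auto simp: V_continuous_on_def)
  let ?M = "lebesgue_on {0..T}"
  fix t k assume t: "t \<in> {0..T}" and k: "k \<noteq> (0 :: int ^ 3)"
  define c where "c = \<nu> * (norm (wave L k))\<^sup>2"
  \<comment> \<open>\<open>a\<close> is the defect in the mild formula. It is divergence free, so
    the mode with amplitude \<open>a\<close> is a legitimate test field, and the scalar result turns
    into \<open>a \<bullet> a = 0\<close>.\<close>
  define a where "a = u t k - (heat L \<nu> u0 t k + duh L \<nu> (mild_forcing u) t k)"
  have "solenoidal L (\<lambda>k. u t k - (heat L \<nu> u0 t k + duh L \<nu> (mild_forcing u) t k))"
    using stateD(2)[OF st t] stateD(2)[OF state_add_heat_duh[OF u0V fc] t] by (rule solenoidal_diff)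
  then have adiv: "(\<Sum>i\<in>UNIV. complex_of_real (wave L k $ i) * a $ i) = 0"
    by (simp add: solenoidal_def a_def)
  have v: "cmode k a \<in> V L (\<alpha> + 1)" by (rule cmode_in_V[OF k adiv])
  have fB: "forcing T (\<lambda>s. Bhat L (delayed u s) (u s))"
    by (rule forcing_Bhat[OF L2_fun_drift(2)[OF uL] st])
  have intB: "integrable ?M (\<lambda>s. Bhat L (delayed u s) (u s) k)"
    using fB k by (intro integrable_mode(1)[OF L, where s = "\<alpha> - 1"]) (auto simp: forcing_def)
  have intH: "integrable ?M (\<lambda>s. mild_forcing u s k)"
    using fc k by (intro integrable_mode(1)[OF L, where s = "\<alpha> - 1"]) (auto simp: forcing_def)
  define c3 where "c3 = 2 * L ^ 3"
  have c3: "c3 > 0" using L by (simp add: c3_def)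
  have main: "(LINT r|?M. (u r k \<bullet> a) * deriv \<psi> r) = c * (LINT r|?M. (u r k \<bullet> a) * \<psi> r) - (LINT r|?M. (mild_forcing u r k \<bullet> a) * \<psi> r)"
    if \<psi>: "\<psi> \<in> test_functions T" for \<psi>
  proof -
    have \<psi>c: "continuous_on {0..T} \<psi>" using test_functionsD(1)[OF \<psi>] by (rule smooth_continuous)
    have e1: "(LINT r|?M. pairing L (u r) (cmode k a) * deriv \<psi> r) = c3 * (LINT r|?M. (u r k \<bullet> a) * deriv \<psi> r)"
      unfolding integral_mult_right_zero[symmetric]
      by (intro Bochner_Integration.integral_cong) (auto simp: pairing_cmode[OF k stateD(2)[OF st]] c3_def)
    have lap: "solenoidal L (\<lambda>k. (norm (wave L k))\<^sup>2 *\<^sub>R u r k)" if "r \<in> {0..T}" for r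
      using stateD(2)[OF st that]
      by (auto simp: solenoidal_def vec_eq_iff wave_minus mult_scaleR_right simp flip: scaleR_sum_right)
    have "(LINT r|?M. pairing L (stokes_pow L (1 / 2) (u r)) (stokes_pow L (1 / 2) (cmode k a)) * \<psi> r)
        = (LINT r|?M. (c3 * (norm (wave L k))\<^sup>2) * ((u r k \<bullet> a) * \<psi> r))"
      unfolding pairing_stokes
      by (intro Bochner_Integration.integral_cong) (auto simp: pairing_cmode[OF k lap] c3_def)
    also have "\<dots> = (c3 * (norm (wave L k))\<^sup>2) * (LINT r|?M. (u r k \<bullet> a) * \<psi> r)"
      by (rule integral_mult_right_zero)
    finally have e2: "\<nu> * (LINT r|?M. pairing L (stokes_pow L (1 / 2) (u r)) (stokes_pow L (1 / 2) (cmode k a)) * \<psi> r)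
        = c3 * (c * (LINT r|?M. (u r k \<bullet> a) * \<psi> r))"
      by (simp only: c_def mult_ac)
    have iB: "integrable ?M (\<lambda>r. (Bhat L (delayed u r) (u r) k \<bullet> a) * \<psi> r)"
      by (intro integrable_mult_continuous \<psi>c integrable_inner_left intB)
    have "(LINT r|?M. c3 * ((Bhat L (delayed u r) (u r) k \<bullet> a) * \<psi> r))
        = (LINT r|?M. pairing L (B_op L (1 + \<alpha>) \<alpha> (1 + \<alpha>) (u (r - \<mu>)) (u r)) (cmode k a) * \<psi> r)"
    proof (rule integral_cong_AE_lebesgue_on)
      show "(\<lambda>r. c3 * ((Bhat L (delayed u r) (u r) k \<bullet> a) * \<psi> r)) \<in> borel_measurable ?M"
        using iB by auto
      show "AE r in ?M. c3 * ((Bhat L (delayed u r) (u r) k \<bullet> a) * \<psi> r)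
          = pairing L (B_op L (1 + \<alpha>) \<alpha> (1 + \<alpha>) (u (r - \<mu>)) (u r)) (cmode k a) * \<psi> r"
        using AE_B_op_eq[OF uL] AE_space[of ?M]
      proof eventually_elim
        case (elim r)
        then have "solenoidal L (Bhat L (delayed u r) (u r))" using fB by (auto simp: forcing_def)
        then show ?case unfolding elim(1) by (simp add: pairing_cmode[OF k] c3_def)
      qed
    qed simp
    then have e3: "(LINT r|?M. pairing L (B_op L (1 + \<alpha>) \<alpha> (1 + \<alpha>) (u (r - \<mu>)) (u r)) (cmode k a) * \<psi> r)
        = c3 * (LINT r|?M. (Bhat L (delayed u r) (u r) k \<bullet> a) * \<psi> r)" by simp
    have fsol: "solenoidal L f" using f by (simp add: V_iff)
    have e4: "(LINT r|?M. pairing L f (cmode k a) * \<psi> r) = c3 * (LINT r|?M. (f k \<bullet> a) * \<psi> r)"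
      by (simp add: pairing_cmode[OF k fsol] c3_def)
    have "integrable ?M (\<lambda>r. (f k \<bullet> a) * \<psi> r)"
      by (intro integrable_mult_continuous \<psi>c) simp
    then have e5: "(LINT r|?M. (mild_forcing u r k \<bullet> a) * \<psi> r)
        = (LINT r|?M. (f k \<bullet> a) * \<psi> r) - (LINT r|?M. (Bhat L (delayed u r) (u r) k \<bullet> a) * \<psi> r)"
      using iB by (simp add: inner_diff_left left_diff_distrib)
    have "c3 * (- (LINT r|?M. (u r k \<bullet> a) * deriv \<psi> r) + c * (LINT r|?M. (u r k \<bullet> a) * \<psi> r)
        + (LINT r|?M. (Bhat L (delayed u r) (u r) k \<bullet> a) * \<psi> r)) = c3 * (LINT r|?M. (f k \<bullet> a) * \<psi> r)"
      using weak[OF v \<psi>] unfolding e1 e2 e3 e4 by (simp add: algebra_simps)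
    then show ?thesis using c3 unfolding e5 by simp
  qed
  have "u t k \<bullet> a = exp (- (c * t)) * (u 0 k \<bullet> a) + duhamel c (\<lambda>r. mild_forcing u r k \<bullet> a) t"
    by (rule weak_imp_mild[OF T _ _ main t])
      (auto intro!: continuous_intros V_continuous_on_modes[OF L uV] integrable_inner_left intH)
  also have "duhamel c (\<lambda>r. mild_forcing u r k \<bullet> a) t = duhamel c (\<lambda>r. mild_forcing u r k) t \<bullet> a"
    by (rule duhamel_inner, rule integrable_subinterval[OF intH]) (use t in auto)
  finally have "a \<bullet> a = 0"
    using u0 by (simp add: a_def heat_def duh_def c_def inner_diff_left inner_add_left)
  then show "u t k = heat L \<nu> u0 t k + duh L \<nu> (mild_forcing u) t k" by (simp add: a_def)
qed

text \<open>Each mode satisfies the scalar weak equation tested with the amplitude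
  \<open>v k\<close>. To sum these identities over the lattice, every one of the four terms must be
  summable on its own, which is where the energy bounds enter.\<close>

lemma mild_imp_weak_solution:
  assumes T: "T > 0" and uL: "u \<in> L2_funs L (1 + \<alpha>) (- \<mu>) T" and uV: "V_continuous_on L \<alpha> {0..T} u"
    and u0: "u 0 = u0" and \<phi>: "AE t in lebesgue_on {- \<mu><..<0}. u t = \<phi> t" and mild: "mild u0 T u"
  shows "weak_solution L \<mu> \<nu> \<alpha> f \<phi> u0 T u"
  unfolding weak_solution_def
proof (intro conjI ballI uL uV u0 \<phi>)
  note st = state_V_continuous[OF uV]
  note fc = forcing_mild[OF uL uV]
  have fB: "forcing T (\<lambda>s. Bhat L (delayed u s) (u s))"
    by (rule forcing_Bhat[OF L2_fun_drift(2)[OF uL] st])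
  let ?M = "lebesgue_on {0..T}" and ?K = "count_space (UNIV :: (int ^ 3) set)"
  fix v \<psi> assume v: "v \<in> V L (\<alpha> + 1)" and \<psi>: "\<psi> \<in> test_functions T"
  have vE: "energy L (1 + \<alpha>) v < \<infinity>" and v0: "v 0 = 0"
    using v by (auto simp: V_iff solenoidal_def add.commute)
  have \<psi>c: "continuous_on {0..T} \<psi>" "continuous_on {0..T} (deriv \<psi>)"
    using test_functionsD(1)[OF \<psi>] by (auto intro: smooth_continuous smooth_deriv)
  have um: "modes_measurable {0..T} u" using st by (simp add: state_def)
  have uE: "(\<integral>\<^sup>+r. energy L (1 + \<alpha>) (u r) \<partial>?M) < \<infinity>"
  proof -
    have "(\<integral>\<^sup>+r. energy L (1 + \<alpha>) (u r) \<partial>?M) \<le> (\<integral>\<^sup>+r. energy L (1 + \<alpha>) (u r) \<partial>lebesgue_on {- \<mu>..T})"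
      using \<mu> by (intro nn_integral_lebesgue_on_mono) auto
    also have "\<dots> < \<infinity>" using uL unfolding L2_funs_iff[OF L] by blast
    finally show ?thesis .
  qed
  have lower: "(\<integral>\<^sup>+r. energy L s (G r) \<partial>?M) < \<infinity>"
    if "s \<le> s'" "(\<integral>\<^sup>+r. energy L s' (G r) \<partial>?M) < \<infinity>" "modes_measurable {0..T} G" for s s' G
  proof -
    have "(\<integral>\<^sup>+r. energy L s (G r) \<partial>?M) \<le> (\<integral>\<^sup>+r. ennreal ((2 * pi / L) powr (2 * (s - s'))) * energy L s' (G r) \<partial>?M)"
      by (intro nn_integral_mono energy_exponent_le[OF L that(1)])
    also have "\<dots> = ennreal ((2 * pi / L) powr (2 * (s - s'))) * (\<integral>\<^sup>+r. energy L s' (G r) \<partial>?M)"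
      by (intro nn_integral_cmult measurable_energy that(3))
    also have "\<dots> < \<infinity>" using that(2) by (simp add: ennreal_mult_less_top)
    finally show ?thesis .
  qed
  \<comment> \<open>The test field lies in V^(1+\<alpha>), so every term has to be square integrable
    in time with values in the dual. For the Laplacian this amounts to V^(1-\<alpha>) regularity of
    \<open>u\<close>; for \<open>Bhat\<close> and \<open>f\<close> it follows from
    V^(\<alpha>-1).\<close>
  have E1: "(\<integral>\<^sup>+r. energy L (- (1 + \<alpha>)) (u r) \<partial>?M) < \<infinity>"
    by (rule lower[OF _ uE um]) (use \<alpha> in simp)
  have lm: "modes_measurable {0..T} (\<lambda>r k. (norm (wave L k))\<^sup>2 *\<^sub>R u r k)"
    using um unfolding modes_measurable_def by (auto intro!: borel_measurable_scaleR)
  have E2: "(\<integral>\<^sup>+r. energy L (- (1 + \<alpha>)) (\<lambda>k. (norm (wave L k))\<^sup>2 *\<^sub>R u r k) \<partial>?M) < \<infinity>"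
    unfolding energy_laplace[OF L] by (rule lower[OF _ uE um]) (use \<alpha> in simp)
  have Bm: "modes_measurable {0..T} (\<lambda>s. Bhat L (delayed u s) (u s))" using fB by (simp add: forcing_def)
  have E3: "(\<integral>\<^sup>+r. energy L (- (1 + \<alpha>)) (Bhat L (delayed u r) (u r)) \<partial>?M) < \<infinity>"
    by (rule lower[OF _ _ Bm, where s' = "\<alpha> - 1"]) (use \<alpha> fB in \<open>auto simp: forcing_def\<close>)
  have fm: "modes_measurable {0..T} (\<lambda>_. f)" using forcing_const[of T] by (simp add: forcing_def)
  have E4: "(\<integral>\<^sup>+r. energy L (- (1 + \<alpha>)) f \<partial>?M) < \<infinity>"
    by (rule lower[OF _ _ fm, where s' = "\<alpha> - 1"]) (use \<alpha> forcing_const[of T] in \<open>auto simp: forcing_def\<close>)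
  define I1 I2 I3 I4 where "I1 = (\<lambda>k. LINT r|?M. (u r k \<bullet> v k) * deriv \<psi> r)"
    and "I2 = (\<lambda>k. LINT r|?M. ((norm (wave L k))\<^sup>2 *\<^sub>R u r k \<bullet> v k) * \<psi> r)"
    and "I3 = (\<lambda>k. LINT r|?M. (Bhat L (delayed u r) (u r) k \<bullet> v k) * \<psi> r)"
    and "I4 = (\<lambda>k. LINT r|?M. (f k \<bullet> v k) * \<psi> r)"
  have i: "integrable ?K I1" "integrable ?K I2" "integrable ?K I3" "integrable ?K I4"
    unfolding I1_def I2_def I3_def I4_def
    by (rule integrable_mode_pairing[OF L um E1 vE v0 \<psi>c(2)] integrable_mode_pairing[OF L lm E2 vE v0 \<psi>c(1)]
        integrable_mode_pairing[OF L Bm E3 vE v0 \<psi>c(1)] integrable_mode_pairing[OF L fm E4 vE v0 \<psi>c(1)])+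
  have s1: "(LINT r|?M. pairing L (u r) v * deriv \<psi> r) = L ^ 3 * (LINT k|?K. I1 k)"
    unfolding I1_def by (rule integral_pairing[OF L um E1 vE v0 \<psi>c(2)])
  have s2: "(LINT r|?M. pairing L (stokes_pow L (1 / 2) (u r)) (stokes_pow L (1 / 2) v) * \<psi> r) = L ^ 3 * (LINT k|?K. I2 k)"
    unfolding pairing_stokes I2_def by (rule integral_pairing[OF L lm E2 vE v0 \<psi>c(1)])
  have s4: "(LINT r|?M. pairing L f v * \<psi> r) = L ^ 3 * (LINT k|?K. I4 k)"
    unfolding I4_def by (rule integral_pairing[OF L fm E4 vE v0 \<psi>c(1)])
  have s3': "(LINT r|?M. pairing L (Bhat L (delayed u r) (u r)) v * \<psi> r) = L ^ 3 * (LINT k|?K. I3 k)"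
    unfolding I3_def by (rule integral_pairing[OF L Bm E3 vE v0 \<psi>c(1)])
  have pm: "(\<lambda>r. pairing L (Bhat L (delayed u r) (u r)) v * \<psi> r) \<in> borel_measurable ?M"
  proof -
    have [measurable]: "(\<lambda>r. LINT k|?K. (Bhat L (delayed u r) (u r) k \<bullet> v k)) \<in> borel_measurable ?M"
      using Bm by (intro borel_measurable_integral_count_space borel_measurable_inner) (auto simp: modes_measurable_def)
    have [measurable]: "\<psi> \<in> borel_measurable ?M"
      by (rule continuous_imp_measurable_on_sets_lebesgue[OF \<psi>c(1)]) simp
    have "(\<lambda>r. L ^ 3 * (LINT k|?K. (Bhat L (delayed u r) (u r) k \<bullet> v k)) * \<psi> r) \<in> borel_measurable ?M"
      by measurable
    moreover have "AE r in ?M. L ^ 3 * (LINT k|?K. (Bhat L (delayed u r) (u r) k \<bullet> v k)) * \<psi> r = pairing L (Bhat L (delayed u r) (u r)) v * \<psi> r"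
    proof -
      have "AE r in ?M. energy L (- (1 + \<alpha>)) (Bhat L (delayed u r) (u r)) \<noteq> \<infinity>"
        using E3 Bm by (intro nn_integral_PInf_AE measurable_energy) auto
      then show ?thesis
      proof eventually_elim
        case (elim r)
        then have "integrable ?K (\<lambda>k. Bhat L (delayed u r) (u r) k \<bullet> v k)"
          using vE by (intro integrable_pairing[OF L, where s = "1 + \<alpha>"]) (auto simp: less_top)
        from infsum_eq_integral_count_space[OF this] show ?case by (simp add: pairing_def)
      qed
    qed
    ultimately show ?thesis by (rule borel_measurable_lebesgue_on_AE) simp
  qed
  have s3: "(LINT r|?M. pairing L (B_op L (1 + \<alpha>) \<alpha> (1 + \<alpha>) (u (r - \<mu>)) (u r)) v * \<psi> r) = L ^ 3 * (LINT k|?K. I3 k)"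
  proof -
    have "AE r in ?M. pairing L (Bhat L (delayed u r) (u r)) v * \<psi> r
        = pairing L (B_op L (1 + \<alpha>) \<alpha> (1 + \<alpha>) (u (r - \<mu>)) (u r)) v * \<psi> r"
      using AE_B_op_eq[OF uL] by eventually_elim simp
    from integral_cong_AE_lebesgue_on[OF pm this] show ?thesis using s3' by simp
  qed
  have modes: "- I1 k + \<nu> * I2 k + I3 k = I4 k" for k
  proof (cases "k = 0")
    case True
    then show ?thesis by (simp add: I1_def I2_def I3_def I4_def v0)
  next
    case False
    let ?c = "\<nu> * (norm (wave L k))\<^sup>2"
    have intB: "integrable ?M (\<lambda>s. Bhat L (delayed u s) (u s) k)"
      using fB False by (intro integrable_mode(1)[OF L, where s = "\<alpha> - 1"]) (auto simp: forcing_def)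
    have intH: "integrable ?M (\<lambda>s. mild_forcing u s k)"
      using fc False by (intro integrable_mode(1)[OF L, where s = "\<alpha> - 1"]) (auto simp: forcing_def)
    have "(LINT r|?M. (u r k \<bullet> v k) * deriv \<psi> r) = ?c * (LINT r|?M. (u r k \<bullet> v k) * \<psi> r) - (LINT r|?M. (mild_forcing u r k \<bullet> v k) * \<psi> r)"
    proof (rule mild_imp_weak[OF T _ _ \<psi>, where ?y0.0 = "u0 k \<bullet> v k"])
      show "integrable ?M (\<lambda>r. mild_forcing u r k \<bullet> v k)" by (intro integrable_inner_left intH)
      fix t assume t: "t \<in> {0..T}"
      have "duhamel ?c (\<lambda>r. mild_forcing u r k \<bullet> v k) t = duhamel ?c (\<lambda>r. mild_forcing u r k) t \<bullet> v k"
        by (rule duhamel_inner, rule integrable_subinterval[OF intH]) (use t in auto)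
      then show "u t k \<bullet> v k = exp (- (?c * t)) * (u0 k \<bullet> v k) + duhamel ?c (\<lambda>r. mild_forcing u r k \<bullet> v k) t"
        using mild t False by (simp add: mild_def heat_def duh_def inner_add_left)
    qed
    moreover have "(LINT r|?M. (mild_forcing u r k \<bullet> v k) * \<psi> r) = I4 k - I3 k"
    proof -
      have "integrable ?M (\<lambda>r. (f k \<bullet> v k) * \<psi> r)" "integrable ?M (\<lambda>r. (Bhat L (delayed u r) (u r) k \<bullet> v k) * \<psi> r)"
        by (intro integrable_mult_continuous \<psi>c integrable_inner_left intB; simp)+
      then show ?thesis by (simp add: I3_def I4_def inner_diff_left left_diff_distrib)
    qed
    moreover have "I2 k = (norm (wave L k))\<^sup>2 * (LINT r|?M. (u r k \<bullet> v k) * \<psi> r)"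
      by (simp add: I2_def mult.assoc)
    ultimately show ?thesis by (simp add: I1_def)
  qed
  have "- (LINT k|?K. I1 k) + \<nu> * (LINT k|?K. I2 k) + (LINT k|?K. I3 k) = (LINT k|?K. - I1 k + \<nu> * I2 k + I3 k)"
    using i by simp
  also have "\<dots> = (LINT k|?K. I4 k)" unfolding modes ..
  finally have "L ^ 3 * (- (LINT k|?K. I1 k) + \<nu> * (LINT k|?K. I2 k) + (LINT k|?K. I3 k)) = L ^ 3 * (LINT k|?K. I4 k)" by simp
  then show "- (LINT r|?M. pairing L (u r) v * deriv \<psi> r)
      + \<nu> * (LINT r|?M. pairing L (stokes_pow L (1 / 2) (u r)) (stokes_pow L (1 / 2) v) * \<psi> r)
      + (LINT r|?M. pairing L (B_op L (1 + \<alpha>) \<alpha> (1 + \<alpha>) (u (r - \<mu>)) (u r)) v * \<psi> r)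
      = (LINT r|?M. pairing L f v * \<psi> r)"
    unfolding s1 s2 s3 s4 by (simp add: algebra_simps)
qed

end

section \<open>The solution semigroup\<close>

lemma L2_funs_cong:
  assumes L: "L > 0" and eq: "\<And>t. t \<in> {a..b} \<Longrightarrow> u t = v t"
  shows "u \<in> L2_funs L s a b \<longleftrightarrow> v \<in> L2_funs L s a b"
proof -
  have "(AE t in lebesgue_on {a..b}. u t \<in> V L s) \<longleftrightarrow> (AE t in lebesgue_on {a..b}. v t \<in> V L s)"
    by (rule AE_cong) (simp add: eq)
  moreover have "modes_measurable {a..b} u \<longleftrightarrow> modes_measurable {a..b} v"
    unfolding modes_measurable_def by (intro all_cong1 measurable_cong) (simp add: eq)
  moreover have "(\<integral>\<^sup>+t. energy L s (u t) \<partial>lebesgue_on {a..b}) = (\<integral>\<^sup>+t. energy L s (v t) \<partial>lebesgue_on {a..b})"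
    by (rule nn_integral_cong) (simp add: eq)
  ultimately show ?thesis by (simp only: L2_funs_iff[OF L])
qed

lemma AE_lebesgue_on_subset:
  fixes a b c d :: real
  assumes "AE x in lebesgue_on {a..b}. P x" "{c..d} \<subseteq> {a..b}"
  shows "AE x in lebesgue_on {c..d}. P x"
proof -
  have "AE x in lebesgue. x \<in> {a..b} \<longrightarrow> P x" using assms(1) by (subst (asm) AE_restrict_space_iff) simp_all
  then have "AE x in lebesgue. x \<in> {c..d} \<longrightarrow> P x"
    by eventually_elim (use assms(2) in blast)
  then show ?thesis by (subst AE_restrict_space_iff) simp_all
qed

lemma L2_funs_subset:
  assumes L: "L > 0" and u: "u \<in> L2_funs L s a b" and sub: "{c..d} \<subseteq> {a..b}"
  shows "u \<in> L2_funs L s c d"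
  unfolding L2_funs_iff[OF L]
proof (intro conjI)
  note u' = u[unfolded L2_funs_iff[OF L]]
  show "AE t in lebesgue_on {c..d}. u t \<in> V L s"
    by (rule AE_lebesgue_on_subset[OF conjunct1[OF u'] sub])
  show "modes_measurable {c..d} u" using u' sub modes_measurable_mono by blast
  have "(\<integral>\<^sup>+t. energy L s (u t) \<partial>lebesgue_on {c..d}) \<le> (\<integral>\<^sup>+t. energy L s (u t) \<partial>lebesgue_on {a..b})"
    using sub by (intro nn_integral_lebesgue_on_mono) auto
  then show "(\<integral>\<^sup>+t. energy L s (u t) \<partial>lebesgue_on {c..d}) < \<infinity>"
    using u' by (auto intro: order_le_less_trans)
qed

lemma L2_funs_translate:
  assumes L: "L > 0" and u: "u \<in> L2_funs L s (a + c) (b + c)"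
  shows "(\<lambda>t. u (c + t)) \<in> L2_funs L s a b"
proof -
  note u' = u[unfolded L2_funs_iff[OF L]]
  have ab: "{a + c - c..b + c - c} = {a..b}" by simp
  have "AE t in lebesgue_on {a..b}. u (c + t) \<in> V L s"
    using AE_translate[OF conjunct1[OF u'], of c] unfolding ab .
  moreover have "modes_measurable {a..b} (\<lambda>t. u (c + t))"
    unfolding modes_measurable_def
  proof
    fix k
    have "(\<lambda>t. u t k) \<in> borel_measurable (lebesgue_on {a + c..b + c})" using u' by (simp add: modes_measurable_def)
    from borel_measurable_translate[OF this, of c] show "(\<lambda>t. u (c + t) k) \<in> borel_measurable (lebesgue_on {a..b})"
      unfolding ab .
  qed
  moreover have "(\<integral>\<^sup>+t. energy L s (u (c + t)) \<partial>lebesgue_on {a..b}) < \<infinity>"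
    using nn_integral_translate[OF measurable_energy, of "a + c" "b + c" u c L s] u' unfolding ab by simp
  ultimately show ?thesis unfolding L2_funs_iff[OF L] by blast
qed

lemma L2_funs_glue:
  assumes L: "L > 0" and \<phi>: "\<phi> \<in> L2_funs L s (- m) 0" and v: "v \<in> L2_funs L s 0 T" and m: "m > 0" and T: "T \<ge> 0"
  shows "(\<lambda>t. if t < 0 then \<phi> t else v t) \<in> L2_funs L s (- m) T"
  unfolding L2_funs_iff[OF L]
proof (intro conjI)
  let ?g = "\<lambda>t. if t < 0 then \<phi> t else v t"
  note p = \<phi>[unfolded L2_funs_iff[OF L]] and q = v[unfolded L2_funs_iff[OF L]]
  have "AE t in lebesgue. t \<in> {- m..0} \<longrightarrow> \<phi> t \<in> V L s" "AE t in lebesgue. t \<in> {0..T} \<longrightarrow> v t \<in> V L s"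
    using conjunct1[OF p] conjunct1[OF q] by (simp_all add: AE_restrict_space_iff)
  then have "AE t in lebesgue. t \<in> {- m..T} \<longrightarrow> ?g t \<in> V L s"
    by eventually_elim auto
  then show "AE t in lebesgue_on {- m..T}. ?g t \<in> V L s" by (simp add: AE_restrict_space_iff)
  have meas: "(\<lambda>t. indicator {- m..<0} t *\<^sub>R \<phi> t k) \<in> borel_measurable lebesgue"
    "(\<lambda>t. indicator {0..T} t *\<^sub>R v t k) \<in> borel_measurable lebesgue" for k
  proof -
    have "(\<lambda>t. \<phi> t k) \<in> borel_measurable (lebesgue_on {- m..0})" using p by (simp add: modes_measurable_def)
    then have "(\<lambda>t. \<phi> t k) \<in> borel_measurable (lebesgue_on {- m..<0})"
      by (rule lebesgue_on_measurable_mono) auto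
    then show "(\<lambda>t. indicator {- m..<0} t *\<^sub>R \<phi> t k) \<in> borel_measurable lebesgue"
      by (simp add: borel_measurable_restrict_space_iff)
    have "(\<lambda>t. v t k) \<in> borel_measurable (lebesgue_on {0..T})" using q by (simp add: modes_measurable_def)
    then show "(\<lambda>t. indicator {0..T} t *\<^sub>R v t k) \<in> borel_measurable lebesgue"
      by (simp add: borel_measurable_restrict_space_iff)
  qed
  show "modes_measurable {- m..T} ?g"
    unfolding modes_measurable_def
  proof
    fix k
    have "(\<lambda>t. indicator {- m..<0} t *\<^sub>R \<phi> t k + indicator {0..T} t *\<^sub>R v t k) \<in> borel_measurable lebesgue"
      by (intro borel_measurable_add meas)
    also have "(\<lambda>t. indicator {- m..<0} t *\<^sub>R \<phi> t k + indicator {0..T} t *\<^sub>R v t k) = (\<lambda>t. indicator {- m..T} t *\<^sub>R ?g t k)"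
      using m T by (auto simp: fun_eq_iff indicator_def)
    finally show "(\<lambda>t. ?g t k) \<in> borel_measurable (lebesgue_on {- m..T})"
      by (subst borel_measurable_restrict_space_iff) auto
  qed
  have em: "(\<lambda>t. energy L s (\<phi> t) * indicator {- m..0} t) \<in> borel_measurable lebesgue"
    "(\<lambda>t. energy L s (v t) * indicator {0..T} t) \<in> borel_measurable lebesgue"
    using measurable_energy[of "{- m..0}" \<phi> L s] measurable_energy[of "{0..T}" v L s] p q
    by (simp_all add: borel_measurable_restrict_space_iff_ennreal)
  have "(\<integral>\<^sup>+t. energy L s (?g t) \<partial>lebesgue_on {- m..T}) = (\<integral>\<^sup>+t. energy L s (?g t) * indicator {- m..T} t \<partial>lebesgue)"
    by (simp add: nn_integral_restrict_space)
  also have "\<dots> \<le> (\<integral>\<^sup>+t. energy L s (\<phi> t) * indicator {- m..0} t + energy L s (v t) * indicator {0..T} t \<partial>lebesgue)"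
    by (intro nn_integral_mono) (auto simp: indicator_def)
  also have "\<dots> = (\<integral>\<^sup>+t. energy L s (\<phi> t) \<partial>lebesgue_on {- m..0}) + (\<integral>\<^sup>+t. energy L s (v t) \<partial>lebesgue_on {0..T})"
    using em by (simp add: nn_integral_add nn_integral_restrict_space)
  also have "\<dots> < \<infinity>" using p q by simp
  finally show "(\<integral>\<^sup>+t. energy L s (?g t) \<partial>lebesgue_on {- m..T}) < \<infinity>" .
qed

lemma duh_cong:
  assumes "\<And>s. s \<in> {0..t} \<Longrightarrow> H s = G s"
  shows "duh L \<nu> H t = duh L \<nu> G t"
  unfolding duh_def duhamel_def by (intro ext Bochner_Integration.integral_cong) (auto simp: assms)

lemma duh_at_0: "duh L \<nu> H 0 k = 0"
proof -
  have "AE s in lebesgue_on {0..0 :: real}. exp (- (\<nu> * (norm (wave L k))\<^sup>2 * (0 - s))) *\<^sub>R H s k = 0"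
  proof (subst AE_restrict_space_iff)
    show "AE s in lebesgue. s \<in> {0..0 :: real} \<longrightarrow> exp (- (\<nu> * (norm (wave L k))\<^sup>2 * (0 - s))) *\<^sub>R H s k = 0"
      using AE_completion[OF AE_lborel_singleton[of "0 :: real"]] by eventually_elim auto
  qed simp
  then show ?thesis unfolding duh_def duhamel_def by (rule integral_eq_zero_AE)
qed

section \<open>Translation of test functions and of integrals against them\<close>

lemma test_function_translate:
  assumes \<psi>: "\<psi> \<in> test_functions T" and \<tau>: "\<tau> \<ge> 0"
  shows "(\<lambda>r. \<psi> (r - \<tau>)) \<in> test_functions (\<tau> + T)" "deriv (\<lambda>r. \<psi> (r - \<tau>)) r = deriv \<psi> (r - \<tau>)"
proof -
  have sm: "smooth \<psi>" using test_functionsD[OF \<psi>] by blast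
  have "smooth (\<lambda>r. \<psi> (- \<tau> + 1 * r))" by (rule smooth_affine[OF sm])
  then have sm2: "smooth (\<lambda>r. \<psi> (r - \<tau>))" by simp
  have "{r. \<psi> (r - \<tau>) \<noteq> 0} = (+) \<tau> ` {r. \<psi> r \<noteq> 0}" by (force simp: image_iff)
  then have "closure {r. \<psi> (r - \<tau>) \<noteq> 0} = (+) \<tau> ` closure {r. \<psi> r \<noteq> 0}" by (simp only: closure_translation)
  also have "\<dots> \<subseteq> {0<..<\<tau> + T}" using \<psi> \<tau> by (force simp: test_functions_def)
  finally show "(\<lambda>r. \<psi> (r - \<tau>)) \<in> test_functions (\<tau> + T)"
    using sm2 by (simp add: test_functions_def smooth_def)
  have "((\<lambda>r. \<psi> (r - \<tau>)) has_field_derivative deriv \<psi> (r - \<tau>) * 1) (at r)"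
    by (rule DERIV_chain2[OF smooth_DERIV[OF sm]]) (auto intro!: derivative_eq_intros)
  then show "deriv (\<lambda>r. \<psi> (r - \<tau>)) r = deriv \<psi> (r - \<tau>)" by (intro DERIV_imp_deriv) simp
qed

lemma test_function_deriv_eq_0:
  assumes "\<psi> \<in> test_functions T" "r \<le> 0 \<or> r \<ge> T"
  shows "deriv \<psi> r = 0"
proof -
  let ?S = "- closure {r. \<psi> r \<noteq> 0}"
  have support: "closure {r. \<psi> r \<noteq> 0} \<subseteq> {0<..<T}" using assms(1) by (simp add: test_functions_def)
  have "r \<in> ?S" using subsetD[OF support, of r] assms(2) by auto
  moreover have "open ?S" by (intro open_Compl closed_closure)
  moreover have "\<forall>x\<in>?S. \<psi> x = 0" using closure_subset[of "{r. \<psi> r \<noteq> 0}"] by blast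
  ultimately have "\<forall>\<^sub>F x in nhds r. \<psi> x = 0" unfolding eventually_nhds by blast
  then have "deriv \<psi> r = deriv (\<lambda>_. 0) r" by (rule deriv_cong_ev) simp
  then show ?thesis by simp
qed

text \<open>The substitution is valid for every \<open>F\<close>: if one integrand fails to be
  integrable, so does the other, and both integrals are 0. The added interval before
  \<open>\<tau>\<close> contributes nothing because \<open>\<xi>\<close> vanishes on negative
  arguments.\<close>

lemma integral_translate_test:
  fixes F \<xi> :: "real \<Rightarrow> real"
  assumes \<xi>: "\<And>r. r < 0 \<or> r > T \<Longrightarrow> \<xi> r = 0" and \<tau>: "\<tau> \<ge> 0"
  shows "(LINT r|lebesgue_on {0..\<tau> + T}. F r * \<xi> (r - \<tau>)) = (LINT r|lebesgue_on {0..T}. F (\<tau> + r) * \<xi> r)"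
proof -
  have "(LINT r|lebesgue_on {0..\<tau> + T}. F r * \<xi> (r - \<tau>)) = (LINT r|lebesgue. indicator {0..\<tau> + T} r *\<^sub>R (F r * \<xi> (r - \<tau>)))"
    by (rule integral_restrict_space) simp
  also have "\<dots> = (LINT r|lebesgue. indicator {0..\<tau> + T} (\<tau> + r) *\<^sub>R (F (\<tau> + r) * \<xi> (\<tau> + r - \<tau>)))"
    using lebesgue_integral_real_affine[of 1 "\<lambda>r. indicator {0..\<tau> + T} r *\<^sub>R (F r * \<xi> (r - \<tau>))" \<tau>] by simp
  also have "\<dots> = (LINT r|lebesgue. indicator {0..T} r *\<^sub>R (F (\<tau> + r) * \<xi> r))"
    using \<xi> \<tau> by (intro Bochner_Integration.integral_cong) (auto simp: indicator_def not_le)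
  also have "\<dots> = (LINT r|lebesgue_on {0..T}. F (\<tau> + r) * \<xi> r)"
    by (rule integral_restrict_space[symmetric]) simp
  finally show ?thesis .
qed

section \<open>The method of steps\<close>

context delay_navier_stokes
begin

text \<open>Causality: the Duhamel integral at time \<open>r\<close> involves the drift up to
  \<open>r\<close> only.\<close>

lemma dser_cong:
  assumes "\<And>s. s \<in> {0..t} \<Longrightarrow> w s = w' s" "r \<in> {0..t}"
  shows "dser w u0 n r = dser w' u0 n r"
  using assms(2)
proof (induction n arbitrary: r)
  case (Suc n)
  then have "- Bhat L (w s) (dser w u0 n s) k = - Bhat L (w' s) (dser w' u0 n s) k" if "s \<in> {0..r}" for s k
    using that assms(1) by auto
  then show ?case by (auto intro!: duh_cong)
qed simp

lemma lin_sol_cong: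
  assumes "\<And>s. s \<in> {0..t} \<Longrightarrow> w s = w' s" "t \<ge> 0"
  shows "lin_sol w u0 t = lin_sol w' u0 t"
  using dser_cong[of t w w' t u0] assms by (simp add: lin_sol_def fun_eq_iff)

text \<open>A solution must be regular enough to act as the drift one delay later. The heat flow
  gains one derivative over V^\<alpha> and the Duhamel integral gains two over V^(\<alpha>-1), so
  both reach V^(1+\<alpha>) in the square mean.\<close>

lemma lin_sol_L2:
  assumes w: "drift T w" and u0: "u0 \<in> V L \<alpha>"
  shows "lin_sol w u0 \<in> L2_funs L (1 + \<alpha>) 0 T"
proof -
  note st = state_lin_sol[OF w u0] and ml = lin_sol_mild[OF w u0]
  define H where "H = (\<lambda>s k. f k - Bhat L (w s) (lin_sol w u0 s) k)"
  have H: "forcing T H" unfolding H_def by (intro forcing_diff forcing_const forcing_Bhat w st)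
  have m: "modes_measurable {0..T} (lin_sol w u0)" using st by (simp add: state_def)
  have dm: "modes_measurable {0..T} (duh L \<nu> H)" using state_duh[OF H] by (simp add: state_def)
  have hm: "modes_measurable {0..T} (heat L \<nu> u0)"
    unfolding modes_measurable_def by (auto intro!: continuous_imp_measurable_on_sets_lebesgue continuous_on_heat)
  have "(\<integral>\<^sup>+t. energy L (1 + \<alpha>) (lin_sol w u0 t) \<partial>lebesgue_on {0..T})
      \<le> (\<integral>\<^sup>+t. 2 * energy L (1 + \<alpha>) (heat L \<nu> u0 t) + 2 * energy L (1 + \<alpha>) (duh L \<nu> H t) \<partial>lebesgue_on {0..T})"
  proof (rule nn_integral_mono)
    fix t assume "t \<in> space (lebesgue_on {0..T})"
    then have "energy L (1 + \<alpha>) (lin_sol w u0 t) = energy L (1 + \<alpha>) (\<lambda>k. heat L \<nu> u0 t k + duh L \<nu> H t k)"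
      using ml by (intro energy_cong) (simp add: H_def)
    then show "energy L (1 + \<alpha>) (lin_sol w u0 t) \<le> 2 * energy L (1 + \<alpha>) (heat L \<nu> u0 t) + 2 * energy L (1 + \<alpha>) (duh L \<nu> H t)"
      using energy_add_le by simp
  qed
  also have "\<dots> = 2 * (\<integral>\<^sup>+t. energy L (1 + \<alpha>) (heat L \<nu> u0 t) \<partial>lebesgue_on {0..T}) + 2 * (\<integral>\<^sup>+t. energy L (1 + \<alpha>) (duh L \<nu> H t) \<partial>lebesgue_on {0..T})"
    using measurable_energy[OF dm, of L "1 + \<alpha>"] measurable_energy[OF hm, of L "1 + \<alpha>"] by (simp add: nn_integral_add nn_integral_cmult)
  also have "\<dots> < \<infinity>"
  proof -
    have "(\<integral>\<^sup>+t. energy L (\<alpha> + 1) (heat L \<nu> u0 t) \<partial>lebesgue_on {0..T}) < \<infinity>"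
      by (rule order_le_less_trans[OF energy_heat_L2_le[OF L \<nu>]]) (use u0 in \<open>simp add: V_iff ennreal_mult_less_top\<close>)
    moreover have "(\<integral>\<^sup>+t. energy L (\<alpha> + 1) (duh L \<nu> H t) \<partial>lebesgue_on {0..T}) < \<infinity>"
      by (rule order_le_less_trans[OF energy_duh_L2_le[OF L \<nu> _ dm]]) (use H in \<open>simp_all add: forcing_def ennreal_mult_less_top\<close>)
    ultimately show ?thesis by (simp add: add.commute[of 1] ennreal_mult_less_top)
  qed
  finally have fin: "(\<integral>\<^sup>+t. energy L (1 + \<alpha>) (lin_sol w u0 t) \<partial>lebesgue_on {0..T}) < \<infinity>" .
  have "AE t in lebesgue_on {0..T}. energy L (1 + \<alpha>) (lin_sol w u0 t) \<noteq> \<infinity>"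
    using fin by (intro nn_integral_PInf_AE measurable_energy[OF m]) auto
  then have "AE t in lebesgue_on {0..T}. lin_sol w u0 t \<in> V L (1 + \<alpha>)"
    using AE_space[of "lebesgue_on {0..T}"]
    by eventually_elim (use stateD(2)[OF st] in \<open>auto simp: V_iff less_top\<close>)
  then show ?thesis unfolding L2_funs_iff[OF L] using m fin by blast
qed

text \<open>The iterate with index \<open>n\<close> is correct for times below n \<mu>. Every stage
  solves the linear equation again from time 0 with the delayed previous iterate as drift, so no
  pieces have to be joined continuously at multiples of the delay.\<close>

primrec steps :: "(real \<Rightarrow> coeffs) \<Rightarrow> coeffs \<Rightarrow> nat \<Rightarrow> real \<Rightarrow> coeffs" where
  "steps \<phi> u0 0 = (\<lambda>t. if t < 0 then \<phi> t else (\<lambda>k. 0))"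
| "steps \<phi> u0 (Suc n) = (\<lambda>t. if t < 0 then \<phi> t else lin_sol (delayed (steps \<phi> u0 n)) u0 t)"

lemma steps_neg: "t < 0 \<Longrightarrow> steps \<phi> u0 n t = \<phi> t"
  by (cases n) auto

lemma delayed_cong: "u (s - \<mu>) = v (s - \<mu>) \<Longrightarrow> delayed u s = delayed v s"
  by (simp add: delayed_def vfix_def)

text \<open>For times below (n+1) \<mu> the delayed argument lies below n \<mu>, where the two
  drifts agree by induction; causality transfers this to the solutions.\<close>

lemma steps_Suc: "t < real n * \<mu> \<Longrightarrow> steps \<phi> u0 (Suc n) t = steps \<phi> u0 n t"
proof (induction n arbitrary: t)
  case (Suc n)
  show ?case
  proof (cases "t < 0")
    case False
    have "delayed (steps \<phi> u0 (Suc n)) s = delayed (steps \<phi> u0 n) s" if "s \<in> {0..t}" for s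
      using that Suc.prems by (intro delayed_cong Suc.IH) (simp add: algebra_simps)
    then have "lin_sol (delayed (steps \<phi> u0 (Suc n))) u0 t = lin_sol (delayed (steps \<phi> u0 n)) u0 t"
      using False by (intro lin_sol_cong) auto
    then show ?thesis using False by simp
  qed simp
qed simp

lemma steps_eq:
  assumes "t < real n * \<mu>" "t < real m * \<mu>"
  shows "steps \<phi> u0 n t = steps \<phi> u0 m t"
proof -
  have *: "steps \<phi> u0 (n + j) t = steps \<phi> u0 n t" if "t < real n * \<mu>" for n j
  proof (induction j)
    case (Suc j)
    have "real n * \<mu> \<le> real (n + j) * \<mu>" using \<mu> by (intro mult_right_mono) auto
    then have "t < real (n + j) * \<mu>" using that by linarith
    from steps_Suc[OF this, of \<phi> u0] show ?case using Suc by simp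
  qed simp
  show ?thesis
    using *[OF assms(1), of "m - n"] *[OF assms(2), of "n - m"] by (cases "n \<le> m") auto
qed

lemma steps_L2:
  assumes \<phi>: "\<phi> \<in> L2_funs L (1 + \<alpha>) (- \<mu>) 0" and u0: "u0 \<in> V L \<alpha>" and T: "T \<ge> 0"
  shows "steps \<phi> u0 n \<in> L2_funs L (1 + \<alpha>) (- \<mu>) T"
proof (induction n)
  case 0
  have "(\<lambda>t k. 0) \<in> L2_funs L (1 + \<alpha>) 0 T" by (simp add: L2_funs_iff[OF L] modes_measurable_def)
  then show ?case using L2_funs_glue[OF L \<phi> _ \<mu> T] by simp
next
  case (Suc n)
  show ?case
    using L2_funs_glue[OF L \<phi> lin_sol_L2[OF L2_fun_drift(2)[OF Suc] u0] \<mu> T] by simp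
qed

text \<open>Every admissible \<open>n\<close> gives the same value, by \<open>steps_eq\<close>, so
  the choice is immaterial.\<close>

definition delay_sol :: "(real \<Rightarrow> coeffs) \<Rightarrow> coeffs \<Rightarrow> real \<Rightarrow> coeffs" where
  "delay_sol \<phi> u0 t = steps \<phi> u0 (SOME n. t < real n * \<mu>) t"

lemma delay_sol_eq:
  assumes "t < real n * \<mu>"
  shows "delay_sol \<phi> u0 t = steps \<phi> u0 n t"
  unfolding delay_sol_def by (rule steps_eq[OF someI[of "\<lambda>n. t < real n * \<mu>", OF assms] assms])

lemma global_weak_solution_exists:
  assumes \<phi>: "\<phi> \<in> L2_funs L (1 + \<alpha>) (- \<mu>) 0" and u0: "u0 \<in> V L \<alpha>"
  shows "global_weak_solution L \<mu> \<nu> \<alpha> f \<phi> u0 (delay_sol \<phi> u0)"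
  unfolding global_weak_solution_def
proof (intro allI impI)
  fix T :: real assume T: "T > 0"
  define u where "u = delay_sol \<phi> u0"
  obtain n :: nat where n: "T < real n * \<mu>" using reals_Archimedean3[OF \<mu>] by blast
  define w where "w = delayed (steps \<phi> u0 n)"
  have un: "u t = steps \<phi> u0 n t" if "t \<le> T" for t
    unfolding u_def using that n by (intro delay_sol_eq) simp
  have sL: "steps \<phi> u0 n \<in> L2_funs L (1 + \<alpha>) (- \<mu>) T" using steps_L2[OF \<phi> u0] T by simp
  have w: "drift T w" unfolding w_def by (rule L2_fun_drift(2)[OF sL])
  \<comment> \<open>Below n \<mu> the iterates with indices \<open>n\<close> and
    \<open>Suc n\<close> coincide, so \<open>u\<close> solves the linear equation whose drift is its
    own delayed value.\<close>
  have uw: "u t = lin_sol w u0 t" if "t \<in> {0..T}" for t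
    using un[of t] steps_Suc[of t n \<phi> u0] that n by (simp add: w_def)
  have dw: "delayed u s = w s" if "s \<in> {0..T}" for s
    unfolding w_def using that \<mu> by (intro delayed_cong un) auto
  note st = state_lin_sol[OF w u0] and ml = lin_sol_mild[OF w u0]
  define H where "H = (\<lambda>s k. f k - Bhat L (w s) (lin_sol w u0 s) k)"
  have H: "forcing T H" unfolding H_def by (intro forcing_diff forcing_const forcing_Bhat w st)
  have eq: "u t k = heat L \<nu> u0 t k + duh L \<nu> H t k" if "t \<in> {0..T}" "k \<noteq> 0" for t k
    using uw[OF that(1)] ml[OF that] by (simp add: H_def)
  have "weak_solution L \<mu> \<nu> \<alpha> f \<phi> u0 T u"
  proof (rule mild_imp_weak_solution[OF T])
    show "u \<in> L2_funs L (1 + \<alpha>) (- \<mu>) T"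
      using sL L2_funs_cong[OF L, of "- \<mu>" T u "steps \<phi> u0 n"] un by auto
    show "V_continuous_on L \<alpha> {0..T} u"
      unfolding V_continuous_on_iff[OF L]
    proof (intro ballI conjI)
      fix t assume t: "t \<in> {0..T}"
      show "u t \<in> V L \<alpha>" using st t uw[OF t] by (simp add: state_def)
      show "((\<lambda>r. energy L \<alpha> (\<lambda>k. u r k - u t k)) \<longlongrightarrow> 0) (at t within {0..T})"
        by (rule energy_mild_tendsto[OF L \<nu> _ _ _ eq t]) (use u0 H in \<open>auto simp: V_iff forcing_def\<close>)
    qed
    show "u 0 = u0"
    proof
      fix k
      show "u 0 k = u0 k"
      proof (cases "k = 0")
        case True
        then show ?thesis using uw[of 0] stateD(3)[OF st, of 0] u0 T by (simp add: V_iff solenoidal_def)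
      next
        case False
        then show ?thesis using eq[of 0 k] T by (simp add: heat_def duh_at_0)
      qed
    qed
    show "AE t in lebesgue_on {- \<mu><..<0}. u t = \<phi> t"
      by (rule AE_I2) (simp add: u_def delay_sol_def steps_neg)
    show "mild u0 T u"
      unfolding mild_def
    proof (intro ballI allI impI)
      fix t k assume t: "t \<in> {0..T}" and k: "k \<noteq> (0 :: int ^ 3)"
      have "duh L \<nu> H t = duh L \<nu> (mild_forcing u) t"
        using t dw uw by (intro duh_cong) (auto simp: H_def)
      then show "u t k = heat L \<nu> u0 t k + duh L \<nu> (mild_forcing u) t k" using eq[OF t k] by simp
    qed
  qed
  then show "weak_solution L \<mu> \<nu> \<alpha> f \<phi> u0 T (delay_sol \<phi> u0)" by (simp add: u_def)
qed

section \<open>Uniqueness and time translation of global weak solutions\<close>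

lemma weak_solutionD:
  assumes "weak_solution L \<mu> \<nu> \<alpha> f \<phi> u0 T u"
  shows "u \<in> L2_funs L (1 + \<alpha>) (- \<mu>) T" "V_continuous_on L \<alpha> {0..T} u" "u 0 = u0"
    "AE t in lebesgue_on {- \<mu><..<0}. u t = \<phi> t"
  using assms by (auto simp: weak_solution_def)

text \<open>Equality on [0, n \<mu>] together with almost everywhere equal histories makes the
  delayed velocities agree almost everywhere one delay further. The Duhamel integral ignores null
  sets, so both functions solve the mild equation with the same drift, and
  \<open>mild_unique\<close> advances the induction.\<close>

lemma global_weak_solution_unique:
  assumes u: "global_weak_solution L \<mu> \<nu> \<alpha> f \<phi> u0 u" and v: "global_weak_solution L \<mu> \<nu> \<alpha> f \<phi>' u0 v"
    and \<phi>: "AE t in lebesgue_on {- \<mu><..<0}. \<phi> t = \<phi>' t"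
  shows "AE t in lebesgue_on {- \<mu>..0}. u t = v t" and "\<And>t. t \<ge> 0 \<Longrightarrow> u t = v t"
proof -
  have wu: "weak_solution L \<mu> \<nu> \<alpha> f \<phi> u0 T u" and wv: "weak_solution L \<mu> \<nu> \<alpha> f \<phi>' u0 T v" if "T > 0" for T
    using u v that by (auto simp: global_weak_solution_def)
  have "AE t in lebesgue_on {- \<mu><..<0}. u t = \<phi> t" "AE t in lebesgue_on {- \<mu><..<0}. v t = \<phi>' t"
    using weak_solutionD(4)[OF wu[of 1]] weak_solutionD(4)[OF wv[of 1]] by simp_all
  with \<phi> have "AE t in lebesgue_on {- \<mu><..<0}. u t = v t" by eventually_elim simp
  then show AE: "AE t in lebesgue_on {- \<mu>..0}. u t = v t" by (simp only: AE_open_iff_closed)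
  have main: "\<forall>t\<in>{0..real n * \<mu>}. u t = v t" for n
  proof (induction n)
    case 0
    then show ?case using weak_solutionD(3)[OF wu[of 1]] weak_solutionD(3)[OF wv[of 1]] by simp
  next
    case (Suc n)
    define T where "T = real (Suc n) * \<mu>"
    have T: "T > 0" using \<mu> by (simp add: T_def)
    note uL = weak_solutionD(1)[OF wu[OF T]] and vL = weak_solutionD(1)[OF wv[OF T]]
    note su = state_V_continuous[OF weak_solutionD(2)[OF wu[OF T]]] and sv = state_V_continuous[OF weak_solutionD(2)[OF wv[OF T]]]
    note mu = weak_solution_imp_mild[OF T wu[OF T], unfolded mild_def, rule_format]
      and mv = weak_solution_imp_mild[OF T wv[OF T], unfolded mild_def, rule_format]
    note w = L2_fun_drift(2)[OF uL]
    have "AE s in lebesgue. s \<in> {- \<mu>..0} \<longrightarrow> u s = v s" using AE by (simp add: AE_restrict_space_iff)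
    from AE_lebesgue_translate[OF this, of "- \<mu>"]
    have "AE s in lebesgue. s \<in> {0..T} \<longrightarrow> delayed u s = delayed v s"
    proof eventually_elim
      case (elim s)
      show ?case
      proof
        assume s: "s \<in> {0..T}"
        have "u (s - \<mu>) = v (s - \<mu>)"
        proof (cases "s \<le> \<mu>")
          case True
          then show ?thesis using elim s by simp
        next
          case False
          then show ?thesis using Suc s by (auto simp: T_def algebra_simps)
        qed
        then show "delayed u s = delayed v s" by (rule delayed_cong)
      qed
    qed
    then have AEd: "AE s in lebesgue_on {0..T}. delayed u s = delayed v s" by (simp add: AE_restrict_space_iff)
    have "u t = v t" if t: "t \<in> {0..T}" for t
    proof (rule mild_unique[OF w su sv mu _ t])
      fix t k assume t: "t \<in> {0..T}" and k: "k \<noteq> (0 :: int ^ 3)"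
      have "duh L \<nu> (\<lambda>s k. f k - Bhat L (delayed u s) (v s) k) t k = duh L \<nu> (mild_forcing v) t k"
        unfolding duh_def duhamel_def
      proof (rule integral_cong_AE_lebesgue_on)
        have "forcing T (\<lambda>s k. f k - Bhat L (delayed u s) (v s) k)"
          by (rule forcing_diff[OF forcing_const forcing_Bhat[OF w sv]])
        then have "(\<lambda>s. f k - Bhat L (delayed u s) (v s) k) \<in> borel_measurable (lebesgue_on {0..T})"
          by (simp add: forcing_def modes_measurable_def)
        then have [measurable]: "(\<lambda>s. f k - Bhat L (delayed u s) (v s) k) \<in> borel_measurable (lebesgue_on {0..t})"
          by (rule lebesgue_on_measurable_mono) (use t in auto)
        show "(\<lambda>s. exp (- (\<nu> * (norm (wave L k))\<^sup>2 * (t - s))) *\<^sub>R (f k - Bhat L (delayed u s) (v s) k)) \<in> borel_measurable (lebesgue_on {0..t})"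
          by measurable
        have "AE s in lebesgue_on {0..t}. delayed u s = delayed v s"
          by (rule AE_lebesgue_on_subset[OF AEd]) (use t in auto)
        then show "AE s in lebesgue_on {0..t}. exp (- (\<nu> * (norm (wave L k))\<^sup>2 * (t - s))) *\<^sub>R (f k - Bhat L (delayed u s) (v s) k)
          = exp (- (\<nu> * (norm (wave L k))\<^sup>2 * (t - s))) *\<^sub>R (f k - Bhat L (delayed v s) (v s) k)"
          by eventually_elim simp
      qed simp
      then show "v t k = heat L \<nu> u0 t k + duh L \<nu> (\<lambda>s k. f k - Bhat L (delayed u s) (v s) k) t k"
        using mv[OF t k] by simp
    qed
    then show ?case by (simp add: T_def)
  qed
  show "u t = v t" if "t \<ge> 0" for t
  proof -
    obtain n :: nat where "t < real n * \<mu>" using reals_Archimedean3[OF \<mu>] by blast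
    then show ?thesis using main[of n] that by simp
  qed
qed

text \<open>Testing the original equation on [0, \<tau> + T] with the test function shifted by
  \<tau> gives the translated equation. The delayed argument may reach back before \<tau>, so the
  history of the translate is the translated function itself.\<close>

lemma weak_solution_translate:
  assumes u: "weak_solution L \<mu> \<nu> \<alpha> f \<phi> u0 (\<tau> + T) u" and \<tau>: "\<tau> \<ge> 0" and T: "T > 0"
  shows "weak_solution L \<mu> \<nu> \<alpha> f (\<lambda>s. u (\<tau> + s)) (u \<tau>) T (\<lambda>s. u (\<tau> + s))"
  unfolding weak_solution_def
proof (intro conjI ballI)
  note uL = weak_solutionD(1)[OF u] and uV = weak_solutionD(2)[OF u, unfolded V_continuous_on_iff[OF L]]
  show "(\<lambda>s. u (\<tau> + s)) \<in> L2_funs L (1 + \<alpha>) (- \<mu>) T"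
    by (rule L2_funs_translate[OF L], rule L2_funs_subset[OF L uL]) (use \<tau> in auto)
  show "V_continuous_on L \<alpha> {0..T} (\<lambda>s. u (\<tau> + s))"
    unfolding V_continuous_on_iff[OF L]
  proof (intro ballI conjI)
    fix t assume t: "t \<in> {0..T}"
    then have t': "\<tau> + t \<in> {0..\<tau> + T}" using \<tau> by auto
    show "u (\<tau> + t) \<in> V L \<alpha>" using uV t' by blast
    have lim: "((\<lambda>r. energy L \<alpha> (\<lambda>k. u r k - u (\<tau> + t) k)) \<longlongrightarrow> 0) (at (\<tau> + t) within {0..\<tau> + T})"
      using uV t' by blast
    show "((\<lambda>r. energy L \<alpha> (\<lambda>k. u (\<tau> + r) k - u (\<tau> + t) k)) \<longlongrightarrow> 0) (at t within {0..T})"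
      unfolding tendsto_at_iff_sequentially o_def
    proof (intro allI impI)
      fix X :: "nat \<Rightarrow> real" assume X: "\<forall>i. X i \<in> {0..T} - {t}" "X \<longlonglongrightarrow> t"
      have "\<forall>i. \<tau> + X i \<in> {0..\<tau> + T} - {\<tau> + t}" using X(1) \<tau> by auto
      moreover have "(\<lambda>i. \<tau> + X i) \<longlonglongrightarrow> \<tau> + t" by (intro tendsto_intros X(2))
      ultimately show "(\<lambda>i. energy L \<alpha> (\<lambda>k. u (\<tau> + X i) k - u (\<tau> + t) k)) \<longlonglongrightarrow> 0"
        using lim[unfolded tendsto_at_iff_sequentially o_def, rule_format, of "\<lambda>i. \<tau> + X i"] by blast
    qed
  qed
  show "u (\<tau> + 0) = u \<tau>" by simp
  show "AE t in lebesgue_on {- \<mu><..<0}. u (\<tau> + t) = u (\<tau> + t)" by simp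
  fix v \<psi> assume v: "v \<in> V L (\<alpha> + 1)" and \<psi>: "\<psi> \<in> test_functions T"
  note weak = u[unfolded weak_solution_def, THEN conjunct2, THEN conjunct2, THEN conjunct2, THEN conjunct2, rule_format,
      OF v test_function_translate(1)[OF \<psi> \<tau>]]
  have s: "(LINT r|lebesgue_on {0..\<tau> + T}. F r * \<psi> (r - \<tau>)) = (LINT r|lebesgue_on {0..T}. F (\<tau> + r) * \<psi> r)" for F
    by (rule integral_translate_test[OF _ \<tau>]) (use test_functionsD[OF \<psi>] in auto)
  have s': "(LINT r|lebesgue_on {0..\<tau> + T}. F r * deriv \<psi> (r - \<tau>)) = (LINT r|lebesgue_on {0..T}. F (\<tau> + r) * deriv \<psi> r)" for F
    by (rule integral_translate_test[OF _ \<tau>]) (use test_function_deriv_eq_0[OF \<psi>] in auto)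
  show "- (LINT r|lebesgue_on {0..T}. pairing L (u (\<tau> + r)) v * deriv \<psi> r)
      + \<nu> * (LINT r|lebesgue_on {0..T}. pairing L (stokes_pow L (1 / 2) (u (\<tau> + r))) (stokes_pow L (1 / 2) v) * \<psi> r)
      + (LINT r|lebesgue_on {0..T}. pairing L (B_op L (1 + \<alpha>) \<alpha> (1 + \<alpha>) (u (\<tau> + (r - \<mu>))) (u (\<tau> + r))) v * \<psi> r)
      = (LINT r|lebesgue_on {0..T}. pairing L f v * \<psi> r)"
    using weak unfolding test_function_translate(2)[OF \<psi> \<tau>] s s' by (simp only: add_diff_eq)
qed

lemma global_weak_solution_translate:
  assumes "global_weak_solution L \<mu> \<nu> \<alpha> f \<phi> u0 u" "\<tau> \<ge> 0"
  shows "global_weak_solution L \<mu> \<nu> \<alpha> f (\<lambda>s. u (\<tau> + s)) (u \<tau>) (\<lambda>s. u (\<tau> + s))"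
  unfolding global_weak_solution_def
proof (intro allI impI)
  fix T :: real assume T: "T > 0"
  then have "weak_solution L \<mu> \<nu> \<alpha> f \<phi> u0 (\<tau> + T) u" using assms by (auto simp: global_weak_solution_def)
  then show "weak_solution L \<mu> \<nu> \<alpha> f (\<lambda>s. u (\<tau> + s)) (u \<tau>) T (\<lambda>s. u (\<tau> + s))"
    using assms(2) T by (rule weak_solution_translate)
qed

lemma global_weak_solution_segment:
  assumes u: "global_weak_solution L \<mu> \<nu> \<alpha> f \<phi> u0 u" and t: "t \<ge> 0"
  shows "(\<lambda>s. u (t + s)) \<in> L2_funs L (1 + \<alpha>) (- \<mu>) 0" and "u t \<in> V L \<alpha>"
proof -
  have "weak_solution L \<mu> \<nu> \<alpha> f (\<lambda>s. u (t + s)) (u t) 1 (\<lambda>s. u (t + s))"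
    using global_weak_solution_translate[OF u t] by (simp add: global_weak_solution_def)
  note w = weak_solutionD[OF this]
  show "(\<lambda>s. u (t + s)) \<in> L2_funs L (1 + \<alpha>) (- \<mu>) 0"
    by (rule L2_funs_subset[OF L w(1)]) auto
  have "u (t + 0) \<in> V L \<alpha>" using conjunct1[OF bspec[OF w(2)[unfolded V_continuous_on_iff[OF L]]], of 0] by simp
  then show "u t \<in> V L \<alpha>" by simp
qed

section \<open>Equivalence classes of histories and the operators S(t)\<close>

lemma ae_rel_iff: "(u, w) \<in> ae_rel L s a b \<longleftrightarrow> u \<in> L2_funs L s a b \<and> w \<in> L2_funs L s a b
     \<and> (AE t in lebesgue_on {a<..<b}. u t = w t)"
  by (simp add: ae_rel_def)

lemma L2_class_eq:
  assumes "u \<in> L2_funs L s a b" "w \<in> L2_funs L s a b" "AE t in lebesgue_on {a<..<b}. u t = w t"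
  shows "L2_class L s a b u = L2_class L s a b w"
proof -
  have "(AE t in lebesgue_on {a<..<b}. u t = z t) \<longleftrightarrow> (AE t in lebesgue_on {a<..<b}. w t = z t)" for z
  proof
    assume "AE t in lebesgue_on {a<..<b}. u t = z t"
    with assms(3) show "AE t in lebesgue_on {a<..<b}. w t = z t" by eventually_elim simp
  next
    assume "AE t in lebesgue_on {a<..<b}. w t = z t"
    with assms(3) show "AE t in lebesgue_on {a<..<b}. u t = z t" by eventually_elim simp
  qed
  then show ?thesis using assms(1,2) by (auto simp: L2_class_def ae_rel_iff)
qed

lemma L2_class_in_space: "u \<in> L2_funs L s a b \<Longrightarrow> L2_class L s a b u \<in> L2_space L s a b"
  unfolding L2_class_def L2_space_def by (rule quotientI)

lemma L2_class_self: "u \<in> L2_funs L s a b \<Longrightarrow> u \<in> L2_class L s a b u"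
  by (simp add: L2_class_def ae_rel_iff)

lemma L2_space_obtain:
  assumes "c \<in> L2_space L s a b"
  obtains \<phi> where "\<phi> \<in> L2_funs L s a b" "c = L2_class L s a b \<phi>"
  using assms unfolding L2_space_def L2_class_def by (elim quotientE) blast

abbreviation S where "S \<equiv> S_op L \<mu> \<nu> \<alpha> f"

abbreviation segment_class where "segment_class u \<equiv> L2_class L (1 + \<alpha>) (- \<mu>) 0 u"

text \<open>Independence of representatives: where t + s is nonnegative, two solutions agree
  pointwise; where it is negative, the segment still reads the history, and histories in one class
  agree almost everywhere, a property that survives translation.\<close>

lemma S_eq:
  assumes \<phi>: "\<phi> \<in> L2_funs L (1 + \<alpha>) (- \<mu>) 0"
    and u: "global_weak_solution L \<mu> \<nu> \<alpha> f \<phi> u0 u" and t: "t \<ge> 0"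
  shows "S t (segment_class \<phi>, u0) = (segment_class (\<lambda>s. u (t + s)), u t)"
  unfolding S_op_def
proof (rule the_equality)
  show "\<exists>\<phi>'\<in>fst (segment_class \<phi>, u0). \<exists>u'. global_weak_solution L \<mu> \<nu> \<alpha> f \<phi>' (snd (segment_class \<phi>, u0)) u'
      \<and> (segment_class (\<lambda>s. u (t + s)), u t) = (segment_class (\<lambda>s. u' (t + s)), u' t)"
    using L2_class_self[OF \<phi>] u by auto
next
  fix z assume "\<exists>\<phi>'\<in>fst (segment_class \<phi>, u0). \<exists>u'. global_weak_solution L \<mu> \<nu> \<alpha> f \<phi>' (snd (segment_class \<phi>, u0)) u'
      \<and> z = (segment_class (\<lambda>s. u' (t + s)), u' t)"
  then obtain \<phi>' v where \<phi>': "\<phi>' \<in> segment_class \<phi>" and v: "global_weak_solution L \<mu> \<nu> \<alpha> f \<phi>' u0 v"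
    and z: "z = (segment_class (\<lambda>s. v (t + s)), v t)" by auto
  have "AE s in lebesgue_on {- \<mu><..<0}. \<phi> s = \<phi>' s" using \<phi>' by (simp add: L2_class_def ae_rel_iff)
  note uniq = global_weak_solution_unique[OF u v this]
  have "AE s in lebesgue. s \<in> {- \<mu>..0} \<longrightarrow> u s = v s" using uniq(1) by (simp add: AE_restrict_space_iff)
  from AE_lebesgue_translate[OF this, of t]
  have "AE s in lebesgue. s \<in> {- \<mu><..<0} \<longrightarrow> u (t + s) = v (t + s)"
  proof eventually_elim
    case (elim s)
    show ?case
    proof
      assume s: "s \<in> {- \<mu><..<0}"
      show "u (t + s) = v (t + s)"
      proof (cases "t + s \<ge> 0")
        case True
        then show ?thesis by (rule uniq(2))
      next
        case False
        then show ?thesis using elim s t by simp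
      qed
    qed
  qed
  then have "AE s in lebesgue_on {- \<mu><..<0}. u (t + s) = v (t + s)" by (simp add: AE_restrict_space_iff)
  then have "segment_class (\<lambda>s. u (t + s)) = segment_class (\<lambda>s. v (t + s))"
    by (intro L2_class_eq global_weak_solution_segment(1)[OF u t] global_weak_solution_segment(1)[OF v t])
  then show "z = (segment_class (\<lambda>s. u (t + s)), u t)" using z uniq(2)[OF t] by simp
qed

lemma Y_space_cases:
  assumes "y \<in> Y_space L \<mu> \<alpha>"
  obtains \<phi> u0 u where "\<phi> \<in> L2_funs L (1 + \<alpha>) (- \<mu>) 0" "y = (segment_class \<phi>, u0)"
    "global_weak_solution L \<mu> \<nu> \<alpha> f \<phi> u0 u"
proof -
  obtain c u0 where y: "y = (c, u0)" "c \<in> L2_space L (1 + \<alpha>) (- \<mu>) 0" "u0 \<in> V L \<alpha>"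
    using assms unfolding Y_space_def by blast
  obtain \<phi> where \<phi>: "\<phi> \<in> L2_funs L (1 + \<alpha>) (- \<mu>) 0" "c = segment_class \<phi>" using L2_space_obtain[OF y(2)] .
  show ?thesis using that[OF \<phi>(1) _ global_weak_solution_exists[OF \<phi>(1) y(3)]] y \<phi> by simp
qed

lemma S_in_Y_space:
  assumes "t \<ge> 0" "y \<in> Y_space L \<mu> \<alpha>"
  shows "S t y \<in> Y_space L \<mu> \<alpha>"
  using assms(2)
proof (rule Y_space_cases)
  fix \<phi> u0 u assume \<phi>: "\<phi> \<in> L2_funs L (1 + \<alpha>) (- \<mu>) 0" and y: "y = (segment_class \<phi>, u0)"
    and u: "global_weak_solution L \<mu> \<nu> \<alpha> f \<phi> u0 u"
  show ?thesis
    unfolding y S_eq[OF \<phi> u assms(1)] Y_space_def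
    using global_weak_solution_segment[OF u assms(1)] L2_class_in_space by blast
qed

lemma S_0:
  assumes "y \<in> Y_space L \<mu> \<alpha>"
  shows "S 0 y = y"
  using assms
proof (rule Y_space_cases)
  fix \<phi> u0 u assume \<phi>: "\<phi> \<in> L2_funs L (1 + \<alpha>) (- \<mu>) 0" and y: "y = (segment_class \<phi>, u0)"
    and u: "global_weak_solution L \<mu> \<nu> \<alpha> f \<phi> u0 u"
  note w = weak_solutionD[OF u[unfolded global_weak_solution_def, rule_format, OF zero_less_one]]
  have "segment_class u = segment_class \<phi>"
    using global_weak_solution_segment(1)[OF u order_refl] by (intro L2_class_eq \<phi> w(4)) simp
  then show ?thesis unfolding y S_eq[OF \<phi> u order_refl] using w(3) by simp
qed

lemma S_add:
  assumes t: "t \<ge> 0" and \<tau>: "\<tau> \<ge> 0" and "y \<in> Y_space L \<mu> \<alpha>"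
  shows "S (t + \<tau>) y = S t (S \<tau> y)"
  using assms(3)
proof (rule Y_space_cases)
  fix \<phi> u0 u assume \<phi>: "\<phi> \<in> L2_funs L (1 + \<alpha>) (- \<mu>) 0" and y: "y = (segment_class \<phi>, u0)"
    and u: "global_weak_solution L \<mu> \<nu> \<alpha> f \<phi> u0 u"
  have "S t (S \<tau> y) = (segment_class (\<lambda>s. u (\<tau> + (t + s))), u (\<tau> + t))"
    unfolding y S_eq[OF \<phi> u \<tau>]
    by (rule S_eq[OF global_weak_solution_segment(1)[OF u \<tau>] global_weak_solution_translate[OF u \<tau>] t])
  also have "\<dots> = S (t + \<tau>) y"
    unfolding y using S_eq[OF \<phi> u, of "t + \<tau>"] t \<tau> by (simp add: ac_simps)
  finally show ?thesis ..
qed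

end

theorem lemma5p1:
  fixes L \<mu> \<nu> \<alpha> :: real and f :: coeffs
  assumes "L > 0" and "\<mu> > 0" and "\<nu> > 0" and "\<alpha> > 1/2" and "f \<in> V L (\<alpha> - 1)"
  shows "(\<forall>t\<ge>0. S_op L \<mu> \<nu> \<alpha> f t \<in> Y_space L \<mu> \<alpha> \<rightarrow> Y_space L \<mu> \<alpha>)
    \<and> (\<forall>y\<in>Y_space L \<mu> \<alpha>. S_op L \<mu> \<nu> \<alpha> f 0 y = y)
    \<and> (\<forall>t\<ge>0. \<forall>\<tau>\<ge>0. \<forall>y\<in>Y_space L \<mu> \<alpha>.
         S_op L \<mu> \<nu> \<alpha> f (t + \<tau>) y = S_op L \<mu> \<nu> \<alpha> f t (S_op L \<mu> \<nu> \<alpha> f \<tau> y))"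
proof -
  interpret delay_navier_stokes L \<nu> \<alpha> f \<mu>
    using assms by unfold_locales auto
  show ?thesis
    using S_in_Y_space S_0 S_add by blast
qed

end
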